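(* Assume (G1) and (G2). Let $c_0$ and, for each $c\in(0,c_0)$, $s_0=s_0(c)\in(0,\pi/3]$ be the constants defined in the context. Then for every $c\in(0,c_0)$ the problem (P) admits a solution $(\bar u,\bar\lambda_c)\in\mathcal S_c\times\mathbb R$ with $\bar\lambda_c>0$ and $$\Phi(\bar u)=m(c):=\inf\{\Phi(u):\ u\in\mathcal S_c,\ \|\nabla u\|_2^2<s_0\}.$$
   Context: $H^1_r(\mathbb R^2)$ denotes the radially symmetric functions in $H^1(\mathbb R^2)$ (for $u\in H^1_r$ we write $u(s)$ for its radial profile). For $u\in H^1_r(\mathbb R^2)$ set $B(u):=\int_{\mathbb R^2}\frac{u(x)^2}{|x|^2}\Big(\int_0^{|x|}\frac s2u(s)^2\,ds\Big)^2dx$ and $$\Phi(u):=\tfrac12\|\nabla u\|_2^2+\tfrac12B(u)-\tfrac12\int_{\mathbb R^2}\big(e^{u^2}-1-u^2\big)dx-\int_{\mathbb R^2}g(x)u\,dx,$$ which is $C^1$ on $H^1_r(\mathbb R^2)$. $\mathcal S_c:=\{u\in H^1_r(\mathbb R^2):\|u\|_2^2=c\}$. Problem (P): find $(u,\lambda)\in\mathcal S_c\times\mathbb R$ with $\langle\Phi'(u),v\rangle+\lambda\int_{\mathbb R^2}uv\,dx=0$ for all $v\in H^1_r(\mathbb R^2)$; i.e. $u$ is a weak solution of $-\Delta u+\lambda u+\big(\frac{h^2(|x|)}{|x|^2}+\int_{|x|}^\infty\frac{h(s)}{s}u^2(s)ds\big)u=(e^{u^2}-1)u+g(x)$ in $\mathbb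 R^2$, where $h(s)=\int_0^s\frac l2u^2(l)dl$. Hypotheses on $g:\mathbb R^2\to\mathbb R$: (G1) $g\in C(\mathbb R^2,[0,\infty))\cap L^{4/3}(\mathbb R^2)$, $g$ is radial, $g\not\equiv0$. (G2) $g$ is differentiable, $\nabla g(x)\cdot x\in L^{4/3}(\mathbb R^2)$ and $2g(x)+\nabla g(x)\cdot x\ge0$ for all $x$. Constants: $\mathcal C_4$ is the sharp constant with $\|u\|_4\le\mathcal C_4\|u\|_2^{1/2}\|\nabla u\|_2^{1/2}$ for all $u\in H^1(\mathbb R^2)$. $\zeta(t):=\sum_{k\ge0}\frac{4^{k+2}(k+1)+1}{(k+1)(k+3)!}t^k$. Let $L_1(c):=30c^{1/4}\mathcal C_4\|g\|_{4/3}\Big[\frac{2c^{5/4}\zeta(\sqrt{c/(3\pi)})}{3\pi^2\mathcal C_4\|g\|_{4/3}}\Big]^{3/5}$ and $L_2(c):=12c^{1/4}(\pi/3)^{-3/4}\mathcal C_4\|g\|_{4/3}+\frac{12c^{3/2}(\pi/3)^{1/2}}{\pi^2}\zeta(\sqrt{c/(3\pi)})$; both are continuous and increasing in $c>0$, tending to $0$ as $c\to0^+$. Let $c_i:=\sup\{c\in(0,2\pi]: L_i(c)\le1\}$ ($i=1,2$), $c_0:=\min\{c_1,c_2\}$. For $c>0$ let $s_c:=\Big[\frac{3\pi^2\mathcal C_4\|g\|_{4/3}}{2c^{5/4}\zeta(\sqrt{c/(3\pi)})}\Big]^{4/5}$ and $s_0=s_0(c):=\min\{s_c,\pi/3\}$.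 *)

theory Defs
  imports "HOL-Analysis.Analysis"
begin

type_synonym R2 = "real ^ 2"

definition Lp_fun :: "real \<Rightarrow> (R2 \<Rightarrow> real) \<Rightarrow> bool" where
  "Lp_fun p f \<longleftrightarrow> f \<in> borel_measurable lborel \<and> integrable lborel (\<lambda>x. \<bar>f x\<bar> powr p)"

definition Lp_norm :: "real \<Rightarrow> (R2 \<Rightarrow> real) \<Rightarrow> real" where
  "Lp_norm p f = (\<integral>x. \<bar>f x\<bar> powr p \<partial>lborel) powr (1 / p)"

definition test_fun :: "(R2 \<Rightarrow> real) \<Rightarrow> (R2 \<Rightarrow> R2) \<Rightarrow> bool" where
  "test_fun phi Dphi \<longleftrightarrow>
     (\<forall>x. (phi has_derivative (\<lambda>h. Dphi x \<bullet> h)) (at x)) \<and>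
     continuous_on UNIV Dphi \<and> compact (closure {x. phi x \<noteq> 0})"

definition weak_grad :: "(R2 \<Rightarrow> real) \<Rightarrow> (R2 \<Rightarrow> R2) \<Rightarrow> bool" where
  "weak_grad u G \<longleftrightarrow>
     (\<forall>phi Dphi. test_fun phi Dphi \<longrightarrow>
        (\<integral>x. u x *\<^sub>R Dphi x \<partial>lborel) = - (\<integral>x. phi x *\<^sub>R G x \<partial>lborel))"

definition L2_grad :: "(R2 \<Rightarrow> real) \<Rightarrow> (R2 \<Rightarrow> R2) \<Rightarrow> bool" where
  "L2_grad u G \<longleftrightarrow> G \<in> borel_measurable lborel \<and>
     integrable lborel (\<lambda>x. (norm (G x))\<^sup>2) \<and> weak_grad u G"

definition H1 :: "(R2 \<Rightarrow> real) \<Rightarrow> bool" where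
  "H1 u \<longleftrightarrow> Lp_fun 2 u \<and> (\<exists>G. L2_grad u G)"

text \<open>Radial functions (we take the radial representative).\<close>
definition radial :: "(R2 \<Rightarrow> real) \<Rightarrow> bool" where
  "radial u \<longleftrightarrow> (\<forall>x y. norm x = norm y \<longrightarrow> u x = u y)"

definition H1r :: "(R2 \<Rightarrow> real) \<Rightarrow> bool" where
  "H1r u \<longleftrightarrow> H1 u \<and> radial u"

definition profile :: "(R2 \<Rightarrow> real) \<Rightarrow> real \<Rightarrow> real" where
  "profile u s = u (s *\<^sub>R axis 1 1)"

definition wgrad :: "(R2 \<Rightarrow> real) \<Rightarrow> R2 \<Rightarrow> R2" where
  "wgrad u = (SOME G. L2_grad u G)"

definition grad_sq :: "(R2 \<Rightarrow> real) \<Rightarrow> real" where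
  "grad_sq u = (\<integral>x. (norm (wgrad u x))\<^sup>2 \<partial>lborel)"

definition L2_sq :: "(R2 \<Rightarrow> real) \<Rightarrow> real" where
  "L2_sq u = (\<integral>x. (u x)\<^sup>2 \<partial>lborel)"

definition Bterm :: "(R2 \<Rightarrow> real) \<Rightarrow> real" where
  "Bterm u = (\<integral>x. (u x)\<^sup>2 / (norm x)\<^sup>2 *
      (LINT s:{0..norm x}|lborel. s / 2 * (profile u s)\<^sup>2)\<^sup>2 \<partial>lborel)"

definition Phi :: "(R2 \<Rightarrow> real) \<Rightarrow> (R2 \<Rightarrow> real) \<Rightarrow> real" where
  "Phi g u = 1/2 * grad_sq u + 1/2 * Bterm u
      - 1/2 * (\<integral>x. exp ((u x)\<^sup>2) - 1 - (u x)\<^sup>2 \<partial>lborel)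
      - (\<integral>x. g x * u x \<partial>lborel)"

text \<open>Problem (P): <Phi'(u),v> + lambda * int u v = 0 for all v in H^1_r,
  with Phi'(u) v expressed as the (Gateaux) directional derivative, which coincides
  with the Frechet derivative since Phi is C^1 on H^1_r.\<close>
definition solves_P :: "(R2 \<Rightarrow> real) \<Rightarrow> real \<Rightarrow> (R2 \<Rightarrow> real) \<Rightarrow> real \<Rightarrow> bool" where
  "solves_P g c u lam \<longleftrightarrow> H1r u \<and> L2_sq u = c \<and>
     (\<forall>v. H1r v \<longrightarrow>
        ((\<lambda>t. Phi g (\<lambda>x. u x + t * v x)) has_real_derivative
            (- lam * (\<integral>x. u x * v x \<partial>lborel))) (at 0))"

definition C4 :: real where
  "C4 = Inf {C. C \<ge> 0 \<and> (\<forall>u. H1 u \<longrightarrow>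
      Lp_norm 4 u \<le> C * (L2_sq u) powr (1/4) * (grad_sq u) powr (1/4))}"

definition zeta :: "real \<Rightarrow> real" where
  "zeta t = (\<Sum>k. (4 ^ (k + 2) * (real k + 1) + 1) / ((real k + 1) * fact (k + 3)) * t ^ k)"

definition L1 :: "(R2 \<Rightarrow> real) \<Rightarrow> real \<Rightarrow> real" where
  "L1 g c = 30 * c powr (1/4) * C4 * Lp_norm (4/3) g *
     ((2 * c powr (5/4) * zeta (sqrt (c / (3 * pi)))) / (3 * pi\<^sup>2 * C4 * Lp_norm (4/3) g)) powr (3/5)"

definition L2c :: "(R2 \<Rightarrow> real) \<Rightarrow> real \<Rightarrow> real" where
  "L2c g c = 12 * c powr (1/4) * (pi / 3) powr (-3/4) * C4 * Lp_norm (4/3) g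
     + 12 * c powr (3/2) * (pi / 3) powr (1/2) / pi\<^sup>2 * zeta (sqrt (c / (3 * pi)))"

definition c1 :: "(R2 \<Rightarrow> real) \<Rightarrow> real" where
  "c1 g = Sup {c. 0 < c \<and> c \<le> 2 * pi \<and> L1 g c \<le> 1}"

definition c2 :: "(R2 \<Rightarrow> real) \<Rightarrow> real" where
  "c2 g = Sup {c. 0 < c \<and> c \<le> 2 * pi \<and> L2c g c \<le> 1}"

definition c0 :: "(R2 \<Rightarrow> real) \<Rightarrow> real" where
  "c0 g = min (c1 g) (c2 g)"

definition s_c :: "(R2 \<Rightarrow> real) \<Rightarrow> real \<Rightarrow> real" where
  "s_c g c = ((3 * pi\<^sup>2 * C4 * Lp_norm (4/3) g) /
              (2 * c powr (5/4) * zeta (sqrt (c / (3 * pi))))) powr (4/5)"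

definition s0 :: "(R2 \<Rightarrow> real) \<Rightarrow> real \<Rightarrow> real" where
  "s0 g c = min (s_c g c) (pi / 3)"

text \<open>m(c), as an extended real infimum (so that the value -infinity is not conflated).\<close>
definition m_level :: "(R2 \<Rightarrow> real) \<Rightarrow> real \<Rightarrow> ereal" where
  "m_level g c = (INF u \<in> {u. H1r u \<and> L2_sq u = c \<and> grad_sq u < s0 g c}. ereal (Phi g u))"

end

theory Submission
  imports Defs "HOL-Complex_Analysis.Great_Picard" "HOL-Real_Asymp.Real_Asymp"
begin

text \<open>
  A nonnegative minimizing sequence is compact in the radial class, since a radial profile \<open>f\<close> satisfies
  \<open>(f b - f a)\<^sup>2 \<le> ln (b / a) / (2 * pi) * \<parallel>\<nabla>u\<parallel>\<^sup>2\<close> and decays like \<open>1 / sqrt r\<close>: it converges pointwise, the exponential and the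
  source term pass to the limit, and the remaining terms are lower semicontinuous. Mass lost in
  the limit is restored by a dilation, which lowers \<open>\<Phi>\<close> because (G2) makes \<open>t\<^sup>2 g(t x)\<close> increasing in \<open>t\<close>.
  As \<open>\<Phi> \<ge> 0\<close> on the sphere \<open>\<parallel>\<nabla>u\<parallel>\<^sup>2 = s\<^sub>0\<close> while \<open>m(c) < 0\<close>, the minimizer is interior, hence solves the
  Euler--Lagrange equation. Comparing it with \<open>a u(a x)\<close> for \<open>a \<le> 1\<close> gives the sign of the multiplier;
  no Pohozaev identity is needed.
\<close>

subsection \<open>Polar coordinates and test functions in the plane\<close>

text \<open>The threshold pi/3 tames the exponential: if \<parallel>grad u\<parallel>^2 \<le> pi/3,
  the logarithmic estimate gives u^2 \<le> 2 K + (1/3) ln(1/r) near the origin, so exp(u^2) is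
  dominated there by one multiple of 1/r for the whole minimizing sequence. This takes the place of
  a Moser-Trudinger inequality.

  The numbers fit as follows. The condition \<open>L2c g c\<close> \<le> 1 forces c \<le> 0.432. For
  such masses the exponential integral is at most 5/6 of the Dirichlet energy, which leaves 1/2 -
  5/12 = 1/12 of that energy. The conditions on \<open>L1\<close> and \<open>L2c\<close> make the
  source term cost at most \<open>s0 g c / 12\<close> on the sphere.

  H^1_r does not embed compactly into L^2, so the mass constraint may fail in the limit. The repair
  v(x) = w(x/t) with t \<ge> 1 keeps the energy, multiplies the exponential integral F by t^2 and
  the nonlocal term B by t^4. It pays off because B \<le> c/(8 pi) F, which follows from exp(y^2) -
  1 - y^2 \<ge> y^4/2. The same comparison decides the sign of the multiplier.\<close>

lemma emeasure_norm_le_R2: "emeasure lborel {x::R2. norm x \<le> r} = ennreal (pi * (if r \<ge> 0 then r^2 else 0))"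
proof (cases "r \<ge> 0")
  case True
  have "{x::R2. norm x \<le> r} = cball 0 r" by auto
  then show ?thesis using True emeasure_cball[of r "0::R2"] by (simp add: unit_ball_vol_2 mult.commute)
next
  case False
  then have "{x::R2. norm x \<le> r} = {}" by (auto simp: not_le intro: less_le_trans[OF _ norm_ge_zero])
  then show ?thesis using False by (simp only:) simp
qed

lemma measure_eqI_atMost:
  fixes M N :: "real measure"
  assumes sets: "sets M = sets borel" "sets N = sets borel"
    and fin: "\<And>x. emeasure M {..x} < \<infinity>"
    and eq: "\<And>x. emeasure M {..x} = emeasure N {..x}"
  shows "M = N"
proof (rule measure_eqI_generator_eq)
  let ?E = "range (\<lambda>a::real. {..a})" and ?A = "\<lambda>n::nat. {..real n}"
  show "Int_stable ?E" by (auto simp: Int_stable_def)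
  have "sets (borel :: real measure) = sigma_sets UNIV ?E"
    by (subst borel_eq_atMost) (auto simp: sets_measure_of)
  then show "sets M = sigma_sets UNIV ?E" "sets N = sigma_sets UNIV ?E" using sets by auto
  show "range ?A \<subseteq> ?E" by auto
  show "(\<Union>i. ?A i) = UNIV" using real_arch_simple by auto
  show "\<And>i. emeasure M (?A i) \<noteq> \<infinity>" using fin by (auto simp: less_top)
  show "\<And>X. X \<in> ?E \<Longrightarrow> emeasure M X = emeasure N X" using eq by auto
qed auto

text \<open>Both measures give the half-line up to a the area of the disc of radius a. For r < 0 the
  value \<open>ennreal (2 * pi * r)\<close> is 0, so the density lives on the positive half-line
  without an indicator.\<close>

lemma distr_norm_R2: "distr lborel borel (norm :: R2 \<Rightarrow> real) = density lborel (\<lambda>r. ennreal (2 * pi * r))"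
proof (rule measure_eqI_atMost)
  fix a :: real
  have 1: "emeasure (distr lborel borel (norm :: R2 \<Rightarrow> real)) {..a} = ennreal (pi * (if a \<ge> 0 then a^2 else 0))"
    by (subst emeasure_distr) (auto simp: vimage_def emeasure_norm_le_R2)
  then show "emeasure (distr lborel borel (norm :: R2 \<Rightarrow> real)) {..a} < \<infinity>" by simp
  have "emeasure (density lborel (\<lambda>r. ennreal (2 * pi * r))) {..a} = (\<integral>\<^sup>+r. ennreal (2 * pi * r) * indicator {0..a} r \<partial>lborel)"
    by (subst emeasure_density) (auto intro!: nn_integral_cong split: split_indicator simp: ennreal_neg mult_nonneg_nonpos)
  also have "\<dots> = ennreal (pi * (if a \<ge> 0 then a^2 else 0))"
  proof (cases "a \<ge> 0")
    case True
    have "(\<integral>\<^sup>+r. ennreal (2 * pi * r) * indicator {0..a} r \<partial>lborel) = ennreal (pi * a^2 - pi * 0^2)"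
      by (rule nn_integral_FTC_Icc) (use True in \<open>auto intro!: derivative_eq_intros\<close>)
    then show ?thesis using True by simp
  qed simp
  finally show "emeasure (distr lborel borel (norm :: R2 \<Rightarrow> real)) {..a} = emeasure (density lborel (\<lambda>r. ennreal (2 * pi * r))) {..a}"
    using 1 by simp
qed auto

text \<open>In the area variable r = |x|^2 the radial measure has constant density. Radial
  integration by parts is done in this variable, where the du Bois-Reymond lemma needs no
  weight.\<close>

lemma distr_norm_square_R2:
  "distr lborel borel (\<lambda>x::R2. (norm x)\<^sup>2) = density lborel (\<lambda>r. ennreal (pi * indicator {0<..} r))"
proof (rule measure_eqI_atMost)
  fix a :: real
  have "emeasure (distr lborel borel (\<lambda>x::R2. (norm x)\<^sup>2)) {..a} = emeasure lborel {x::R2. (norm x)\<^sup>2 \<le> a}"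
    by (subst emeasure_distr) (auto simp: vimage_def)
  also have "{x::R2. (norm x)\<^sup>2 \<le> a} = (if a \<ge> 0 then {x::R2. norm x \<le> sqrt a} else {})"
    by (auto simp: real_le_rsqrt intro: sqrt_ge_absD order_trans[OF zero_le_power2])
  finally have 1: "emeasure (distr lborel borel (\<lambda>x::R2. (norm x)\<^sup>2)) {..a} = ennreal (pi * max 0 a)"
    by (auto simp: emeasure_norm_le_R2 max_def split: if_splits)
  then show "emeasure (distr lborel borel (\<lambda>x::R2. (norm x)\<^sup>2)) {..a} < \<infinity>" by simp
  have "emeasure (density lborel (\<lambda>r. ennreal (pi * indicator {0<..} r))) {..a} = (\<integral>\<^sup>+r. ennreal pi * indicator {0<..a} r \<partial>lborel)"
    by (subst emeasure_density) (auto intro!: nn_integral_cong split: split_indicator)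
  also have "\<dots> = ennreal (pi * max 0 a)"
    by (subst nn_integral_cmult_indicator) (auto simp: max_def ennreal_mult)
  finally show "emeasure (distr lborel borel (\<lambda>x::R2. (norm x)\<^sup>2)) {..a} = emeasure (density lborel (\<lambda>r. ennreal (pi * indicator {0<..} r))) {..a}"
    using 1 by simp
qed auto

lemma integral_norm_square_R2:
  fixes f :: "real \<Rightarrow> real"
  assumes [measurable]: "f \<in> borel_measurable borel"
  shows "(\<integral>x. f ((norm (x::R2))\<^sup>2) \<partial>lborel) = (\<integral>r. (pi * indicator {0<..} r) * f r \<partial>lborel)"
    and "integrable lborel (\<lambda>x::R2. f ((norm x)\<^sup>2)) \<longleftrightarrow> integrable lborel (\<lambda>r. (pi * indicator {0<..} r) * f r)"
proof -
  have "(\<integral>x. f ((norm (x::R2))\<^sup>2) \<partial>lborel) = (\<integral>r. f r \<partial>distr lborel borel (\<lambda>x::R2. (norm x)\<^sup>2))"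
    by (subst integral_distr) auto
  then show "(\<integral>x. f ((norm (x::R2))\<^sup>2) \<partial>lborel) = (\<integral>r. (pi * indicator {0<..} r) * f r \<partial>lborel)"
    unfolding distr_norm_square_R2 by (subst (asm) integral_density) auto
  have "integrable lborel (\<lambda>x::R2. f ((norm x)\<^sup>2)) \<longleftrightarrow> integrable (distr lborel borel (\<lambda>x::R2. (norm x)\<^sup>2)) f"
    by (subst integrable_distr_eq) auto
  then show "integrable lborel (\<lambda>x::R2. f ((norm x)\<^sup>2)) \<longleftrightarrow> integrable lborel (\<lambda>r. (pi * indicator {0<..} r) * f r)"
    unfolding distr_norm_square_R2 by (subst (asm) integrable_density) auto
qed

lemma integral_norm_R2:
  fixes f :: "real \<Rightarrow> real"
  assumes [measurable]: "f \<in> borel_measurable borel"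
  shows "(\<integral>x. f (norm (x::R2)) \<partial>lborel) = (\<integral>r. (2 * pi * r * indicator {0..} r) * f r \<partial>lborel)"
    and "integrable lborel (\<lambda>x::R2. f (norm x)) \<longleftrightarrow> integrable lborel (\<lambda>r. (2 * pi * r * indicator {0..} r) * f r)"
proof -
  \<comment> \<open>Integrals against a density need a real nonnegative one, so the truncation
    hidden in \<open>ennreal\<close> becomes an explicit indicator.\<close>
  have d: "distr lborel borel (norm :: R2 \<Rightarrow> real) = density lborel (\<lambda>r. ennreal (2 * pi * r * indicator {0..} r))"
    unfolding distr_norm_R2 by (intro density_cong) (auto split: split_indicator simp: ennreal_neg mult_nonneg_nonpos)
  have "(\<integral>x. f (norm (x::R2)) \<partial>lborel) = (\<integral>r. f r \<partial>distr lborel borel (norm :: R2 \<Rightarrow> real))"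
    by (subst integral_distr) auto
  then show "(\<integral>x. f (norm (x::R2)) \<partial>lborel) = (\<integral>r. (2 * pi * r * indicator {0..} r) * f r \<partial>lborel)"
    unfolding d by (subst (asm) integral_density) (auto split: split_indicator)
  have "integrable lborel (\<lambda>x::R2. f (norm x)) \<longleftrightarrow> integrable (distr lborel borel (norm :: R2 \<Rightarrow> real)) f"
    by (subst integrable_distr_eq) auto
  then show "integrable lborel (\<lambda>x::R2. f (norm x)) \<longleftrightarrow> integrable lborel (\<lambda>r. (2 * pi * r * indicator {0..} r) * f r)"
    unfolding d by (subst (asm) integrable_density) (auto split: split_indicator)
qed

text \<open>Boxes generate the Borel sets and are stable under intersection, so Dynkin's argument
  extends the vanishing of the integral to all Borel sets. It is run on the growing boxes
  \<open>Bx n\<close>, on which h is integrable.\<close>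

lemma AE_zero_if_integral_box_zero:
  fixes h :: "'a::euclidean_space \<Rightarrow> 'b::{banach, second_countable_topology}"
  assumes int: "\<And>a b. integrable lborel (\<lambda>x. indicator (box a b) x *\<^sub>R h x)"
    and zero: "\<And>a b. (\<integral>x. indicator (box a b) x *\<^sub>R h x \<partial>lborel) = 0"
  shows "AE x in lborel. h x = 0"
proof -
  define Bx where "Bx n = box (- (real n *\<^sub>R One)) (real n *\<^sub>R One :: 'a)" for n :: nat
  have "AE x in lborel. indicator (Bx n) x *\<^sub>R h x = 0" for n
  proof (rule sigma_finite_measure.density_zero[OF sigma_finite_lborel])
    show I: "integrable lborel (\<lambda>x. indicator (Bx n) x *\<^sub>R h x)" unfolding Bx_def by (rule int)
    fix A :: "'a set" assume "A \<in> sets lborel"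
    then have A: "A \<in> sigma_sets UNIV (range (\<lambda>(a, b). box a b :: 'a set))"
      by (simp add: borel_eq_box)
    have "Int_stable (range (\<lambda>(a, b). box a b :: 'a set))" by (auto simp: Int_stable_def box_Int_box)
    moreover have "range (\<lambda>(a, b). box a b :: 'a set) \<subseteq> Pow UNIV" by simp
    moreover note A
    ultimately show "set_lebesgue_integral lborel A (\<lambda>x. indicator (Bx n) x *\<^sub>R h x) = 0"
    proof (induction rule: sigma_sets_induct_disjoint)
      case (basic A)
      then obtain a b where "A \<inter> Bx n = box a b" unfolding Bx_def by (auto simp: box_Int_box)
      then have "indicator A x *\<^sub>R indicator (Bx n) x *\<^sub>R h x = indicator (box a b) x *\<^sub>R h x" for x
        by (auto split: split_indicator)
      then show ?case using zero[of a b] by (simp only: set_lebesgue_integral_def)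
    next
      case empty then show ?case by (simp add: set_lebesgue_integral_def)
    next
      case (compl A)
      have A: "A \<in> sets lborel" using compl by (simp add: borel_eq_box)
      have "indicator (UNIV - A) x *\<^sub>R indicator (Bx n) x *\<^sub>R h x
         = indicator (Bx n) x *\<^sub>R h x - indicator A x *\<^sub>R indicator (Bx n) x *\<^sub>R h x" for x
        by (auto split: split_indicator)
      moreover have "integrable lborel (\<lambda>x. indicator A x *\<^sub>R indicator (Bx n) x *\<^sub>R h x)"
        by (rule integrable_mult_indicator[OF A I])
      ultimately show ?case using I compl(2) zero[of "- (real n *\<^sub>R One)" "real n *\<^sub>R One"]
        by (simp add: set_lebesgue_integral_def Bx_def)
    next
      case (union A)
      have A: "A i \<in> sets lborel" for i using union(2) by (auto simp: borel_eq_box)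
      have "set_lebesgue_integral lborel (\<Union>i. A i) (\<lambda>x. indicator (Bx n) x *\<^sub>R h x) = (\<Sum>i. set_lebesgue_integral lborel (A i) (\<lambda>x. indicator (Bx n) x *\<^sub>R h x))"
      proof (rule lebesgue_integral_countable_add)
        show "\<And>i j. i \<noteq> j \<Longrightarrow> A i \<inter> A j = {}" using union(1) by (auto simp: disjoint_family_on_def)
        have "(\<Union>i. A i) \<in> sets lborel" using A by auto
        then show "set_integrable lborel (\<Union>i. A i) (\<lambda>x. indicator (Bx n) x *\<^sub>R h x)"
          unfolding set_integrable_def by (rule integrable_mult_indicator[OF _ I])
      qed (rule A)
      then show ?case using union(3) by simp
    qed
  qed
  then have "AE x in lborel. \<forall>n. indicator (Bx n) x *\<^sub>R h x = 0" by (subst AE_all_countable) blast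
  then show ?thesis
  proof (rule eventually_mono)
    fix x assume H: "\<forall>n. indicator (Bx n) x *\<^sub>R h x = 0"
    have "x \<in> (\<Union>n. Bx n)" unfolding Bx_def using UN_box_eq_UNIV by auto
    then obtain n where "x \<in> Bx n" by auto
    then show "h x = 0" using H[rule_format, of n] by simp
  qed
qed

section \<open>C^1 bump functions and the fundamental lemma of the calculus of variations\<close>

definition pos_sq :: "real \<Rightarrow> real" where "pos_sq t = (max 0 t)\<^sup>2"

lemma pos_sq_deriv: "(pos_sq has_real_derivative 2 * max 0 t) (at t)"
proof -
  consider "t < 0" | "t = 0" | "t > 0" by linarith
  then show ?thesis
  proof cases
    case 1
    have "((\<lambda>t. 0) has_real_derivative 2 * max 0 t) (at t)" using 1 by (auto intro!: derivative_eq_intros)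
    then show ?thesis
      by (rule has_field_derivative_transform_within_open[where S = "{..<0}"]) (use 1 in \<open>auto simp: pos_sq_def\<close>)
  next
    case 3
    have "((\<lambda>t. t\<^sup>2) has_real_derivative 2 * max 0 t) (at t)" using 3 by (auto intro!: derivative_eq_intros)
    then show ?thesis
      by (rule has_field_derivative_transform_within_open[where S = "{0<..}"]) (use 3 in \<open>auto simp: pos_sq_def\<close>)
  next
    case 2
    have "((\<lambda>h. pos_sq h / h) \<longlongrightarrow> 0) (at 0)"
    proof (rule Lim_null_comparison)
      show "eventually (\<lambda>h. norm (pos_sq h / h) \<le> \<bar>h\<bar>) (at (0::real))"
        by (intro always_eventually) (auto simp: pos_sq_def max_def power2_eq_square)
    qed (auto intro!: tendsto_eq_intros)
    then show ?thesis unfolding 2 DERIV_def by (simp add: pos_sq_def[of 0])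
  qed
qed

text \<open>\<open>test_fun\<close> asks for one continuous derivative only, so the truncated square
  \<open>pos_sq\<close> of a quadratic is regular enough. The product w of two such factors is
  positive exactly on the box.\<close>

lemma test_fun_box_bump:
  fixes a b :: R2
  obtains phi Dphi where "\<And>n::nat. test_fun (phi n) (Dphi n)" "\<And>n x. 0 \<le> phi n x \<and> phi n x \<le> indicator (box a b) x"
    "\<And>x. (\<lambda>n. phi n x) \<longlonglongrightarrow> indicator (box a b) x"
proof -
  define q where "q i x = pos_sq ((x - a $ i) * (b $ i - x))" for i :: 2 and x
  define q' where "q' i x = 2 * max 0 ((x - a $ i) * (b $ i - x)) * (a $ i + b $ i - 2 * x)" for i :: 2 and x
  have q: "(q i has_real_derivative q' i x) (at x)" for i x
    unfolding q_def q'_def by (rule derivative_eq_intros DERIV_chain2[OF pos_sq_deriv] refl)+ (simp add: algebra_simps)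
  show ?thesis
  proof (cases "a $ 1 < b $ 1 \<and> a $ 2 < b $ 2")
    case False
    then have e: "box a b = {}" by (force simp: mem_box_cart set_eq_iff forall_2)
    show ?thesis
      by (rule that[of "\<lambda>n x. 0" "\<lambda>n x. 0"]) (auto simp: e test_fun_def)
  next
    case True
    then have ab: "a $ i < b $ i" for i using exhaust_2[of i] by auto
    have q0iff: "q i x \<noteq> 0 \<longleftrightarrow> a $ i < x \<and> x < b $ i" for i x
    proof -
      have "q i x \<noteq> 0 \<longleftrightarrow> 0 < (x - a $ i) * (b $ i - x)" by (auto simp: q_def pos_sq_def max_def less_le)
      then show ?thesis using ab[of i] by (auto simp: zero_less_mult_iff)
    qed
    define w where "w x = q 1 (x $ 1) * q 2 (x $ 2)" for x :: R2
    define w' where "w' x = (vector [q' 1 (x $ 1) * q 2 (x $ 2), q 1 (x $ 1) * q' 2 (x $ 2)] :: R2)" for x :: R2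
    have wnn: "w x \<ge> 0" for x by (auto simp: w_def q_def pos_sq_def)
    have wbox: "w x \<noteq> 0 \<longleftrightarrow> x \<in> box a b" for x
      using q0iff[of 1 "x $ 1"] q0iff[of 2 "x $ 2"] by (auto simp: w_def mem_box_cart forall_2)
    have w': "(w has_derivative (\<lambda>h. w' x \<bullet> h)) (at x)" for x
    proof -
      have 1: "((\<lambda>x::R2. q i (x $ i)) has_derivative (\<lambda>h. q' i (x $ i) * h $ i)) (at x)" for i
        using has_derivative_compose[OF bounded_linear_imp_has_derivative[OF bounded_linear_vec_nth] q[of i "x $ i", unfolded has_field_derivative_def]] .
      have "(w has_derivative (\<lambda>h. q 1 (x $ 1) * (q' 2 (x $ 2) * h $ 2) + q' 1 (x $ 1) * h $ 1 * q 2 (x $ 2))) (at x)"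
        unfolding w_def by (rule has_derivative_mult[OF 1 1])
      then show ?thesis
        by (rule has_derivative_eq_rhs) (auto simp: w'_def inner_vec_def sum_2 algebra_simps)
    qed
    have cq: "continuous_on UNIV (q i)" for i
      using q by (auto intro!: continuous_at_imp_continuous_on DERIV_isCont)
    have cq': "continuous_on UNIV (q' i)" for i
      unfolding q'_def by (intro continuous_intros)
    have cqi: "continuous_on UNIV (\<lambda>x::R2. q i (x $ i))" "continuous_on UNIV (\<lambda>x::R2. q' i (x $ i))" for i
      by (intro continuous_on_compose2[OF cq] continuous_on_compose2[OF cq'] continuous_intros; simp)+
    have cw': "continuous_on UNIV w'"
    proof -
      have "w' = (\<lambda>x. \<chi> i. if i = 1 then q' 1 (x $ 1) * q 2 (x $ 2) else q 1 (x $ 1) * q' 2 (x $ 2))"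
        by (auto simp: w'_def vec_eq_iff forall_2)
      moreover have "continuous_on UNIV (\<lambda>x::R2. if i = 1 then q' 1 (x $ 1) * q 2 (x $ 2) else q 1 (x $ 1) * q' 2 (x $ 2))" for i :: 2
        by (cases "i = 1") (auto intro!: continuous_intros cqi)
      ultimately show ?thesis by (auto intro!: continuous_on_vec_lambda)
    qed
    have cw: "continuous_on UNIV w" unfolding w_def by (intro continuous_intros cqi)
    \<comment> \<open>The map y \<mapsto> 1 - 1/(1 + n y) fixes 0 and sends every y > 0 to a value
      below 1 that tends to 1 with n. So the support stays that of w while the limit is the
      indicator.\<close>
    define phi where "phi n x = 1 - 1 / (1 + real n * w x)" for n :: nat and x
    define Dphi where "Dphi n x = (real n / (1 + real n * w x)\<^sup>2) *\<^sub>R w' x" for n :: nat and x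
    have pos: "1 + real n * w x > 0" for n x using mult_nonneg_nonneg[OF of_nat_0_le_iff wnn[of x], of n] by linarith
    show ?thesis
    proof (rule that[of phi Dphi])
      fix n :: nat
      have "(phi n has_derivative (\<lambda>h. Dphi n x \<bullet> h)) (at x)" for x
        unfolding phi_def Dphi_def using pos[of n x]
        by (auto intro!: derivative_eq_intros w' simp: fun_eq_iff power2_eq_square field_simps)
      moreover have "continuous_on UNIV (Dphi n)"
        unfolding Dphi_def using pos by (intro continuous_intros cw cw') (auto simp: less_imp_neq[symmetric])
      moreover have "{x. phi n x \<noteq> 0} \<subseteq> cbox a b"
      proof -
        have "phi n x = 0" if "w x = 0" for x using that by (simp add: phi_def)
        then show ?thesis using wbox box_subset_cbox by blast
      qed
      then have "compact (closure {x. phi n x \<noteq> 0})"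
        by (meson bounded_cbox bounded_subset compact_closure)
      ultimately show "test_fun (phi n) (Dphi n)" by (auto simp: test_fun_def)
      fix x
      show "0 \<le> phi n x \<and> phi n x \<le> indicator (box a b) x"
        using wbox[of x] wnn[of x] pos[of n x] by (auto simp: phi_def divide_simps split: split_indicator)
    next
      fix x
      show "(\<lambda>n. phi n x) \<longlonglongrightarrow> indicator (box a b) x"
      proof (cases "x \<in> box a b")
        case True
        then have "w x > 0" using wbox[of x] wnn[of x] by auto
        then have "(\<lambda>n. 1 - 1 / (1 + real n * w x)) \<longlonglongrightarrow> 1" by real_asymp
        then show ?thesis using True by (simp add: phi_def)
      next
        case False
        then show ?thesis using wbox[of x] by (simp add: phi_def)
      qed
    qed
  qed
qed

lemma test_fun_props:
  assumes "test_fun phi Dphi"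
  obtains R M where "R > 0" "M \<ge> 0" "\<And>x. norm x > R \<Longrightarrow> phi x = 0" "\<And>x. norm x > R \<Longrightarrow> Dphi x = 0"
    "\<And>x. \<bar>phi x\<bar> \<le> M" "\<And>x. norm (Dphi x) \<le> M" "continuous_on UNIV phi" "continuous_on UNIV Dphi"
    "\<And>x. (phi has_derivative (\<lambda>h. Dphi x \<bullet> h)) (at x)"
proof -
  have D: "(phi has_derivative (\<lambda>h. Dphi x \<bullet> h)) (at x)" for x using assms by (auto simp: test_fun_def)
  have c: "continuous_on UNIV phi" using D by (auto intro!: continuous_at_imp_continuous_on has_derivative_continuous)
  have cD: "continuous_on UNIV Dphi" using assms by (auto simp: test_fun_def)
  have "bounded (closure {x. phi x \<noteq> 0})" using assms by (auto simp: test_fun_def intro: compact_imp_bounded)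
  then obtain R where R: "R > 0" "\<And>x. x \<in> closure {x. phi x \<noteq> 0} \<Longrightarrow> norm x \<le> R"
    by (meson bounded_pos)
  have phi0: "phi x = 0" if "norm x > R" for x using R(2)[of x] that closure_subset[of "{x. phi x \<noteq> 0}"] by (meson linorder_not_le mem_Collect_eq subsetD)
  have Dphi0: "Dphi x = 0" if "norm x > R" for x
  proof -
    have "((\<lambda>x. 0) has_derivative (\<lambda>h. 0)) (at x)" by simp
    then have "(phi has_derivative (\<lambda>h. 0)) (at x)"
      by (rule has_derivative_transform_within_open[where s = "{x. norm x > R}"])
        (use that phi0 in \<open>auto intro!: open_Collect_less continuous_intros\<close>)
    then have "(\<lambda>h. Dphi x \<bullet> h) = (\<lambda>h. 0)" using D by (rule has_derivative_unique[rotated])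
    then have "Dphi x \<bullet> Dphi x = 0" by metis
    then show ?thesis by simp
  qed
  have "compact (phi ` cball 0 R)" "compact (Dphi ` cball 0 R)"
    by (auto intro!: compact_continuous_image continuous_on_subset[OF c] continuous_on_subset[OF cD])
  then have "bounded (phi ` cball 0 R)" "bounded (Dphi ` cball 0 R)" by (auto intro: compact_imp_bounded)
  then obtain M1 M2 where "\<forall>x\<in>cball 0 R. norm (phi x) \<le> M1" "\<forall>x\<in>cball 0 R. norm (Dphi x) \<le> M2"
    unfolding bounded_iff by blast
  then have M: "\<bar>phi x\<bar> \<le> M1" "norm (Dphi x) \<le> M2" if "x \<in> cball 0 R" for x using that by auto
  let ?M = "max 0 (max M1 M2)"
  have "\<bar>phi x\<bar> \<le> ?M \<and> norm (Dphi x) \<le> ?M" for x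
    using M[of x] phi0[of x] Dphi0[of x] by (cases "norm x > R") (auto simp: not_less)
  then show ?thesis using that[of R ?M] R phi0 Dphi0 c cD D by auto
qed

text \<open>The bumps tend to the indicator of a box and are dominated by it, so h has integral zero
  over every box.\<close>

lemma AE_zero_if_test_fun:
  fixes h :: "R2 \<Rightarrow> R2"
  assumes int: "\<And>a b. integrable lborel (\<lambda>x. indicator (box a b) x *\<^sub>R h x)"
    and h[measurable]: "h \<in> borel_measurable borel"
    and zero: "\<And>phi Dphi. test_fun phi Dphi \<Longrightarrow> (\<integral>x. phi x *\<^sub>R h x \<partial>lborel) = 0"
  shows "AE x in lborel. h x = 0"
proof (rule AE_zero_if_integral_box_zero[OF int])
  fix a b :: R2
  obtain phi Dphi where phi: "\<And>n::nat. test_fun (phi n) (Dphi n)" "\<And>n x. 0 \<le> phi n x \<and> phi n x \<le> indicator (box a b) x"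
    "\<And>x. (\<lambda>n. phi n x) \<longlonglongrightarrow> indicator (box a b) x" by (rule test_fun_box_bump[of a b]) blast
  have [measurable]: "phi n \<in> borel_measurable borel" for n
    by (rule test_fun_props[OF phi(1)[of n]]) (auto intro: borel_measurable_continuous_onI)
  have "(\<lambda>n. \<integral>x. phi n x *\<^sub>R h x \<partial>lborel) \<longlonglongrightarrow> (\<integral>x. indicator (box a b) x *\<^sub>R h x \<partial>lborel)"
  proof (rule integral_dominated_convergence)
    show "integrable lborel (\<lambda>x. norm (indicator (box a b) x *\<^sub>R h x))" using int by (rule integrable_norm)
    show "AE x in lborel. norm (phi i x *\<^sub>R h x) \<le> norm (indicator (box a b) x *\<^sub>R h x)" for i
      using phi(2) by (auto intro!: mult_right_mono)
    show "AE x in lborel. (\<lambda>i. phi i x *\<^sub>R h x) \<longlonglongrightarrow> indicat_real (box a b) x *\<^sub>R h x"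
      using phi(3) by (auto intro!: tendsto_intros)
  qed auto
  then show "(\<integral>x. indicator (box a b) x *\<^sub>R h x \<partial>lborel) = 0"
    using zero[OF phi(1)] by (simp add: LIMSEQ_const_iff)
qed

subsection \<open>Weak gradients\<close>

lemma
  fixes f :: "R2 \<Rightarrow> 'b::{banach, second_countable_topology}"
  assumes f[measurable]: "f \<in> borel_measurable borel" and c: "c \<noteq> 0"
  shows integral_affine_R2: "(\<integral>x. f (c *\<^sub>R x + a) \<partial>lborel) = (1 / c\<^sup>2) *\<^sub>R (\<integral>x. f x \<partial>lborel)"
    and integrable_affine_R2: "integrable lborel (\<lambda>x. f (c *\<^sub>R x + a)) \<longleftrightarrow> integrable lborel f"
proof -
  have L: "(lborel :: R2 measure) = density (distr lborel borel (\<lambda>x. a + c *\<^sub>R x)) (\<lambda>_. ennreal (c\<^sup>2))"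
    using lborel_affine[OF c, of a] by simp
  have "(\<integral>x. f x \<partial>lborel) = c\<^sup>2 *\<^sub>R (\<integral>x. f (a + c *\<^sub>R x) \<partial>lborel)"
    by (subst L, subst integral_density) (auto simp: integral_distr)
  then show "(\<integral>x. f (c *\<^sub>R x + a) \<partial>lborel) = (1 / c\<^sup>2) *\<^sub>R (\<integral>x. f x \<partial>lborel)"
    using c by (simp add: add.commute)
  have "integrable lborel f \<longleftrightarrow> integrable lborel (\<lambda>x. c\<^sup>2 *\<^sub>R f (a + c *\<^sub>R x))"
    by (subst L, subst integrable_density) (auto simp: integrable_distr_eq)
  also have "\<dots> \<longleftrightarrow> integrable lborel (\<lambda>x. f (a + c *\<^sub>R x))"
  proof
    assume "integrable lborel (\<lambda>x. c\<^sup>2 *\<^sub>R f (a + c *\<^sub>R x))"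
    from integrable_scaleR_right[OF this, of "1 / c\<^sup>2"] show "integrable lborel (\<lambda>x. f (a + c *\<^sub>R x))"
      using c by simp
  qed auto
  finally show "integrable lborel (\<lambda>x. f (c *\<^sub>R x + a)) \<longleftrightarrow> integrable lborel f"
    by (simp add: add.commute)
qed

lemma nn_integral_affine_R2:
  assumes f[measurable]: "f \<in> borel_measurable borel" and c: "c \<noteq> 0"
  shows "(\<integral>\<^sup>+x. f (c *\<^sub>R x + (a::R2)) \<partial>lborel) = ennreal (1 / c\<^sup>2) * (\<integral>\<^sup>+x. f x \<partial>lborel)"
proof -
  have L: "(lborel :: R2 measure) = density (distr lborel borel (\<lambda>x. a + c *\<^sub>R x)) (\<lambda>_. ennreal (c\<^sup>2))"
    using lborel_affine[OF c, of a] by simp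
  have "(\<integral>\<^sup>+x. f x \<partial>lborel) = ennreal (c\<^sup>2) * (\<integral>\<^sup>+x. f (a + c *\<^sub>R x) \<partial>lborel)"
    by (subst L, subst nn_integral_density) (auto simp: nn_integral_distr nn_integral_cmult)
  then have "ennreal (1 / c\<^sup>2) * (\<integral>\<^sup>+x. f x \<partial>lborel) = (ennreal (1 / c\<^sup>2) * ennreal (c\<^sup>2)) * (\<integral>\<^sup>+x. f (a + c *\<^sub>R x) \<partial>lborel)"
    by (simp add: mult.assoc)
  also have "ennreal (1 / c\<^sup>2) * ennreal (c\<^sup>2) = 1" using c by (subst ennreal_mult[symmetric]) auto
  finally show ?thesis by (simp add: add.commute)
qed

lemma AE_affine_R2:
  assumes c: "c \<noteq> 0" and P[measurable]: "Measurable.pred borel P" and AE: "AE x in lborel. P (x::R2)"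
  shows "AE x in lborel. P (c *\<^sub>R x + a)"
proof -
  have "(lborel :: R2 measure) = density (distr lborel borel (\<lambda>x. a + c *\<^sub>R x)) (\<lambda>_. ennreal (c\<^sup>2))"
    using lborel_affine[OF c, of a] by simp
  then have "AE x in density (distr lborel borel (\<lambda>x. a + c *\<^sub>R x)) (\<lambda>_. ennreal (c\<^sup>2)). P x" using AE by metis
  then have "AE x in distr lborel borel (\<lambda>x. a + c *\<^sub>R x). P x" using c by (subst (asm) AE_density) auto
  then show ?thesis by (subst (asm) AE_distr_iff) (auto simp: add.commute)
qed

lemma test_fun_affine:
  assumes "test_fun phi Dphi" "c \<noteq> 0"
  shows "test_fun (\<lambda>x. phi (c *\<^sub>R x + a)) (\<lambda>x. c *\<^sub>R Dphi (c *\<^sub>R x + a))"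
proof -
  obtain R M where R: "\<And>x. norm x > R \<Longrightarrow> phi x = 0" "continuous_on UNIV Dphi"
    "\<And>x. (phi has_derivative (\<lambda>h. Dphi x \<bullet> h)) (at x)" by (rule test_fun_props[OF assms(1)]) blast
  have d: "((\<lambda>x. c *\<^sub>R x + a) has_derivative (\<lambda>h. c *\<^sub>R h)) (at x)" for x
    by (auto intro!: derivative_eq_intros)
  have "((\<lambda>x. phi (c *\<^sub>R x + a)) has_derivative (\<lambda>h. (c *\<^sub>R Dphi (c *\<^sub>R x + a)) \<bullet> h)) (at x)" for x
    using has_derivative_compose[OF d R(3), of x] by simp
  moreover have "continuous_on UNIV (\<lambda>x. c *\<^sub>R Dphi (c *\<^sub>R x + a))"
    by (intro continuous_intros continuous_on_compose2[OF R(2)]) auto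
  moreover have "{x. phi (c *\<^sub>R x + a) \<noteq> 0} \<subseteq> cball 0 ((R + norm a) / \<bar>c\<bar>)"
  proof
    fix x assume "x \<in> {x. phi (c *\<^sub>R x + a) \<noteq> 0}"
    then have "norm (c *\<^sub>R x + a) \<le> R" using R(1) by (force simp: not_less)
    then have "norm (c *\<^sub>R x) \<le> R + norm a" using norm_triangle_ineq4[of "c *\<^sub>R x + a" a] by simp
    then show "x \<in> cball 0 ((R + norm a) / \<bar>c\<bar>)" using assms(2) by (simp add: field_simps)
  qed
  then have "compact (closure {x. phi (c *\<^sub>R x + a) \<noteq> 0})"
    by (meson bounded_cball bounded_subset compact_closure)
  ultimately show ?thesis by (auto simp: test_fun_def)
qed

text \<open>A ball has finite measure, and |f| \<le> 1 + |f|^2 turns local square integrability into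
  integrability.\<close>

lemma integrable_dominated_L2:
  fixes F :: "R2 \<Rightarrow> 'b::{banach, second_countable_topology}" and f :: "R2 \<Rightarrow> 'c::real_normed_vector"
  assumes [measurable]: "F \<in> borel_measurable borel" and f: "integrable lborel (\<lambda>x. (norm (f x))\<^sup>2)"
    and le: "\<And>x. norm x \<le> R \<Longrightarrow> norm (F x) \<le> M * norm (f x)" and 0: "\<And>x. norm x > R \<Longrightarrow> F x = 0"
  shows "integrable lborel F"
proof (rule Bochner_Integration.integrable_bound)
  have "emeasure lborel (cball (0::R2) R) < \<infinity>" by (rule emeasure_bounded_finite) simp
  then show "integrable lborel (\<lambda>x. \<bar>M\<bar> * (indicator (cball 0 R) x + (norm (f x))\<^sup>2))"
    using f by (intro integrable_mult_right Bochner_Integration.integrable_add integrable_real_indicator) auto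
  have "norm (F x) \<le> \<bar>M\<bar> * (indicator (cball 0 R) x + (norm (f x))\<^sup>2)" for x
  proof (cases "norm x \<le> R")
    case True
    have "norm (f x) \<le> 1 + (norm (f x))\<^sup>2" using sum_squares_bound[of "norm (f x)" 1] norm_ge_zero[of "f x"] unfolding mult_1_right power_one by linarith
    then have "\<bar>M\<bar> * norm (f x) \<le> \<bar>M\<bar> * (1 + (norm (f x))\<^sup>2)" by (intro mult_left_mono) auto
    moreover have "M * norm (f x) \<le> \<bar>M\<bar> * norm (f x)" by (intro mult_right_mono) auto
    ultimately show ?thesis using le[OF True] True by simp
  qed (simp add: 0)
  then show "AE x in lborel. norm (F x) \<le> norm (\<bar>M\<bar> * (indicator (cball 0 R) x + (norm (f x))\<^sup>2))"
    by (auto simp: order_trans[OF _ abs_ge_self])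
qed simp

lemma Lp_fun_2: "Lp_fun 2 u \<longleftrightarrow> u \<in> borel_measurable borel \<and> integrable lborel (\<lambda>x. (u x)\<^sup>2)"
  by (simp add: Lp_fun_def)

lemma test_fun_integrable:
  assumes "test_fun phi Dphi"
  shows "G \<in> borel_measurable borel \<Longrightarrow> integrable lborel (\<lambda>x. (norm (G x))\<^sup>2) \<Longrightarrow> integrable lborel (\<lambda>x. phi x *\<^sub>R (G x :: R2))"
    and "u \<in> borel_measurable borel \<Longrightarrow> integrable lborel (\<lambda>x. (u x)\<^sup>2) \<Longrightarrow> integrable lborel (\<lambda>x. u x *\<^sub>R Dphi x)"
    and "phi \<in> borel_measurable borel" "Dphi \<in> borel_measurable borel"
proof -
  obtain R M where R: "\<And>x. norm x > R \<Longrightarrow> phi x = 0" "\<And>x. norm x > R \<Longrightarrow> Dphi x = 0"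
    "\<And>x. \<bar>phi x\<bar> \<le> M" "\<And>x. norm (Dphi x) \<le> M" "continuous_on UNIV phi" "continuous_on UNIV Dphi"
    by (rule test_fun_props[OF assms]) blast
  show [measurable]: "phi \<in> borel_measurable borel" "Dphi \<in> borel_measurable borel"
    using R(5,6) by (auto intro: borel_measurable_continuous_onI)
  show "integrable lborel (\<lambda>x. phi x *\<^sub>R (G x :: R2))" if [measurable]: "G \<in> borel_measurable borel" and "integrable lborel (\<lambda>x. (norm (G x))\<^sup>2)"
    by (rule integrable_dominated_L2[OF _ that(2), where R = R and M = M]) (use R in \<open>auto intro!: mult_right_mono\<close>)
  show "integrable lborel (\<lambda>x. u x *\<^sub>R Dphi x)" if [measurable]: "u \<in> borel_measurable borel" and "integrable lborel (\<lambda>x. (u x)\<^sup>2)"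
    by (rule integrable_dominated_L2[where f = u and R = R and M = M]) (use R that in \<open>auto simp: mult.commute[of M] intro!: mult_left_mono\<close>)
qed

lemma L2_grad_test:
  "L2_grad u G \<Longrightarrow> test_fun phi Dphi \<Longrightarrow> (\<integral>x. u x *\<^sub>R Dphi x \<partial>lborel) = - (\<integral>x. phi x *\<^sub>R G x \<partial>lborel)"
  by (simp add: L2_grad_def weak_grad_def)

lemma L2_grad_unique:
  assumes "L2_grad u G" "L2_grad u H"
  shows "AE x in lborel. G x = H x"
proof -
  have [measurable]: "G \<in> borel_measurable borel" "H \<in> borel_measurable borel" using assms by (auto simp: L2_grad_def)
  have I: "integrable lborel (\<lambda>x. (norm (G x))\<^sup>2)" "integrable lborel (\<lambda>x. (norm (H x))\<^sup>2)" using assms by (auto simp: L2_grad_def)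
  have B: "integrable lborel (\<lambda>x. indicator (box a b) x *\<^sub>R K x)"
    if "K \<in> borel_measurable borel" "integrable lborel (\<lambda>x. (norm (K x))\<^sup>2)" for a b :: R2 and K :: "R2 \<Rightarrow> R2"
  proof -
    obtain R where "\<And>x. x \<in> box a b \<Longrightarrow> norm x \<le> R" using bounded_box[of a b] by (auto simp: bounded_iff)
    then show ?thesis
      by (intro integrable_dominated_L2[OF _ that(2), where R = R and M = 1])
        (use that in \<open>auto split: split_indicator simp: not_less[symmetric]\<close>)
  qed
  have "AE x in lborel. G x - H x = 0"
  proof (rule AE_zero_if_test_fun)
    show "integrable lborel (\<lambda>x. indicator (box a b) x *\<^sub>R (G x - H x))" for a b
      using Bochner_Integration.integrable_diff[OF B[of G a b] B[of H a b]] I by (simp add: scaleR_diff_right)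
    fix phi Dphi assume t: "test_fun phi Dphi"
    have "(\<integral>x. phi x *\<^sub>R G x \<partial>lborel) = (\<integral>x. phi x *\<^sub>R H x \<partial>lborel)"
      using L2_grad_test[OF assms(1) t] L2_grad_test[OF assms(2) t] by simp
    then show "(\<integral>x. phi x *\<^sub>R (G x - H x) \<partial>lborel) = 0"
      using test_fun_integrable(1)[OF t _ I(1)] test_fun_integrable(1)[OF t _ I(2)] by (simp add: scaleR_diff_right)
  qed simp
  then show ?thesis by simp
qed

lemma L2_grad_wgrad: "L2_grad u G \<Longrightarrow> L2_grad u (wgrad u)"
  unfolding wgrad_def using someI[of "L2_grad u" G] .

text \<open>\<open>wgrad\<close> is a choice by \<open>SOME\<close>. Uniqueness almost everywhere
  lets the energy be computed with whichever weak gradient is at hand.\<close>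

lemma grad_sq_eq:
  assumes "L2_grad u G" shows "grad_sq u = (\<integral>x. (norm (G x))\<^sup>2 \<partial>lborel)"
  unfolding grad_sq_def
  by (rule integral_cong_AE) (use L2_grad_unique[OF L2_grad_wgrad[OF assms] assms] assms L2_grad_wgrad[OF assms] in \<open>auto simp: L2_grad_def\<close>)

lemma H1_D:
  assumes "H1 u"
  shows "u \<in> borel_measurable borel" "integrable lborel (\<lambda>x. (u x)\<^sup>2)" "L2_grad u (wgrad u)"
  using assms L2_grad_wgrad by (auto simp: H1_def Lp_fun_2)

lemma H1_I:
  assumes "u \<in> borel_measurable borel" "integrable lborel (\<lambda>x. (u x)\<^sup>2)" "L2_grad u G"
  shows "H1 u"
  using assms by (auto simp: H1_def Lp_fun_2)

lemma integrable_mult_L2: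
  fixes u v :: "R2 \<Rightarrow> real"
  assumes [measurable]: "u \<in> borel_measurable borel" "v \<in> borel_measurable borel"
    and "integrable lborel (\<lambda>x. (u x)\<^sup>2)" "integrable lborel (\<lambda>x. (v x)\<^sup>2)"
  shows "integrable lborel (\<lambda>x. u x * v x)"
proof (rule Bochner_Integration.integrable_bound[OF Bochner_Integration.integrable_add[OF assms(3,4)]])
  have "\<bar>u x * v x\<bar> \<le> (u x)\<^sup>2 + (v x)\<^sup>2" for x
    using sum_squares_bound[of "\<bar>u x\<bar>" "\<bar>v x\<bar>"] abs_ge_zero[of "u x * v x"]
    unfolding abs_mult power2_abs by linarith
  then show "AE x in lborel. norm (u x * v x) \<le> norm ((u x)\<^sup>2 + (v x)\<^sup>2)" by simp
qed simp

lemma integrable_square_lincomb: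
  fixes u v :: "R2 \<Rightarrow> real"
  assumes [measurable]: "u \<in> borel_measurable borel" "v \<in> borel_measurable borel"
    and "integrable lborel (\<lambda>x. (u x)\<^sup>2)" "integrable lborel (\<lambda>x. (v x)\<^sup>2)"
  shows "integrable lborel (\<lambda>x. (a * u x + b * v x)\<^sup>2)"
    and "(\<integral>x. (a * u x + b * v x)\<^sup>2 \<partial>lborel) = a\<^sup>2 * (\<integral>x. (u x)\<^sup>2 \<partial>lborel) + 2 * a * b * (\<integral>x. u x * v x \<partial>lborel) + b\<^sup>2 * (\<integral>x. (v x)\<^sup>2 \<partial>lborel)"
proof -
  have e: "(a * u x + b * v x)\<^sup>2 = a\<^sup>2 * (u x)\<^sup>2 + (2 * a * b) * (u x * v x) + b\<^sup>2 * (v x)\<^sup>2" for x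
    by (simp add: power2_eq_square algebra_simps)
  note I = assms(3,4) integrable_mult_L2[OF assms]
  show "integrable lborel (\<lambda>x. (a * u x + b * v x)\<^sup>2)" unfolding e using I by auto
  show "(\<integral>x. (a * u x + b * v x)\<^sup>2 \<partial>lborel) = a\<^sup>2 * (\<integral>x. (u x)\<^sup>2 \<partial>lborel) + 2 * a * b * (\<integral>x. u x * v x \<partial>lborel) + b\<^sup>2 * (\<integral>x. (v x)\<^sup>2 \<partial>lborel)"
    unfolding e using I by simp
qed

lemma integrable_inner_L2:
  fixes G H :: "R2 \<Rightarrow> R2"
  assumes [measurable]: "G \<in> borel_measurable borel" "H \<in> borel_measurable borel"
    and "integrable lborel (\<lambda>x. (norm (G x))\<^sup>2)" "integrable lborel (\<lambda>x. (norm (H x))\<^sup>2)"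
  shows "integrable lborel (\<lambda>x. G x \<bullet> H x)"
proof (rule Bochner_Integration.integrable_bound[OF Bochner_Integration.integrable_add[OF assms(3,4)]])
  have "\<bar>G x \<bullet> H x\<bar> \<le> (norm (G x))\<^sup>2 + (norm (H x))\<^sup>2" for x
    using sum_squares_bound[of "norm (G x)" "norm (H x)"] Cauchy_Schwarz_ineq2[of "G x" "H x"]
      mult_nonneg_nonneg[OF norm_ge_zero norm_ge_zero, of "G x" "H x"] by linarith
  then show "AE x in lborel. norm (G x \<bullet> H x) \<le> norm ((norm (G x))\<^sup>2 + (norm (H x))\<^sup>2)" by simp
qed simp

lemma L2_grad_lincomb:
  assumes u: "u \<in> borel_measurable borel" "integrable lborel (\<lambda>x. (u x)\<^sup>2)" "L2_grad u G"
    and v: "v \<in> borel_measurable borel" "integrable lborel (\<lambda>x. (v x)\<^sup>2)" "L2_grad v H"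
  shows "L2_grad (\<lambda>x. a * u x + b * v x) (\<lambda>x. a *\<^sub>R G x + b *\<^sub>R H x)"
    and "(\<integral>x. (norm (a *\<^sub>R G x + b *\<^sub>R H x))\<^sup>2 \<partial>lborel) =
      a\<^sup>2 * (\<integral>x. (norm (G x))\<^sup>2 \<partial>lborel) + 2 * a * b * (\<integral>x. G x \<bullet> H x \<partial>lborel) + b\<^sup>2 * (\<integral>x. (norm (H x))\<^sup>2 \<partial>lborel)"
proof -
  have [measurable]: "G \<in> borel_measurable borel" "H \<in> borel_measurable borel" using u v by (auto simp: L2_grad_def)
  have I: "integrable lborel (\<lambda>x. (norm (G x))\<^sup>2)" "integrable lborel (\<lambda>x. (norm (H x))\<^sup>2)" using u v by (auto simp: L2_grad_def)
  have e: "(norm (a *\<^sub>R G x + b *\<^sub>R H x))\<^sup>2 = a\<^sup>2 * (norm (G x))\<^sup>2 + (2 * a * b) * (G x \<bullet> H x) + b\<^sup>2 * (norm (H x))\<^sup>2" for x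
    unfolding power2_norm_eq_inner by (simp add: inner_add_left inner_add_right inner_commute[of "H x" "G x"] power2_eq_square algebra_simps)
  note I3 = I integrable_inner_L2[OF _ _ I]
  show "(\<integral>x. (norm (a *\<^sub>R G x + b *\<^sub>R H x))\<^sup>2 \<partial>lborel) =
      a\<^sup>2 * (\<integral>x. (norm (G x))\<^sup>2 \<partial>lborel) + 2 * a * b * (\<integral>x. G x \<bullet> H x \<partial>lborel) + b\<^sup>2 * (\<integral>x. (norm (H x))\<^sup>2 \<partial>lborel)"
    unfolding e using I3 by simp
  have "integrable lborel (\<lambda>x. (norm (a *\<^sub>R G x + b *\<^sub>R H x))\<^sup>2)" unfolding e using I3 by auto
  moreover have "weak_grad (\<lambda>x. a * u x + b * v x) (\<lambda>x. a *\<^sub>R G x + b *\<^sub>R H x)"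
    unfolding weak_grad_def
  proof (intro allI impI)
    fix phi Dphi assume t: "test_fun phi Dphi"
    note J = test_fun_integrable(2)[OF t u(1,2)] test_fun_integrable(2)[OF t v(1,2)]
      test_fun_integrable(1)[OF t _ I(1)] test_fun_integrable(1)[OF t _ I(2)]
    have "(\<integral>x. (a * u x + b * v x) *\<^sub>R Dphi x \<partial>lborel) = (\<integral>x. a *\<^sub>R (u x *\<^sub>R Dphi x) + b *\<^sub>R (v x *\<^sub>R Dphi x) \<partial>lborel)"
      by (simp add: scaleR_add_left)
    also have "\<dots> = a *\<^sub>R (\<integral>x. u x *\<^sub>R Dphi x \<partial>lborel) + b *\<^sub>R (\<integral>x. v x *\<^sub>R Dphi x \<partial>lborel)"
      using J by (simp del: scaleR_scaleR)
    also have "\<dots> = a *\<^sub>R - (\<integral>x. phi x *\<^sub>R G x \<partial>lborel) + b *\<^sub>R - (\<integral>x. phi x *\<^sub>R H x \<partial>lborel)"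
      using u(3) v(3) t by (simp add: L2_grad_def weak_grad_def)
    also have "\<dots> = - (\<integral>x. a *\<^sub>R (phi x *\<^sub>R G x) + b *\<^sub>R (phi x *\<^sub>R H x) \<partial>lborel)"
      using J by (simp del: scaleR_scaleR)
    finally show "(\<integral>x. (a * u x + b * v x) *\<^sub>R Dphi x \<partial>lborel) = - (\<integral>x. phi x *\<^sub>R (a *\<^sub>R G x + b *\<^sub>R H x) \<partial>lborel)"
      by (simp add: scaleR_add_right mult.commute)
  qed
  ultimately show "L2_grad (\<lambda>x. a * u x + b * v x) (\<lambda>x. a *\<^sub>R G x + b *\<^sub>R H x)"
    by (simp add: L2_grad_def)
qed

text \<open>The factor t^2 from the chain rule cancels the planar Jacobian t^(-2), so the energy
  sees only the amplitude k.\<close>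

lemma L2_grad_dilate:
  assumes "L2_grad u G" and t: "t > 0" and [measurable]: "u \<in> borel_measurable borel"
  shows "L2_grad (\<lambda>x. k * u (t *\<^sub>R x)) (\<lambda>x. (k * t) *\<^sub>R G (t *\<^sub>R x))"
    and "(\<integral>x. (norm ((k * t) *\<^sub>R G (t *\<^sub>R x)))\<^sup>2 \<partial>lborel) = k\<^sup>2 * (\<integral>x. (norm (G x))\<^sup>2 \<partial>lborel)"
proof -
  have [measurable]: "G \<in> borel_measurable borel" using assms by (auto simp: L2_grad_def)
  have I: "integrable lborel (\<lambda>x. (norm (G x))\<^sup>2)" using assms by (auto simp: L2_grad_def)
  have t0: "t \<noteq> 0" using t by simp
  show "(\<integral>x. (norm ((k * t) *\<^sub>R G (t *\<^sub>R x)))\<^sup>2 \<partial>lborel) = k\<^sup>2 * (\<integral>x. (norm (G x))\<^sup>2 \<partial>lborel)"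
    using integral_affine_R2[of "\<lambda>x. (norm (G x))\<^sup>2" t 0] t by (simp add: power_mult_distrib)
  have "integrable lborel (\<lambda>x. (norm ((k * t) *\<^sub>R G (t *\<^sub>R x)))\<^sup>2)"
    using integrable_affine_R2[of "\<lambda>x. (norm (G x))\<^sup>2" t 0] t I by (simp add: power_mult_distrib)
  moreover have "weak_grad (\<lambda>x. k * u (t *\<^sub>R x)) (\<lambda>x. (k * t) *\<^sub>R G (t *\<^sub>R x))"
    unfolding weak_grad_def
  proof (intro allI impI)
    fix phi Dphi assume T: "test_fun phi Dphi"
    note [measurable] = test_fun_integrable(3,4)[OF T]
    have W: "(\<integral>x. u x *\<^sub>R (1 / t) *\<^sub>R Dphi ((1 / t) *\<^sub>R x) \<partial>lborel) = - (\<integral>x. phi ((1 / t) *\<^sub>R x) *\<^sub>R G x \<partial>lborel)"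
      using L2_grad_test[OF assms(1) test_fun_affine[OF T, of "1 / t" 0, unfolded add_0_right]] t by (simp del: scaleR_scaleR)
    have "(\<integral>x. (k * u (t *\<^sub>R x)) *\<^sub>R Dphi x \<partial>lborel) = k *\<^sub>R (\<integral>x. u (t *\<^sub>R x) *\<^sub>R Dphi x \<partial>lborel)"
      by (simp flip: scaleR_scaleR)
    also have "(\<integral>x. u (t *\<^sub>R x) *\<^sub>R Dphi x \<partial>lborel) = (1 / t\<^sup>2) *\<^sub>R (\<integral>x. u x *\<^sub>R Dphi ((1 / t) *\<^sub>R x) \<partial>lborel)"
      using integral_affine_R2[of "\<lambda>x. u x *\<^sub>R Dphi ((1 / t) *\<^sub>R x)" t 0] t by simp
    also have "(\<integral>x. u x *\<^sub>R Dphi ((1 / t) *\<^sub>R x) \<partial>lborel) = t *\<^sub>R (\<integral>x. u x *\<^sub>R (1 / t) *\<^sub>R Dphi ((1 / t) *\<^sub>R x) \<partial>lborel)"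
      using t by (simp flip: integral_scaleR_right)
    also have "\<dots> = - (t *\<^sub>R (\<integral>x. phi ((1 / t) *\<^sub>R x) *\<^sub>R G x \<partial>lborel))" by (simp only: W scaleR_minus_right)
    also have "(\<integral>x. phi ((1 / t) *\<^sub>R x) *\<^sub>R G x \<partial>lborel) = t\<^sup>2 *\<^sub>R (\<integral>x. phi x *\<^sub>R G (t *\<^sub>R x) \<partial>lborel)"
      using integral_affine_R2[of "\<lambda>x. phi ((1 / t) *\<^sub>R x) *\<^sub>R G x" t 0] t by simp
    also have "k *\<^sub>R (1 / t\<^sup>2) *\<^sub>R - (t *\<^sub>R t\<^sup>2 *\<^sub>R (\<integral>x. phi x *\<^sub>R G (t *\<^sub>R x) \<partial>lborel))
      = - ((k * t) *\<^sub>R (\<integral>x. phi x *\<^sub>R G (t *\<^sub>R x) \<partial>lborel))" using t by simp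
    finally show "(\<integral>x. (k * u (t *\<^sub>R x)) *\<^sub>R Dphi x \<partial>lborel) = - (\<integral>x. phi x *\<^sub>R (k * t) *\<^sub>R G (t *\<^sub>R x) \<partial>lborel)"
      by (simp flip: integral_scaleR_right add: mult_ac)
  qed
  ultimately show "L2_grad (\<lambda>x. k * u (t *\<^sub>R x)) (\<lambda>x. (k * t) *\<^sub>R G (t *\<^sub>R x))"
    by (simp add: L2_grad_def)
qed

subsection \<open>Translations and the Gagliardo--Nirenberg bound\<close>

lemma test_fun_lipschitz:
  assumes t: "test_fun phi Dphi" and M: "\<And>x. norm (Dphi x) \<le> M"
  shows "\<bar>phi (x + y) - phi x\<bar> \<le> M * norm y"
proof -
  obtain R where D: "\<And>x. (phi has_derivative (\<lambda>h. Dphi x \<bullet> h)) (at x)"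
    by (rule test_fun_props[OF t]) blast
  have "norm (phi (x + y) - phi x) \<le> M * norm (x + y - x)"
  proof (rule differentiable_bound[of UNIV phi "\<lambda>x h. Dphi x \<bullet> h"])
    fix x
    have "\<bar>Dphi x \<bullet> h\<bar> \<le> M * norm h" for h
      using Cauchy_Schwarz_ineq2[of "Dphi x" h] mult_right_mono[OF M[of x] norm_ge_zero[of h]] by linarith
    then show "onorm (\<lambda>h. Dphi x \<bullet> h) \<le> M" by (intro onorm_le) auto
  qed (auto intro: D)
  then show ?thesis by simp
qed

lemma test_fun_diff_quotient:
  assumes t: "test_fun phi Dphi"
  shows "(\<lambda>n. real (Suc n) * (phi (x + inverse (real (Suc n)) *\<^sub>R h) - phi x)) \<longlonglongrightarrow> Dphi x \<bullet> h"
proof -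
  obtain R where D: "\<And>x. (phi has_derivative (\<lambda>h. Dphi x \<bullet> h)) (at x)"
    by (rule test_fun_props[OF t]) blast
  have "((\<lambda>s::real. x + s *\<^sub>R h) has_derivative (\<lambda>s. s *\<^sub>R h)) (at 0)"
    by (auto intro!: derivative_eq_intros)
  from has_derivative_compose[OF this, of phi "\<lambda>h. Dphi x \<bullet> h"] D[of x]
  have "((\<lambda>s::real. phi (x + s *\<^sub>R h)) has_field_derivative (Dphi x \<bullet> h)) (at 0)"
    by (simp add: has_field_derivative_def mult.commute[of _ "Dphi x \<bullet> h"])
  then have "((\<lambda>s. (phi (x + s *\<^sub>R h) - phi x) / s) \<longlongrightarrow> Dphi x \<bullet> h) (at 0)"
    by (simp add: DERIV_def)
  then have "(\<lambda>n. (phi (x + inverse (real (Suc n)) *\<^sub>R h) - phi x) / inverse (real (Suc n))) \<longlonglongrightarrow> Dphi x \<bullet> h"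
    by (rule filterlim_compose) (auto simp: filterlim_at intro!: LIMSEQ_inverse_real_of_nat simp del: of_nat_Suc)
  then show ?thesis by (simp add: field_simps del: of_nat_Suc)
qed

text \<open>Difference quotients of w have integral zero by translation invariance and converge,
  dominated by the Lipschitz constant on a slightly larger ball, to the directional derivative.
  Taking the direction h to be the integral itself finishes the proof.\<close>

lemma test_fun_integral_grad:
  assumes t: "test_fun w Dw"
  shows "(\<integral>x. Dw x \<partial>lborel) = 0"
proof -
  obtain R M where R: "R > 0" "M \<ge> 0" "\<And>x. norm x > R \<Longrightarrow> w x = 0" "\<And>x. norm x > R \<Longrightarrow> Dw x = 0"
    "\<And>x. \<bar>w x\<bar> \<le> M" "\<And>x. norm (Dw x) \<le> M" "continuous_on UNIV w" "continuous_on UNIV Dw"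
    by (rule test_fun_props[OF t]) blast
  note [measurable] = test_fun_integrable(3,4)[OF t]
  have fin: "emeasure lborel (cball (0::R2) r) < \<infinity>" for r by (rule emeasure_bounded_finite) simp
  have iw: "integrable lborel w"
    by (rule Bochner_Integration.integrable_bound[where f = "\<lambda>x. M * indicator (cball 0 R) x"])
      (use R fin[of R] in \<open>auto split: split_indicator intro!: integrable_mult_right integrable_real_indicator simp: not_le\<close>)
  have iDw: "integrable lborel Dw"
    by (rule Bochner_Integration.integrable_bound[where f = "\<lambda>x. M * indicator (cball 0 R) x"])
      (use R fin[of R] in \<open>auto split: split_indicator intro!: integrable_mult_right integrable_real_indicator simp: not_le\<close>)
  have "(\<integral>x. Dw x \<partial>lborel) \<bullet> h = 0" for h
  proof -
    let ?f = "\<lambda>n x. real (Suc n) * (w (x + inverse (real (Suc n)) *\<^sub>R h) - w x)"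
    have "(\<lambda>n. \<integral>x. ?f n x \<partial>lborel) \<longlonglongrightarrow> (\<integral>x. Dw x \<bullet> h \<partial>lborel)"
    proof (rule integral_dominated_convergence[where w = "\<lambda>x. (M * norm h) * indicator (cball 0 (R + norm h)) x"])
      show "integrable lborel (\<lambda>x::R2. (M * norm h) * indicator (cball 0 (R + norm h)) x)"
        using fin[of "R + norm h"] by (intro integrable_mult_right integrable_real_indicator) auto
      show "AE x in lborel. (\<lambda>n. ?f n x) \<longlonglongrightarrow> Dw x \<bullet> h" using test_fun_diff_quotient[OF t] by auto
      fix n
      have "norm (?f n x) \<le> (M * norm h) * indicator (cball 0 (R + norm h)) x" for x
      proof (cases "norm x \<le> R + norm h")
        case True
        have "\<bar>w (x + inverse (real (Suc n)) *\<^sub>R h) - w x\<bar> \<le> M * norm (inverse (real (Suc n)) *\<^sub>R h)"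
          by (rule test_fun_lipschitz[OF t R(6)])
        then have "real (Suc n) * \<bar>w (x + inverse (real (Suc n)) *\<^sub>R h) - w x\<bar> \<le> real (Suc n) * (M * norm (inverse (real (Suc n)) *\<^sub>R h))"
          by (intro mult_left_mono) auto
        also have "real (Suc n) * (M * norm (inverse (real (Suc n)) *\<^sub>R h)) = M * norm h" by (simp del: of_nat_Suc)
        finally show ?thesis using True by (simp add: abs_mult del: of_nat_Suc)
      next
        case False
        have "norm (inverse (real (Suc n)) *\<^sub>R h) \<le> norm h" by (simp add: field_simps)
        then have "norm (x + inverse (real (Suc n)) *\<^sub>R h) > R"
          using False norm_triangle_ineq4[of "x + inverse (real (Suc n)) *\<^sub>R h" "inverse (real (Suc n)) *\<^sub>R h"] by auto
        moreover have "norm x > R" using False norm_ge_zero[of h] by linarith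
        ultimately show ?thesis using R(2,3) by simp
      qed
      then show "AE x in lborel. norm (?f n x) \<le> (M * norm h) * indicator (cball 0 (R + norm h)) x" by auto
    qed auto
    moreover have "(\<integral>x. ?f n x \<partial>lborel) = 0" for n
    proof -
      have "integrable lborel (\<lambda>x. w (x + inverse (real (Suc n)) *\<^sub>R h))"
        using integrable_affine_R2[of w 1] iw by simp
      then show ?thesis using integral_affine_R2[of w 1] iw by simp
    qed
    ultimately have "(\<integral>x. Dw x \<bullet> h \<partial>lborel) = 0" by (simp add: LIMSEQ_const_iff)
    then show ?thesis using iDw by simp
  qed
  then have "(\<integral>x. Dw x \<partial>lborel) \<bullet> (\<integral>x. Dw x \<partial>lborel) = 0" .
  then show ?thesis by simp
qed

text \<open>The product of u with a test function is again a test function, and its gradient has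
  integral zero; the product rule then is the weak gradient identity.\<close>

lemma weak_grad_C1:
  assumes u: "\<And>x. (u has_derivative (\<lambda>h. G x \<bullet> h)) (at x)" and G: "continuous_on UNIV G"
    and uL: "integrable lborel (\<lambda>x. (u x)\<^sup>2)" and GL: "integrable lborel (\<lambda>x. (norm (G x))\<^sup>2)"
  shows "L2_grad u G"
proof -
  have cu: "continuous_on UNIV u" using u by (auto intro!: continuous_at_imp_continuous_on has_derivative_continuous)
  have [measurable]: "u \<in> borel_measurable borel" "G \<in> borel_measurable borel"
    using cu G by (auto intro: borel_measurable_continuous_onI)
  have "(\<integral>x. u x *\<^sub>R Dphi x \<partial>lborel) = - (\<integral>x. phi x *\<^sub>R G x \<partial>lborel)" if t: "test_fun phi Dphi" for phi Dphi
  proof -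
    obtain R M where R: "\<And>x. norm x > R \<Longrightarrow> phi x = 0" "continuous_on UNIV phi" "continuous_on UNIV Dphi"
      "\<And>x. (phi has_derivative (\<lambda>h. Dphi x \<bullet> h)) (at x)"
      by (rule test_fun_props[OF t]) blast
    have "test_fun (\<lambda>x. u x * phi x) (\<lambda>x. u x *\<^sub>R Dphi x + phi x *\<^sub>R G x)"
      unfolding test_fun_def
    proof (intro conjI allI)
      show "((\<lambda>x. u x * phi x) has_derivative (\<lambda>h. (u x *\<^sub>R Dphi x + phi x *\<^sub>R G x) \<bullet> h)) (at x)" for x
        by (rule has_derivative_eq_rhs[OF has_derivative_mult[OF u R(4)]]) (auto simp: inner_add_left algebra_simps)
      show "continuous_on UNIV (\<lambda>x. u x *\<^sub>R Dphi x + phi x *\<^sub>R G x)" by (intro continuous_intros cu R G)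
      have "{x. u x * phi x \<noteq> 0} \<subseteq> cball 0 R" using R(1) by (force simp: not_le)
      then show "compact (closure {x. u x * phi x \<noteq> 0})" by (meson bounded_cball bounded_subset compact_closure)
    qed
    from test_fun_integral_grad[OF this] show ?thesis
      using test_fun_integrable(1)[OF t _ GL] test_fun_integrable(2)[OF t _ uL] by (simp add: eq_neg_iff_add_eq_0)
  qed
  then show ?thesis using GL by (simp add: L2_grad_def weak_grad_def)
qed

lemma AE_zero_if_test_fun_real:
  fixes h :: "R2 \<Rightarrow> real"
  assumes int: "\<And>a b. integrable lborel (\<lambda>x. indicator (box a b) x * h x)"
    and [measurable]: "h \<in> borel_measurable borel"
    and zero: "\<And>phi Dphi. test_fun phi Dphi \<Longrightarrow> (\<integral>x. phi x * h x \<partial>lborel) = 0"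
  shows "AE x in lborel. h x = 0"
proof -
  have "AE x in lborel. h x *\<^sub>R (axis 1 1 :: R2) = 0"
  proof (rule AE_zero_if_test_fun)
    show "integrable lborel (\<lambda>x. indicator (box a b) x *\<^sub>R h x *\<^sub>R (axis 1 1 :: R2))" for a b
      using integrable_scaleR_left[OF int[of a b], of "axis 1 1 :: R2"] by simp
    fix phi Dphi assume t: "test_fun phi Dphi"
    have "(\<integral>x. (phi x * h x) *\<^sub>R (axis 1 1 :: R2) \<partial>lborel) = 0"
    \<comment> \<open>Without integrability the Bochner integral is 0 by convention, which is the
      claimed value.\<close>
    proof (cases "integrable lborel (\<lambda>x. (phi x * h x) *\<^sub>R (axis 1 1 :: R2))")
      case True
      from integrable_inner_left[OF this, of "axis 1 1"] have "integrable lborel (\<lambda>x. phi x * h x)"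
        by (simp add: inner_axis_axis)
      then show ?thesis using zero[OF t] by simp
    qed (rule not_integrable_integral_eq)
    then show "(\<integral>x. phi x *\<^sub>R h x *\<^sub>R (axis 1 1 :: R2) \<partial>lborel) = 0" by simp
  qed simp
  then show ?thesis by (simp add: axis_eq_0_iff)
qed

text \<open>The hypothesis of Fubini for averages over a segment: |a b| \<le> a^2 + b^2, and by
  translation invariance the inner integral of b^2 does not depend on t.\<close>

lemma integrable_translate_product:
  fixes a b :: "R2 \<Rightarrow> real"
  assumes [measurable]: "a \<in> borel_measurable borel" "b \<in> borel_measurable borel"
    and a: "integrable lborel (\<lambda>x. (a x)\<^sup>2)" and b: "integrable lborel (\<lambda>x. (b x)\<^sup>2)"
  shows "integrable (lborel \<Otimes>\<^sub>M lborel) (\<lambda>(x, t). indicator {0..1::real} t * (a x * b (x + t *\<^sub>R h)))"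
proof (rule integrableI_bounded)
  show "(\<lambda>(x, t). indicator {0..1::real} t * (a x * b (x + t *\<^sub>R h))) \<in> borel_measurable (lborel \<Otimes>\<^sub>M lborel)"
    by measurable
  let ?A = "\<integral>\<^sup>+x. ennreal ((a x)\<^sup>2) \<partial>lborel" and ?B = "\<integral>\<^sup>+x. ennreal ((b x)\<^sup>2) \<partial>lborel"
  have "(\<integral>\<^sup>+p. ennreal (norm (case p of (x, t) \<Rightarrow> indicator {0..1::real} t * (a x * b (x + t *\<^sub>R h)))) \<partial>(lborel \<Otimes>\<^sub>M lborel))
     \<le> (\<integral>\<^sup>+p. (case p of (x, t) \<Rightarrow> indicator {0..1::real} t * (ennreal ((a x)\<^sup>2) + ennreal ((b (x + t *\<^sub>R h))\<^sup>2))) \<partial>(lborel \<Otimes>\<^sub>M lborel))"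
  proof (rule nn_integral_mono, clarify)
    fix x t
    have "\<bar>a x * b (x + t *\<^sub>R h)\<bar> \<le> (a x)\<^sup>2 + (b (x + t *\<^sub>R h))\<^sup>2"
      using sum_squares_bound[of "\<bar>a x\<bar>" "\<bar>b (x + t *\<^sub>R h)\<bar>"] abs_ge_zero[of "a x * b (x + t *\<^sub>R h)"]
      unfolding abs_mult power2_abs by linarith
    then show "ennreal (norm (indicator {0..1::real} t * (a x * b (x + t *\<^sub>R h)))) \<le> indicator {0..1::real} t * (ennreal ((a x)\<^sup>2) + ennreal ((b (x + t *\<^sub>R h))\<^sup>2))"
      by (auto split: split_indicator simp flip: ennreal_plus intro!: ennreal_leI)
  qed
  also have "\<dots> = (\<integral>\<^sup>+t. \<integral>\<^sup>+x. indicator {0..1::real} t * (ennreal ((a x)\<^sup>2) + ennreal ((b (x + t *\<^sub>R h))\<^sup>2)) \<partial>lborel \<partial>lborel)"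
    by (subst lborel_pair.nn_integral_snd[symmetric]) auto
  also have "\<dots> = (\<integral>\<^sup>+t. indicator {0..1::real} t * (?A + ?B) \<partial>lborel)"
  proof (rule nn_integral_cong)
    fix t :: real
    have "(\<integral>\<^sup>+x. ennreal ((b (x + t *\<^sub>R h))\<^sup>2) \<partial>lborel) = ?B"
      using nn_integral_affine_R2[of "\<lambda>x. ennreal ((b x)\<^sup>2)" 1 "t *\<^sub>R h"] by simp
    then show "(\<integral>\<^sup>+x. indicator {0..1::real} t * (ennreal ((a x)\<^sup>2) + ennreal ((b (x + t *\<^sub>R h))\<^sup>2)) \<partial>lborel) = indicator {0..1::real} t * (?A + ?B)"
      by (subst nn_integral_cmult) (auto simp: nn_integral_add)
  qed
  also have "\<dots> = ?A + ?B" by (subst nn_integral_multc) auto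
  also have "\<dots> < \<infinity>" using a b by (auto simp: integrable_iff_bounded)
  finally show "(\<integral>\<^sup>+p. ennreal (norm (case p of (x, t) \<Rightarrow> indicator {0..1::real} t * (a x * b (x + t *\<^sub>R h)))) \<partial>(lborel \<Otimes>\<^sub>M lborel)) < \<infinity>" .
qed

text \<open>Jensen's inequality from the nonnegativity of a variance. If f is not integrable, the
  left integral is 0 by convention. The open interval on the right makes shifts in opposite
  directions give disjoint sets later on.\<close>

lemma square_integral_unit_interval_le:
  fixes f :: "real \<Rightarrow> real"
  assumes [measurable]: "f \<in> borel_measurable borel"
  shows "ennreal ((\<integral>t. indicator {0..1} t * f t \<partial>lborel)\<^sup>2) \<le> (\<integral>\<^sup>+t. indicator {0<..<1} t * ennreal ((f t)\<^sup>2) \<partial>lborel)"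
proof -
  have e: "(\<integral>\<^sup>+t. indicator {0<..<1} t * ennreal ((f t)\<^sup>2) \<partial>lborel) = (\<integral>\<^sup>+t. ennreal (indicator {0..1} t * (f t)\<^sup>2) \<partial>lborel)"
  proof (rule nn_integral_cong_AE)
    have "AE t in lborel. t \<noteq> (0::real)" "AE t in lborel. t \<noteq> (1::real)" by (rule AE_lborel_singleton)+
    then show "AE t in lborel. indicator {0<..<1} t * ennreal ((f t)\<^sup>2) = ennreal (indicator {0..1::real} t * (f t)\<^sup>2)"
      by eventually_elim (auto split: split_indicator)
  qed
  show ?thesis
  proof (cases "(\<integral>\<^sup>+t. ennreal (indicator {0..1} t * (f t)\<^sup>2) \<partial>lborel) = \<infinity> \<or> \<not> integrable lborel (\<lambda>t. indicator {0..1} t * f t)")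
    case True
    then show ?thesis unfolding e by (auto simp: not_integrable_integral_eq)
  next
    case False
    have i0: "integrable lborel (indicator {0..1} :: real \<Rightarrow> real)" by (intro integrable_real_indicator) auto
    have i1: "integrable lborel (\<lambda>t. indicator {0..1} t * f t)" using False by simp
    have i2: "integrable lborel (\<lambda>t. indicator {0..1} t * (f t)\<^sup>2)"
      using False by (intro integrableI_nonneg) (auto simp: less_top)
    let ?m = "\<integral>t. indicator {0..1} t * f t \<partial>lborel"
    have "0 \<le> (\<integral>t. indicator {0..1} t * (f t - ?m)\<^sup>2 \<partial>lborel)" by (intro integral_nonneg_AE) auto
    also have "\<dots> = (\<integral>t. indicator {0..1} t * (f t)\<^sup>2 - 2 * ?m * (indicator {0..1} t * f t) + ?m\<^sup>2 * indicator {0..1} t \<partial>lborel)"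
      by (intro Bochner_Integration.integral_cong) (auto simp: power2_eq_square algebra_simps)
    also have "\<dots> = (\<integral>t. indicator {0..1} t * (f t)\<^sup>2 \<partial>lborel) - 2 * ?m * ?m + ?m\<^sup>2"
      using i0 i1 i2 by simp
    finally have "?m\<^sup>2 \<le> (\<integral>t. indicator {0..1} t * (f t)\<^sup>2 \<partial>lborel)" by (simp add: power2_eq_square)
    then show ?thesis unfolding e by (subst nn_integral_eq_integral[OF i2]) (auto intro: ennreal_leI)
  qed
qed

text \<open>The fundamental theorem of calculus along the segment from x to x + h, valid for almost
  every x. The proof shows the equality u(x + h) - u(x) = K(x) by testing, then applies
  Jensen.\<close>

lemma L2_grad_translate:
  assumes u[measurable]: "u \<in> borel_measurable borel" and uL: "integrable lborel (\<lambda>x. (u x)\<^sup>2)" and G: "L2_grad u G"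
  shows "AE x in lborel. ennreal ((u (x + h) - u x)\<^sup>2) \<le> (\<integral>\<^sup>+t. indicator {0<..<1::real} t * ennreal ((G (x + t *\<^sub>R h) \<bullet> h)\<^sup>2) \<partial>lborel)"
proof -
  have [measurable]: "G \<in> borel_measurable borel" and GI: "integrable lborel (\<lambda>x. (norm (G x))\<^sup>2)" using G by (auto simp: L2_grad_def)
  have GhL: "integrable lborel (\<lambda>x. (G x \<bullet> h)\<^sup>2)"
  proof (rule Bochner_Integration.integrable_bound[OF integrable_mult_right[OF GI, of "(norm h)\<^sup>2"]])
    have "(G x \<bullet> h)\<^sup>2 \<le> (norm h)\<^sup>2 * (norm (G x))\<^sup>2" for x
      using Cauchy_Schwarz_ineq[of "G x" h] by (simp add: power2_norm_eq_inner mult.commute)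
    then show "AE x in lborel. norm ((G x \<bullet> h)\<^sup>2) \<le> norm ((norm h)\<^sup>2 * (norm (G x))\<^sup>2)" by simp
  qed simp
  define K where "K x = (\<integral>t. indicator {0..1} t * (G (x + t *\<^sub>R h) \<bullet> h) \<partial>lborel)" for x
  have [measurable]: "K \<in> borel_measurable borel" unfolding K_def by measurable
  have aK: "integrable lborel (\<lambda>x. a x * K x)"
    and aK2: "(\<integral>x. a x * K x \<partial>lborel) = (\<integral>t. indicator {0..1} t * (\<integral>x. a x * (G (x + t *\<^sub>R h) \<bullet> h) \<partial>lborel) \<partial>lborel)"
    if [measurable]: "a \<in> borel_measurable borel" and a: "integrable lborel (\<lambda>x. (a x)\<^sup>2)" for a :: "R2 \<Rightarrow> real"
  proof -
    note I = integrable_translate_product[of a "\<lambda>x. G x \<bullet> h", OF _ _ a GhL, of h]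
    have I': "integrable (lborel \<Otimes>\<^sub>M lborel) (\<lambda>(x, t). indicator {0..1::real} t * (a x * (G (x + t *\<^sub>R h) \<bullet> h)))"
      using I by simp
    have e: "(\<integral>t. indicator {0..1} t * (a x * (G (x + t *\<^sub>R h) \<bullet> h)) \<partial>lborel) = a x * K x" for x
      unfolding K_def by (subst integral_mult_right_zero[symmetric]) (simp add: mult_ac)
    show "integrable lborel (\<lambda>x. a x * K x)" using lborel_pair.integrable_fst'[OF I'] by (simp add: e)
    show "(\<integral>x. a x * K x \<partial>lborel) = (\<integral>t. indicator {0..1} t * (\<integral>x. a x * (G (x + t *\<^sub>R h) \<bullet> h) \<partial>lborel) \<partial>lborel)"
      using lborel_pair.Fubini_integral[OF I'] by (simp add: e)
  qed
  have ut: "integrable lborel (\<lambda>x. (u (x + h))\<^sup>2)" using integrable_affine_R2[of "\<lambda>x. (u x)\<^sup>2" 1 h] uL by simp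
  have "AE x in lborel. u (x + h) - u x - K x = 0"
  proof (rule AE_zero_if_test_fun_real)
    fix a b :: R2
    have i2: "integrable lborel (\<lambda>x. (indicator (box a b) x :: real)\<^sup>2)"
      using emeasure_bounded_finite[OF bounded_box[of a b]] by (simp add: power2_eq_square flip: indicator_inter_arith)
    have i1: "integrable lborel (\<lambda>x. indicator (box a b) x * u (x + h))" "integrable lborel (\<lambda>x. indicator (box a b) x * u x)"
      by (rule integrable_mult_L2; use i2 ut uL in simp)+
    show "integrable lborel (\<lambda>x. indicator (box a b) x * (u (x + h) - u x - K x))"
      using i1 aK[OF _ i2] by (simp add: right_diff_distrib)
  next
    fix phi Dphi assume T: "test_fun phi Dphi"
    obtain R M where R: "\<And>x. norm x > R \<Longrightarrow> phi x = 0" "\<And>x. norm x > R \<Longrightarrow> Dphi x = 0"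
      "\<And>x. \<bar>phi x\<bar> \<le> M" "\<And>x. norm (Dphi x) \<le> M" "continuous_on UNIV phi" "continuous_on UNIV Dphi"
      "\<And>x. (phi has_derivative (\<lambda>h. Dphi x \<bullet> h)) (at x)"
      by (rule test_fun_props[OF T]) blast
    note [measurable] = test_fun_integrable(3,4)[OF T]
    have fin: "emeasure lborel (cball (0::R2) R) < \<infinity>" by (rule emeasure_bounded_finite) simp
    have phi2: "integrable lborel (\<lambda>x. (phi x)\<^sup>2)"
    proof (rule Bochner_Integration.integrable_bound[where f = "\<lambda>x. M\<^sup>2 * indicator (cball 0 R) x"])
      have "(phi x)\<^sup>2 \<le> M\<^sup>2" for x using R(3)[of x] by (simp add: abs_le_square_iff[symmetric])
      then show "AE x in lborel. norm ((phi x)\<^sup>2) \<le> norm (M\<^sup>2 * indicator (cball 0 R) x)"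
        using R(1) by (auto split: split_indicator simp: not_le)
    qed (use fin in \<open>auto intro!: integrable_mult_right integrable_real_indicator\<close>)
    have Dphi2: "integrable lborel (\<lambda>x. (- (Dphi x \<bullet> h))\<^sup>2)"
    proof (rule Bochner_Integration.integrable_bound[where f = "\<lambda>x. (M * norm h)\<^sup>2 * indicator (cball 0 R) x"])
      have "(- (Dphi x \<bullet> h))\<^sup>2 \<le> (M * norm h)\<^sup>2" for x
        using order_trans[OF Cauchy_Schwarz_ineq2 mult_right_mono[OF R(4) norm_ge_zero], of x h]
        by (intro abs_le_square_iff[THEN iffD1]) auto
      then show "AE x in lborel. norm ((- (Dphi x \<bullet> h))\<^sup>2) \<le> norm ((M * norm h)\<^sup>2 * indicator (cball 0 R) x)"
        using R(2) by (auto split: split_indicator simp: not_le)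
    qed (use fin in \<open>auto intro!: integrable_mult_right integrable_real_indicator\<close>)
    have tr: "test_fun (\<lambda>x. phi (x + a)) (\<lambda>x. Dphi (x + a))" for a using test_fun_affine[OF T, of 1 a] by simp
    \<comment> \<open>The classical fundamental theorem is used on the test function only; the weak
      gradient enters for each t separately below.\<close>
    have ftc: "phi (x - h) - phi x = (\<integral>t. indicator {0..1} t * - (Dphi (x + t *\<^sub>R (-h)) \<bullet> h) \<partial>lborel)" for x
    proof -
      have d: "((\<lambda>t::real. phi (x + t *\<^sub>R (-h))) has_real_derivative - (Dphi (x + t *\<^sub>R (-h)) \<bullet> h)) (at t)" for t
      proof -
        have "((\<lambda>t::real. x + t *\<^sub>R (-h)) has_derivative (\<lambda>t. t *\<^sub>R (-h))) (at t)"
          by (auto intro!: derivative_eq_intros)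
        from has_derivative_compose[OF this R(7)] show ?thesis
          unfolding has_field_derivative_def by (rule has_derivative_eq_rhs) (auto simp: fun_eq_iff)
      qed
      have "has_bochner_integral lborel (\<lambda>t. - (Dphi (x + t *\<^sub>R (-h)) \<bullet> h) * indicator {0..1} t) (phi (x + 1 *\<^sub>R (-h)) - phi (x + 0 *\<^sub>R (-h)))"
      proof (rule has_bochner_integral_FTC_Icc_real[OF _ d])
        show "isCont (\<lambda>t. - (Dphi (x + t *\<^sub>R (-h)) \<bullet> h)) t" for t
          using continuous_on_compose2[OF R(6), of UNIV "\<lambda>t. x + t *\<^sub>R (-h)"]
          by (auto intro!: continuous_intros simp: continuous_on_eq_continuous_at)
      qed simp
      then show ?thesis by (simp add: has_bochner_integral_iff mult.commute)
    qed
    \<comment> \<open>Discrete integration by parts: the shift moves from u to phi with the opposite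
      sign.\<close>
    have A: "(\<integral>x. phi x * (u (x + h) - u x) \<partial>lborel) = (\<integral>x. u x * (phi (x - h) - phi x) \<partial>lborel)"
    proof -
      have i1: "integrable lborel (\<lambda>x. phi x * u (x + h))" "integrable lborel (\<lambda>x. phi x * u x)"
        by (rule integrable_mult_L2; use phi2 ut uL in simp)+
      have i3: "integrable lborel (\<lambda>x. phi (x - h) * u x)" using integrable_affine_R2[of "\<lambda>x. phi (x - h) * u x" 1 h] i1 by simp
      have "(\<integral>x. phi x * u (x + h) \<partial>lborel) = (\<integral>x. phi (x - h) * u x \<partial>lborel)"
        using integral_affine_R2[of "\<lambda>x. phi (x - h) * u x" 1 h] by simp
      then show ?thesis using i1 i3 by (simp add: algebra_simps)
    qed
    have I: "integrable (lborel \<Otimes>\<^sub>M lborel) (\<lambda>(x, t). indicator {0..1::real} t * (u x * - (Dphi (x + t *\<^sub>R (-h)) \<bullet> h)))"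
      using integrable_translate_product[of u "\<lambda>x. - (Dphi x \<bullet> h)", OF _ _ uL Dphi2, of "-h"] by simp
    have "(\<integral>x. u x * (phi (x - h) - phi x) \<partial>lborel) = (\<integral>x. \<integral>t. indicator {0..1} t * (u x * - (Dphi (x + t *\<^sub>R (-h)) \<bullet> h)) \<partial>lborel \<partial>lborel)"
      unfolding ftc by (subst integral_mult_right_zero[symmetric]) (simp add: mult_ac)
    also have "\<dots> = (\<integral>t. \<integral>x. indicator {0..1} t * (u x * - (Dphi (x + t *\<^sub>R (-h)) \<bullet> h)) \<partial>lborel \<partial>lborel)"
      using lborel_pair.Fubini_integral[OF I] by simp
    \<comment> \<open>For fixed t the shifted phi is a test function, so the weak gradient identity
      applies; a translation then moves the shift over to G.\<close>
    also have "\<dots> = (\<integral>t. indicator {0..1} t * (\<integral>x. phi x * (G (x + t *\<^sub>R h) \<bullet> h) \<partial>lborel) \<partial>lborel)"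
    proof (rule Bochner_Integration.integral_cong[OF refl])
      fix t :: real
      have "(\<integral>x. u x * (Dphi (x + t *\<^sub>R (-h)) \<bullet> h) \<partial>lborel) = (\<integral>x. u x *\<^sub>R Dphi (x + t *\<^sub>R (-h)) \<partial>lborel) \<bullet> h"
        using integral_inner_left[OF test_fun_integrable(2)[OF tr[of "t *\<^sub>R (-h)"] u uL], of h] by simp
      also have "\<dots> = - (\<integral>x. phi (x + t *\<^sub>R (-h)) *\<^sub>R G x \<partial>lborel) \<bullet> h"
        by (simp only: L2_grad_test[OF G tr])
      also have "\<dots> = - (\<integral>x. phi (x + t *\<^sub>R (-h)) * (G x \<bullet> h) \<partial>lborel)"
        using integral_inner_left[OF test_fun_integrable(1)[OF tr[of "t *\<^sub>R (-h)"] _ GI], of h] by simp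
      also have "(\<integral>x. phi (x + t *\<^sub>R (-h)) * (G x \<bullet> h) \<partial>lborel) = (\<integral>x. phi x * (G (x + t *\<^sub>R h) \<bullet> h) \<partial>lborel)"
        using integral_affine_R2[of "\<lambda>x. phi (x + t *\<^sub>R (-h)) * (G x \<bullet> h)" 1 "t *\<^sub>R h"] by simp
      finally have "(\<integral>x. u x * - (Dphi (x + t *\<^sub>R (-h)) \<bullet> h) \<partial>lborel) = (\<integral>x. phi x * (G (x + t *\<^sub>R h) \<bullet> h) \<partial>lborel)"
        by simp
      then show "(\<integral>x. indicator {0..1} t * (u x * - (Dphi (x + t *\<^sub>R (-h)) \<bullet> h)) \<partial>lborel) = indicator {0..1} t * (\<integral>x. phi x * (G (x + t *\<^sub>R h) \<bullet> h) \<partial>lborel)"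
        by (subst integral_mult_right_zero) simp
    qed
    also have "\<dots> = (\<integral>x. phi x * K x \<partial>lborel)" using aK2[OF _ phi2] by simp
    finally have B: "(\<integral>x. phi x * (u (x + h) - u x) \<partial>lborel) = (\<integral>x. phi x * K x \<partial>lborel)" using A by simp
    have "integrable lborel (\<lambda>x. phi x * (u (x + h) - u x))"
      using integrable_mult_L2[OF _ _ phi2 ut] integrable_mult_L2[OF _ _ phi2 uL] by (simp add: right_diff_distrib)
    then show "(\<integral>x. phi x * (u (x + h) - u x - K x) \<partial>lborel) = 0"
      using B aK[OF _ phi2] by (simp add: right_diff_distrib[of _ "u _ - u _"])
  qed simp
  then show ?thesis
  proof (rule eventually_mono)
    fix x assume "u (x + h) - u x - K x = 0"
    then have e: "u (x + h) - u x = K x" by simp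
    show "ennreal ((u (x + h) - u x)\<^sup>2) \<le> (\<integral>\<^sup>+t. indicator {0<..<1::real} t * ennreal ((G (x + t *\<^sub>R h) \<bullet> h)\<^sup>2) \<partial>lborel)"
      unfolding e K_def by (rule square_integral_unit_interval_le) simp
  qed
qed

text \<open>The L^2 bound on difference quotients by the gradient. It is what survives when u is
  replaced by |u|, whose differences are no larger.\<close>

lemma L2_grad_translate_integral:
  assumes u[measurable]: "u \<in> borel_measurable borel" and uL: "integrable lborel (\<lambda>x. (u x)\<^sup>2)" and G: "L2_grad u G"
  shows "(\<integral>\<^sup>+x. ennreal ((u (x + h) - u x)\<^sup>2) \<partial>lborel) \<le> (\<integral>\<^sup>+x. ennreal ((G x \<bullet> h)\<^sup>2) \<partial>lborel)"
proof -
  have [measurable]: "G \<in> borel_measurable borel" using G by (auto simp: L2_grad_def)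
  have "(\<integral>\<^sup>+x. ennreal ((u (x + h) - u x)\<^sup>2) \<partial>lborel) \<le> (\<integral>\<^sup>+x. \<integral>\<^sup>+t. indicator {0<..<1::real} t * ennreal ((G (x + t *\<^sub>R h) \<bullet> h)\<^sup>2) \<partial>lborel \<partial>lborel)"
    by (rule nn_integral_mono_AE[OF L2_grad_translate[OF assms]])
  also have "\<dots> = (\<integral>\<^sup>+t. \<integral>\<^sup>+x. indicator {0<..<1::real} t * ennreal ((G (x + t *\<^sub>R h) \<bullet> h)\<^sup>2) \<partial>lborel \<partial>lborel)"
    by (rule lborel_pair.Fubini'[symmetric]) measurable
  also have "\<dots> = (\<integral>\<^sup>+t. indicator {0<..<1::real} t * (\<integral>\<^sup>+x. ennreal ((G x \<bullet> h)\<^sup>2) \<partial>lborel) \<partial>lborel)"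
  proof (rule nn_integral_cong)
    fix t :: real
    have "(\<integral>\<^sup>+x. ennreal ((G (x + t *\<^sub>R h) \<bullet> h)\<^sup>2) \<partial>lborel) = (\<integral>\<^sup>+x. ennreal ((G x \<bullet> h)\<^sup>2) \<partial>lborel)"
      using nn_integral_affine_R2[of "\<lambda>x. ennreal ((G x \<bullet> h)\<^sup>2)" 1 "t *\<^sub>R h"] by simp
    then show "(\<integral>\<^sup>+x. indicator {0<..<1::real} t * ennreal ((G (x + t *\<^sub>R h) \<bullet> h)\<^sup>2) \<partial>lborel) = indicator {0<..<1::real} t * (\<integral>\<^sup>+x. ennreal ((G x \<bullet> h)\<^sup>2) \<partial>lborel)"
      by (subst nn_integral_cmult) auto
  qed
  also have "\<dots> = (\<integral>\<^sup>+x. ennreal ((G x \<bullet> h)\<^sup>2) \<partial>lborel)" by (subst nn_integral_multc) auto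
  finally show ?thesis .
qed

lemma measurable_vector_R2[measurable]: "(\<lambda>(a, b). vector [a, b] :: R2) \<in> borel_measurable borel"
proof (rule borel_measurable_continuous_onI)
  have "(\<lambda>(a::real, b::real). vector [a, b] :: R2) = (\<lambda>p. \<chi> i. if i = 1 then fst p else snd p)"
    by (auto simp: fun_eq_iff vec_eq_iff forall_2)
  moreover have "continuous_on UNIV (\<lambda>p::real\<times>real. if i = 1 then fst p else snd p)" for i :: 2
    by (cases "i = 1") (auto intro!: continuous_intros)
  ultimately show "continuous_on UNIV (\<lambda>(a::real, b::real). vector [a, b] :: R2)" by (auto intro!: continuous_on_vec_lambda)
qed

text \<open>The type \<open>real ^ 2\<close> is not literally a product, so Tonelli's theorem
  reaches it through this image measure.\<close>

lemma distr_pair_vector_R2: "distr (lborel \<Otimes>\<^sub>M lborel) borel (\<lambda>(a, b). vector [a, b] :: R2) = lborel"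
proof (rule lborel_eqI[symmetric])
  have m': "(\<lambda>(a, b). vector [a, b] :: R2) \<in> borel_measurable (lborel \<Otimes>\<^sub>M lborel)"
    by (simp add: lborel_prod)
  fix l u :: R2 assume le: "\<And>b. b \<in> Basis \<Longrightarrow> l \<bullet> b \<le> u \<bullet> b"
  have le': "l $ i \<le> u $ i" for i using le[of "axis i 1"] by (auto simp: inner_axis axis_in_Basis_iff)
  have v: "(\<lambda>(a, b). vector [a, b] :: R2) -` box l u = box (l $ 1) (u $ 1) \<times> box (l $ 2) (u $ 2)"
    by (auto simp: mem_box_cart forall_2)
  have B: "(Basis :: R2 set) = {axis 1 1, axis 2 1}"
    by (auto simp: Basis_vec_def UNIV_2)
  have "emeasure (distr (lborel \<Otimes>\<^sub>M lborel) borel (\<lambda>(a, b). vector [a, b] :: R2)) (box l u)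
    = emeasure (lborel \<Otimes>\<^sub>M lborel) (box (l $ 1) (u $ 1) \<times> box (l $ 2) (u $ 2))"
    using m' by (subst emeasure_distr) (auto simp: v space_pair_measure)
  also have "\<dots> = ennreal ((u $ 1 - l $ 1) * (u $ 2 - l $ 2))"
    using le' by (subst lborel.emeasure_pair_measure_Times) (auto simp: ennreal_mult)
  also have "(u $ 1 - l $ 1) * (u $ 2 - l $ 2) = (\<Prod>b\<in>Basis. (u - l) \<bullet> b)"
    by (simp add: B axis_eq_axis inner_axis)
  finally show "emeasure (distr (lborel \<Otimes>\<^sub>M lborel) borel (\<lambda>(a, b). vector [a, b] :: R2)) (box l u) = ennreal (\<Prod>b\<in>Basis. (u - l) \<bullet> b)" .
qed simp

lemma nn_integral_R2_iterated:
  assumes [measurable]: "f \<in> borel_measurable borel"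
  shows "(\<integral>\<^sup>+x. f (x::R2) \<partial>lborel) = (\<integral>\<^sup>+a. \<integral>\<^sup>+b. f (vector [a, b]) \<partial>lborel \<partial>lborel)"
    and "(\<integral>\<^sup>+x. f (x::R2) \<partial>lborel) = (\<integral>\<^sup>+b. \<integral>\<^sup>+a. f (vector [a, b]) \<partial>lborel \<partial>lborel)"
proof -
  have m: "(\<lambda>(a, b). vector [a, b] :: R2) \<in> borel_measurable (lborel \<Otimes>\<^sub>M lborel)"
    by (simp add: lborel_prod)
  have m2: "(\<lambda>(a, b). f (vector [a, b])) \<in> borel_measurable (lborel \<Otimes>\<^sub>M lborel)"
    using measurable_compose[OF m assms] by (simp add: split_beta)
  have "(\<integral>\<^sup>+x. f (x::R2) \<partial>lborel) = (\<integral>\<^sup>+p. (case p of (a, b) \<Rightarrow> f (vector [a, b])) \<partial>(lborel \<Otimes>\<^sub>M lborel))"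
    using m by (subst distr_pair_vector_R2[symmetric], subst nn_integral_distr) (auto intro!: nn_integral_cong simp: split_beta)
  then show "(\<integral>\<^sup>+x. f (x::R2) \<partial>lborel) = (\<integral>\<^sup>+a. \<integral>\<^sup>+b. f (vector [a, b]) \<partial>lborel \<partial>lborel)"
    and "(\<integral>\<^sup>+x. f (x::R2) \<partial>lborel) = (\<integral>\<^sup>+b. \<integral>\<^sup>+a. f (vector [a, b]) \<partial>lborel \<partial>lborel)"
    using lborel.nn_integral_fst[OF m2] lborel_pair.nn_integral_snd[OF m2] by simp_all
qed

lemma nn_integral_scaled_unit_interval:
  fixes f :: "real \<Rightarrow> ennreal"
  assumes [measurable]: "f \<in> borel_measurable borel" and t: "t > 0"
  shows "(\<integral>\<^sup>+s. indicator {0<..<1} s * f (s * t) \<partial>lborel) = ennreal (1 / t) * (\<integral>\<^sup>+s. indicator {0<..<t} s * f s \<partial>lborel)"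
    and "(\<integral>\<^sup>+s. indicator {0<..<1} s * f (- (s * t)) \<partial>lborel) = ennreal (1 / t) * (\<integral>\<^sup>+s. indicator {-t<..<0} s * f s \<partial>lborel)"
proof -
  have a: "ennreal (1 / t) * (ennreal t * I) = I" for I
    using t by (simp add: mult.assoc[symmetric] flip: ennreal_mult)
  have "(\<integral>\<^sup>+s. indicator {0<..<t} s * f s \<partial>lborel) = ennreal t * (\<integral>\<^sup>+s. indicator {0<..<t} (0 + t * s) * f (0 + t * s) \<partial>lborel)"
    using nn_integral_real_affine[of "\<lambda>s. indicator {0<..<t} s * f s" t 0] t by simp
  also have "(\<integral>\<^sup>+s. indicator {0<..<t} (0 + t * s) * f (0 + t * s) \<partial>lborel) = (\<integral>\<^sup>+s. indicator {0<..<1} s * f (s * t) \<partial>lborel)"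
    using t by (intro nn_integral_cong) (auto split: split_indicator simp: mult.commute zero_less_mult_iff)
  finally show "(\<integral>\<^sup>+s. indicator {0<..<1} s * f (s * t) \<partial>lborel) = ennreal (1 / t) * (\<integral>\<^sup>+s. indicator {0<..<t} s * f s \<partial>lborel)"
    by (simp add: a)
  have "(\<integral>\<^sup>+s. indicator {-t<..<0} s * f s \<partial>lborel) = ennreal t * (\<integral>\<^sup>+s. indicator {-t<..<0} (0 + (-t) * s) * f (0 + (-t) * s) \<partial>lborel)"
    using nn_integral_real_affine[of "\<lambda>s. indicator {-t<..<0} s * f s" "-t" 0] t by simp
  also have "(\<integral>\<^sup>+s. indicator {-t<..<0} (0 + (-t) * s) * f (0 + (-t) * s) \<partial>lborel) = (\<integral>\<^sup>+s. indicator {0<..<1} s * f (- (s * t)) \<partial>lborel)"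
    using t by (intro nn_integral_cong) (auto split: split_indicator simp: mult.commute zero_less_mult_iff)
  finally show "(\<integral>\<^sup>+s. indicator {0<..<1} s * f (- (s * t)) \<partial>lborel) = ennreal (1 / t) * (\<integral>\<^sup>+s. indicator {-t<..<0} s * f s \<partial>lborel)"
    by (simp add: a)
qed

text \<open>Averaging over shifts in both directions gives the one-dimensional bound
  \<open>sup u\<^sup>2 \<le> (\<integral>u\<^sup>2) / l + (l / 2) \<integral>u'\<^sup>2\<close> on almost every line.\<close>
lemma L2_grad_line_bound:
  assumes u[measurable]: "u \<in> borel_measurable borel" and uL: "integrable lborel (\<lambda>x. (u x)\<^sup>2)" and G: "L2_grad u G"
    and l: "l > 0"
  shows "AE x in lborel. ennreal ((u x)\<^sup>2) \<le> ennreal (1 / l) * (\<integral>\<^sup>+t. ennreal ((u (x + t *\<^sub>R e))\<^sup>2) \<partial>lborel)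
     + ennreal (l / 2) * (\<integral>\<^sup>+t. ennreal ((G (x + t *\<^sub>R e) \<bullet> e)\<^sup>2) \<partial>lborel)"
proof -
  have [measurable]: "G \<in> borel_measurable borel" using G by (auto simp: L2_grad_def)
  define V where "V x = (\<integral>\<^sup>+t. ennreal ((G (x + t *\<^sub>R e) \<bullet> e)\<^sup>2) \<partial>lborel)" for x
  define U where "U x = (\<integral>\<^sup>+t. ennreal ((u (x + t *\<^sub>R e))\<^sup>2) \<partial>lborel)" for x
  have [measurable]: "V \<in> borel_measurable borel" "U \<in> borel_measurable borel" unfolding V_def U_def by measurable
  define Q where "Q t x \<longleftrightarrow> (t > 0 \<longrightarrow> ennreal ((u x)\<^sup>2) \<le> ennreal ((u (x + t *\<^sub>R e))\<^sup>2) + ennreal ((u (x + (-t) *\<^sub>R e))\<^sup>2) + ennreal t * V x)" for t x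
  have "AE x in lborel. Q t x" for t
  proof (cases "t > 0")
    case t: True
    from L2_grad_translate[OF u uL G, of "t *\<^sub>R e"] L2_grad_translate[OF u uL G, of "(-t) *\<^sub>R e"]
    show ?thesis
    proof eventually_elim
      case (elim x)
      let ?f = "\<lambda>s. ennreal ((G (x + s *\<^sub>R e) \<bullet> e)\<^sup>2)"
      have "ennreal ((u (x + t *\<^sub>R e) - u x)\<^sup>2) \<le> (\<integral>\<^sup>+s. indicator {0<..<1::real} s * ennreal ((G (x + s *\<^sub>R t *\<^sub>R e) \<bullet> (t *\<^sub>R e))\<^sup>2) \<partial>lborel)"
        by (rule elim(1))
      also have "\<dots> = (\<integral>\<^sup>+s. ennreal (t\<^sup>2) * (indicator {0<..<1} s * ?f (s * t)) \<partial>lborel)"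
        by (intro nn_integral_cong) (auto simp: power_mult_distrib ennreal_mult mult_ac)
      also have "\<dots> = ennreal (t\<^sup>2) * (ennreal (1 / t) * (\<integral>\<^sup>+s. indicator {0<..<t} s * ?f s \<partial>lborel))"
        using nn_integral_scaled_unit_interval(1)[of ?f, OF _ t] by (subst nn_integral_cmult) auto
      also have "\<dots> = ennreal t * (\<integral>\<^sup>+s. indicator {0<..<t} s * ?f s \<partial>lborel)"
        using t by (simp add: mult.assoc[symmetric] power2_eq_square flip: ennreal_mult)
      finally have 1: "ennreal ((u (x + t *\<^sub>R e) - u x)\<^sup>2) \<le> ennreal t * (\<integral>\<^sup>+s. indicator {0<..<t} s * ?f s \<partial>lborel)" .
      have "ennreal ((u (x + (-t) *\<^sub>R e) - u x)\<^sup>2) \<le> (\<integral>\<^sup>+s. indicator {0<..<1::real} s * ennreal ((G (x + s *\<^sub>R (-t) *\<^sub>R e) \<bullet> ((-t) *\<^sub>R e))\<^sup>2) \<partial>lborel)"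
        by (rule elim(2))
      also have "\<dots> = (\<integral>\<^sup>+s. ennreal (t\<^sup>2) * (indicator {0<..<1} s * ?f (- (s * t))) \<partial>lborel)"
        by (intro nn_integral_cong) (auto simp: power_mult_distrib ennreal_mult mult_ac)
      also have "\<dots> = ennreal (t\<^sup>2) * (ennreal (1 / t) * (\<integral>\<^sup>+s. indicator {-t<..<0} s * ?f s \<partial>lborel))"
        using nn_integral_scaled_unit_interval(2)[of ?f, OF _ t] by (subst nn_integral_cmult) auto
      also have "\<dots> = ennreal t * (\<integral>\<^sup>+s. indicator {-t<..<0} s * ?f s \<partial>lborel)"
        using t by (simp add: mult.assoc[symmetric] power2_eq_square flip: ennreal_mult)
      finally have 2: "ennreal ((u (x + (-t) *\<^sub>R e) - u x)\<^sup>2) \<le> ennreal t * (\<integral>\<^sup>+s. indicator {-t<..<0} s * ?f s \<partial>lborel)" .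
      have "(\<integral>\<^sup>+s. indicator {0<..<t} s * ?f s \<partial>lborel) + (\<integral>\<^sup>+s. indicator {-t<..<0} s * ?f s \<partial>lborel)
        = (\<integral>\<^sup>+s. indicator {0<..<t} s * ?f s + indicator {-t<..<0} s * ?f s \<partial>lborel)"
        by (rule nn_integral_add[symmetric]) auto
      also have "\<dots> \<le> V x" unfolding V_def by (intro nn_integral_mono) (auto split: split_indicator)
      finally have 3: "(\<integral>\<^sup>+s. indicator {0<..<t} s * ?f s \<partial>lborel) + (\<integral>\<^sup>+s. indicator {-t<..<0} s * ?f s \<partial>lborel) \<le> V x" .
      \<comment> \<open>The sum over a and b of y^2/2 \<le> a^2 + (a - y)^2, which is (2 a - y)^2
        \<ge> 0.\<close>
      have r: "y\<^sup>2 \<le> a\<^sup>2 + b\<^sup>2 + ((a - y)\<^sup>2 + (b - y)\<^sup>2)" for y a b :: real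
        using zero_le_power2[of "2 * a - y"] zero_le_power2[of "2 * b - y"] by (simp add: power2_eq_square algebra_simps)
      have "ennreal ((u x)\<^sup>2) \<le> ennreal ((u (x + t *\<^sub>R e))\<^sup>2) + ennreal ((u (x + (-t) *\<^sub>R e))\<^sup>2) +
          (ennreal ((u (x + t *\<^sub>R e) - u x)\<^sup>2) + ennreal ((u (x + (-t) *\<^sub>R e) - u x)\<^sup>2))"
        using r[of "u x" "u (x + t *\<^sub>R e)" "u (x + (-t) *\<^sub>R e)"] by (simp flip: ennreal_plus)
      also have "\<dots> \<le> ennreal ((u (x + t *\<^sub>R e))\<^sup>2) + ennreal ((u (x + (-t) *\<^sub>R e))\<^sup>2) +
        (ennreal t * (\<integral>\<^sup>+s. indicator {0<..<t} s * ?f s \<partial>lborel) + ennreal t * (\<integral>\<^sup>+s. indicator {-t<..<0} s * ?f s \<partial>lborel))"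
        by (intro add_mono order_refl 1 2)
      also have "\<dots> \<le> ennreal ((u (x + t *\<^sub>R e))\<^sup>2) + ennreal ((u (x + (-t) *\<^sub>R e))\<^sup>2) + ennreal t * V x"
        unfolding distrib_left[symmetric] by (intro add_mono order_refl mult_left_mono 3) auto
      finally show ?case by (simp add: Q_def)
    qed
  qed (simp add: Q_def)
  \<comment> \<open>The exceptional null set of x depends on t. Averaging over t at a fixed x needs
    the quantifiers the other way round, which Fubini allows for this measurable relation.\<close>
  then have "AE t in lborel. AE x in lborel. Q t x" by simp
  moreover have "{p \<in> space (lborel \<Otimes>\<^sub>M lborel). Q (fst p) (snd p)} \<in> sets (lborel \<Otimes>\<^sub>M lborel)"
    unfolding Q_def by measurable
  ultimately have "AE x in lborel. AE t in lborel. Q t x"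
    by (subst (asm) lborel_pair.AE_commute) auto
  then show ?thesis
  proof (rule eventually_mono)
    fix x assume AE: "AE t in lborel. Q t x"
    \<comment> \<open>Integrating over 0 < t < l makes the two shifted squares cover disjoint pieces
      of the line, and the factor t contributes l^2/2.\<close>
    have "ennreal l * ennreal ((u x)\<^sup>2) = (\<integral>\<^sup>+t. indicator {0<..<l} t * ennreal ((u x)\<^sup>2) \<partial>lborel)"
      using l by (subst nn_integral_multc) auto
    also have "\<dots> \<le> (\<integral>\<^sup>+t. (indicator {0<..<l} t * ennreal ((u (x + t *\<^sub>R e))\<^sup>2) + indicator {0<..<l} t * ennreal ((u (x + (-t) *\<^sub>R e))\<^sup>2)) + ennreal (t * indicator {0<..<l} t) * V x \<partial>lborel)"
    proof (rule nn_integral_mono_AE, use AE in eventually_elim)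
      case (elim t)
      then show ?case by (auto simp: Q_def split: split_indicator)
    qed
    also have "\<dots> = ((\<integral>\<^sup>+t. indicator {0<..<l} t * ennreal ((u (x + t *\<^sub>R e))\<^sup>2) \<partial>lborel) + (\<integral>\<^sup>+t. indicator {0<..<l} t * ennreal ((u (x + (-t) *\<^sub>R e))\<^sup>2) \<partial>lborel))
        + (\<integral>\<^sup>+t. ennreal (t * indicator {0<..<l} t) \<partial>lborel) * V x"
      by (subst nn_integral_add; (subst nn_integral_add nn_integral_multc)?; measurable?) (simp add: nn_integral_add nn_integral_multc)
    also have "(\<integral>\<^sup>+t. indicator {0<..<l} t * ennreal ((u (x + (-t) *\<^sub>R e))\<^sup>2) \<partial>lborel) = (\<integral>\<^sup>+t. indicator {-l<..<0} t * ennreal ((u (x + t *\<^sub>R e))\<^sup>2) \<partial>lborel)"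
      by (subst nn_integral_real_affine[of _ "-1" 0]) (auto intro!: nn_integral_cong split: split_indicator)
    also have "(\<integral>\<^sup>+t. ennreal (t * indicator {0<..<l} t) \<partial>lborel) \<le> (\<integral>\<^sup>+t. ennreal t * indicator {0..l} t \<partial>lborel)"
      by (intro nn_integral_mono) (auto split: split_indicator)
    also have "(\<integral>\<^sup>+t. ennreal t * indicator {0..l} t \<partial>lborel) = ennreal (l\<^sup>2 / 2 - 0\<^sup>2 / 2)"
      by (rule nn_integral_FTC_Icc) (use l in \<open>auto intro!: derivative_eq_intros\<close>)
    also have "(\<integral>\<^sup>+t. indicator {0<..<l} t * ennreal ((u (x + t *\<^sub>R e))\<^sup>2) \<partial>lborel) + (\<integral>\<^sup>+t. indicator {-l<..<0} t * ennreal ((u (x + t *\<^sub>R e))\<^sup>2) \<partial>lborel)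
      = (\<integral>\<^sup>+t. indicator {0<..<l} t * ennreal ((u (x + t *\<^sub>R e))\<^sup>2) + indicator {-l<..<0} t * ennreal ((u (x + t *\<^sub>R e))\<^sup>2) \<partial>lborel)"
      by (rule nn_integral_add[symmetric]) auto
    also have "\<dots> \<le> U x" unfolding U_def by (intro nn_integral_mono) (auto split: split_indicator)
    finally have "ennreal l * ennreal ((u x)\<^sup>2) \<le> U x + ennreal (l\<^sup>2 / 2) * V x"
      by (simp add: add_mono mult_right_mono)
    then have "ennreal (1 / l) * (ennreal l * ennreal ((u x)\<^sup>2)) \<le> ennreal (1 / l) * (U x + ennreal (l\<^sup>2 / 2) * V x)"
      by (intro mult_left_mono) auto
    moreover have "ennreal (1 / l) * (ennreal l * ennreal ((u x)\<^sup>2)) = ennreal ((u x)\<^sup>2)"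
      using l by (simp add: mult.assoc[symmetric] flip: ennreal_mult)
    moreover have "ennreal (1 / l) * (ennreal (l\<^sup>2 / 2) * V x) = ennreal (l / 2) * V x"
      using l by (simp add: mult.assoc[symmetric] power2_eq_square flip: ennreal_mult)
    ultimately show "ennreal ((u x)\<^sup>2) \<le> ennreal (1 / l) * (\<integral>\<^sup>+t. ennreal ((u (x + t *\<^sub>R e))\<^sup>2) \<partial>lborel)
     + ennreal (l / 2) * (\<integral>\<^sup>+t. ennreal ((G (x + t *\<^sub>R e) \<bullet> e)\<^sup>2) \<partial>lborel)"
      by (simp add: distrib_left U_def V_def)
  qed
qed

text \<open>The bracket is smallest at l = 2 sqrt(c/s), where it equals sqrt(c s). Replacing c and s
  by c + e and s + e keeps this l meaningful when one of them is zero; then e tends to 0.\<close>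

lemma le_mult_if_le_square:
  fixes X c s :: real
  assumes "\<And>l. l > 0 \<Longrightarrow> X \<le> (c / l + l * s / 4)\<^sup>2" "c \<ge> 0" "s \<ge> 0"
  shows "X \<le> c * s"
proof -
  have "X \<le> (c + e) * (s + e)" if e: "e > 0" for e
  proof -
    define l where "l = 2 * sqrt ((c + e) / (s + e))"
    have l: "l > 0" using e assms by (simp add: l_def)
    have "X \<le> (c / l + l * s / 4)\<^sup>2" by (rule assms(1)[OF l])
    also have "\<dots> \<le> ((c + e) / l + l * (s + e) / 4)\<^sup>2"
      using l e assms by (intro power_mono add_mono divide_right_mono mult_left_mono) auto
    also have "(c + e) / l + l * (s + e) / 4 = sqrt ((c + e) * (s + e))"
    proof -
      have "p\<^sup>2 / (2 * (p / q)) + 2 * (p / q) * q\<^sup>2 / 4 = p * q" if "p > 0" "q > 0" for p q :: real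
        using that by (simp add: field_simps power2_eq_square)
      from this[of "sqrt (c + e)" "sqrt (s + e)"] show ?thesis
        using e assms by (simp add: l_def real_sqrt_mult real_sqrt_divide)
    qed
    also have "(sqrt ((c + e) * (s + e)))\<^sup>2 = (c + e) * (s + e)" using e assms by simp
    finally show ?thesis .
  qed
  then have ev: "eventually (\<lambda>e. X \<le> (c + e) * (s + e)) (at_right 0)" by (auto simp: eventually_at_right_field intro: exI[of _ 1])
  have "((\<lambda>e. (c + e) * (s + e)) \<longlongrightarrow> (c + 0) * (s + 0)) (at_right 0)" by (intro tendsto_intros)
  from tendsto_lowerbound[OF this ev] show ?thesis by simp
qed

declare borel_measurable_nth[measurable]

text \<open>Ladyzhenskaya's argument. On almost every horizontal line u^2 is bounded by a function
  M1 of the second coordinate, on almost every vertical line by a function M2 of the first. The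
  integral of M1 M2 factorizes, and optimizing the free length l gives the constant 1.\<close>

lemma L4_bound:
  assumes u[measurable]: "u \<in> borel_measurable borel" and uL: "integrable lborel (\<lambda>x. (u x)\<^sup>2)" and G: "L2_grad u G"
  shows "integrable lborel (\<lambda>x. (u x)^4)"
    and "(\<integral>x. (u x)^4 \<partial>lborel) \<le> (\<integral>x. (u x)\<^sup>2 \<partial>lborel) * (\<integral>x. (norm (G x))\<^sup>2 \<partial>lborel)"
proof -
  have [measurable]: "G \<in> borel_measurable borel" and GI: "integrable lborel (\<lambda>x. (norm (G x))\<^sup>2)" using G by (auto simp: L2_grad_def)
  define c where "c = (\<integral>x. (u x)\<^sup>2 \<partial>lborel)"
  define s where "s i = (\<integral>x. (G x $ i)\<^sup>2 \<partial>lborel)" for i :: 2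
  have sI: "integrable lborel (\<lambda>x. (G x $ i)\<^sup>2)" for i
    by (rule Bochner_Integration.integrable_bound[OF GI])
      (auto simp: component_le_norm_cart abs_le_square_iff[symmetric])
  have "(norm (G x))\<^sup>2 = (G x $ 1)\<^sup>2 + (G x $ 2)\<^sup>2" for x
    unfolding power2_norm_eq_inner by (simp add: inner_vec_def sum_2 power2_eq_square)
  then have s: "(\<integral>x. (norm (G x))\<^sup>2 \<partial>lborel) = s 1 + s 2" using sI by (simp add: s_def)
  have c0: "c \<ge> 0" and s0: "s i \<ge> 0" for i by (auto simp: c_def s_def)
  have ceq: "(\<integral>\<^sup>+x. ennreal ((u x)\<^sup>2) \<partial>lborel) = ennreal c" unfolding c_def by (rule nn_integral_eq_integral[OF uL]) simp
  have seq: "(\<integral>\<^sup>+x. ennreal ((G x $ i)\<^sup>2) \<partial>lborel) = ennreal (s i)" for i unfolding s_def by (rule nn_integral_eq_integral[OF sI]) simp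
  have main: "(\<integral>\<^sup>+x. ennreal ((u x)^4) \<partial>lborel) \<le> ennreal ((c / l + l * (s 1 + s 2) / 4)\<^sup>2)" if l: "l > 0" for l
  proof -
    define M1 where "M1 b = ennreal (1 / l) * (\<integral>\<^sup>+a. ennreal ((u (vector [a, b]))\<^sup>2) \<partial>lborel) + ennreal (l / 2) * (\<integral>\<^sup>+a. ennreal ((G (vector [a, b]) $ 1)\<^sup>2) \<partial>lborel)" for b
    define M2 where "M2 a = ennreal (1 / l) * (\<integral>\<^sup>+b. ennreal ((u (vector [a, b]))\<^sup>2) \<partial>lborel) + ennreal (l / 2) * (\<integral>\<^sup>+b. ennreal ((G (vector [a, b]) $ 2)\<^sup>2) \<partial>lborel)" for a
    have mv: "(\<lambda>(a, b). vector [a, b] :: R2) \<in> borel_measurable (borel \<Otimes>\<^sub>M borel)" by (simp add: borel_prod)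
    have [measurable]: "(\<lambda>x. vector [f x, g x] :: R2) \<in> borel_measurable M" if "f \<in> borel_measurable M" "g \<in> borel_measurable M" for f g and M :: "'z measure"
      using measurable_compose[OF measurable_Pair[OF that] mv] by simp
    have [measurable]: "M1 \<in> borel_measurable borel" "M2 \<in> borel_measurable borel" unfolding M1_def M2_def by measurable
    have e1: "x + t *\<^sub>R axis 1 1 = vector [x $ 1 + 1 * t, x $ 2]" "x + t *\<^sub>R axis 2 1 = vector [x $ 1, x $ 2 + 1 * t]" for x :: R2 and t
      by (auto simp: vec_eq_iff forall_2 axis_def)
    have A1: "AE x in lborel. ennreal ((u x)\<^sup>2) \<le> M1 (x $ 2)"
      using L2_grad_line_bound[OF u uL G l, of "axis 1 1"]
    proof (rule eventually_mono)
      fix x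
      have "(\<integral>\<^sup>+a. ennreal ((u (vector [a, x $ 2]))\<^sup>2) \<partial>lborel) = (\<integral>\<^sup>+t. ennreal ((u (x + t *\<^sub>R axis 1 1))\<^sup>2) \<partial>lborel)"
        "(\<integral>\<^sup>+a. ennreal ((G (vector [a, x $ 2]) $ 1)\<^sup>2) \<partial>lborel) = (\<integral>\<^sup>+t. ennreal ((G (x + t *\<^sub>R axis 1 1) \<bullet> axis 1 1)\<^sup>2) \<partial>lborel)"
        unfolding e1 by (subst nn_integral_real_affine[where c = 1 and t = "x $ 1"]; simp add: inner_axis)+
      then show "ennreal ((u x)\<^sup>2) \<le> ennreal (1 / l) * (\<integral>\<^sup>+t. ennreal ((u (x + t *\<^sub>R axis 1 1))\<^sup>2) \<partial>lborel)
         + ennreal (l / 2) * (\<integral>\<^sup>+t. ennreal ((G (x + t *\<^sub>R axis 1 1) \<bullet> axis 1 1)\<^sup>2) \<partial>lborel) \<Longrightarrow> ennreal ((u x)\<^sup>2) \<le> M1 (x $ 2)"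
        unfolding M1_def by simp
    qed
    have A2: "AE x in lborel. ennreal ((u x)\<^sup>2) \<le> M2 (x $ 1)"
      using L2_grad_line_bound[OF u uL G l, of "axis 2 1"]
    proof (rule eventually_mono)
      fix x
      have "(\<integral>\<^sup>+a. ennreal ((u (vector [x $ 1, a]))\<^sup>2) \<partial>lborel) = (\<integral>\<^sup>+t. ennreal ((u (x + t *\<^sub>R axis 2 1))\<^sup>2) \<partial>lborel)"
        "(\<integral>\<^sup>+a. ennreal ((G (vector [x $ 1, a]) $ 2)\<^sup>2) \<partial>lborel) = (\<integral>\<^sup>+t. ennreal ((G (x + t *\<^sub>R axis 2 1) \<bullet> axis 2 1)\<^sup>2) \<partial>lborel)"
        unfolding e1 by (subst nn_integral_real_affine[where c = 1 and t = "x $ 2"]; simp add: inner_axis)+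
      then show "ennreal ((u x)\<^sup>2) \<le> ennreal (1 / l) * (\<integral>\<^sup>+t. ennreal ((u (x + t *\<^sub>R axis 2 1))\<^sup>2) \<partial>lborel)
         + ennreal (l / 2) * (\<integral>\<^sup>+t. ennreal ((G (x + t *\<^sub>R axis 2 1) \<bullet> axis 2 1)\<^sup>2) \<partial>lborel) \<Longrightarrow> ennreal ((u x)\<^sup>2) \<le> M2 (x $ 1)"
        unfolding M2_def by simp
    qed
    have "(\<integral>\<^sup>+x. ennreal ((u x)^4) \<partial>lborel) \<le> (\<integral>\<^sup>+x. M1 ((x::R2) $ 2) * M2 (x $ 1) \<partial>lborel)"
    proof (rule nn_integral_mono_AE, use A1 A2 in eventually_elim)
      case (elim x)
      have "ennreal ((u x)^4) = ennreal ((u x)\<^sup>2) * ennreal ((u x)\<^sup>2)" by (simp flip: ennreal_mult add: power2_eq_square power4_eq_xxxx mult_ac)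
      also have "\<dots> \<le> M1 (x $ 2) * M2 (x $ 1)" using elim by (intro mult_mono) auto
      finally show ?case .
    qed
    also have "\<dots> = (\<integral>\<^sup>+a. \<integral>\<^sup>+b. M1 b * M2 a \<partial>lborel \<partial>lborel)"
      by (subst nn_integral_R2_iterated(1)) auto
    also have "\<dots> = (\<integral>\<^sup>+b. M1 b \<partial>lborel) * (\<integral>\<^sup>+a. M2 a \<partial>lborel)"
      by (simp add: nn_integral_multc nn_integral_cmult)
    also have "(\<integral>\<^sup>+b. M1 b \<partial>lborel) = ennreal (1 / l) * (\<integral>\<^sup>+x. ennreal ((u x)\<^sup>2) \<partial>lborel) + ennreal (l / 2) * (\<integral>\<^sup>+x. ennreal ((G x $ 1)\<^sup>2) \<partial>lborel)"
      unfolding M1_def by (simp add: nn_integral_add nn_integral_cmult nn_integral_R2_iterated(2))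
    also have "(\<integral>\<^sup>+b. M2 b \<partial>lborel) = ennreal (1 / l) * (\<integral>\<^sup>+x. ennreal ((u x)\<^sup>2) \<partial>lborel) + ennreal (l / 2) * (\<integral>\<^sup>+x. ennreal ((G x $ 2)\<^sup>2) \<partial>lborel)"
      unfolding M2_def by (simp add: nn_integral_add nn_integral_cmult nn_integral_R2_iterated(1))
    also have "(ennreal (1 / l) * (\<integral>\<^sup>+x. ennreal ((u x)\<^sup>2) \<partial>lborel) + ennreal (l / 2) * (\<integral>\<^sup>+x. ennreal ((G x $ 1)\<^sup>2) \<partial>lborel)) *
      (ennreal (1 / l) * (\<integral>\<^sup>+x. ennreal ((u x)\<^sup>2) \<partial>lborel) + ennreal (l / 2) * (\<integral>\<^sup>+x. ennreal ((G x $ 2)\<^sup>2) \<partial>lborel))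
      = ennreal ((c / l + l * s 1 / 2) * (c / l + l * s 2 / 2))"
      unfolding ceq seq using l c0 s0 by (simp flip: ennreal_mult ennreal_plus)
    \<comment> \<open>Arithmetic-geometric mean; it makes the bound depend only on the sum of the
      two partial energies.\<close>
    also have "(c / l + l * s 1 / 2) * (c / l + l * s 2 / 2) \<le> (c / l + l * (s 1 + s 2) / 4)\<^sup>2"
      using zero_le_power2[of "l * s 1 - l * s 2"] by (simp add: power2_eq_square algebra_simps)
    finally show ?thesis by (simp add: ennreal_leI)
  qed
  have "(\<integral>\<^sup>+x. ennreal ((u x)^4) \<partial>lborel) < \<infinity>" using main[of 1] by (auto simp: less_top[symmetric] top_unique)
  then show I4: "integrable lborel (\<lambda>x. (u x)^4)" by (intro integrableI_nonneg) auto
  have "(\<integral>x. (u x)^4 \<partial>lborel) \<le> c * (s 1 + s 2)"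
  proof (rule le_mult_if_le_square)
    fix l :: real assume "l > 0"
    from main[OF this] show "(\<integral>x. (u x)^4 \<partial>lborel) \<le> (c / l + l * (s 1 + s 2) / 4)\<^sup>2"
      by (subst (asm) nn_integral_eq_integral[OF I4]) auto
  qed (use c0 s0[of 1] s0[of 2] in auto)
  then show "(\<integral>x. (u x)^4 \<partial>lborel) \<le> (\<integral>x. (u x)\<^sup>2 \<partial>lborel) * (\<integral>x. (norm (G x))\<^sup>2 \<partial>lborel)"
    unfolding s c_def .
qed

subsection \<open>Weak limits of gradients\<close>

lemma Cauchy_Schwarz_integral:
  fixes a b :: "'a \<Rightarrow> real"
  assumes [measurable]: "a \<in> borel_measurable M" "b \<in> borel_measurable M"
    and A: "integrable M (\<lambda>x. (a x)\<^sup>2)" and B: "integrable M (\<lambda>x. (b x)\<^sup>2)"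
  shows "integrable M (\<lambda>x. a x * b x)"
    and "(\<integral>x. a x * b x \<partial>M)\<^sup>2 \<le> (\<integral>x. (a x)\<^sup>2 \<partial>M) * (\<integral>x. (b x)\<^sup>2 \<partial>M)"
proof -
  show I: "integrable M (\<lambda>x. a x * b x)"
  proof (rule Bochner_Integration.integrable_bound[OF Bochner_Integration.integrable_add[OF A B]])
    have "\<bar>a x * b x\<bar> \<le> (a x)\<^sup>2 + (b x)\<^sup>2" for x
      using sum_squares_bound[of "\<bar>a x\<bar>" "\<bar>b x\<bar>"] abs_ge_zero[of "a x * b x"]
      unfolding abs_mult power2_abs by linarith
    then show "AE x in M. norm (a x * b x) \<le> norm ((a x)\<^sup>2 + (b x)\<^sup>2)" by simp
  qed simp
  define A' where "A' = (\<integral>x. (a x)\<^sup>2 \<partial>M)"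
  define B' where "B' = (\<integral>x. (b x)\<^sup>2 \<partial>M)"
  define m where "m = (\<integral>x. a x * b x \<partial>M)"
  have q: "0 \<le> A' * t\<^sup>2 - 2 * m * t + B'" for t
  proof -
    have "0 \<le> (\<integral>x. (t * a x - b x)\<^sup>2 \<partial>M)" by simp
    also have "\<dots> = (\<integral>x. t\<^sup>2 * (a x)\<^sup>2 - (2 * t) * (a x * b x) + (b x)\<^sup>2 \<partial>M)"
      by (intro Bochner_Integration.integral_cong) (auto simp: power2_eq_square algebra_simps)
    also have "\<dots> = A' * t\<^sup>2 - 2 * m * t + B'" using A B I by (simp add: A'_def B'_def m_def)
    finally show ?thesis .
  qed
  have A0: "A' \<ge> 0" by (auto simp: A'_def)
  have "m\<^sup>2 \<le> A' * B'"
  proof (cases "A' = 0")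
    case True
    have "m = 0"
    proof (rule ccontr)
      assume "m \<noteq> 0"
      then show False using q[of "(B' + 1) / (2 * m)"] True by simp
    qed
    then show ?thesis using True by simp
  next
    case False
    then show ?thesis using q[of "m / A'"] A0 by (simp add: field_simps power2_eq_square)
  qed
  then show "(\<integral>x. a x * b x \<partial>M)\<^sup>2 \<le> (\<integral>x. (a x)\<^sup>2 \<partial>M) * (\<integral>x. (b x)\<^sup>2 \<partial>M)" by (simp add: A'_def B'_def m_def)
qed

text \<open>A substitute for the convex hull of the tail from index n on: the parallelogram law
  needs only midpoints.\<close>

inductive mid_hull :: "(nat \<Rightarrow> 'a \<Rightarrow> 'b::real_vector) \<Rightarrow> nat \<Rightarrow> ('a \<Rightarrow> 'b) \<Rightarrow> bool" for G n where
  base: "n \<le> i \<Longrightarrow> mid_hull G n (G i)"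
| mid: "mid_hull G n f \<Longrightarrow> mid_hull G n g \<Longrightarrow> mid_hull G n (\<lambda>x. (1/2) *\<^sub>R (f x + g x))"

lemma mid_hull_mono: "mid_hull G m f \<Longrightarrow> n \<le> m \<Longrightarrow> mid_hull G n f"
  by (induction rule: mid_hull.induct) (auto intro: mid_hull.intros)

lemma integrable_norm_square_add:
  fixes f g :: "'a \<Rightarrow> 'b::{real_inner, second_countable_topology}"
  assumes [measurable]: "f \<in> borel_measurable M" "g \<in> borel_measurable M"
    and f: "integrable M (\<lambda>x. (norm (f x))\<^sup>2)" and g: "integrable M (\<lambda>x. (norm (g x))\<^sup>2)"
  shows "integrable M (\<lambda>x. (norm (f x + g x))\<^sup>2)" "integrable M (\<lambda>x. (norm (f x - g x))\<^sup>2)"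
    and "(\<integral>x. (norm (f x + g x))\<^sup>2 \<partial>M) + (\<integral>x. (norm (f x - g x))\<^sup>2 \<partial>M) = 2 * (\<integral>x. (norm (f x))\<^sup>2 \<partial>M) + 2 * (\<integral>x. (norm (g x))\<^sup>2 \<partial>M)"
proof -
  have p: "(norm (f x + g x))\<^sup>2 + (norm (f x - g x))\<^sup>2 = 2 * (norm (f x))\<^sup>2 + 2 * (norm (g x))\<^sup>2" for x
    unfolding power2_norm_eq_inner by (simp add: algebra_simps inner_commute)
  have p1: "(norm (f x + g x))\<^sup>2 \<le> 2 * (norm (f x))\<^sup>2 + 2 * (norm (g x))\<^sup>2"
    and p2: "(norm (f x - g x))\<^sup>2 \<le> 2 * (norm (f x))\<^sup>2 + 2 * (norm (g x))\<^sup>2" for x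
    using p[of x] zero_le_power2[of "norm (f x + g x)"] zero_le_power2[of "norm (f x - g x)"] by linarith+
  have I: "integrable M (\<lambda>x. 2 * (norm (f x))\<^sup>2 + 2 * (norm (g x))\<^sup>2)" using f g by auto
  show i1: "integrable M (\<lambda>x. (norm (f x + g x))\<^sup>2)" by (rule Bochner_Integration.integrable_bound[OF I]) (use p1 in auto)
  show i2: "integrable M (\<lambda>x. (norm (f x - g x))\<^sup>2)" by (rule Bochner_Integration.integrable_bound[OF I]) (use p2 in auto)
  show "(\<integral>x. (norm (f x + g x))\<^sup>2 \<partial>M) + (\<integral>x. (norm (f x - g x))\<^sup>2 \<partial>M) = 2 * (\<integral>x. (norm (f x))\<^sup>2 \<partial>M) + 2 * (\<integral>x. (norm (g x))\<^sup>2 \<partial>M)"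
    using Bochner_Integration.integral_add[OF i1 i2] f g by (simp add: p)
qed

text \<open>The sum of 2^k |g(k+1) - g(k)|^2 has a finite integral, so it is finite almost
  everywhere. Hence the increments are at most a constant times 2^(-k/2) pointwise and can be
  summed.\<close>

lemma L2_complete_fast:
  fixes g :: "nat \<Rightarrow> 'a \<Rightarrow> 'b::{euclidean_space}"
  assumes [measurable]: "\<And>k. g k \<in> borel_measurable M"
    and I: "\<And>k. integrable M (\<lambda>x. (norm (g k x))\<^sup>2)"
    and fast: "\<And>k. (\<integral>x. (norm (g (Suc k) x - g k x))\<^sup>2 \<partial>M) \<le> (1/4)^k"
  shows "AE x in M. convergent (\<lambda>k. g k x)"
proof -
  have Id: "integrable M (\<lambda>x. (norm (g (Suc k) x - g k x))\<^sup>2)" for k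
    by (rule integrable_norm_square_add) (use I in auto)
  have "(\<integral>\<^sup>+x. (\<Sum>k. ennreal (2^k * (norm (g (Suc k) x - g k x))\<^sup>2)) \<partial>M) = (\<Sum>k. \<integral>\<^sup>+x. ennreal (2^k * (norm (g (Suc k) x - g k x))\<^sup>2) \<partial>M)"
    by (rule nn_integral_suminf) auto
  also have "\<dots> \<le> (\<Sum>k. ennreal ((1/2)^k))"
  proof (rule suminf_le)
    fix k
    have "(\<integral>\<^sup>+x. ennreal (2^k * (norm (g (Suc k) x - g k x))\<^sup>2) \<partial>M) = ennreal (2^k * (\<integral>x. (norm (g (Suc k) x - g k x))\<^sup>2 \<partial>M))"
      by (subst nn_integral_eq_integral) (use Id[of k] in auto)
    also have "2^k * (\<integral>x. (norm (g (Suc k) x - g k x))\<^sup>2 \<partial>M) \<le> 2^k * (1/4)^k"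
      using fast[of k] by (intro mult_left_mono) auto
    also have "2^k * (1/4)^k = ((1/2)^k :: real)" by (simp flip: power_mult_distrib)
    finally show "(\<integral>\<^sup>+x. ennreal (2^k * (norm (g (Suc k) x - g k x))\<^sup>2) \<partial>M) \<le> ennreal ((1/2)^k)" by (simp add: ennreal_leI)
  qed auto
  also have "\<dots> = ennreal (\<Sum>k. (1/2)^k)" by (rule suminf_ennreal2) (auto intro: summable_geometric)
  also have "\<dots> < \<infinity>" by simp
  finally have "AE x in M. (\<Sum>k. ennreal (2^k * (norm (g (Suc k) x - g k x))\<^sup>2)) \<noteq> \<infinity>"
    by (intro nn_integral_noteq_infinite) auto
  then show ?thesis
  proof (rule eventually_mono)
    fix x assume fin: "(\<Sum>k. ennreal (2^k * (norm (g (Suc k) x - g k x))\<^sup>2)) \<noteq> \<infinity>"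
    have s: "summable (\<lambda>k. 2^k * (norm (g (Suc k) x - g k x))\<^sup>2)"
      by (rule summable_suminf_not_top) (use fin in auto)
    then have "bounded (range (\<lambda>k. 2^k * (norm (g (Suc k) x - g k x))\<^sup>2))"
      by (intro convergent_imp_bounded) (auto dest: summable_LIMSEQ_zero)
    then obtain S where S: "S > 0" "\<And>k. 2^k * (norm (g (Suc k) x - g k x))\<^sup>2 \<le> S" by (auto simp: bounded_pos)
    have le: "norm (g (Suc k) x - g k x) \<le> sqrt S * (sqrt (1/2))^k" for k
    proof -
      have "(norm (g (Suc k) x - g k x))\<^sup>2 \<le> S * (1/2)^k" using S(2)[of k] by (simp add: field_simps power_divide)
      then have "norm (g (Suc k) x - g k x) \<le> sqrt (S * (1/2)^k)" by (rule real_le_rsqrt)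
      then show ?thesis by (simp add: real_sqrt_mult real_sqrt_power)
    qed
    have "sqrt (1/2) < sqrt 1" by (subst real_sqrt_less_iff) simp
    then have "sqrt (1/2) < (1::real)" by simp
    then have "summable (\<lambda>k. sqrt S * (sqrt (1/2))^k)" by (intro summable_mult summable_geometric) auto
    then have "summable (\<lambda>k. g (Suc k) x - g k x)"
      by (rule summable_comparison_test'[where N = 0]) (use le in auto)
    then have "convergent (\<lambda>n. \<Sum>k<n. g (Suc k) x - g k x)" by (simp add: summable_iff_convergent)
    then have "convergent (\<lambda>n. (\<Sum>k<n. g (Suc k) x - g k x) + g 0 x)"
      by (intro convergent_add convergent_const)
    then show "convergent (\<lambda>k. g k x)" by (simp add: sum_lessThan_telescope[of "\<lambda>k. g k x"])
  qed
qed

text \<open>Weak sequential compactness in \<open>L\<^sup>2\<close> without duality: almost minimal elements of the tail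
  hulls form a Cauchy sequence by the parallelogram law, and all linear limits pass to the hulls.\<close>
lemma L2_weak_limit:
  fixes G :: "nat \<Rightarrow> 'a \<Rightarrow> 'b::euclidean_space" and phi :: "'i \<Rightarrow> 'a \<Rightarrow> real"
  assumes Gm[measurable]: "\<And>n. G n \<in> borel_measurable M"
    and GI: "\<And>n. integrable M (\<lambda>x. (norm (G n x))\<^sup>2)"
    and GK: "\<And>n. (\<integral>x. (norm (G n x))\<^sup>2 \<partial>M) \<le> K n" and K: "K \<longlonglongrightarrow> kappa"
    and phim[measurable]: "\<And>i. i \<in> I \<Longrightarrow> phi i \<in> borel_measurable M"
    and phiI: "\<And>i. i \<in> I \<Longrightarrow> integrable M (\<lambda>x. (phi i x)\<^sup>2)"
    and lim: "\<And>i. i \<in> I \<Longrightarrow> (\<lambda>n. \<integral>x. phi i x *\<^sub>R G n x \<partial>M) \<longlonglongrightarrow> l i"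
  obtains H where "H \<in> borel_measurable M" "integrable M (\<lambda>x. (norm (H x))\<^sup>2)" "(\<integral>x. (norm (H x))\<^sup>2 \<partial>M) \<le> kappa"
    "\<And>i. i \<in> I \<Longrightarrow> (\<integral>x. phi i x *\<^sub>R H x \<partial>M) = l i"
proof -
  define q where "q f = (\<integral>x. (norm (f x :: 'b))\<^sup>2 \<partial>M)" for f
  have q0: "q f \<ge> 0" for f by (simp add: q_def)
  have hm: "f \<in> borel_measurable M" if "mid_hull G n f" for n f
    using that by (induction rule: mid_hull.induct) auto
  have hI: "integrable M (\<lambda>x. (norm (f x))\<^sup>2)" if "mid_hull G n f" for n f
    using that
  proof (induction rule: mid_hull.induct)
    case (mid f g)
    have "integrable M (\<lambda>x. (1/4) * (norm (f x + g x))\<^sup>2)"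
      using integrable_norm_square_add(1)[OF hm hm mid.IH] mid.hyps by auto
    then show ?case by (simp add: power_mult_distrib power_divide power2_eq_square)
  qed (simp add: GI)
  have phiG: "integrable M (\<lambda>x. phi i x *\<^sub>R f x)" and
    phiCS: "norm (\<integral>x. phi i x *\<^sub>R f x \<partial>M) \<le> sqrt ((\<integral>x. (phi i x)\<^sup>2 \<partial>M) * q f)"
    if [measurable]: "f \<in> borel_measurable M" and "integrable M (\<lambda>x. (norm (f x))\<^sup>2)" and i: "i \<in> I" for f i
  proof -
    note [measurable] = phim[OF i]
    have 1: "integrable M (\<lambda>x. \<bar>phi i x\<bar> * norm (f x))" "(\<integral>x. \<bar>phi i x\<bar> * norm (f x) \<partial>M)\<^sup>2 \<le> (\<integral>x. (phi i x)\<^sup>2 \<partial>M) * q f"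
      using Cauchy_Schwarz_integral[of "\<lambda>x. \<bar>phi i x\<bar>" M "\<lambda>x. norm (f x)"] that phiI[OF i] by (auto simp: q_def)
    show 2: "integrable M (\<lambda>x. phi i x *\<^sub>R f x)"
      by (rule Bochner_Integration.integrable_bound[OF 1(1)]) auto
    have "norm (\<integral>x. phi i x *\<^sub>R f x \<partial>M) \<le> (\<integral>x. norm (phi i x *\<^sub>R f x) \<partial>M)" by (rule integral_norm_bound)
    also have "\<dots> = (\<integral>x. \<bar>phi i x\<bar> * norm (f x) \<partial>M)" by simp
    also have "\<dots> \<le> sqrt ((\<integral>x. (phi i x)\<^sup>2 \<partial>M) * q f)" by (rule real_le_rsqrt[OF 1(2)])
    finally show "norm (\<integral>x. phi i x *\<^sub>R f x \<partial>M) \<le> sqrt ((\<integral>x. (phi i x)\<^sup>2 \<partial>M) * q f)" .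
  qed
  \<comment> \<open>Closeness to \<open>l i\<close> within e is a convex condition, so it passes
    from the tail of the sequence to the hull of the tail.\<close>
  have hlim: "norm ((\<integral>x. phi i x *\<^sub>R f x \<partial>M) - l i) \<le> e"
    if "mid_hull G n f" and i: "i \<in> I" and e: "\<And>k. k \<ge> n \<Longrightarrow> norm ((\<integral>x. phi i x *\<^sub>R G k x \<partial>M) - l i) \<le> e" for i n f e
    using that(1)
  proof (induction rule: mid_hull.induct)
    case (mid f g)
    have "(\<integral>x. phi i x *\<^sub>R (1/2) *\<^sub>R (f x + g x) \<partial>M) = (\<integral>x. (1/2) *\<^sub>R (phi i x *\<^sub>R f x + phi i x *\<^sub>R g x) \<partial>M)"
      by (simp add: scaleR_add_right mult.commute)
    also have "\<dots> = (1/2) *\<^sub>R ((\<integral>x. phi i x *\<^sub>R f x \<partial>M) + (\<integral>x. phi i x *\<^sub>R g x \<partial>M))"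
      using phiG[OF hm hI i, OF mid.hyps(1) mid.hyps(1)] phiG[OF hm hI i, OF mid.hyps(2) mid.hyps(2)]
      by (simp del: scaleR_scaleR)
    finally have "(\<integral>x. phi i x *\<^sub>R (1/2) *\<^sub>R (f x + g x) \<partial>M) - l i = (1/2) *\<^sub>R (((\<integral>x. phi i x *\<^sub>R f x \<partial>M) - l i) + ((\<integral>x. phi i x *\<^sub>R g x \<partial>M) - l i))"
      using scaleR_half_double[of "l i"] by (simp only: add_diff_add[symmetric] scaleR_diff_right)
    then show ?case using mid.IH norm_triangle_le[of "(\<integral>x. phi i x *\<^sub>R f x \<partial>M) - l i" "(\<integral>x. phi i x *\<^sub>R g x \<partial>M) - l i" "2 * e"]
      by simp
  qed (use e in auto)
  \<comment> \<open>The hulls shrink with n, so their minimal energies increase; they stay below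
    kappa because each hull contains all later \<open>G k\<close>.\<close>
  define d where "d n = Inf {q f | f. mid_hull G n f}" for n
  have bdd: "bdd_below {q f | f. mid_hull G n f}" for n by (rule bdd_belowI[of _ 0]) (auto simp: q0)
  have ne: "{q f | f. mid_hull G n f} \<noteq> {}" for n using mid_hull.base[of n n G] by auto
  have d_le: "d n \<le> q f" if "mid_hull G n f" for n f unfolding d_def by (rule cInf_lower[OF _ bdd]) (use that in auto)
  have "mono d"
  proof (rule monoI)
    fix n m :: nat assume "n \<le> m"
    then show "d n \<le> d m" unfolding d_def by (intro cInf_superset_mono[OF ne bdd]) (auto intro: mid_hull_mono)
  qed
  have dK0: "d n \<le> kappa" for n
  proof (rule LIMSEQ_le_const[OF K], intro exI[of _ n] allI impI)
    fix k assume "n \<le> k"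
    then have "d n \<le> q (G k)" by (intro d_le mid_hull.base)
    then show "d n \<le> K k" using GK[of k] by (simp add: q_def)
  qed
  then obtain D where D: "d \<longlonglongrightarrow> D" "\<And>n. d n \<le> D"
    using incseq_convergent[of d kappa] \<open>mono d\<close> by (auto simp: mono_def incseq_def)
  have DK0: "D \<le> kappa" using LIMSEQ_le_const2[OF D(1)] dK0 by auto
  have "\<exists>f. mid_hull G n f \<and> q f < d n + 1 / real (Suc n)" for n
  proof -
    have "d n < d n + 1 / real (Suc n)" by simp
    then show ?thesis using cInf_lessD[OF ne[of n], of "d n + 1 / real (Suc n)"] by (auto simp: d_def)
  qed
  then obtain f where f: "\<And>n. mid_hull G n (f n)" "\<And>n. q (f n) < d n + 1 / real (Suc n)" by metis
  note [measurable] = hm[OF f(1)]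
  \<comment> \<open>The midpoint of \<open>f m\<close> and \<open>f n\<close> lies in the hull from
    n and has energy at least \<open>d n\<close>. The parallelogram law bounds the energy of the
    difference by twice both energies minus \<open>4 * d n\<close>; with \<open>d m \<le> D\<close>
    this is at most \<open>e n\<close>.\<close>
  define e where "e n = 2 * (D - d n) + 4 / real (Suc n)" for n
  have "(\<lambda>n. 4 / real (Suc n)) \<longlonglongrightarrow> 0" by real_asymp
  from tendsto_add[OF tendsto_mult[OF tendsto_const[of 2] tendsto_diff[OF tendsto_const[of D] D(1)]] this]
  have e_lim: "e \<longlonglongrightarrow> 0" unfolding e_def by simp
  have cauchy: "q (\<lambda>x. f m x - f n x) \<le> e n" if "n \<le> m" for n m
  proof -
    have h: "mid_hull G n (\<lambda>x. (1/2) *\<^sub>R (f m x + f n x))" using f(1) mid_hull_mono[OF f(1) that] by (intro mid_hull.mid)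
    have "q (\<lambda>x. (1/2) *\<^sub>R (f m x + f n x)) = (\<integral>x. (1/4) * (norm (f m x + f n x))\<^sup>2 \<partial>M)"
      unfolding q_def by (simp add: power_mult_distrib power_divide power2_eq_square)
    then have "q (\<lambda>x. (1/2) *\<^sub>R (f m x + f n x)) = (1/4) * (\<integral>x. (norm (f m x + f n x))\<^sup>2 \<partial>M)" by simp
    moreover have "(\<integral>x. (norm (f m x + f n x))\<^sup>2 \<partial>M) + q (\<lambda>x. f m x - f n x) = 2 * q (f m) + 2 * q (f n)"
      unfolding q_def by (rule integrable_norm_square_add(3)) (use hI[OF f(1)] in auto)
    ultimately have "q (\<lambda>x. f m x - f n x) \<le> 2 * q (f m) + 2 * q (f n) - 4 * d n" using d_le[OF h] by simp
    moreover have "1 / real (Suc m) \<le> 1 / real (Suc n)" using that by (simp add: field_simps)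
    ultimately show ?thesis using f(2)[of m] f(2)[of n] D(2)[of m] by (simp add: e_def del: of_nat_Suc)
  qed
  have "\<exists>r. strict_mono (r :: nat \<Rightarrow> nat) \<and> (\<forall>k. e (r k) \<le> (1/4)^k)"
  proof -
    have ex: "\<exists>N>m. e N \<le> (1/4)^k" for k m
    proof -
      have "eventually (\<lambda>n. e n < (1/4)^k) sequentially" by (rule order_tendstoD(2)[OF e_lim]) simp
      then have E: "eventually (\<lambda>n. e n < (1/4)^k \<and> n > m) sequentially" using eventually_gt_at_top[of m] by eventually_elim auto
      show ?thesis using eventually_happens[OF E] by (auto intro: less_imp_le)
    qed
    \<comment> \<open>A subsequence with errors (1/4)^k, the rate that gives pointwise
      convergence.\<close>
    define r where "r = rec_nat (SOME N. N > 0 \<and> e N \<le> 1) (\<lambda>k m. SOME N. N > m \<and> e N \<le> (1/4)^(Suc k))"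
    have r0: "e (r 0) \<le> (1/4)^0" using someI_ex[OF ex[of 0 0]] by (simp add: r_def)
    have rS: "r (Suc k) > r k \<and> e (r (Suc k)) \<le> (1/4)^(Suc k)" for k
      using someI_ex[OF ex[of "r k" "Suc k"]] by (simp add: r_def)
    have "e (r k) \<le> (1/4)^k" for k using r0 rS by (cases k) auto
    moreover have "strict_mono r" using rS by (simp add: strict_mono_Suc_iff)
    ultimately show ?thesis by auto
  qed
  then obtain r where r: "strict_mono r" "\<And>k. e (r k) \<le> (1/4)^k" by auto
  define g where "g k = f (r k)" for k
  have gm[measurable]: "g k \<in> borel_measurable M" for k by (simp add: g_def)
  have gI: "integrable M (\<lambda>x. (norm (g k x))\<^sup>2)" for k unfolding g_def by (rule hI[OF f(1)])
  have conv: "AE x in M. convergent (\<lambda>k. g k x)"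
  proof (rule L2_complete_fast[OF gm gI])
    fix k
    have "q (\<lambda>x. g (Suc k) x - g k x) \<le> e (r k)" unfolding g_def
      using r(1) by (intro cauchy) (simp add: strict_mono_less_eq)
    then show "(\<integral>x. (norm (g (Suc k) x - g k x))\<^sup>2 \<partial>M) \<le> (1/4)^k" using r(2)[of k] by (simp add: q_def)
  qed
  define H where "H x = lim (\<lambda>k. g k x)" for x
  have Hm[measurable]: "H \<in> borel_measurable M" unfolding H_def by (rule borel_measurable_lim_metric) simp
  have gH: "AE x in M. (\<lambda>k. g k x) \<longlonglongrightarrow> H x"
    using conv by eventually_elim (simp add: H_def convergent_LIMSEQ_iff)
  \<comment> \<open>Pointwise convergence is upgraded to convergence in L^2 by Fatou's lemma applied
    to the Cauchy estimate.\<close>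
  have fat: "(\<integral>\<^sup>+x. ennreal ((norm (g k x - H x))\<^sup>2) \<partial>M) \<le> ennreal (e (r k))" for k
  proof -
    have "(\<integral>\<^sup>+x. ennreal ((norm (g k x - H x))\<^sup>2) \<partial>M) = (\<integral>\<^sup>+x. liminf (\<lambda>j. ennreal ((norm (g k x - g j x))\<^sup>2)) \<partial>M)"
    proof (rule nn_integral_cong_AE, use gH in eventually_elim)
      case (elim x)
      have L: "(\<lambda>j. ennreal ((norm (g k x - g j x))\<^sup>2)) \<longlonglongrightarrow> ennreal ((norm (g k x - H x))\<^sup>2)"
        by (intro tendsto_ennrealI tendsto_intros elim)
      show ?case by (rule lim_imp_Liminf[OF _ L, symmetric]) simp
    qed
    also have "\<dots> \<le> liminf (\<lambda>j. \<integral>\<^sup>+x. ennreal ((norm (g k x - g j x))\<^sup>2) \<partial>M)" by (rule nn_integral_liminf) simp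
    also have "\<dots> \<le> ennreal (e (r k))"
    proof (rule Liminf_le)
      show "eventually (\<lambda>j. (\<integral>\<^sup>+x. ennreal ((norm (g k x - g j x))\<^sup>2) \<partial>M) \<le> ennreal (e (r k))) sequentially"
        using eventually_ge_at_top[of k]
      proof eventually_elim
        case (elim j)
        have "q (\<lambda>x. g j x - g k x) \<le> e (r k)" unfolding g_def
          using r(1) elim by (intro cauchy) (simp add: strict_mono_less_eq)
        moreover have "integrable M (\<lambda>x. (norm (g k x - g j x))\<^sup>2)" by (rule integrable_norm_square_add) (use gI in auto)
        ultimately show ?case by (subst nn_integral_eq_integral) (auto simp: q_def norm_minus_commute intro: ennreal_leI)
      qed
    qed simp
    finally show ?thesis .
  qed
  have dI: "integrable M (\<lambda>x. (norm (g k x - H x))\<^sup>2)" for k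
    using order_le_less_trans[OF fat[of k]] by (intro integrableI_nonneg) auto
  have HI: "integrable M (\<lambda>x. (norm (H x))\<^sup>2)"
    using integrable_norm_square_add(2)[OF _ _ gI[of 0] dI[of 0]] by simp
  have dq: "q (\<lambda>x. g k x - H x) \<le> e (r k)" for k
  proof -
    have "0 \<le> e (r k)" using order_trans[OF q0 cauchy[of "r k" "r k"]] by simp
    then show ?thesis using fat[of k] unfolding q_def by (subst (asm) nn_integral_eq_integral[OF dI]) auto
  qed
  have er: "(\<lambda>k. e (r k)) \<longlonglongrightarrow> 0" using LIMSEQ_subseq_LIMSEQ[OF e_lim r(1)] by (simp add: o_def)
  show ?thesis
  proof (rule that[OF Hm HI])
    have "ennreal (q H) = (\<integral>\<^sup>+x. ennreal ((norm (H x))\<^sup>2) \<partial>M)" unfolding q_def by (rule nn_integral_eq_integral[symmetric, OF HI]) simp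
    also have "\<dots> = (\<integral>\<^sup>+x. liminf (\<lambda>j. ennreal ((norm (g j x))\<^sup>2)) \<partial>M)"
    proof (rule nn_integral_cong_AE, use gH in eventually_elim)
      case (elim x)
      have L: "(\<lambda>j. ennreal ((norm (g j x))\<^sup>2)) \<longlonglongrightarrow> ennreal ((norm (H x))\<^sup>2)"
        by (intro tendsto_ennrealI tendsto_intros elim)
      show ?case by (rule lim_imp_Liminf[OF _ L, symmetric]) simp
    qed
    also have "\<dots> \<le> liminf (\<lambda>j. \<integral>\<^sup>+x. ennreal ((norm (g j x))\<^sup>2) \<partial>M)" by (rule nn_integral_liminf) simp
    also have "\<dots> \<le> liminf (\<lambda>j. ennreal (D + 1 / real (Suc j)))"
    proof (rule Liminf_mono, rule always_eventually, rule allI)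
      fix j
      have "r j \<ge> j" using r(1) by (rule seq_suble)
      then have "1 / real (Suc (r j)) \<le> 1 / real (Suc j)" by (simp add: field_simps)
      then have "q (g j) \<le> D + 1 / real (Suc j)" using f(2)[of "r j"] D(2)[of "r j"] by (simp add: g_def del: of_nat_Suc)
      then show "(\<integral>\<^sup>+x. ennreal ((norm (g j x))\<^sup>2) \<partial>M) \<le> ennreal (D + 1 / real (Suc j))"
        by (subst nn_integral_eq_integral[OF gI]) (auto simp: q_def intro: ennreal_leI)
    qed
    also have "\<dots> = ennreal D"
    proof -
      have "(\<lambda>j. D + 1 / real (Suc j)) \<longlonglongrightarrow> D" by real_asymp
      from tendsto_ennrealI[OF this] show ?thesis by (intro lim_imp_Liminf) simp_all
    qed
    finally have "ennreal (q H) \<le> ennreal D" .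
    moreover have "0 \<le> d 0" unfolding d_def using q0 by (intro cInf_greatest[OF ne]) auto
    then have "0 \<le> D" using D(2)[of 0] by linarith
    ultimately have "q H \<le> D" by simp
    then show "(\<integral>x. (norm (H x))\<^sup>2 \<partial>M) \<le> kappa" using DK0 by (simp add: q_def)
  next
    fix i assume i: "i \<in> I"
    let ?P = "\<lambda>h. \<integral>x. phi i x *\<^sub>R h x \<partial>M"
    have 1: "(\<lambda>k. ?P (g k)) \<longlonglongrightarrow> l i"
    proof (rule LIMSEQ_I)
      fix \<epsilon> :: real assume "\<epsilon> > 0"
      then obtain N where N: "\<And>n. n \<ge> N \<Longrightarrow> norm (?P (G n) - l i) < \<epsilon> / 2"
        using LIMSEQ_D[OF lim[OF i], of "\<epsilon> / 2"] by auto
      show "\<exists>no. \<forall>k\<ge>no. norm (?P (g k) - l i) < \<epsilon>"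
      proof (intro exI[of _ N] allI impI)
        fix k assume k: "N \<le> k"
        have "mid_hull G N (g k)" unfolding g_def using f(1)[of "r k"] order_trans[OF k seq_suble[OF r(1)]] by (rule mid_hull_mono)
        then have "norm (?P (g k) - l i) \<le> \<epsilon> / 2" by (rule hlim[OF _ i]) (use N in \<open>auto intro: less_imp_le\<close>)
        then show "norm (?P (g k) - l i) < \<epsilon>" using \<open>\<epsilon> > 0\<close> by linarith
      qed
    qed
    have 2: "(\<lambda>k. ?P (g k)) \<longlonglongrightarrow> ?P H"
    proof (rule LIM_zero_cancel, rule Lim_null_comparison)
      show "eventually (\<lambda>k. norm (?P (g k) - ?P H) \<le> sqrt ((\<integral>x. (phi i x)\<^sup>2 \<partial>M) * e (r k))) sequentially"
      proof (intro always_eventually allI)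
        fix k
        have "?P (g k) - ?P H = ?P (\<lambda>x. g k x - H x)"
          using phiG[OF gm gI i] phiG[OF Hm HI i] by (simp add: scaleR_diff_right)
        also have "norm \<dots> \<le> sqrt ((\<integral>x. (phi i x)\<^sup>2 \<partial>M) * q (\<lambda>x. g k x - H x))" by (rule phiCS[OF _ dI i]) simp
        also have "\<dots> \<le> sqrt ((\<integral>x. (phi i x)\<^sup>2 \<partial>M) * e (r k))" using dq[of k] by (intro real_sqrt_le_mono mult_left_mono) auto
        finally show "norm (?P (g k) - ?P H) \<le> sqrt ((\<integral>x. (phi i x)\<^sup>2 \<partial>M) * e (r k))" .
      qed
      have "(\<lambda>k. sqrt ((\<integral>x. (phi i x)\<^sup>2 \<partial>M) * e (r k))) \<longlonglongrightarrow> sqrt ((\<integral>x. (phi i x)\<^sup>2 \<partial>M) * 0)"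
        by (intro tendsto_intros er)
      then show "(\<lambda>k. sqrt ((\<integral>x. (phi i x)\<^sup>2 \<partial>M) * e (r k))) \<longlonglongrightarrow> 0" by simp
    qed
    show "?P H = l i" by (rule LIMSEQ_unique[OF 2 1])
  qed
qed

lemma test_fun_L2:
  assumes T: "test_fun phi Dphi"
  shows "integrable lborel (\<lambda>x. (phi x)\<^sup>2)"
proof -
  obtain R M where R: "\<And>x. norm x > R \<Longrightarrow> phi x = 0" "\<And>x. \<bar>phi x\<bar> \<le> M"
    by (rule test_fun_props[OF T]) blast
  note [measurable] = test_fun_integrable(3,4)[OF T]
  have fin: "emeasure lborel (cball (0::R2) R) < \<infinity>" by (rule emeasure_bounded_finite) simp
  show ?thesis
  proof (rule Bochner_Integration.integrable_bound[where f = "\<lambda>x. M\<^sup>2 * indicator (cball 0 R) x"])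
    have "(phi x)\<^sup>2 \<le> M\<^sup>2" for x using R(2)[of x] by (simp add: abs_le_square_iff[symmetric])
    then show "AE x in lborel. norm ((phi x)\<^sup>2) \<le> norm (M\<^sup>2 * indicator (cball 0 R) x)"
      using R(1) by (auto split: split_indicator simp: not_le)
  qed (use fin in \<open>auto intro!: integrable_mult_right integrable_real_indicator\<close>)
qed

text \<open>Lower semicontinuity of the Dirichlet energy. Convergence of u n enters only through
  pairings with \<open>Dphi\<close>, so pointwise convergence with a local dominating function will
  be enough. Test functions are indexed as pairs with their gradients.\<close>

lemma L2_grad_limit:
  fixes u :: "nat \<Rightarrow> R2 \<Rightarrow> real"
  assumes G: "\<And>n. L2_grad (u n) (G n)" and GK: "(\<lambda>n. \<integral>x. (norm (G n x))\<^sup>2 \<partial>lborel) \<longlonglongrightarrow> K0"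
    and lim: "\<And>phi Dphi. test_fun phi Dphi \<Longrightarrow> (\<lambda>n. \<integral>x. u n x *\<^sub>R Dphi x \<partial>lborel) \<longlonglongrightarrow> (\<integral>x. w x *\<^sub>R Dphi x \<partial>lborel)"
  obtains H where "L2_grad w H" "(\<integral>x. (norm (H x))\<^sup>2 \<partial>lborel) \<le> K0"
proof -
  have g: "G n \<in> borel_measurable lborel" "integrable lborel (\<lambda>x. (norm (G n x))\<^sup>2)" for n using G[of n] by (auto simp: L2_grad_def)
  obtain H where H: "H \<in> borel_measurable lborel" "integrable lborel (\<lambda>x. (norm (H x))\<^sup>2)" "(\<integral>x. (norm (H x))\<^sup>2 \<partial>lborel) \<le> K0"
    "\<And>i. i \<in> {p. test_fun (fst p) (snd p)} \<Longrightarrow> (\<integral>x. fst i x *\<^sub>R H x \<partial>lborel) = - (\<integral>x. w x *\<^sub>R snd i x \<partial>lborel)"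
  proof (rule L2_weak_limit[where G = G and M = lborel and K = "\<lambda>n. \<integral>x. (norm (G n x))\<^sup>2 \<partial>lborel" and kappa = K0 and I = "{p. test_fun (fst p) (snd p)}" and phi = fst and l = "\<lambda>i. - (\<integral>x. w x *\<^sub>R snd i x \<partial>lborel)"])
    fix i :: "(R2 \<Rightarrow> real) \<times> (R2 \<Rightarrow> R2)" assume "i \<in> {p. test_fun (fst p) (snd p)}"
    then have i: "test_fun (fst i) (snd i)" by simp
    show "fst i \<in> borel_measurable lborel" "integrable lborel (\<lambda>x. (fst i x)\<^sup>2)"
      using test_fun_integrable(3)[OF i] test_fun_L2[OF i] by auto
    show "(\<lambda>n. \<integral>x. fst i x *\<^sub>R G n x \<partial>lborel) \<longlonglongrightarrow> - (\<integral>x. w x *\<^sub>R snd i x \<partial>lborel)"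
      using tendsto_minus[OF lim[OF i]] L2_grad_test[OF G i] by simp
  qed (use g GK in \<open>auto\<close>)
  have "L2_grad w H" unfolding L2_grad_def weak_grad_def using H by force
  then show ?thesis using H(3) that by auto
qed

text \<open>Avoids a chain rule for the nonsmooth absolute value. Since ||a| - |b|| \<le> |a - b|,
  the difference quotients of |u| are bounded in L^2 by the gradient of u, and a weak limit of them
  is a gradient of |u|. Minimization needs only the inequality of energies.\<close>

lemma L2_grad_abs:
  assumes u[measurable]: "u \<in> borel_measurable borel" and uL: "integrable lborel (\<lambda>x. (u x)\<^sup>2)" and G: "L2_grad u G"
  obtains H where "L2_grad (\<lambda>x. \<bar>u x\<bar>) H" "(\<integral>x. (norm (H x))\<^sup>2 \<partial>lborel) \<le> (\<integral>x. (norm (G x))\<^sup>2 \<partial>lborel)"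
proof -
  have [measurable]: "G \<in> borel_measurable borel" and GI: "integrable lborel (\<lambda>x. (norm (G x))\<^sup>2)" using G by (auto simp: L2_grad_def)
  define w where "w x = \<bar>u x\<bar>" for x
  have [measurable]: "w \<in> borel_measurable borel" unfolding w_def by measurable
  have wL: "integrable lborel (\<lambda>x. (w x)\<^sup>2)" using uL by (simp add: w_def)
  define e where "e n = inverse (real (Suc n))" for n
  have e0: "e n > 0" for n by (simp add: e_def)
  have [measurable]: "cball (0::R2) r \<in> sets borel" for r by simp
  \<comment> \<open>Each component carries its own direction, so the bound on translations applies
    componentwise and adds up to the full energy.\<close>
  define Q where "Q n = (\<lambda>x. \<chi> i. (w (x + e n *\<^sub>R axis i 1) - w x) / e n :: R2)" for n
  have Qi[measurable]: "(\<lambda>x. (w (x + e n *\<^sub>R axis i 1) - w x) / e n) \<in> borel_measurable borel" for n i by measurable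
  have Qm[measurable]: "Q n \<in> borel_measurable borel" for n
  proof -
    have "Q n = (\<lambda>x. ((w (x + e n *\<^sub>R axis 1 1) - w x) / e n) *\<^sub>R axis 1 1 + ((w (x + e n *\<^sub>R axis 2 1) - w x) / e n) *\<^sub>R axis 2 1)"
      by (auto simp: Q_def fun_eq_iff vec_eq_iff forall_2 axis_def)
    then show ?thesis by simp
  qed
  have normR2: "(norm y)\<^sup>2 = (y $ 1)\<^sup>2 + (y $ 2)\<^sup>2" for y :: R2
    unfolding power2_norm_eq_inner by (simp add: inner_vec_def sum_2 power2_eq_square)
  have sI: "integrable lborel (\<lambda>x. (G x $ i)\<^sup>2)" for i
    by (rule Bochner_Integration.integrable_bound[OF GI])
      (auto simp: component_le_norm_cart abs_le_square_iff[symmetric])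
  have Gs: "(\<integral>x. (norm (G x))\<^sup>2 \<partial>lborel) = (\<integral>x. (G x $ 1)\<^sup>2 \<partial>lborel) + (\<integral>x. (G x $ 2)\<^sup>2 \<partial>lborel)"
    using sI by (simp add: normR2)
  have b: "(\<integral>\<^sup>+x. ennreal ((Q n x $ i)\<^sup>2) \<partial>lborel) \<le> ennreal (\<integral>x. (G x $ i)\<^sup>2 \<partial>lborel)" for n i
  proof -
    have "(\<integral>\<^sup>+x. ennreal ((Q n x $ i)\<^sup>2) \<partial>lborel) \<le> (\<integral>\<^sup>+x. ennreal (1 / (e n)\<^sup>2) * ennreal ((u (x + e n *\<^sub>R axis i 1) - u x)\<^sup>2) \<partial>lborel)"
    proof (rule nn_integral_mono)
      fix x
      have "(w (x + e n *\<^sub>R axis i 1) - w x)\<^sup>2 \<le> (u (x + e n *\<^sub>R axis i 1) - u x)\<^sup>2"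
        unfolding abs_le_square_iff[symmetric] w_def by linarith
      then have "(Q n x $ i)\<^sup>2 \<le> (1 / (e n)\<^sup>2) * (u (x + e n *\<^sub>R axis i 1) - u x)\<^sup>2"
        by (simp add: Q_def power_divide divide_right_mono)
      then show "ennreal ((Q n x $ i)\<^sup>2) \<le> ennreal (1 / (e n)\<^sup>2) * ennreal ((u (x + e n *\<^sub>R axis i 1) - u x)\<^sup>2)"
        by (simp flip: ennreal_mult add: ennreal_leI)
    qed
    also have "\<dots> = ennreal (1 / (e n)\<^sup>2) * (\<integral>\<^sup>+x. ennreal ((u (x + e n *\<^sub>R axis i 1) - u x)\<^sup>2) \<partial>lborel)"
      by (rule nn_integral_cmult) measurable
    also have "\<dots> \<le> ennreal (1 / (e n)\<^sup>2) * (\<integral>\<^sup>+x. ennreal ((G x \<bullet> (e n *\<^sub>R axis i 1))\<^sup>2) \<partial>lborel)"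
      by (intro mult_left_mono L2_grad_translate_integral[OF u uL G]) auto
    also have "\<dots> = (\<integral>\<^sup>+x. ennreal (1 / (e n)\<^sup>2) * ennreal ((G x \<bullet> (e n *\<^sub>R axis i 1))\<^sup>2) \<partial>lborel)"
      by (rule nn_integral_cmult[symmetric]) measurable
    also have "\<dots> = (\<integral>\<^sup>+x. ennreal ((G x $ i)\<^sup>2) \<partial>lborel)"
      using e0[of n] by (intro nn_integral_cong) (simp add: inner_axis power_mult_distrib flip: ennreal_mult)
    also have "\<dots> = ennreal (\<integral>x. (G x $ i)\<^sup>2 \<partial>lborel)" by (rule nn_integral_eq_integral[OF sI]) simp
    finally show ?thesis .
  qed
  have Qi2: "integrable lborel (\<lambda>x. (Q n x $ i)\<^sup>2)" for n i
    using b[of n i] by (intro integrableI_nonneg) (auto intro: order_le_less_trans)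
  have Qle: "(\<integral>x. (Q n x $ i)\<^sup>2 \<partial>lborel) \<le> (\<integral>x. (G x $ i)\<^sup>2 \<partial>lborel)" for n i
    using b[of n i] by (subst (asm) nn_integral_eq_integral[OF Qi2]) auto
  have QI: "integrable lborel (\<lambda>x. (norm (Q n x))\<^sup>2)" for n using Qi2[of n] by (simp add: normR2)
  have QK: "(\<integral>x. (norm (Q n x))\<^sup>2 \<partial>lborel) \<le> (\<integral>x. (norm (G x))\<^sup>2 \<partial>lborel)" for n
    unfolding Gs using Qi2[of n] Qle[of n 1] Qle[of n 2] by (simp add: normR2)
  obtain H where H: "H \<in> borel_measurable lborel" "integrable lborel (\<lambda>x. (norm (H x))\<^sup>2)" "(\<integral>x. (norm (H x))\<^sup>2 \<partial>lborel) \<le> (\<integral>x. (norm (G x))\<^sup>2 \<partial>lborel)"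
    "\<And>i. i \<in> {p. test_fun (fst p) (snd p)} \<Longrightarrow> (\<integral>x. fst i x *\<^sub>R H x \<partial>lborel) = - (\<integral>x. w x *\<^sub>R snd i x \<partial>lborel)"
  proof (rule L2_weak_limit[where G = Q and M = lborel and K = "\<lambda>n. \<integral>x. (norm (G x))\<^sup>2 \<partial>lborel" and I = "{p. test_fun (fst p) (snd p)}" and phi = fst and l = "\<lambda>i. - (\<integral>x. w x *\<^sub>R snd i x \<partial>lborel)"])
    fix p :: "(R2 \<Rightarrow> real) \<times> (R2 \<Rightarrow> R2)" assume "p \<in> {p. test_fun (fst p) (snd p)}"
    then have T: "test_fun (fst p) (snd p)" by simp
    obtain phi Dphi where p: "p = (phi, Dphi)" by (cases p)
    have T: "test_fun phi Dphi" using T p by simp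
    note tm[measurable] = test_fun_integrable(3,4)[OF T]
    show "fst p \<in> borel_measurable lborel" "integrable lborel (\<lambda>x. (fst p x)\<^sup>2)" using tm test_fun_L2[OF T] by (auto simp: p)
    obtain R M where R: "R > 0" "\<And>x. norm x > R \<Longrightarrow> phi x = 0" "\<And>x. norm x > R \<Longrightarrow> Dphi x = 0"
      "\<And>x. norm (Dphi x) \<le> M" by (rule test_fun_props[OF T]) blast
    have "(\<lambda>n. \<integral>x. phi x *\<^sub>R Q n x \<partial>lborel) \<longlonglongrightarrow> - (\<integral>x. w x *\<^sub>R Dphi x \<partial>lborel)"
    proof (rule vec_tendstoI)
      fix i
      \<comment> \<open>Discrete integration by parts: the forward quotient of w becomes a backward
        quotient of phi, which converges to minus a partial derivative.\<close>
      have lhs: "(\<integral>x. phi x *\<^sub>R Q n x \<partial>lborel) $ i = (\<integral>x. w x * (real (Suc n) * (phi (x + e n *\<^sub>R (- axis i 1)) - phi x)) \<partial>lborel)" for n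
      proof -
        have pL: "integrable lborel (\<lambda>x. (phi x)\<^sup>2)" by (rule test_fun_L2[OF T])
        have wt: "integrable lborel (\<lambda>x. (w (x + e n *\<^sub>R axis i 1))\<^sup>2)" using integrable_affine_R2[of "\<lambda>x. (w x)\<^sup>2" 1 "e n *\<^sub>R axis i 1"] wL by simp
        have i1: "integrable lborel (\<lambda>x. phi x * w (x + e n *\<^sub>R axis i 1))" "integrable lborel (\<lambda>x. phi x * w x)"
          by (rule integrable_mult_L2; use pL wt wL in simp)+
        have i3: "integrable lborel (\<lambda>x. phi (x - e n *\<^sub>R axis i 1) * w x)" using integrable_affine_R2[of "\<lambda>x. phi (x - e n *\<^sub>R axis i 1) * w x" 1 "e n *\<^sub>R axis i 1"] i1 by simp
        have sh: "(\<integral>x. phi x * w (x + e n *\<^sub>R axis i 1) \<partial>lborel) = (\<integral>x. phi (x - e n *\<^sub>R axis i 1) * w x \<partial>lborel)"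
          using integral_affine_R2[of "\<lambda>x. phi (x - e n *\<^sub>R axis i 1) * w x" 1 "e n *\<^sub>R axis i 1"] by simp
        have "(\<integral>x. phi x *\<^sub>R Q n x \<partial>lborel) $ i = (\<integral>x. phi x *\<^sub>R Q n x \<partial>lborel) \<bullet> axis i 1" by (simp add: inner_axis)
        also have "\<dots> = (\<integral>x. phi x *\<^sub>R Q n x \<bullet> axis i 1 \<partial>lborel)"
          by (rule integral_inner_left[symmetric]) (use test_fun_integrable(1)[OF T _ QI] in auto)
        also have "\<dots> = (\<integral>x. real (Suc n) * (phi x * w (x + e n *\<^sub>R axis i 1) - phi x * w x) \<partial>lborel)"
          by (intro Bochner_Integration.integral_cong) (auto simp: inner_axis Q_def e_def field_simps)
        also have "\<dots> = (\<integral>x. real (Suc n) * (phi (x - e n *\<^sub>R axis i 1) * w x - phi x * w x) \<partial>lborel)"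
          using i1 i3 sh by simp
        also have "\<dots> = (\<integral>x. w x * (real (Suc n) * (phi (x + e n *\<^sub>R (- axis i 1)) - phi x)) \<partial>lborel)"
          by (intro Bochner_Integration.integral_cong) (auto simp: algebra_simps)
        finally show ?thesis .
      qed
      have rhs: "(- (\<integral>x. w x *\<^sub>R Dphi x \<partial>lborel)) $ i = (\<integral>x. w x * (Dphi x \<bullet> (- axis i 1)) \<partial>lborel)"
      proof -
        have "(\<integral>x. w x *\<^sub>R Dphi x \<partial>lborel) \<bullet> (- axis i 1) = (\<integral>x. w x *\<^sub>R Dphi x \<bullet> (- axis i 1) \<partial>lborel)"
          by (rule integral_inner_left[symmetric]) (use test_fun_integrable(2)[OF T _ wL] in auto)
        then show ?thesis by (simp add: inner_axis)
      qed
      have "(\<lambda>n. \<integral>x. w x * (real (Suc n) * (phi (x + e n *\<^sub>R (- axis i 1)) - phi x)) \<partial>lborel) \<longlonglongrightarrow> (\<integral>x. w x * (Dphi x \<bullet> (- axis i 1)) \<partial>lborel)"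
      \<comment> \<open>Steps have length at most 1, so every quotient of phi is supported in the
        ball of radius R + 1 and bounded there by the Lipschitz constant.\<close>
      proof (rule integral_dominated_convergence[where w = "\<lambda>x. M * \<bar>w x\<bar> * indicator (cball 0 (R + 1)) x"])
        show "integrable lborel (\<lambda>x. M * \<bar>w x\<bar> * indicator (cball 0 (R + 1)) x)"
        proof (rule integrable_dominated_L2[where f = w and R = "R + 1" and M = "\<bar>M\<bar>"])
          show "(\<lambda>x. M * \<bar>w x\<bar> * indicator (cball 0 (R + 1)) x) \<in> borel_measurable borel" by measurable
        qed (use wL in \<open>auto simp: abs_mult split: split_indicator\<close>)
        show "AE x in lborel. (\<lambda>n. w x * (real (Suc n) * (phi (x + e n *\<^sub>R (- axis i 1)) - phi x))) \<longlonglongrightarrow> w x * (Dphi x \<bullet> (- axis i 1))"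
          unfolding e_def by (intro AE_I2 tendsto_mult tendsto_const test_fun_diff_quotient[OF T])
        fix n
        have "norm (w x * (real (Suc n) * (phi (x + e n *\<^sub>R (- axis i 1)) - phi x))) \<le> M * \<bar>w x\<bar> * indicator (cball 0 (R + 1)) x" for x
        proof (cases "norm x \<le> R + 1")
          case True
          have "\<bar>phi (x + e n *\<^sub>R (- axis i 1)) - phi x\<bar> \<le> M * norm (e n *\<^sub>R (- axis i 1 :: R2))"
            by (rule test_fun_lipschitz[OF T R(4)])
          also have "\<dots> = M * e n" using e0[of n] by (simp add: norm_axis_1)
          finally have "\<bar>w x\<bar> * (real (Suc n) * \<bar>phi (x + e n *\<^sub>R (- axis i 1)) - phi x\<bar>) \<le> \<bar>w x\<bar> * (real (Suc n) * (M * e n))"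
            by (intro mult_left_mono) auto
          also have "\<dots> = M * \<bar>w x\<bar>" by (simp add: e_def)
          finally show ?thesis using True by (simp add: abs_mult del: of_nat_Suc)
        next
          case False
          have "norm (e n *\<^sub>R (- axis i 1 :: R2)) \<le> 1" by (simp add: norm_axis_1 e_def field_simps)
          then have "norm (x + e n *\<^sub>R (- axis i 1)) > R"
            using False norm_triangle_ineq4[of "x + e n *\<^sub>R (- axis i 1)" "e n *\<^sub>R (- axis i 1)"] by auto
          moreover have "norm x > R" using False by linarith
          ultimately show ?thesis using R(2) False by simp
        qed
        then show "AE x in lborel. norm (w x * (real (Suc n) * (phi (x + e n *\<^sub>R (- axis i 1)) - phi x))) \<le> M * \<bar>w x\<bar> * indicator (cball 0 (R + 1)) x" by auto
      qed auto
      then show "(\<lambda>n. (\<integral>x. phi x *\<^sub>R Q n x \<partial>lborel) $ i) \<longlonglongrightarrow> (- (\<integral>x. w x *\<^sub>R Dphi x \<partial>lborel)) $ i"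
        unfolding lhs rhs .
    qed
    then show "(\<lambda>n. \<integral>x. fst p x *\<^sub>R Q n x \<partial>lborel) \<longlonglongrightarrow> - (\<integral>x. w x *\<^sub>R snd p x \<partial>lborel)" by (simp add: p)
  qed (use QI QK in auto)
  have "L2_grad w H" unfolding L2_grad_def weak_grad_def using H by force
  then show ?thesis using that H(3) unfolding w_def by auto
qed

subsection \<open>Radial representatives\<close>

text \<open>The du Bois-Reymond lemma on the open half-line. Supports stay away from 0 because k is
  integrable only on intervals bounded away from it.\<close>

lemma AE_const_if_mean_zero_orthogonal:
  fixes k :: "real \<Rightarrow> real"
  assumes k[measurable]: "k \<in> borel_measurable borel"
    and I: "\<And>a b. 0 < a \<Longrightarrow> integrable lborel (\<lambda>x. indicator {a..b} x * k x)"
    and orth: "\<And>phi a b. continuous_on UNIV phi \<Longrightarrow> 0 < a \<Longrightarrow> a < b \<Longrightarrow> (\<And>x. x \<notin> {a..b} \<Longrightarrow> phi x = 0) \<Longrightarrow>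
       (\<integral>x. phi x \<partial>lborel) = 0 \<Longrightarrow> (\<integral>x. phi x * k x \<partial>lborel) = 0"
  obtains c where "AE x in lborel. x > 0 \<longrightarrow> k x = c"
proof -
  \<comment> \<open>A fixed tent of positive mass J; subtracting a multiple of it makes any other
    function mean-zero. The constant c is the mean of k with respect to the tent.\<close>
  define th where "th x = max 0 (1 - \<bar>x - 2\<bar>)" for x :: real
  have cth: "continuous_on UNIV th" unfolding th_def by (intro continuous_intros)
  have th0: "th x = 0" if "x \<notin> {1..3}" for x using that by (auto simp: th_def max_def abs_if)
  have cint: "integrable lborel phi" and cintk: "integrable lborel (\<lambda>x. phi x * k x)"
    if c: "continuous_on UNIV phi" and a: "0 < a" and z: "\<And>x. x \<notin> {a..b} \<Longrightarrow> phi x = 0" for phi :: "real \<Rightarrow> real" and a b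
  proof -
    have e: "phi x = indicator {a..b} x * phi x" for x using z[of x] by (auto split: split_indicator)
    have "integrable lborel (\<lambda>x. indicator {a..b} x *\<^sub>R phi x)" by (rule borel_integrable_compact) (auto intro: continuous_on_subset[OF c])
    then show "integrable lborel phi" using e by simp
    have [measurable]: "phi \<in> borel_measurable borel" using c by (rule borel_measurable_continuous_onI)
    have "bounded (phi ` {a..b})" using compact_continuous_image[OF continuous_on_subset[OF c], of "{a..b}"] by (auto intro: compact_imp_bounded)
    then obtain B where "\<forall>x\<in>{a..b}. norm (phi x) \<le> B" unfolding bounded_iff by blast
    then have B: "\<bar>phi x\<bar> \<le> B" if "x \<in> {a..b}" for x using that by auto
    show "integrable lborel (\<lambda>x. phi x * k x)"
    proof (rule Bochner_Integration.integrable_bound[OF integrable_mult_right[OF integrable_abs[OF I[OF a, of b]], of B]])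
      have "\<bar>phi x * k x\<bar> \<le> \<bar>B * \<bar>indicator {a..b} x * k x\<bar>\<bar>" for x
      proof (cases "x \<in> {a..b}")
        case True
        then have "\<bar>phi x\<bar> * \<bar>k x\<bar> \<le> B * \<bar>k x\<bar>" using B[of x] by (intro mult_right_mono) auto
        then show ?thesis using True abs_ge_self[of "B * \<bar>k x\<bar>"] by (simp add: abs_mult)
      qed (simp add: z)
      then show "AE x in lborel. norm (phi x * k x) \<le> norm (B * \<bar>indicator {a..b} x * k x\<bar>)" by simp
    qed simp
  qed
  have thI: "integrable lborel th" and thkI: "integrable lborel (\<lambda>x. th x * k x)"
    by (rule cint[of th 1 3] cintk[of th 1 3]; use cth th0 in simp)+
  define J where "J = (\<integral>x. th x \<partial>lborel)"
  have "J > 0"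
  proof -
    have "(\<integral>x. (1/2) * indicator {3/2..5/2::real} x \<partial>lborel) \<le> J"
      unfolding J_def
    proof (rule integral_mono)
      show "integrable lborel th" by (rule thI)
      show "(1/2) * indicator {3/2..5/2::real} x \<le> th x" for x by (auto simp: th_def abs_if split: split_indicator)
    qed auto
    then show ?thesis by simp
  qed
  define c where "c = (\<integral>x. th x * k x \<partial>lborel) / J"
  have z: "(\<integral>x. phi x * (k x - c) \<partial>lborel) = 0"
    if cp: "continuous_on UNIV phi" and a: "0 < a" "a < b" and z: "\<And>x. x \<notin> {a..b} \<Longrightarrow> phi x = 0" for phi a b
  proof -
    define m where "m = (\<integral>x. phi x \<partial>lborel) / J"
    define psi where "psi x = phi x - m * th x" for x
    have "(\<integral>x. psi x * k x \<partial>lborel) = 0"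
    proof (rule orth[of psi "min a 1" "max b 3"])
      show "continuous_on UNIV psi" unfolding psi_def by (intro continuous_intros cp cth)
      show "(\<integral>x. psi x \<partial>lborel) = 0" unfolding psi_def
        using cint[OF cp a(1) z] thI \<open>J > 0\<close> by (simp add: m_def J_def[symmetric])
      show "psi x = 0" if "x \<notin> {min a 1..max b 3}" for x
      proof -
        have "x \<notin> {a..b}" "x \<notin> {1..3}" using that by auto
        then show ?thesis using z[of x] th0[of x] by (simp add: psi_def)
      qed
    qed (use a in auto)
    then have "(\<integral>x. phi x * k x \<partial>lborel) = m * (\<integral>x. th x * k x \<partial>lborel)"
      unfolding psi_def using cintk[OF cp a(1) z] thkI by (simp add: left_diff_distrib mult.assoc)
    also have "\<dots> = c * (\<integral>x. phi x \<partial>lborel)" by (simp add: m_def c_def)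
    finally show ?thesis using cintk[OF cp a(1) z] cint[OF cp a(1) z] by (simp add: right_diff_distrib mult.commute)
  qed
  have box0: "(\<integral>x. indicator {a<..<b} x * (k x - c) \<partial>lborel) = 0" if a: "0 < a" "a < b" for a b
  proof -
    define w where "w x = max 0 ((x - a) * (b - x))" for x
    have w0: "w x \<ge> 0" for x by (simp add: w_def)
    have wz: "w x = 0" if "x \<notin> {a<..<b}" for x
    proof -
      have "(x - a) * (b - x) \<le> 0"
        using that a by (cases "x \<le> a") (auto intro: mult_nonpos_nonneg mult_nonneg_nonpos)
      then show ?thesis by (simp add: w_def)
    qed
    have wp: "w x > 0" if "x \<in> {a<..<b}" for x using that by (auto simp: w_def)
    define phi where "phi n x = 1 - 1 / (1 + real n * w x)" for n x
    have pos: "1 + real n * w x > 0" for n x using mult_nonneg_nonneg[OF of_nat_0_le_iff w0[of x], of n] by linarith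
    have cphi: "continuous_on UNIV (phi n)" for n
      unfolding phi_def w_def using pos[unfolded w_def] by (intro continuous_intros) (auto simp: less_imp_neq[symmetric])
    have phib: "0 \<le> phi n x \<and> phi n x \<le> indicator {a<..<b} x" for n x
      using wz[of x] w0[of x] pos[of n x] by (cases "x \<in> {a<..<b}") (auto simp: phi_def divide_simps)
    have [measurable]: "phi n \<in> borel_measurable borel" for n using cphi by (rule borel_measurable_continuous_onI)
    have kI: "integrable lborel (\<lambda>x. indicator {a<..<b} x * (k x - c))"
    proof -
      have "integrable lborel (\<lambda>x. indicator {a<..<b} x *\<^sub>R (indicator {a..b} x * k x - c * indicator {a..b} x))"
        using I[OF a(1), of b] emeasure_compact_finite[of "{a..b}"] by (intro integrable_mult_indicator Bochner_Integration.integrable_diff integrable_mult_right integrable_real_indicator) auto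
      then show ?thesis by (rule Bochner_Integration.integrable_cong[THEN iffD1, rotated 2]) (auto split: split_indicator)
    qed
    have "(\<lambda>n. \<integral>x. phi n x * (k x - c) \<partial>lborel) \<longlonglongrightarrow> (\<integral>x. indicator {a<..<b} x * (k x - c) \<partial>lborel)"
    proof (rule integral_dominated_convergence[OF _ _ integrable_abs[OF kI]])
      show "AE x in lborel. (\<lambda>n. phi n x * (k x - c)) \<longlonglongrightarrow> indicator {a<..<b} x * (k x - c)"
      proof (intro AE_I2 tendsto_mult tendsto_const)
        fix x
        show "(\<lambda>n. phi n x) \<longlonglongrightarrow> indicator {a<..<b} x"
        proof (cases "x \<in> {a<..<b}")
          case True
          then have "(\<lambda>n. 1 - 1 / (1 + real n * w x)) \<longlonglongrightarrow> 1" using wp[of x] by real_asymp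
          then show ?thesis using True by (simp add: phi_def)
        qed (simp add: phi_def wz)
      qed
      show "AE x in lborel. norm (phi n x * (k x - c)) \<le> \<bar>indicator {a<..<b} x * (k x - c)\<bar>" for n
        using phib[of n] by (auto simp: abs_mult intro!: mult_right_mono)
    qed auto
    moreover have "(\<integral>x. phi n x * (k x - c) \<partial>lborel) = 0" for n
      using a by (intro z[OF cphi, of a b]) (auto simp: phi_def wz)
    ultimately show ?thesis by (simp add: LIMSEQ_const_iff)
  qed
  have "AE x in lborel. indicator {d<..} x * (k x - c) = 0" if d: "d > 0" for d
  proof (rule AE_zero_if_integral_box_zero)
    fix a b :: real
    have e: "indicator (box a b) x *\<^sub>R (indicator {d<..} x * (k x - c)) = indicator {max a d<..<b} x * (k x - c)" for x
      by (auto simp: box_real split: split_indicator)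
    show "(\<integral>x. indicator (box a b) x *\<^sub>R (indicator {d<..} x * (k x - c)) \<partial>lborel) = 0"
      unfolding e using box0[of "max a d" b] d by (cases "max a d < b") auto
    have "integrable lborel (\<lambda>x. indicator {max a d<..<b} x *\<^sub>R (indicator {max a d..b} x * k x - c * indicator {max a d..b} x))"
      using I[of "max a d" b] d emeasure_compact_finite[of "{max a d..b}"] by (intro integrable_mult_indicator Bochner_Integration.integrable_diff integrable_mult_right integrable_real_indicator) auto
    then show "integrable lborel (\<lambda>x. indicator (box a b) x *\<^sub>R (indicator {d<..} x * (k x - c)))"
      unfolding e by (rule Bochner_Integration.integrable_cong[THEN iffD1, rotated 2]) (auto split: split_indicator)
  qed
  then have "AE x in lborel. \<forall>n. indicator {inverse (real (Suc n))<..} x * (k x - c) = 0"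
    by (subst AE_all_countable) simp
  then have "AE x in lborel. x > 0 \<longrightarrow> k x = c"
  proof (rule eventually_mono, intro impI)
    fix x :: real assume H: "\<forall>n. indicator {inverse (real (Suc n))<..} x * (k x - c) = 0" and "x > 0"
    then obtain n where "inverse (real (Suc n)) < x" using reals_Archimedean by blast
    then show "k x = c" using H[rule_format, of n] by simp
  qed
  then show ?thesis by (rule that)
qed

text \<open>The source of the logarithm in the radial estimates: in the area variable the integral
  is that of pi/r from a^2 to b^2.\<close>

lemma integral_annulus_inverse_square:
  assumes "0 < a" "a \<le> b"
  shows "has_bochner_integral lborel (\<lambda>x::R2. indicator {x. a < norm x \<and> norm x \<le> b} x / (norm x)\<^sup>2) (2 * pi * ln (b / a))"
proof -
  let ?f = "\<lambda>r::real. indicator {a\<^sup>2<..b\<^sup>2} r / r"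
  have e: "indicator {x. a < norm x \<and> norm x \<le> b} x / (norm x)\<^sup>2 = ?f ((norm x)\<^sup>2)" for x :: R2
  proof -
    have "a < norm x \<longleftrightarrow> a\<^sup>2 < (norm x)\<^sup>2" "norm x \<le> b \<longleftrightarrow> (norm x)\<^sup>2 \<le> b\<^sup>2"
      using assms power_mono_iff[of "norm x" a 2] by (auto simp: power_mono_iff simp flip: not_le)
    then show ?thesis by (auto split: split_indicator)
  qed
  have F: "has_bochner_integral lborel (\<lambda>r. 1 / r * indicator {a\<^sup>2..b\<^sup>2} r) (ln (b\<^sup>2) - ln (a\<^sup>2))"
  proof (rule has_bochner_integral_FTC_Icc_real)
    show "a\<^sup>2 \<le> b\<^sup>2" using assms by (intro power_mono) auto
    fix r :: real assume "a\<^sup>2 \<le> r"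
    then have "r > 0" using assms zero_less_power[of a 2] by linarith
    then show "(ln has_real_derivative 1 / r) (at r)" "isCont (\<lambda>r. 1 / r) r" by (auto intro!: derivative_eq_intros continuous_intros)
  qed
  have ae: "AE r in lborel. (pi * indicator {0<..} r) * ?f r = pi * (1 / r * indicator {a\<^sup>2..b\<^sup>2} r)"
    using AE_lborel_singleton[of "a\<^sup>2"]
  proof eventually_elim
    case (elim r)
    have "a\<^sup>2 > 0" using assms by simp
    then have "r > 0 \<or> r < a\<^sup>2" by linarith
    then show ?case using elim by (auto split: split_indicator)
  qed
  have "has_bochner_integral lborel (\<lambda>r. (pi * indicator {0<..} r) * ?f r) (pi * (ln (b\<^sup>2) - ln (a\<^sup>2)))"
    by (rule has_bochner_integral_cong_AE[THEN iffD2, OF _ _ ae has_bochner_integral_mult_right[OF F]]) auto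
  moreover have "pi * (ln (b\<^sup>2) - ln (a\<^sup>2)) = 2 * pi * ln (b / a)" using assms by (simp add: ln_div ln_realpow algebra_simps)
  ultimately show ?thesis
    unfolding e has_bochner_integral_iff using integral_norm_square_R2[of ?f] by simp
qed

lemma measurable_profile:
  assumes [measurable]: "u \<in> borel_measurable borel"
  shows "profile u \<in> borel_measurable borel"
  unfolding profile_def by measurable

lemma radial_profile_norm:
  assumes "radial u" shows "u x = profile u (norm x)"
  unfolding profile_def by (rule assms[unfolded radial_def, rule_format]) simp

text \<open>Testing the weak gradient with the fields \<open>q(\<bar>x\<bar>\<^sup>2) x / (2 \<bar>x\<bar>\<^sup>2)\<close>, whose divergence
  is \<open>q'(\<bar>x\<bar>\<^sup>2)\<close>.\<close>
lemma weak_grad_radial_test: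
  assumes u[measurable]: "u \<in> borel_measurable borel" and uL: "integrable lborel (\<lambda>x. (u x)\<^sup>2)" and G: "L2_grad u G"
    and q: "\<And>r. (q has_real_derivative q' r) (at r)" and cq': "continuous_on UNIV q'"
    and a: "0 < a" "a < b" and z: "\<And>r. r < a \<Longrightarrow> q r = 0" "\<And>r. r > b \<Longrightarrow> q r = 0" "\<And>r. r < a \<Longrightarrow> q' r = 0"
  shows "(\<integral>x. u x * q' ((norm x)\<^sup>2) \<partial>lborel) = - (\<integral>x. q ((norm x)\<^sup>2) / (2 * (norm x)\<^sup>2) * (x \<bullet> G x) \<partial>lborel)"
proof -
  have [measurable]: "G \<in> borel_measurable borel" and GI: "integrable lborel (\<lambda>x. (norm (G x))\<^sup>2)" using G by (auto simp: L2_grad_def)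
  \<comment> \<open>The field k(|x|^2) x has divergence 2 r k'(r) + 2 k(r) at r = |x|^2, and this
    choice of k turns it into q'(r).\<close>
  define k where "k r = q r / (2 * r)" for r
  define k' where "k' r = q' r / (2 * r) - q r / (2 * r\<^sup>2)" for r
  have k: "(k has_real_derivative k' r) (at r)" for r
  proof (cases "r < a")
    case True
    have "((\<lambda>r. 0) has_real_derivative k' r) (at r)" using True z by (auto simp: k'_def)
    then show ?thesis
      by (rule has_field_derivative_transform_within_open[where S = "{..<a}"]) (use True z in \<open>auto simp: k_def\<close>)
  next
    case False
    then have "r \<noteq> 0" using a by auto
    then show ?thesis unfolding k_def k'_def
      by (auto intro!: derivative_eq_intros q simp: field_simps power2_eq_square)
  qed
  have ck': "continuous_on UNIV k'"
  proof -
    have cq: "continuous_on UNIV q" using q by (auto intro!: continuous_at_imp_continuous_on DERIV_isCont)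
    have "continuous_on {..<a} k'" using z by (subst continuous_on_cong[OF refl, of _ _ "\<lambda>_. 0"]) (auto simp: k'_def)
    moreover have "continuous_on {0<..} k'" unfolding k'_def
      by (intro continuous_intros continuous_on_subset[OF cq] continuous_on_subset[OF cq']) auto
    ultimately have "continuous_on ({..<a} \<union> {0<..}) k'" by (intro continuous_on_open_Un) auto
    moreover have "{..<a} \<union> {0<..} = UNIV" using a by auto
    ultimately show ?thesis by simp
  qed
  have ck: "continuous_on UNIV k" using k by (auto intro!: continuous_at_imp_continuous_on DERIV_isCont)
  \<comment> \<open>Both components of the field are test functions, since q vanishes near 0 and
    beyond b. The weak gradient identity is used for each and the diagonal derivatives are
    added.\<close>
  define P where "P i x = k ((norm x)\<^sup>2) * x $ i" for i :: 2 and x :: R2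
  define DP where "DP i x = (2 * k' ((norm x)\<^sup>2) * x $ i) *\<^sub>R x + k ((norm x)\<^sup>2) *\<^sub>R axis i 1" for i :: 2 and x :: R2
  have T: "test_fun (P i) (DP i)" for i
    unfolding test_fun_def
  proof (intro conjI allI)
    fix x :: R2
    have n: "((\<lambda>x::R2. (norm x)\<^sup>2) has_derivative (\<lambda>h. 2 * (x \<bullet> h))) (at x)"
      unfolding power2_norm_eq_inner by (auto intro!: derivative_eq_intros simp: inner_commute)
    have kn: "((\<lambda>x::R2. k ((norm x)\<^sup>2)) has_derivative (\<lambda>h. k' ((norm x)\<^sup>2) * (2 * (x \<bullet> h)))) (at x)"
      using has_derivative_compose[OF n k[of "(norm x)\<^sup>2", unfolded has_field_derivative_def]] by simp
    show "(P i has_derivative (\<bullet>) (DP i x)) (at x)"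
      unfolding P_def DP_def
      by (rule has_derivative_eq_rhs[OF has_derivative_mult[OF kn bounded_linear_imp_has_derivative[OF bounded_linear_vec_nth]]])
        (auto simp: inner_add_left inner_axis' algebra_simps)
  next
    have "continuous_on UNIV (\<lambda>x::R2. k ((norm x)\<^sup>2))" "continuous_on UNIV (\<lambda>x::R2. k' ((norm x)\<^sup>2))"
      by (intro continuous_on_compose2[OF ck] continuous_on_compose2[OF ck'] continuous_intros; simp)+
    then show "continuous_on UNIV (DP i)" unfolding DP_def by (intro continuous_intros)
    have "P i x = 0" if "norm x > sqrt b" for x
    proof -
      have "(sqrt b)\<^sup>2 < (norm x)\<^sup>2" using that a by (intro power_strict_mono) auto
      then have "(norm x)\<^sup>2 > b" using a by simp
      then show ?thesis using z by (simp add: P_def k_def)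
    qed
    then have "{x. P i x \<noteq> 0} \<subseteq> cball 0 (sqrt b)" by (force simp: not_le)
    then show "compact (closure {x. P i x \<noteq> 0})" by (meson bounded_cball bounded_subset compact_closure)
  qed
  have comp: "(\<integral>x. u x * (DP i x $ i) \<partial>lborel) = - (\<integral>x. P i x * (G x $ i) \<partial>lborel)"
    and i1: "integrable lborel (\<lambda>x. u x * (DP i x $ i))" and i2: "integrable lborel (\<lambda>x. P i x * (G x $ i))" for i
  proof -
    note J = test_fun_integrable(2)[OF T[of i] u uL] test_fun_integrable(1)[OF T[of i] _ GI]
    show "integrable lborel (\<lambda>x. u x * (DP i x $ i))" using integrable_inner_left[OF J(1), of "axis i 1"] by (simp add: inner_axis)
    show "integrable lborel (\<lambda>x. P i x * (G x $ i))" using integrable_inner_left[OF J(2), of "axis i 1"] by (simp add: inner_axis)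
    have A: "(\<integral>x. u x *\<^sub>R DP i x \<bullet> axis i 1 \<partial>lborel) = (\<integral>x. u x *\<^sub>R DP i x \<partial>lborel) \<bullet> axis i 1"
      "(\<integral>x. P i x *\<^sub>R G x \<bullet> axis i 1 \<partial>lborel) = (\<integral>x. P i x *\<^sub>R G x \<partial>lborel) \<bullet> axis i 1"
      by (rule integral_inner_left; use J in simp)+
    have "(\<integral>x. u x *\<^sub>R DP i x \<partial>lborel) \<bullet> axis i 1 = (- (\<integral>x. P i x *\<^sub>R G x \<partial>lborel)) \<bullet> axis i 1"
      using L2_grad_test[OF G T] by simp
    then show "(\<integral>x. u x * (DP i x $ i) \<partial>lborel) = - (\<integral>x. P i x * (G x $ i) \<partial>lborel)"
      using A by (simp add: inner_axis)
  qed
  have n2: "(norm x)\<^sup>2 = x $ 1 * x $ 1 + x $ 2 * x $ 2" for x :: R2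
    unfolding power2_norm_eq_inner by (simp add: inner_vec_def sum_2)
  have div: "DP 1 x $ 1 + DP 2 x $ 2 = q' ((norm x)\<^sup>2)" for x
  proof -
    have "DP 1 x $ 1 + DP 2 x $ 2 = 2 * k' ((norm x)\<^sup>2) * (x $ 1 * x $ 1 + x $ 2 * x $ 2) + 2 * k ((norm x)\<^sup>2)"
      by (simp add: DP_def axis_def algebra_simps)
    also have "\<dots> = 2 * k' ((norm x)\<^sup>2) * (norm x)\<^sup>2 + 2 * k ((norm x)\<^sup>2)" by (simp only: n2)
    also have "\<dots> = q' ((norm x)\<^sup>2)"
    proof (cases "(norm x)\<^sup>2 = 0")
      case True
      then show ?thesis using z a by (simp add: k_def k'_def)
    next
      case False
      then show ?thesis by (simp add: k_def k'_def field_simps power2_eq_square)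
    qed
    finally show ?thesis .
  qed
  have "(\<integral>x. u x * q' ((norm x)\<^sup>2) \<partial>lborel) = (\<integral>x. u x * (DP 1 x $ 1) + u x * (DP 2 x $ 2) \<partial>lborel)"
    by (simp flip: div add: distrib_left)
  also have "\<dots> = - (\<integral>x. P 1 x * (G x $ 1) + P 2 x * (G x $ 2) \<partial>lborel)"
    using i1 i2 comp by simp
  also have "(\<lambda>x. P 1 x * (G x $ 1) + P 2 x * (G x $ 2)) = (\<lambda>x. q ((norm x)\<^sup>2) / (2 * (norm x)\<^sup>2) * (x \<bullet> G x))"
    by (auto simp: P_def k_def inner_vec_def sum_2 algebra_simps)
  finally show ?thesis .
qed

text \<open>To the right of the support the primitive equals the full integral, so a mean-zero phi
  has a compactly supported primitive. This is why the du Bois-Reymond form of the argument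
  fits.\<close>

lemma has_derivative_integral_atMost:
  fixes phi :: "real \<Rightarrow> real"
  assumes c: "continuous_on UNIV phi" and z: "\<And>x. x \<notin> {a..b} \<Longrightarrow> phi x = 0"
  shows "((\<lambda>y. \<integral>s. indicator {..y} s * phi s \<partial>lborel) has_real_derivative phi y) (at y)"
    and "y < a \<Longrightarrow> (\<integral>s. indicator {..y} s * phi s \<partial>lborel) = 0"
    and "y > b \<Longrightarrow> (\<integral>s. indicator {..y} s * phi s \<partial>lborel) = (\<integral>s. phi s \<partial>lborel)"
proof -
  let ?q = "\<lambda>y. \<integral>s. indicator {..y} s * phi s \<partial>lborel"
  have "?q y = 0" if "y < a" for y
  proof -
    have "?q y = (\<integral>s. 0 \<partial>(lborel :: real measure))"
      using that z by (intro Bochner_Integration.integral_cong refl) (auto split: split_indicator)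
    then show ?thesis by simp
  qed
  then show "y < a \<Longrightarrow> ?q y = 0" by simp
  have "?q y = (\<integral>s. phi s \<partial>lborel)" if "y > b" for y
    using that z by (intro Bochner_Integration.integral_cong refl) (auto split: split_indicator)
  then show "y > b \<Longrightarrow> ?q y = (\<integral>s. phi s \<partial>lborel)" by simp
  define L where "L = min (a - 1) (y - 1)"
  define U where "U = y + 1"
  have qi: "?q t = integral {L..t} phi" if "t \<in> {L..U}" for t
  proof -
    have "?q t = (\<integral>s. indicator {L..t} s *\<^sub>R phi s \<partial>lborel)"
    proof (intro Bochner_Integration.integral_cong refl)
      fix s show "indicator {..t} s * phi s = indicator {L..t} s *\<^sub>R phi s"
      proof -
        have "L \<le> a - 1" by (simp add: L_def)
        then have "phi s = 0" if "s < L" using that by (intro z) auto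
        then show ?thesis by (auto split: split_indicator)
      qed
    qed
    also have "\<dots> = integral {L..t} phi"
      using set_borel_integral_eq_integral(2)[OF borel_integrable_atLeastAtMost'[OF continuous_on_subset[OF c]], of L t]
      by (simp add: set_lebesgue_integral_def)
    finally show ?thesis .
  qed
  have "((\<lambda>t. integral {L..t} phi) has_real_derivative phi y) (at y within {L..U})"
    by (rule integral_has_real_derivative) (auto simp: L_def U_def intro: continuous_on_subset[OF c])
  then have "(?q has_real_derivative phi y) (at y within {L..U})"
    by (rule has_field_derivative_transform_within[where d = 1]) (auto simp: L_def U_def qi)
  moreover have "at y within {L..U} = at y" by (rule at_within_Icc_at) (auto simp: L_def U_def)
  ultimately show "(?q has_real_derivative phi y) (at y)" by simp
qed

lemma AE_norm_square_R2:
  assumes P[measurable]: "Measurable.pred borel P" and AE: "AE r in lborel. r > 0 \<longrightarrow> P (r::real)"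
  shows "AE x in lborel. P ((norm (x::R2))\<^sup>2)"
proof -
  have "AE r in density lborel (\<lambda>r. ennreal (pi * indicator {0<..} r)). P r"
    by (subst AE_density) (use AE in \<open>auto split: split_indicator_asm elim!: eventually_mono\<close>)
  then have "AE r in distr lborel borel (\<lambda>x::R2. (norm x)\<^sup>2). P r" by (simp only: distr_norm_square_R2)
  then show ?thesis by (subst (asm) AE_distr_iff) auto
qed

text \<open>The representative f has increments f(b) - f(a) equal to 1/(2 pi) times the integral of
  P = x . G / |x|^2 over the annulus. Cauchy-Schwarz against 1/|x| gives the logarithm. That u is
  such a function up to a constant follows from the weak gradient identity for radial fields and the
  du Bois-Reymond lemma. The energy is kept local to the ball of radius b, so that small balls can
  later contribute arbitrarily little.\<close>

lemma radial_representation: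
  assumes u[measurable]: "u \<in> borel_measurable borel" and uL: "integrable lborel (\<lambda>x. (u x)\<^sup>2)" and G: "L2_grad u G"
    and rad: "radial u"
  obtains f :: "real \<Rightarrow> real" where "AE x in lborel. u x = f (norm x)" "f \<in> borel_measurable borel"
    "\<And>a b. 0 < a \<Longrightarrow> a \<le> b \<Longrightarrow> (f b - f a)\<^sup>2 \<le> ln (b / a) / (2 * pi) * (\<integral>x. indicator (cball 0 b) x * (norm (G x))\<^sup>2 \<partial>lborel)"
proof -
  have [measurable]: "G \<in> borel_measurable borel" and GI: "integrable lborel (\<lambda>x. (norm (G x))\<^sup>2)" using G by (auto simp: L2_grad_def)
  note [measurable] = measurable_profile[OF u]
  have [measurable]: "cball (0::R2) r \<in> sets borel" for r by simp
  \<comment> \<open>The profile in the area variable r = |x|^2.\<close>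
  define p where "p r = profile u (sqrt r)" for r
  have pm[measurable]: "p \<in> borel_measurable borel" unfolding p_def by measurable
  have up: "u x = p ((norm x)\<^sup>2)" for x using radial_profile_norm[OF rad, of x] by (simp add: p_def)
  define P where "P x = (x \<bullet> G x) / (norm x)\<^sup>2" for x :: R2
  have [measurable]: "P \<in> borel_measurable borel" unfolding P_def by measurable
  have Ple: "\<bar>P x\<bar> \<le> norm (G x) / norm x" for x
    using Cauchy_Schwarz_ineq2[of x "G x"] by (cases "x = 0") (auto simp: P_def divide_simps power2_eq_square mult_ac)
  have PI: "integrable lborel (\<lambda>x. indicator {x. a < (norm x)\<^sup>2 \<and> (norm x)\<^sup>2 \<le> b} x * P x)" if a: "0 < a" for a b
  proof (rule integrable_dominated_L2[OF _ GI, where R = "sqrt b" and M = "1 / sqrt a"])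
    show "(\<lambda>x. indicator {x. a < (norm x)\<^sup>2 \<and> (norm x)\<^sup>2 \<le> b} x * P x) \<in> borel_measurable borel" by measurable
    fix x :: R2
    show "norm (indicator {x. a < (norm x)\<^sup>2 \<and> (norm x)\<^sup>2 \<le> b} x * P x) \<le> 1 / sqrt a * norm (G x)"
    proof (cases "a < (norm x)\<^sup>2 \<and> (norm x)\<^sup>2 \<le> b")
      case True
      then have "sqrt a \<le> norm x" by (intro real_le_lsqrt) auto
      then have "norm (G x) / norm x \<le> norm (G x) / sqrt a" using a by (intro divide_left_mono mult_pos_pos) (auto intro: less_le_trans[of 0 "sqrt a"])
      then show ?thesis using Ple[of x] True by simp
    qed (use a in auto)
    assume "norm x > sqrt b"
    then have "\<not> (norm x)\<^sup>2 \<le> b" by (metis linorder_not_le norm_ge_zero real_le_rsqrt)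
    then show "indicator {x. a < (norm x)\<^sup>2 \<and> (norm x)\<^sup>2 \<le> b} x * P x = 0" by auto
  qed
  define S where "S y s = (indicator {1<..s} y - indicator {s<..1} y :: real)" for y s :: real
  define F where "F s = (\<integral>x. S ((norm x)\<^sup>2) s * P x \<partial>lborel)" for s
  have S_alt: "S y s = (if 1 < y \<and> y \<le> s then 1 else if s < y \<and> y \<le> 1 then -1 else 0)" for y s
    by (auto simp: S_def split: split_indicator)
  have Sm[measurable]: "(\<lambda>x. S (f x) (g x)) \<in> borel_measurable M" if [measurable]: "f \<in> borel_measurable M" "g \<in> borel_measurable M" for f g and M :: "'z measure"
    unfolding S_alt by measurable
  have Fm[measurable]: "F \<in> borel_measurable borel" unfolding F_def by measurable
  have FI: "integrable lborel (\<lambda>x. S ((norm x)\<^sup>2) s * P x)" if s: "0 < s" for s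
  proof (rule Bochner_Integration.integrable_bound[OF PI[of "min (1/2) (s/2)" "max 1 s"]])
    show "AE x in lborel. norm (S ((norm x)\<^sup>2) s * P x) \<le> norm (indicator {x. min (1/2) (s/2) < (norm x)\<^sup>2 \<and> (norm x)\<^sup>2 \<le> max 1 s} x * P x)"
      using s by (intro AE_I2) (auto simp: S_alt abs_mult split: split_indicator)
  qed (use s in auto)
  have Fdiff: "F s - F r = (\<integral>x. indicator {x. r < (norm x)\<^sup>2 \<and> (norm x)\<^sup>2 \<le> s} x * P x \<partial>lborel)" if r: "0 < r" "r \<le> s" for r s
  proof -
    have "F s - F r = (\<integral>x. S ((norm x)\<^sup>2) s * P x - S ((norm x)\<^sup>2) r * P x \<partial>lborel)"
      unfolding F_def using FI[of r] FI[of s] r by simp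
    also have "\<dots> = (\<integral>x. indicator {x. r < (norm x)\<^sup>2 \<and> (norm x)\<^sup>2 \<le> s} x * P x \<partial>lborel)"
      using r by (intro Bochner_Integration.integral_cong refl) (auto simp: S_alt split: split_indicator)
    finally show ?thesis .
  qed
  have Fb: "\<bar>F s\<bar> \<le> (\<integral>x. \<bar>indicator {x. min (a/2) (1/2) < (norm x)\<^sup>2 \<and> (norm x)\<^sup>2 \<le> max 1 b} x * P x\<bar> \<partial>lborel)" if "0 < a" "s \<in> {a..b}" for a b s
  proof -
    have "\<bar>F s\<bar> \<le> (\<integral>x. \<bar>S ((norm x)\<^sup>2) s * P x\<bar> \<partial>lborel)" unfolding F_def by (rule integral_abs_bound)
    also have "\<dots> \<le> (\<integral>x. \<bar>indicator {x. min (a/2) (1/2) < (norm x)\<^sup>2 \<and> (norm x)\<^sup>2 \<le> max 1 b} x * P x\<bar> \<partial>lborel)"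
      using that PI[of "min (a/2) (1/2)" "max 1 b"] FI[of s]
      by (intro integral_mono integrable_abs) (auto simp: S_alt abs_mult split: split_indicator)
    finally show ?thesis .
  qed
  define k where "k r = p r - F r / (2 * pi)" for r
  have [measurable]: "k \<in> borel_measurable borel" unfolding k_def by measurable
  have pI: "integrable lborel (\<lambda>x. indicator {a..b} x * p x)" if a: "0 < a" for a b
  proof -
    have "integrable lborel (\<lambda>x::R2. indicator {a..b} ((norm x)\<^sup>2) * p ((norm x)\<^sup>2))"
    proof (rule integrable_dominated_L2[where f = u and R = "sqrt b" and M = 1])
      fix x :: R2 assume "norm x > sqrt b"
      then have "\<not> (norm x)\<^sup>2 \<le> b" by (metis linorder_not_le norm_ge_zero real_le_rsqrt)
      then show "indicator {a..b} ((norm x)\<^sup>2) * p ((norm x)\<^sup>2) = 0" by auto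
    qed (use uL up in \<open>auto split: split_indicator\<close>)
    then have "integrable lborel (\<lambda>r. (pi * indicator {0<..} r) * (indicator {a..b} r * p r))"
      using integral_norm_square_R2(2)[of "\<lambda>r. indicator {a..b} r * p r"] by simp
    then have "integrable lborel (\<lambda>r. (1 / pi) * ((pi * indicator {0<..} r) * (indicator {a..b} r * p r)))" by (rule integrable_mult_right)
    then show ?thesis by (rule Bochner_Integration.integrable_cong[THEN iffD1, rotated 2]) (use a in \<open>auto split: split_indicator\<close>)
  qed
  have FI2: "integrable lborel (\<lambda>x. indicator {a..b} x * F x)" if a: "0 < a" for a b
  proof (rule Bochner_Integration.integrable_bound[where f = "\<lambda>x. indicator {a..b} x * (\<integral>x. \<bar>indicator {x. min (a/2) (1/2) < (norm x)\<^sup>2 \<and> (norm x)\<^sup>2 \<le> max 1 b} x * P x\<bar> \<partial>lborel)"])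
    show "integrable lborel (\<lambda>x. indicator {a..b} x * (\<integral>x. \<bar>indicator {x. min (a/2) (1/2) < (norm x)\<^sup>2 \<and> (norm x)\<^sup>2 \<le> max 1 b} x * P x\<bar> \<partial>lborel))"
      using emeasure_compact_finite[of "{a..b}"] by (intro integrable_mult_left integrable_real_indicator) auto
    show "AE x in lborel. norm (indicator {a..b} x * F x) \<le> norm (indicator {a..b} x * (\<integral>x. \<bar>indicator {x. min (a/2) (1/2) < (norm x)\<^sup>2 \<and> (norm x)\<^sup>2 \<le> max 1 b} x * P x\<bar> \<partial>lborel))"
    proof (rule AE_I2)
      fix x show "norm (indicator {a..b} x * F x) \<le> norm (indicator {a..b} x * (\<integral>x. \<bar>indicator {x. min (a/2) (1/2) < (norm x)\<^sup>2 \<and> (norm x)\<^sup>2 \<le> max 1 b} x * P x\<bar> \<partial>lborel))"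
        using Fb[OF a, of x b] by (cases "x \<in> {a..b}") (auto intro: order_trans[OF _ abs_ge_self])
    qed
  qed measurable
  obtain c where c: "AE x in lborel. x > 0 \<longrightarrow> k x = c"
  proof (rule AE_const_if_mean_zero_orthogonal[of k])
    show "k \<in> borel_measurable borel" by measurable
    show "integrable lborel (\<lambda>x. indicator {a..b} x * k x)" if "0 < a" for a b
      unfolding k_def using pI[OF that, of b] FI2[OF that, of b] by (simp add: right_diff_distrib)
    fix phi :: "real \<Rightarrow> real" and a b
    assume cphi: "continuous_on UNIV phi" and a: "0 < a" "a < b" and z: "\<And>x. x \<notin> {a..b} \<Longrightarrow> phi x = 0" and mz: "(\<integral>x. phi x \<partial>lborel) = 0"
    have [measurable]: "phi \<in> borel_measurable borel" using cphi by (rule borel_measurable_continuous_onI)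
    define q where "q y = (\<integral>s. indicator {..y} s * phi s \<partial>lborel)" for y
    have q: "(q has_real_derivative phi y) (at y)" "y < a \<Longrightarrow> q y = 0" "y > b \<Longrightarrow> q y = 0" for y
      using has_derivative_integral_atMost[OF cphi, of a b, OF z, of y] mz unfolding q_def by auto
    have phiI: "integrable lborel phi"
    proof -
      have "integrable lborel (\<lambda>x. indicator {a..b} x *\<^sub>R phi x)" by (rule borel_integrable_compact) (auto intro: continuous_on_subset[OF cphi])
      then show ?thesis by (rule Bochner_Integration.integrable_cong[THEN iffD1, rotated 2]) (use z in \<open>auto split: split_indicator\<close>)
    qed
    have W: "(\<integral>x. u x * phi ((norm x)\<^sup>2) \<partial>lborel) = - (\<integral>x. q ((norm x)\<^sup>2) / (2 * (norm x)\<^sup>2) * (x \<bullet> G x) \<partial>lborel)"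
      by (rule weak_grad_radial_test[OF u uL G q(1) cphi a]) (use q z in auto)
    have W1: "(\<integral>x. u x * phi ((norm x)\<^sup>2) \<partial>lborel) = pi * (\<integral>r. phi r * p r \<partial>lborel)"
    proof -
      have "(\<integral>x. u x * phi ((norm x)\<^sup>2) \<partial>lborel) = (\<integral>r. (pi * indicator {0<..} r) * (p r * phi r) \<partial>lborel)"
        unfolding up by (rule integral_norm_square_R2(1)) measurable
      also have "\<dots> = (\<integral>r. pi * (phi r * p r) \<partial>lborel)"
        using z a by (intro Bochner_Integration.integral_cong refl) (auto split: split_indicator)
      finally show ?thesis by simp
    qed
    have W2: "(\<integral>x. q ((norm x)\<^sup>2) / (2 * (norm x)\<^sup>2) * (x \<bullet> G x) \<partial>lborel) = (1/2) * (\<integral>x. q ((norm x)\<^sup>2) * P x \<partial>lborel)"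
      by (subst integral_mult_right_zero[symmetric]) (simp add: P_def)
    define A where "A = {x::R2. min (a/2) (1/2) < (norm x)\<^sup>2 \<and> (norm x)\<^sup>2 \<le> max 1 b}"
    have prodI: "integrable (lborel \<Otimes>\<^sub>M lborel) (\<lambda>(x, s). S ((norm x)\<^sup>2) s * P x * phi s)"
    proof (rule Bochner_Integration.integrable_bound)
      have AP: "integrable lborel (\<lambda>x. indicator A x * P x)" unfolding A_def by (rule PI) (use a in auto)
      show "integrable (lborel \<Otimes>\<^sub>M lborel) (\<lambda>(x, s). indicator A x * P x * phi s)"
      proof (rule lborel_pair.Fubini_integrable)
        have [measurable]: "A \<in> sets borel" unfolding A_def by measurable
        show "(\<lambda>(x, s). indicator A x * P x * phi s) \<in> borel_measurable (lborel \<Otimes>\<^sub>M lborel)" by measurable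
        show "integrable lborel (\<lambda>x. \<integral>y. norm (case (x, y) of (x, s) \<Rightarrow> indicator A x * P x * phi s) \<partial>lborel)"
          using integrable_mult_left[OF integrable_abs[OF AP], of "\<integral>y. \<bar>phi y\<bar> \<partial>lborel"] by (simp add: abs_mult)
        show "AE x in lborel. integrable lborel (\<lambda>y. case (x, y) of (x, s) \<Rightarrow> indicator A x * P x * phi s)"
          using phiI by simp
      qed
      show "AE x in lborel \<Otimes>\<^sub>M lborel. norm (case x of (x, s) \<Rightarrow> S ((norm x)\<^sup>2) s * P x * phi s) \<le> norm (case x of (x, s) \<Rightarrow> indicator A x * P x * phi s)"
      proof (rule AE_I2, clarify)
        fix x :: R2 and s :: real
        show "norm (S ((norm x)\<^sup>2) s * P x * phi s) \<le> norm (indicator A x * P x * phi s)"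
        proof (cases "s \<in> {a..b}")
          case True
          then have "\<bar>S ((norm x)\<^sup>2) s\<bar> \<le> indicator A x" using a by (auto simp: S_alt A_def split: split_indicator)
          then show ?thesis by (auto simp: abs_mult intro!: mult_right_mono)
        qed (simp add: z)
      qed
    qed measurable
    \<comment> \<open>For y > 1 the integral is that of phi over s \<ge> y, which is -q(y) because
      phi has mean zero; for y \<le> 1 the sign in S gives -q(y) directly.\<close>
    have inner: "(\<integral>s. S y s * phi s \<partial>lborel) = - q y" for y
    proof (cases "y > 1")
      case True
      have "(\<integral>s. S y s * phi s \<partial>lborel) = (\<integral>s. phi s - indicator {..y} s * phi s \<partial>lborel)"
      proof (rule integral_cong_AE)
        show "AE s in lborel. S y s * phi s = phi s - indicator {..y} s * phi s"
          using AE_lborel_singleton[of y] by eventually_elim (use True in \<open>auto simp: S_alt split: split_indicator\<close>)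
      qed measurable
      also have "\<dots> = - q y" unfolding q_def using phiI mz integrable_mult_indicator[OF _ phiI, of "{..y}"] by simp
      finally show ?thesis .
    next
      case False
      have "(\<integral>s. S y s * phi s \<partial>lborel) = (\<integral>s. - (indicator {..y} s * phi s) \<partial>lborel)"
      proof (rule integral_cong_AE)
        show "AE s in lborel. S y s * phi s = - (indicator {..y} s * phi s)"
          using AE_lborel_singleton[of y] by eventually_elim (use False in \<open>auto simp: S_alt split: split_indicator\<close>)
      qed measurable
      then show ?thesis unfolding q_def by simp
    qed
    have "(\<integral>s. phi s * F s \<partial>lborel) = (\<integral>s. \<integral>x. S ((norm x)\<^sup>2) s * P x * phi s \<partial>lborel \<partial>lborel)"
      unfolding F_def by (subst integral_mult_left_zero) (simp add: mult.commute)
    also have "\<dots> = (\<integral>x. \<integral>s. S ((norm x)\<^sup>2) s * P x * phi s \<partial>lborel \<partial>lborel)"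
      using lborel_pair.Fubini_integral[OF prodI] by simp
    also have "\<dots> = (\<integral>x. P x * (\<integral>s. S ((norm x)\<^sup>2) s * phi s \<partial>lborel) \<partial>lborel)"
      by (subst integral_mult_right_zero[symmetric]) (simp add: mult_ac)
    also have "\<dots> = - (\<integral>x. q ((norm x)\<^sup>2) * P x \<partial>lborel)" unfolding inner by (simp add: mult.commute)
    finally have FF: "(\<integral>s. phi s * F s \<partial>lborel) = - (\<integral>x. q ((norm x)\<^sup>2) * P x \<partial>lborel)" .
    have e: "pi * (\<integral>r. phi r * p r \<partial>lborel) = (1/2) * (\<integral>s. phi s * F s \<partial>lborel)"
      using W W1 W2 FF by simp
    have "bounded (phi ` {a..b})" using compact_continuous_image[OF continuous_on_subset[OF cphi], of "{a..b}"] by (auto intro: compact_imp_bounded)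
    then obtain B where "\<forall>x\<in>{a..b}. norm (phi x) \<le> B" unfolding bounded_iff by blast
    then have B: "\<bar>phi x\<bar> \<le> B" if "x \<in> {a..b}" for x using that by auto
    have mI: "integrable lborel (\<lambda>x. phi x * h x)" if [measurable]: "h \<in> borel_measurable borel" and h: "integrable lborel (\<lambda>x. indicator {a..b} x * h x)" for h
    proof (rule Bochner_Integration.integrable_bound[OF integrable_mult_right[OF integrable_abs[OF h], of B]])
      have "\<bar>phi x * h x\<bar> \<le> \<bar>B * \<bar>indicator {a..b} x * h x\<bar>\<bar>" for x
      proof (cases "x \<in> {a..b}")
        case True
        then have "\<bar>phi x\<bar> * \<bar>h x\<bar> \<le> B * \<bar>h x\<bar>" using B[of x] by (intro mult_right_mono) auto
        then show ?thesis using True abs_ge_self[of "B * \<bar>h x\<bar>"] by (simp add: abs_mult)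
      qed (simp add: z)
      then show "AE x in lborel. norm (phi x * h x) \<le> norm (B * \<bar>indicator {a..b} x * h x\<bar>)" by simp
    qed simp
    show "(\<integral>x. phi x * k x \<partial>lborel) = 0"
    proof -
      have "(\<integral>x. phi x * k x \<partial>lborel) = (\<integral>x. phi x * p x - (1 / (2 * pi)) * (phi x * F x) \<partial>lborel)"
        by (simp add: k_def right_diff_distrib)
      also have "\<dots> = (\<integral>x. phi x * p x \<partial>lborel) - (1 / (2 * pi)) * (\<integral>x. phi x * F x \<partial>lborel)"
        using mI[OF pm pI[OF a(1)]] mI[OF Fm FI2[OF a(1)]] by simp
      also have "\<dots> = 0" using e by (simp add: field_simps)
      finally show ?thesis .
    qed
  qed
  define f where "f r = c + F (r\<^sup>2) / (2 * pi)" for r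
  show ?thesis
  proof (rule that[of f])
    show "f \<in> borel_measurable borel" unfolding f_def by measurable
    have "AE x in lborel. k ((norm (x::R2))\<^sup>2) = c" by (rule AE_norm_square_R2[OF _ c]) measurable
    then show "AE x in lborel. u x = f (norm x)" by eventually_elim (simp add: f_def k_def up)
    fix a b :: real assume a: "0 < a" "a \<le> b"
    define A where "A = {x::R2. a < norm x \<and> norm x \<le> b}"
    have [measurable]: "A \<in> sets borel" unfolding A_def by measurable
    have eA: "a\<^sup>2 < (norm x)\<^sup>2 \<and> (norm x)\<^sup>2 \<le> b\<^sup>2 \<longleftrightarrow> a < norm x \<and> norm x \<le> b" for x :: R2
      using a power_mono_iff[of "norm x" a 2] by (auto simp: power_mono_iff simp flip: not_le)
    have sA: "{x::R2. a\<^sup>2 < (norm x)\<^sup>2 \<and> (norm x)\<^sup>2 \<le> b\<^sup>2} = A" unfolding A_def by (simp only: eA)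
    have "0 < a\<^sup>2" "a\<^sup>2 \<le> b\<^sup>2" using a by (auto intro: power_mono)
    from Fdiff[OF this] have "f b - f a = (\<integral>x. indicator A x * P x \<partial>lborel) / (2 * pi)"
      unfolding sA by (simp add: f_def flip: diff_divide_distrib)
    then have 1: "(f b - f a)\<^sup>2 = (\<integral>x. indicator A x * P x \<partial>lborel)\<^sup>2 / (2 * pi)\<^sup>2" by (simp add: power_divide)
    have hb: "has_bochner_integral lborel (\<lambda>x. (indicator A x / norm x)\<^sup>2) (2 * pi * ln (b / a))"
      using integral_annulus_inverse_square[OF a] by (auto simp: A_def power_divide indicator_def power2_eq_square elim!: has_bochner_integral_cong[THEN iffD1, rotated 3])
    have GA: "integrable lborel (\<lambda>x. (indicator (cball 0 b) x * norm (G x))\<^sup>2)"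
      by (rule Bochner_Integration.integrable_bound[OF GI]) (auto split: split_indicator)
    have "\<bar>\<integral>x. indicator A x * P x \<partial>lborel\<bar> \<le> (\<integral>x. \<bar>indicator A x * P x\<bar> \<partial>lborel)" by (rule integral_abs_bound)
    \<comment> \<open>The product is split so that Cauchy-Schwarz pairs the annulus integral of
      1/|x|^2 with the energy of the ball.\<close>
    also have "\<dots> \<le> (\<integral>x. (indicator A x / norm x) * (indicator (cball 0 b) x * norm (G x)) \<partial>lborel)"
    proof (rule integral_mono)
      show "integrable lborel (\<lambda>x. \<bar>indicator A x * P x\<bar>)" using PI[of "a\<^sup>2" "b\<^sup>2", unfolded sA] a by (intro integrable_abs) simp
      show "integrable lborel (\<lambda>x. (indicator A x / norm x) * (indicator (cball 0 b) x * norm (G x)))"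
        by (rule Cauchy_Schwarz_integral(1)) (use hb GA in \<open>auto simp: has_bochner_integral_iff\<close>)
      show "\<bar>indicator A x * P x\<bar> \<le> (indicator A x / norm x) * (indicator (cball 0 b) x * norm (G x))" for x
        using Ple[of x] by (auto simp: A_def split: split_indicator)
    qed
    finally have "(\<integral>x. indicator A x * P x \<partial>lborel)\<^sup>2 \<le> (\<integral>x. (indicator A x / norm x) * (indicator (cball 0 b) x * norm (G x)) \<partial>lborel)\<^sup>2"
      by (subst power2_abs[symmetric]) (intro power_mono, auto)
    also have "\<dots> \<le> (\<integral>x. (indicator A x / norm x)\<^sup>2 \<partial>lborel) * (\<integral>x. (indicator (cball 0 b) x * norm (G x))\<^sup>2 \<partial>lborel)"
      by (rule Cauchy_Schwarz_integral(2)) (use hb GA in \<open>auto simp: has_bochner_integral_iff\<close>)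
    also have "(\<integral>x. (indicator A x / norm x)\<^sup>2 \<partial>lborel) = 2 * pi * ln (b / a)" using hb by (simp add: has_bochner_integral_iff)
    also have "(\<integral>x. (indicator (cball 0 b) x * norm (G x))\<^sup>2 \<partial>lborel) = (\<integral>x. indicator (cball 0 b) x * (norm (G x))\<^sup>2 \<partial>lborel)"
      by (intro Bochner_Integration.integral_cong) (auto split: split_indicator)
    finally show "(f b - f a)\<^sup>2 \<le> ln (b / a) / (2 * pi) * (\<integral>x. indicator (cball 0 b) x * (norm (G x))\<^sup>2 \<partial>lborel)"
      unfolding 1 by (simp add: divide_simps power2_eq_square mult_ac)
  qed
qed

section \<open>Decay and exponential integrability of radial functions\<close>

lemma H1r_D:
  assumes "H1r u"
  shows "u \<in> borel_measurable borel" "integrable lborel (\<lambda>x. (u x)\<^sup>2)" "L2_grad u (wgrad u)" "radial u" "H1 u"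
  using assms H1_D by (auto simp: H1r_def)

lemma H1r_I:
  assumes "u \<in> borel_measurable borel" "integrable lborel (\<lambda>x. (u x)\<^sup>2)" "L2_grad u G" "radial u"
  shows "H1r u"
  using assms H1_I by (auto simp: H1r_def)

lemma grad_sq_nonneg: "grad_sq u \<ge> 0" and L2_sq_nonneg: "L2_sq u \<ge> 0"
  by (auto simp: grad_sq_def L2_sq_def)

lemma H1r_L4:
  assumes "H1r u"
  shows "integrable lborel (\<lambda>x. (u x)^4)" "(\<integral>x. (u x)^4 \<partial>lborel) \<le> L2_sq u * grad_sq u"
  using L4_bound[OF H1r_D(1-3)[OF assms]] by (simp_all add: L2_sq_def grad_sq_def)

lemma integral_inverse_norm_R2:
  assumes "0 \<le> R"
  shows "has_bochner_integral lborel (\<lambda>x::R2. indicator (cball 0 R) x / norm x) (2 * pi * R)"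
proof -
  have e: "indicator (cball 0 R) x / norm x = indicator {..R} (norm x) / norm x" for x :: R2
    by (auto split: split_indicator)
  have ae: "AE r in lborel. (2 * pi * r * indicator {0..} r) * (indicator {..R} r / r) = 2 * pi * indicator {0..R} r"
    using AE_lborel_singleton[of 0] by eventually_elim (auto split: split_indicator)
  have "has_bochner_integral lborel (\<lambda>r. 2 * pi * indicator {0..R} r) (2 * pi * measure lborel {0..R})"
    using emeasure_compact_finite[of "{0..R}"] by (intro has_bochner_integral_mult_right has_bochner_integral_real_indicator) auto
  then have "has_bochner_integral lborel (\<lambda>r. 2 * pi * indicator {0..R} r) (2 * pi * R)" using assms by simp
  from has_bochner_integral_cong_AE[THEN iffD2, OF _ _ ae this]
  have "has_bochner_integral lborel (\<lambda>r. (2 * pi * r * indicator {0..} r) * (indicator {..R} r / r)) (2 * pi * R)" by simp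
  then show ?thesis unfolding e has_bochner_integral_iff
    using integral_norm_R2[of "\<lambda>r. indicator {..R} r / r"] by simp
qed

lemma square_le_double: "(x::real)\<^sup>2 \<le> 2 * y\<^sup>2 + 2 * (y - x)\<^sup>2"
  using zero_le_power2[of "2 * y - x"] by (simp add: power2_eq_square algebra_simps)

text \<open>The last bound is a decay estimate of Strauss type, got by averaging f(r)^2 \<le> 2
  f(t)^2 + 2 (f(t) - f(r))^2 over t in [r, r + l]. The length l stays free: l = 1 serves for
  compactness, the optimal l for the sharp numerical bound.\<close>

lemma H1r_representation:
  assumes u: "H1r u"
  obtains f :: "real \<Rightarrow> real" where "AE x in lborel. u x = f (norm x)" "f \<in> borel_measurable borel"
    "\<And>a b. 0 < a \<Longrightarrow> a \<le> b \<Longrightarrow> (f b - f a)\<^sup>2 \<le> ln (b / a) / (2 * pi) * (\<integral>x. indicator (cball 0 b) x * (norm (wgrad u x))\<^sup>2 \<partial>lborel)"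
    "\<And>a b. 0 < a \<Longrightarrow> a \<le> b \<Longrightarrow> (f b - f a)\<^sup>2 \<le> ln (b / a) / (2 * pi) * grad_sq u"
    "\<And>r l. 0 < r \<Longrightarrow> 0 < l \<Longrightarrow> (f r)\<^sup>2 \<le> (L2_sq u / l + grad_sq u * l / 2) / (pi * r)"
proof -
  note D = H1r_D[OF u]
  obtain f where f: "AE x in lborel. u x = f (norm x)" and fm[measurable]: "f \<in> borel_measurable borel"
    and fd: "\<And>a b. 0 < a \<Longrightarrow> a \<le> b \<Longrightarrow> (f b - f a)\<^sup>2 \<le> ln (b / a) / (2 * pi) * (\<integral>x. indicator (cball 0 b) x * (norm (wgrad u x))\<^sup>2 \<partial>lborel)"
    by (rule radial_representation[OF D(1-4)]) blast
  have [measurable]: "wgrad u \<in> borel_measurable borel" and GI: "integrable lborel (\<lambda>x. (norm (wgrad u x))\<^sup>2)" using D(3) by (auto simp: L2_grad_def)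
  note [measurable] = D(1)
  have fd2: "(f b - f a)\<^sup>2 \<le> ln (b / a) / (2 * pi) * grad_sq u" if ab: "0 < a" "a \<le> b" for a b
  proof (rule order_trans[OF fd[OF ab]])
    have "(\<integral>x. indicator (cball 0 b) x * (norm (wgrad u x))\<^sup>2 \<partial>lborel) \<le> grad_sq u"
      unfolding grad_sq_def
    proof (rule integral_mono[OF _ GI])
      show "integrable lborel (\<lambda>x. indicator (cball 0 b) x * (norm (wgrad u x))\<^sup>2)"
        using integrable_mult_indicator[OF _ GI, of "cball 0 b"] by simp
    qed (auto split: split_indicator)
    moreover have "ln (b / a) / (2 * pi) \<ge> 0" using ab by simp
    ultimately show "ln (b / a) / (2 * pi) * (\<integral>x. indicator (cball 0 b) x * (norm (wgrad u x))\<^sup>2 \<partial>lborel) \<le> ln (b / a) / (2 * pi) * grad_sq u"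
      by (rule mult_left_mono)
  qed
  have fI: "integrable lborel (\<lambda>x::R2. (f (norm x))\<^sup>2)" and fint: "(\<integral>x. (f (norm (x::R2)))\<^sup>2 \<partial>lborel) = L2_sq u"
  proof -
    have ae: "AE x in lborel. (u x)\<^sup>2 = (f (norm x))\<^sup>2" using f by eventually_elim simp
    show "integrable lborel (\<lambda>x::R2. (f (norm x))\<^sup>2)" by (rule integrable_cong_AE_imp[OF D(2) _ ae]) measurable
    show "(\<integral>x. (f (norm (x::R2)))\<^sup>2 \<partial>lborel) = L2_sq u" unfolding L2_sq_def
      by (rule integral_cong_AE[symmetric, OF _ _ ae]) measurable
  qed
  show ?thesis
  proof (rule that[OF f fm fd fd2])
    fix r l :: real assume rl: "0 < r" "0 < l"
    have I0: "integrable lborel (\<lambda>t. (2 * pi * t * indicator {0..} t) * (f t)\<^sup>2)"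
      using integral_norm_R2(2)[of "\<lambda>t. (f t)\<^sup>2"] fI by simp
    have E0: "(\<integral>t. (2 * pi * t * indicator {0..} t) * (f t)\<^sup>2 \<partial>lborel) = L2_sq u"
      using integral_norm_R2(1)[of "\<lambda>t. (f t)\<^sup>2"] fint by simp
    \<comment> \<open>For t \<ge> r the polar weight 2 pi t is at least 2 pi r, which produces the
      decay in r.\<close>
    have b1: "indicator {r..r+l} t * (f t)\<^sup>2 \<le> (1 / (2 * pi * r)) * ((2 * pi * t * indicator {0..} t) * (f t)\<^sup>2)" for t
    proof (cases "t \<in> {r..r+l}")
      case True
      then have "1 \<le> t / r" using rl by simp
      then have "1 * (f t)\<^sup>2 \<le> (t / r) * (f t)\<^sup>2" by (intro mult_right_mono) auto
      then show ?thesis using True rl by (simp add: field_simps)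
    qed (use rl in \<open>auto split: split_indicator\<close>)
    have I1: "integrable lborel (\<lambda>t. indicator {r..r+l} t * (f t)\<^sup>2)"
    proof (rule Bochner_Integration.integrable_bound[OF integrable_mult_right[OF I0, of "1 / (2 * pi * r)"]])
      show "AE t in lborel. norm (indicator {r..r+l} t * (f t)\<^sup>2) \<le> norm (1 / (2 * pi * r) * (2 * pi * t * indicator {0..} t * (f t)\<^sup>2))"
      proof (rule AE_I2)
        fix t
        have "norm (indicator {r..r+l} t * (f t)\<^sup>2) = indicator {r..r+l} t * (f t)\<^sup>2" by simp
        also note b1
        finally show "norm (indicator {r..r+l} t * (f t)\<^sup>2) \<le> norm (1 / (2 * pi * r) * (2 * pi * t * indicator {0..} t * (f t)\<^sup>2))"
          unfolding real_norm_def by (rule order_trans[OF _ abs_ge_self])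
      qed
    qed measurable
    have "(\<integral>t. indicator {r..r+l} t * (f t)\<^sup>2 \<partial>lborel) \<le> (\<integral>t. (1 / (2 * pi * r)) * ((2 * pi * t * indicator {0..} t) * (f t)\<^sup>2) \<partial>lborel)"
      by (rule integral_mono[OF I1 integrable_mult_right[OF I0] b1])
    then have E1: "(\<integral>t. indicator {r..r+l} t * (f t)\<^sup>2 \<partial>lborel) \<le> L2_sq u / (2 * pi * r)"
      by (simp only: integral_mult_right_zero E0) simp
    have E2: "has_bochner_integral lborel (\<lambda>t. (t - r) * indicator {r..r+l} t) ((r + l - r)\<^sup>2 / 2 - (r - r)\<^sup>2 / 2)"
      by (rule has_bochner_integral_FTC_Icc_real) (use rl in \<open>auto intro!: derivative_eq_intros continuous_intros\<close>)
    then have E2i: "integrable lborel (\<lambda>t. (t - r) * indicator {r..r+l} t)" and E2v: "(\<integral>t. (t - r) * indicator {r..r+l} t \<partial>lborel) = l\<^sup>2 / 2"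
      by (simp_all add: has_bochner_integral_iff)
    \<comment> \<open>The logarithm in the oscillation bound is replaced by ln(t/r) \<le> t/r - 1,
      linear in t - r and integrable by hand.\<close>
    have pt: "(f r)\<^sup>2 * indicator {r..r+l} t \<le> 2 * (indicator {r..r+l} t * (f t)\<^sup>2) + (grad_sq u / (pi * r)) * ((t - r) * indicator {r..r+l} t)" for t
    proof (cases "t \<in> {r..r+l}")
      case True
      then have t: "r \<le> t" by simp
      have "ln (t / r) \<le> t / r - 1" using rl t by (intro ln_le_minus_one) auto
      then have "ln (t / r) / (2 * pi) * grad_sq u \<le> (t / r - 1) / (2 * pi) * grad_sq u"
        using grad_sq_nonneg[of u] by (intro mult_right_mono divide_right_mono) auto
      then have "(f t - f r)\<^sup>2 \<le> (t / r - 1) / (2 * pi) * grad_sq u" using fd2[OF rl(1) t] by linarith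
      then have "(f r)\<^sup>2 \<le> 2 * (f t)\<^sup>2 + 2 * ((t / r - 1) / (2 * pi) * grad_sq u)" using square_le_double[of "f r" "f t"] by linarith
      also have "2 * ((t / r - 1) / (2 * pi) * grad_sq u) = (grad_sq u / (pi * r)) * (t - r)" using rl by (simp add: field_simps)
      finally show ?thesis using True by simp
    qed auto
    have i3: "integrable lborel (\<lambda>t. (f r)\<^sup>2 * indicator {r..r+l} t)" using emeasure_compact_finite[of "{r..r+l}"] by (intro integrable_mult_right integrable_real_indicator) auto
    have "(\<integral>t. (f r)\<^sup>2 * indicator {r..r+l} t \<partial>lborel) \<le> (\<integral>t. 2 * (indicator {r..r+l} t * (f t)\<^sup>2) + (grad_sq u / (pi * r)) * ((t - r) * indicator {r..r+l} t) \<partial>lborel)"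
      using E2 by (intro integral_mono[OF i3 _ pt] Bochner_Integration.integrable_add integrable_mult_right I1) (auto simp: has_bochner_integral_iff)
    also have "\<dots> = 2 * (\<integral>t. indicator {r..r+l} t * (f t)\<^sup>2 \<partial>lborel) + (grad_sq u / (pi * r)) * (l\<^sup>2 / 2)"
      using I1 E2i by (simp only: Bochner_Integration.integral_add integrable_mult_right integral_mult_right_zero E2v)
    also have "\<dots> \<le> 2 * (L2_sq u / (2 * pi * r)) + (grad_sq u / (pi * r)) * (l\<^sup>2 / 2)" using E1 by simp
    finally have "(f r)\<^sup>2 * l \<le> 2 * (L2_sq u / (2 * pi * r)) + (grad_sq u / (pi * r)) * (l\<^sup>2 / 2)" using rl by simp
    then have "(f r)\<^sup>2 \<le> (2 * (L2_sq u / (2 * pi * r)) + (grad_sq u / (pi * r)) * (l\<^sup>2 / 2)) / l" using rl by (simp add: pos_le_divide_eq)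
    also have "\<dots> = (L2_sq u / l + grad_sq u * l / 2) / (pi * r)" using rl by (simp add: field_simps power2_eq_square)
    finally show "(f r)\<^sup>2 \<le> (L2_sq u / l + grad_sq u * l / 2) / (pi * r)" .
  qed
qed

text \<open>Radial functions in \<open>H\<^sup>1\<close> grow more slowly than any multiple of \<open>sqrt (ln (1 / \<bar>x\<bar>))\<close> at the
  origin, because the Dirichlet energy of small balls tends to zero.\<close>
lemma H1r_exp_bound:
  assumes u: "H1r u" and k: "k > 0"
  obtains C d where "d > 0" "C \<ge> 0" "AE x in lborel. norm x \<le> d \<longrightarrow> exp (k * (u x)\<^sup>2) \<le> C / sqrt (norm x)"
    "AE x in lborel. norm x > d \<longrightarrow> (u x)\<^sup>2 \<le> C"
proof -
  obtain f where f: "AE x in lborel. u x = f (norm x)" "f \<in> borel_measurable borel"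
    "\<And>a b. 0 < a \<Longrightarrow> a \<le> b \<Longrightarrow> (f b - f a)\<^sup>2 \<le> ln (b / a) / (2 * pi) * (\<integral>x. indicator (cball 0 b) x * (norm (wgrad u x))\<^sup>2 \<partial>lborel)"
    "\<And>r l. 0 < r \<Longrightarrow> 0 < l \<Longrightarrow> (f r)\<^sup>2 \<le> (L2_sq u / l + grad_sq u * l / 2) / (pi * r)"
    by (rule H1r_representation[OF u]) blast
  have [measurable]: "wgrad u \<in> borel_measurable borel" and GI: "integrable lborel (\<lambda>x. (norm (wgrad u x))\<^sup>2)" using H1r_D(3)[OF u] by (auto simp: L2_grad_def)
  have [measurable]: "cball (0::R2) r \<in> sets borel" for r by simp
  define E where "E b = (\<integral>x. indicator (cball 0 b) x * (norm (wgrad u x))\<^sup>2 \<partial>lborel)" for b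
  have "(\<lambda>n. E (inverse (real (Suc n)))) \<longlonglongrightarrow> (\<integral>x. (0::real) \<partial>(lborel :: R2 measure))"
    unfolding E_def
  proof (rule integral_dominated_convergence[OF _ _ GI])
    have "AE x in lborel. x \<noteq> (0::R2)" by (rule AE_lborel_singleton)
    then show "AE x in lborel. (\<lambda>n. indicator (cball 0 (inverse (real (Suc n)))) x * (norm (wgrad u x))\<^sup>2) \<longlonglongrightarrow> 0"
    proof eventually_elim
      case (elim x)
      have "eventually (\<lambda>n. inverse (real (Suc n)) < norm x) sequentially"
        by (rule order_tendstoD(2)[OF LIMSEQ_inverse_real_of_nat]) (use elim in simp)
      then have "eventually (\<lambda>n. indicator (cball 0 (inverse (real (Suc n)))) x * (norm (wgrad u x))\<^sup>2 = 0) sequentially"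
        by eventually_elim (simp add: indicator_def)
      then show ?case by (rule tendsto_eventually)
    qed
  qed (auto split: split_indicator)
  then have "(\<lambda>n. E (inverse (real (Suc n)))) \<longlonglongrightarrow> 0" by simp
  \<comment> \<open>Energy below pi/(2 k) makes the squared oscillation at most ln(d/r)/(4 k). After
    doubling and multiplying by k this is half a logarithm, hence the square root in the
    bound.\<close>
  then have "eventually (\<lambda>n. E (inverse (real (Suc n))) < pi / (2 * k)) sequentially"
    by (rule order_tendstoD) (use k in simp)
  then obtain n where n: "E (inverse (real (Suc n))) < pi / (2 * k)" by (auto dest: eventually_happens)
  define d where "d = inverse (real (Suc n))"
  have d: "d > 0" by (simp add: d_def)
  have near: "exp (k * (f r)\<^sup>2) \<le> exp (2 * k * (f d)\<^sup>2) * sqrt d / sqrt r" if r: "0 < r" "r \<le> d" for r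
  proof -
    have "ln (d / r) / (2 * pi) * E d \<le> ln (d / r) / (2 * pi) * (pi / (2 * k))"
      using n r unfolding d_def[symmetric] by (intro mult_left_mono) auto
    then have "(f d - f r)\<^sup>2 \<le> ln (d / r) / (4 * k)" using f(3)[OF r] unfolding E_def by simp
    then have "(f r)\<^sup>2 \<le> 2 * (f d)\<^sup>2 + 2 * (ln (d / r) / (4 * k))" using square_le_double[of "f r" "f d"] by linarith
    then have "k * (f r)\<^sup>2 \<le> k * (2 * (f d)\<^sup>2 + 2 * (ln (d / r) / (4 * k)))" using k by (intro mult_left_mono) auto
    also have "\<dots> = 2 * k * (f d)\<^sup>2 + ln (d / r) / 2" using k by (simp add: field_simps)
    finally have "exp (k * (f r)\<^sup>2) \<le> exp (2 * k * (f d)\<^sup>2) * exp (ln (d / r) / 2)" by (simp add: exp_add[symmetric])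
    also have "exp (ln (d / r) / 2) = sqrt (d / r)"
      using r d by (simp add: ln_sqrt[symmetric])
    finally show ?thesis by (simp add: real_sqrt_divide)
  qed
  \<comment> \<open>One constant serves both regions: the first entry bounds the exponential inside
    radius d, the second is the decay estimate with l = 1 at radius d.\<close>
  define C where "C = max (exp (2 * k * (f d)\<^sup>2) * sqrt d) ((L2_sq u + grad_sq u / 2) / (pi * d))"
  show ?thesis
  proof (rule that[of d C])
    show "C \<ge> 0" unfolding C_def using d by (intro max.coboundedI1) auto
    show "AE x in lborel. norm x \<le> d \<longrightarrow> exp (k * (u x)\<^sup>2) \<le> C / sqrt (norm x)"
      using f(1) AE_lborel_singleton[of "0::R2"]
    proof eventually_elim
      case (elim x)
      show ?case
      proof
        assume "norm x \<le> d"
        then have "exp (k * (f (norm x))\<^sup>2) \<le> exp (2 * k * (f d)\<^sup>2) * sqrt d / sqrt (norm x)" using elim by (intro near) auto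
        also have "\<dots> \<le> C / sqrt (norm x)" by (intro divide_right_mono) (auto simp: C_def)
        finally show "exp (k * (u x)\<^sup>2) \<le> C / sqrt (norm x)" using elim by simp
      qed
    qed
    show "AE x in lborel. norm x > d \<longrightarrow> (u x)\<^sup>2 \<le> C"
      using f(1)
    proof eventually_elim
      case (elim x)
      show ?case
      proof
        assume x: "norm x > d"
        then have "(f (norm x))\<^sup>2 \<le> (L2_sq u / 1 + grad_sq u * 1 / 2) / (pi * norm x)" using d by (intro f(4)) auto
        also have "\<dots> \<le> (L2_sq u + grad_sq u / 2) / (pi * d)"
          using x d L2_sq_nonneg[of u] grad_sq_nonneg[of u] by (auto intro!: divide_left_mono mult_pos_pos)
        also have "\<dots> \<le> C" by (simp add: C_def)
        finally show "(u x)\<^sup>2 \<le> C" using elim by simp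
      qed
    qed
  qed (rule d)
qed

text \<open>The exponent k + 1 instead of k absorbs the polynomial factor, and (|u| + |v|)^2 \<le> 2
  u^2 + 2 v^2 splits the exponential into a factor a for u and b for v. Each is at most C/sqrt(|x|)
  near 0, so their product is at most a multiple of 1/|x|, integrable in the plane. Far out both are
  bounded and the quadratic factor supplies integrability.\<close>

lemma H1r_exp_integrable:
  assumes u: "H1r u" and v: "H1r v" and k: "k > 0"
  shows "integrable lborel (\<lambda>x. (\<bar>u x\<bar> + \<bar>v x\<bar>)\<^sup>2 * exp (k * (\<bar>u x\<bar> + \<bar>v x\<bar>)\<^sup>2))"
proof -
  note [measurable] = H1r_D(1)[OF u] H1r_D(1)[OF v]
  have k2: "2 * (k + 1) > 0" using k by simp
  obtain C1 d1 where 1: "d1 > 0" "C1 \<ge> 0" "AE x in lborel. norm x \<le> d1 \<longrightarrow> exp (2 * (k + 1) * (u x)\<^sup>2) \<le> C1 / sqrt (norm x)"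
    "AE x in lborel. norm x > d1 \<longrightarrow> (u x)\<^sup>2 \<le> C1" by (rule H1r_exp_bound[OF u k2])
  obtain C2 d2 where 2: "d2 > 0" "C2 \<ge> 0" "AE x in lborel. norm x \<le> d2 \<longrightarrow> exp (2 * (k + 1) * (v x)\<^sup>2) \<le> C2 / sqrt (norm x)"
    "AE x in lborel. norm x > d2 \<longrightarrow> (v x)\<^sup>2 \<le> C2" by (rule H1r_exp_bound[OF v k2])
  define M1 where "M1 = max 1 (exp (2 * (k + 1) * C1))"
  define M2 where "M2 = max 1 (exp (2 * (k + 1) * C2))"
  define T where "T x = (C1 * C2) * (indicator (cball 0 (max d1 d2)) x / norm x) + (C1 * M2 + C2 * M1) * (indicator (cball 0 (max d1 d2)) x * (1 + 1 / norm x)) + (M1 * M2) * (2 * (u x)\<^sup>2 + 2 * (v x)\<^sup>2)" for x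
  have I: "integrable lborel (\<lambda>x::R2. indicator (cball 0 R) x / norm x)" if "R \<ge> 0" for R
    using integral_inverse_norm_R2[OF that] by (simp add: has_bochner_integral_iff)
  have TI: "integrable lborel T"
  proof -
    have "integrable lborel (\<lambda>x::R2. indicator (cball 0 (max d1 d2)) x * (1 + 1 / norm x))"
    proof -
      have "integrable lborel (\<lambda>x::R2. indicator (cball 0 (max d1 d2)) x + indicator (cball 0 (max d1 d2)) x / norm x :: real)"
        using I[of "max d1 d2"] 1(1) emeasure_bounded_finite[of "cball (0::R2) (max d1 d2)"]
        by (intro Bochner_Integration.integrable_add integrable_real_indicator) auto
      then show ?thesis by (simp add: distrib_left)
    qed
    then show ?thesis unfolding T_def using I[of "max d1 d2"] 1(1) H1r_D(2)[OF u] H1r_D(2)[OF v]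
      by (intro Bochner_Integration.integrable_add integrable_mult_right) auto
  qed
  have sq: "1 / sqrt r \<le> 1 + 1 / r" if "r > 0" for r :: real
  proof -
    have "0 \<le> (1 / sqrt r - 1)\<^sup>2" by simp
    also have "\<dots> = 1 + 1 / r - 2 * (1 / sqrt r)" using that by (simp add: power2_eq_square algebra_simps)
    finally have "2 * (1 / sqrt r) \<le> 1 + 1 / r" by simp
    moreover have "1 / sqrt r \<ge> 0" using that by simp
    ultimately show ?thesis by linarith
  qed
  have M: "M1 \<ge> 1" "M2 \<ge> 1" by (auto simp: M1_def M2_def)
  show ?thesis
  proof (rule Bochner_Integration.integrable_bound[OF TI])
    show "AE x in lborel. norm ((\<bar>u x\<bar> + \<bar>v x\<bar>)\<^sup>2 * exp (k * (\<bar>u x\<bar> + \<bar>v x\<bar>)\<^sup>2)) \<le> norm (T x)"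
      using 1(3,4) 2(3,4) AE_lborel_singleton[of "0::R2"]
    proof eventually_elim
      case (elim x)
      define a where "a = exp (2 * (k + 1) * (u x)\<^sup>2)"
      define b where "b = exp (2 * (k + 1) * (v x)\<^sup>2)"
      have w: "(\<bar>u x\<bar> + \<bar>v x\<bar>)\<^sup>2 \<le> 2 * (u x)\<^sup>2 + 2 * (v x)\<^sup>2"
        using zero_le_power2[of "\<bar>u x\<bar> - \<bar>v x\<bar>"] by (simp add: power2_eq_square algebra_simps)
      have ab: "a > 0" "b > 0" by (auto simp: a_def b_def)
      have e1: "exp (k * (\<bar>u x\<bar> + \<bar>v x\<bar>)\<^sup>2) \<le> a * b"
      proof -
        have "k * (\<bar>u x\<bar> + \<bar>v x\<bar>)\<^sup>2 \<le> (k + 1) * (\<bar>u x\<bar> + \<bar>v x\<bar>)\<^sup>2" by (intro mult_right_mono) auto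
        also have "\<dots> \<le> (k + 1) * (2 * (u x)\<^sup>2 + 2 * (v x)\<^sup>2)" using w k by (intro mult_left_mono) auto
        also have "\<dots> = 2 * (k + 1) * (u x)\<^sup>2 + 2 * (k + 1) * (v x)\<^sup>2" by (simp add: algebra_simps)
        finally show ?thesis by (simp add: a_def b_def exp_add[symmetric])
      qed
      have e2: "(\<bar>u x\<bar> + \<bar>v x\<bar>)\<^sup>2 * exp (k * (\<bar>u x\<bar> + \<bar>v x\<bar>)\<^sup>2) \<le> a * b"
      proof -
        have "(\<bar>u x\<bar> + \<bar>v x\<bar>)\<^sup>2 \<le> exp ((\<bar>u x\<bar> + \<bar>v x\<bar>)\<^sup>2)" using exp_ge_add_one_self[of "(\<bar>u x\<bar> + \<bar>v x\<bar>)\<^sup>2"] by linarith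
        then have "(\<bar>u x\<bar> + \<bar>v x\<bar>)\<^sup>2 * exp (k * (\<bar>u x\<bar> + \<bar>v x\<bar>)\<^sup>2) \<le> exp ((\<bar>u x\<bar> + \<bar>v x\<bar>)\<^sup>2) * exp (k * (\<bar>u x\<bar> + \<bar>v x\<bar>)\<^sup>2)"
          by (intro mult_right_mono) auto
        also have "\<dots> = exp ((k + 1) * (\<bar>u x\<bar> + \<bar>v x\<bar>)\<^sup>2)" by (simp add: exp_add[symmetric] algebra_simps)
        also have "\<dots> \<le> exp (2 * (k + 1) * (u x)\<^sup>2 + 2 * (k + 1) * (v x)\<^sup>2)"
        proof -
          have "(k + 1) * (\<bar>u x\<bar> + \<bar>v x\<bar>)\<^sup>2 \<le> (k + 1) * (2 * (u x)\<^sup>2 + 2 * (v x)\<^sup>2)" using w k by (intro mult_left_mono) auto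
          then show ?thesis by (simp add: algebra_simps)
        qed
        finally show ?thesis by (simp add: a_def b_def exp_add)
      qed
      have nx: "norm x > 0" using elim by simp
      have far: "norm x > d1 \<Longrightarrow> a \<le> M1" "norm x > d2 \<Longrightarrow> b \<le> M2"
        using elim k by (auto simp: a_def b_def M1_def M2_def intro!: max.coboundedI2 mult_left_mono)
      have nr: "norm x \<le> d1 \<Longrightarrow> a \<le> C1 * (1 / sqrt (norm x))" "norm x \<le> d2 \<Longrightarrow> b \<le> C2 * (1 / sqrt (norm x))"
        using elim by (auto simp: a_def b_def)
      have T1: "0 \<le> (C1 * C2) * (indicator (cball 0 (max d1 d2)) x / norm x)" "0 \<le> (C1 * M2 + C2 * M1) * (indicator (cball 0 (max d1 d2)) x * (1 + 1 / norm x))"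
        "0 \<le> (M1 * M2) * (2 * (u x)\<^sup>2 + 2 * (v x)\<^sup>2)" using 1(2) 2(2) M by (auto intro!: mult_nonneg_nonneg add_nonneg_nonneg)
      have "(\<bar>u x\<bar> + \<bar>v x\<bar>)\<^sup>2 * exp (k * (\<bar>u x\<bar> + \<bar>v x\<bar>)\<^sup>2) \<le> T x"
      proof -
        consider "norm x \<le> d1" "norm x \<le> d2" | "norm x \<le> d1" "norm x > d2" | "norm x > d1" "norm x \<le> d2" | "norm x > d1" "norm x > d2" by linarith
        then show ?thesis
        proof cases
          case 1
          have "a * b \<le> (C1 * (1 / sqrt (norm x))) * (C2 * (1 / sqrt (norm x)))" using nr 1 ab by (intro mult_mono) auto
          also have "\<dots> = (C1 * C2) * (indicator (cball 0 (max d1 d2)) x / norm x)" using 1 nx by (simp add: field_simps)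
          finally show ?thesis using e2 T1 unfolding T_def by linarith
        next
          case 2
          have "a * b \<le> (C1 * (1 / sqrt (norm x))) * M2" using nr far 2 ab \<open>C1 \<ge> 0\<close> nx by (intro mult_mono) auto
          also have "\<dots> \<le> (C1 * (1 + 1 / norm x)) * M2" using sq[OF nx] \<open>C1 \<ge> 0\<close> M by (intro mult_right_mono mult_left_mono) auto
          also have "\<dots> \<le> (C1 * M2 + C2 * M1) * (indicator (cball 0 (max d1 d2)) x * (1 + 1 / norm x))"
            using 2 \<open>C2 \<ge> 0\<close> M nx by (simp add: algebra_simps)
          finally show ?thesis using e2 T1 unfolding T_def by linarith
        next
          case 3
          have "a * b \<le> M1 * (C2 * (1 / sqrt (norm x)))" using nr far 3 ab M nx by (intro mult_mono) auto
          also have "\<dots> \<le> M1 * (C2 * (1 + 1 / norm x))" using sq[OF nx] \<open>C2 \<ge> 0\<close> M by (intro mult_left_mono) auto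
          also have "\<dots> \<le> (C1 * M2 + C2 * M1) * (indicator (cball 0 (max d1 d2)) x * (1 + 1 / norm x))"
            using 3 \<open>C1 \<ge> 0\<close> M nx by (simp add: algebra_simps)
          finally show ?thesis using e2 T1 unfolding T_def by linarith
        next
          case 4
          have "a * b \<le> M1 * M2" using far 4 ab M by (intro mult_mono) auto
          then have "exp (k * (\<bar>u x\<bar> + \<bar>v x\<bar>)\<^sup>2) \<le> M1 * M2" using e1 by linarith
          then have "(\<bar>u x\<bar> + \<bar>v x\<bar>)\<^sup>2 * exp (k * (\<bar>u x\<bar> + \<bar>v x\<bar>)\<^sup>2) \<le> (2 * (u x)\<^sup>2 + 2 * (v x)\<^sup>2) * (M1 * M2)"
            using w by (intro mult_mono) auto
          then show ?thesis using T1 unfolding T_def by (simp add: mult.commute)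
        qed
      qed
      then show ?case by (simp add: order_trans[OF _ abs_ge_self])
    qed
  qed measurable
qed

subsection \<open>The terms of the functional\<close>

lemma Holder_43_4:
  fixes g u :: "'a \<Rightarrow> real"
  assumes [measurable]: "g \<in> borel_measurable M" "u \<in> borel_measurable M"
    and g: "integrable M (\<lambda>x. \<bar>g x\<bar> powr (4/3))" and u: "integrable M (\<lambda>x. (u x)^4)"
  shows "integrable M (\<lambda>x. g x * u x)"
    and "(\<integral>x. \<bar>g x * u x\<bar> \<partial>M) \<le> (\<integral>x. \<bar>g x\<bar> powr (4/3) \<partial>M) powr (3/4) * (\<integral>x. (u x)^4 \<partial>M) powr (1/4)"
proof -
  have p4: "\<bar>y\<bar> powr 4 = y^4" for y :: real using powr_realpow'[of "\<bar>y\<bar>" 4] by simp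
  have Y: "a * b \<le> a powr (4/3) * (3/4) + b powr 4 / 4" if "a \<ge> 0" "b \<ge> 0" for a b :: real
    using Youngs_inequality[of "4/3" 4 a b] that by simp
  show I: "integrable M (\<lambda>x. g x * u x)"
  proof (rule Bochner_Integration.integrable_bound[where f = "\<lambda>x. \<bar>g x\<bar> powr (4/3) * (3/4) + (u x)^4 / 4"])
    show "integrable M (\<lambda>x. \<bar>g x\<bar> powr (4/3) * (3/4) + (u x)^4 / 4)" using g u by auto
    show "AE x in M. norm (g x * u x) \<le> norm (\<bar>g x\<bar> powr (4/3) * (3/4) + (u x)^4 / 4)"
      using Y[of "\<bar>g x\<bar>" "\<bar>u x\<bar>" for x] by (auto simp: abs_mult p4)
  qed measurable
  define A where "A = (\<integral>x. \<bar>g x\<bar> powr (4/3) \<partial>M)"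
  define B where "B = (\<integral>x. (u x)^4 \<partial>M)"
  have A0: "A \<ge> 0" and B0: "B \<ge> 0" by (auto simp: A_def B_def)
  show "(\<integral>x. \<bar>g x * u x\<bar> \<partial>M) \<le> (\<integral>x. \<bar>g x\<bar> powr (4/3) \<partial>M) powr (3/4) * (\<integral>x. (u x)^4 \<partial>M) powr (1/4)"
  proof (cases "A = 0 \<or> B = 0")
    case True
    then have "AE x in M. \<bar>g x * u x\<bar> = 0"
    proof
      assume "A = 0"
      then have "AE x in M. \<bar>g x\<bar> powr (4/3) = 0" unfolding A_def using g by (subst (asm) integral_nonneg_eq_0_iff_AE) auto
      then show ?thesis by eventually_elim auto
    next
      assume "B = 0"
      then have "AE x in M. (u x)^4 = 0" unfolding B_def using u by (subst (asm) integral_nonneg_eq_0_iff_AE) auto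
      then show ?thesis by eventually_elim auto
    qed
    then have "(\<integral>x. \<bar>g x * u x\<bar> \<partial>M) = 0" by (rule integral_eq_zero_AE)
    then show ?thesis by (simp add: A_def[symmetric] B_def[symmetric])
  next
    case False
    then have A: "A > 0" and B: "B > 0" using A0 B0 by auto
    define a where "a = A powr (3/4)"
    define b where "b = B powr (1/4)"
    have ab: "a > 0" "b > 0" using A B by (auto simp: a_def b_def)
    have aA: "a powr (4/3) = A" using A by (simp add: a_def powr_powr)
    have bB: "b powr 4 = B" using B by (simp add: b_def powr_powr)
    have pt: "\<bar>g x * u x\<bar> \<le> a * b * (\<bar>g x\<bar> powr (4/3) * (3/4) / A + (u x)^4 / 4 / B)" for x
    proof -
      have "(\<bar>g x\<bar> / a) * (\<bar>u x\<bar> / b) \<le> (\<bar>g x\<bar> / a) powr (4/3) * (3/4) + (\<bar>u x\<bar> / b) powr 4 / 4"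
        using ab by (intro Y) auto
      also have "\<dots> = \<bar>g x\<bar> powr (4/3) * (3/4) / A + (u x)^4 / 4 / B"
        using ab by (simp add: powr_divide aA bB p4)
      finally have "a * b * ((\<bar>g x\<bar> / a) * (\<bar>u x\<bar> / b)) \<le> a * b * (\<bar>g x\<bar> powr (4/3) * (3/4) / A + (u x)^4 / 4 / B)"
        using ab by (intro mult_left_mono) auto
      then show ?thesis using ab by (simp add: abs_mult field_simps)
    qed
    have "(\<integral>x. \<bar>g x * u x\<bar> \<partial>M) \<le> (\<integral>x. a * b * (\<bar>g x\<bar> powr (4/3) * (3/4) / A + (u x)^4 / 4 / B) \<partial>M)"
      using g u I by (intro integral_mono pt) auto
    also have "\<dots> = a * b * (A * (3/4) / A + B / 4 / B)" using g u by (simp add: A_def B_def)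
    also have "\<dots> = a * b" using A B by simp
    finally show ?thesis by (simp add: a_def b_def A_def B_def)
  qed
qed

lemma Lp_norm_4: "Lp_norm 4 u = (\<integral>x. (u x)^4 \<partial>lborel) powr (1/4)"
proof -
  have "\<bar>y\<bar> powr 4 = y^4" for y :: real using powr_realpow'[of "\<bar>y\<bar>" 4] by simp
  then show ?thesis by (simp add: Lp_norm_def)
qed

text \<open>The set of admissible constants contains 1 by \<open>L4_bound\<close>, so
  \<open>Inf\<close> is a genuine infimum. It is itself admissible: divide by the product of norms
  if that is positive; otherwise the constant 1 shows that the L^4 norm vanishes. Positivity follows
  from any single function with nonzero L^4 norm.\<close>

lemma C4_bound:
  assumes "H1 u"
  shows "Lp_norm 4 u \<le> C4 * L2_sq u powr (1/4) * grad_sq u powr (1/4)"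
    and "\<And>w. H1 w \<Longrightarrow> (\<integral>x. (w x)^4 \<partial>lborel) > 0 \<Longrightarrow> C4 > 0"
proof -
  define S where "S = {C. C \<ge> 0 \<and> (\<forall>u. H1 u \<longrightarrow> Lp_norm 4 u \<le> C * (L2_sq u) powr (1/4) * (grad_sq u) powr (1/4))}"
  have C4S: "C4 = Inf S" by (simp add: C4_def S_def)
  have one: "1 \<in> S"
    unfolding S_def
  proof (intro CollectI conjI allI impI)
    fix u assume "H1 u"
    note D = H1_D[OF this]
    have "(\<integral>x. (u x)^4 \<partial>lborel) powr (1/4) \<le> (L2_sq u * grad_sq u) powr (1/4)"
      using L4_bound(2)[OF D] by (intro powr_mono2) (auto simp: L2_sq_def grad_sq_def)
    then show "Lp_norm 4 u \<le> 1 * L2_sq u powr (1/4) * grad_sq u powr (1/4)"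
      using L2_sq_nonneg[of u] grad_sq_nonneg[of u] by (simp add: Lp_norm_4 powr_mult)
  qed simp
  have "S \<noteq> {}" using one by blast
  then have pos: "C4 \<ge> 0" unfolding C4S by (rule cInf_greatest) (simp add: S_def)
  have key: "Lp_norm 4 u \<le> C4 * (L2_sq u powr (1/4) * grad_sq u powr (1/4))" if u: "H1 u" for u
  proof (cases "L2_sq u powr (1/4) * grad_sq u powr (1/4) = 0")
    case True
    then show ?thesis using one u by (auto simp: S_def)
  next
    case False
    then have p: "L2_sq u powr (1/4) * grad_sq u powr (1/4) > 0" by (simp add: less_le)
    have "Lp_norm 4 u / (L2_sq u powr (1/4) * grad_sq u powr (1/4)) \<le> Inf S"
    proof (rule cInf_greatest)
      fix C assume "C \<in> S"
      then have "Lp_norm 4 u \<le> C * (L2_sq u powr (1/4) * grad_sq u powr (1/4))" using u by (auto simp: S_def mult.assoc)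
      then show "Lp_norm 4 u / (L2_sq u powr (1/4) * grad_sq u powr (1/4)) \<le> C" using p by (simp only: pos_divide_le_eq)
    qed (use one in blast)
    then show ?thesis using p by (simp only: pos_divide_le_eq C4S)
  qed
  then show "Lp_norm 4 u \<le> C4 * L2_sq u powr (1/4) * grad_sq u powr (1/4)" using assms by (simp add: mult.assoc)
  fix w assume w: "H1 w" "(\<integral>x. (w x)^4 \<partial>lborel) > 0"
  then have "Lp_norm 4 w > 0" by (simp add: Lp_norm_4)
  then have "0 < C4 * (L2_sq w powr (1/4) * grad_sq w powr (1/4))" using key[OF w(1)] by linarith
  then show "C4 > 0" using pos by (auto simp: zero_less_mult_iff)
qed

section \<open>The nonlocal term\<close>

definition ball_mass :: "(R2 \<Rightarrow> real) \<Rightarrow> R2 \<Rightarrow> real" where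
  "ball_mass w x = (\<integral>y. (if norm y \<le> norm x then w y else 0) \<partial>lborel) / (4 * pi)"

lemma ball_mass_measurable[measurable]:
  assumes [measurable]: "w \<in> borel_measurable borel"
  shows "ball_mass w \<in> borel_measurable borel"
  unfolding ball_mass_def by measurable

lemma integrable_ball_restrict:
  assumes "integrable lborel w" shows "integrable lborel (\<lambda>y. if norm y \<le> norm (x::R2) then w y else (0::real))"
proof -
  have e: "(if norm y \<le> norm x then w y else 0) = indicator (cball 0 (norm x)) y *\<^sub>R w y" for y
    by (auto split: split_indicator)
  show ?thesis unfolding e by (rule integrable_mult_indicator[OF _ assms]) simp
qed

text \<open>Cauchy-Schwarz on a disc of area pi |x|^2. The factor |x|^2 is exactly what cancels the
  singular weight in \<open>Bterm\<close>; 16 pi is (4 pi)^2/pi.\<close>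

lemma ball_mass_bound:
  assumes [measurable]: "w \<in> borel_measurable borel" and "integrable lborel (\<lambda>y. (w y)\<^sup>2)"
  shows "(ball_mass w x)\<^sup>2 \<le> (norm x)\<^sup>2 / (16 * pi) * (\<integral>y. (w y)\<^sup>2 \<partial>lborel)"
proof -
  let ?i = "\<lambda>y::R2. indicator (cball 0 (norm x)) y :: real"
  have m: "emeasure lborel (cball (0::R2) (norm x)) = ennreal (pi * (norm x)\<^sup>2)"
    using emeasure_cball[of "norm x" "0::R2"] by (simp add: unit_ball_vol_2)
  have iI: "integrable lborel (\<lambda>y. (?i y)\<^sup>2)" and iv: "(\<integral>y. (?i y)\<^sup>2 \<partial>lborel) = pi * (norm x)\<^sup>2"
    using m by (auto simp: power2_eq_square indicator_inter_arith[symmetric] measure_def)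
  have "(\<integral>y. ?i y * w y \<partial>lborel)\<^sup>2 \<le> (\<integral>y. (?i y)\<^sup>2 \<partial>lborel) * (\<integral>y. (w y)\<^sup>2 \<partial>lborel)"
    by (rule Cauchy_Schwarz_integral(2)[OF _ _ iI assms(2)]) (auto intro!: borel_measurable_indicator)
  then have 1: "(\<integral>y. ?i y * w y \<partial>lborel)\<^sup>2 / (4 * pi)\<^sup>2 \<le> (pi * (norm x)\<^sup>2) * (\<integral>y. (w y)\<^sup>2 \<partial>lborel) / (4 * pi)\<^sup>2"
    unfolding iv by (rule divide_right_mono) simp
  have "ball_mass w x = (\<integral>y. ?i y * w y \<partial>lborel) / (4 * pi)"
    unfolding ball_mass_def by (intro arg_cong2[where f = "(/)"] Bochner_Integration.integral_cong) (auto split: split_indicator)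
  then have "(ball_mass w x)\<^sup>2 \<le> (pi * (norm x)\<^sup>2) * (\<integral>y. (w y)\<^sup>2 \<partial>lborel) / (4 * pi)\<^sup>2"
    using 1 by (simp only: power_divide)
  also have "\<dots> = (norm x)\<^sup>2 / (16 * pi) * (\<integral>y. (w y)\<^sup>2 \<partial>lborel)"
    by (simp add: power2_eq_square)
  finally show ?thesis .
qed

text \<open>For w = u^2 the quantity \<open>ball_mass\<close> is h(|x|), the one-dimensional
  integral of s/2 times the squared profile, rewritten as an integral over a disc. In this form it
  is linear in w and does not mention the profile.\<close>

lemma Bterm_eq:
  assumes u: "H1r u"
  shows "Bterm u = (\<integral>x. (u x)\<^sup>2 / (norm x)\<^sup>2 * (ball_mass (\<lambda>y. (u y)\<^sup>2) x)\<^sup>2 \<partial>lborel)"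
proof -
  note D = H1r_D[OF u]
  note [measurable] = measurable_profile[OF D(1)]
  have "(LINT s:{0..norm x}|lborel. s / 2 * (profile u s)\<^sup>2) = ball_mass (\<lambda>y. (u y)\<^sup>2) x" for x
  proof -
    have "(\<integral>y. (if norm y \<le> norm x then (u y)\<^sup>2 else 0) \<partial>lborel) = (\<integral>y. (if norm (y::R2) \<le> norm x then (profile u (norm y))\<^sup>2 else 0) \<partial>lborel)"
      using radial_profile_norm[OF D(4)] by (intro Bochner_Integration.integral_cong refl) metis
    also have "\<dots> = (\<integral>r. (2 * pi * r * indicator {0..} r) * (if r \<le> norm x then (profile u r)\<^sup>2 else 0) \<partial>lborel)"
      by (rule integral_norm_R2(1)) measurable
    also have "\<dots> = (\<integral>r. (4 * pi) * (indicator {0..norm x} r * (r / 2 * (profile u r)\<^sup>2)) \<partial>lborel)"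
      by (intro Bochner_Integration.integral_cong refl) (auto split: split_indicator)
    also have "\<dots> = (4 * pi) * (LINT s:{0..norm x}|lborel. s / 2 * (profile u s)\<^sup>2)"
      unfolding set_lebesgue_integral_def by (simp only: integral_mult_right_zero real_scaleR_def)
    finally show ?thesis by (simp add: ball_mass_def)
  qed
  then show ?thesis by (simp add: Bterm_def)
qed

lemma Bterm_nonneg: "Bterm u \<ge> 0" by (auto simp: Bterm_def)

lemma H1r_lincomb:
  assumes u: "H1r u" and v: "H1r v"
  shows "H1r (\<lambda>x. a * u x + b * v x)"
    and "grad_sq (\<lambda>x. a * u x + b * v x) = a\<^sup>2 * grad_sq u + 2 * a * b * (\<integral>x. wgrad u x \<bullet> wgrad v x \<partial>lborel) + b\<^sup>2 * grad_sq v"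
    and "L2_sq (\<lambda>x. a * u x + b * v x) = a\<^sup>2 * L2_sq u + 2 * a * b * (\<integral>x. u x * v x \<partial>lborel) + b\<^sup>2 * L2_sq v"
proof -
  note Du = H1r_D[OF u] and Dv = H1r_D[OF v]
  note [measurable] = Du(1) Dv(1)
  note L = L2_grad_lincomb[OF Du(1-3) Dv(1-3), of a b]
  show "H1r (\<lambda>x. a * u x + b * v x)"
  proof (rule H1r_I[OF _ _ L(1)])
    show "integrable lborel (\<lambda>x. (a * u x + b * v x)\<^sup>2)" by (rule integrable_square_lincomb) (use Du Dv in auto)
    show "radial (\<lambda>x. a * u x + b * v x)" using Du(4) Dv(4) unfolding radial_def by metis
  qed measurable
  show "grad_sq (\<lambda>x. a * u x + b * v x) = a\<^sup>2 * grad_sq u + 2 * a * b * (\<integral>x. wgrad u x \<bullet> wgrad v x \<partial>lborel) + b\<^sup>2 * grad_sq v"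
    unfolding grad_sq_eq[OF L(1)] L(2) by (simp add: grad_sq_def)
  show "L2_sq (\<lambda>x. a * u x + b * v x) = a\<^sup>2 * L2_sq u + 2 * a * b * (\<integral>x. u x * v x \<partial>lborel) + b\<^sup>2 * L2_sq v"
    unfolding L2_sq_def by (rule integrable_square_lincomb(2)) (use Du Dv in auto)
qed

text \<open>The density is quadratic in the function and the squared inner mass is quartic, so B is
  a homogeneous polynomial of degree six on the span of u and v. Its derivatives then need no limit
  theorem; of the coefficients only that of a^6 matters by name.\<close>

lemma Bterm_lincomb:
  assumes u: "H1r u" and v: "H1r v"
  obtains k1 k2 k3 k4 k5 k6 where
    "\<And>a b. Bterm (\<lambda>x. a * u x + b * v x) = a^6 * Bterm u + a^5 * b * k1 + a^4 * b^2 * k2 + a^3 * b^3 * k3 + a^2 * b^4 * k4 + a * b^5 * k5 + b^6 * k6"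
proof -
  note Du = H1r_D[OF u] and Dv = H1r_D[OF v]
  note um[measurable] = Du(1) Dv(1)
  have sq4: "((y::real)\<^sup>2)\<^sup>2 = y^4" for y by (simp flip: power_mult)
  have w11: "integrable lborel (\<lambda>x. ((u x)\<^sup>2)\<^sup>2)" and w22: "integrable lborel (\<lambda>x. ((v x)\<^sup>2)\<^sup>2)"
    using H1r_L4(1)[OF u] H1r_L4(1)[OF v] by (simp_all add: sq4)
  have w12: "integrable lborel (\<lambda>x. (u x * v x)\<^sup>2)"
    using Cauchy_Schwarz_integral(1)[OF _ _ w11 w22] by (simp add: power_mult_distrib)
  have uv: "integrable lborel (\<lambda>x. u x * v x)" by (rule integrable_mult_L2) (use Du Dv in auto)
  define h1 where "h1 = ball_mass (\<lambda>x. (u x)\<^sup>2)"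
  define h2 where "h2 = ball_mass (\<lambda>x. u x * v x)"
  define h3 where "h3 = ball_mass (\<lambda>x. (v x)\<^sup>2)"
  have [measurable]: "h1 \<in> borel_measurable borel" "h2 \<in> borel_measurable borel" "h3 \<in> borel_measurable borel"
    unfolding h1_def h2_def h3_def by measurable
  \<comment> \<open>A common constant: each of the three masses h1, h2, h3 is at most sqrt(K) |x|,
    so all products in the expansion are dominated by K (u^2 + v^2).\<close>
  define K where "K = ((\<integral>x. ((u x)\<^sup>2)\<^sup>2 \<partial>lborel) + (\<integral>x. (u x * v x)\<^sup>2 \<partial>lborel) + (\<integral>x. ((v x)\<^sup>2)\<^sup>2 \<partial>lborel)) / (16 * pi)"
  have K0: "K \<ge> 0" by (auto simp: K_def intro!: divide_nonneg_nonneg add_nonneg_nonneg)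
  have hb: "\<bar>h x\<bar> \<le> sqrt K * norm x" if h: "h = h1 \<or> h = h2 \<or> h = h3" for h x
  proof -
    have "(h x)\<^sup>2 \<le> K * (norm x)\<^sup>2"
    proof -
      have I0: "(\<integral>x. ((u x)\<^sup>2)\<^sup>2 \<partial>lborel) \<ge> 0" "(\<integral>x. (u x * v x)\<^sup>2 \<partial>lborel) \<ge> 0" "(\<integral>x. ((v x)\<^sup>2)\<^sup>2 \<partial>lborel) \<ge> 0" by auto
      have "(h x)\<^sup>2 \<le> (norm x)\<^sup>2 / (16 * pi) * ((\<integral>x. ((u x)\<^sup>2)\<^sup>2 \<partial>lborel) + (\<integral>x. (u x * v x)\<^sup>2 \<partial>lborel) + (\<integral>x. ((v x)\<^sup>2)\<^sup>2 \<partial>lborel))"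
        using h
      proof (elim disjE)
        assume "h = h1"
        then have "(h x)\<^sup>2 \<le> (norm x)\<^sup>2 / (16 * pi) * (\<integral>x. ((u x)\<^sup>2)\<^sup>2 \<partial>lborel)" unfolding h1_def using ball_mass_bound[OF _ w11] by simp
        also have "\<dots> \<le> (norm x)\<^sup>2 / (16 * pi) * ((\<integral>x. ((u x)\<^sup>2)\<^sup>2 \<partial>lborel) + (\<integral>x. (u x * v x)\<^sup>2 \<partial>lborel) + (\<integral>x. ((v x)\<^sup>2)\<^sup>2 \<partial>lborel))"
          using I0 by (intro mult_left_mono) auto
        finally show ?thesis .
      next
        assume "h = h2"
        then have "(h x)\<^sup>2 \<le> (norm x)\<^sup>2 / (16 * pi) * (\<integral>x. (u x * v x)\<^sup>2 \<partial>lborel)" unfolding h2_def using ball_mass_bound[OF _ w12] by simp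
        also have "\<dots> \<le> (norm x)\<^sup>2 / (16 * pi) * ((\<integral>x. ((u x)\<^sup>2)\<^sup>2 \<partial>lborel) + (\<integral>x. (u x * v x)\<^sup>2 \<partial>lborel) + (\<integral>x. ((v x)\<^sup>2)\<^sup>2 \<partial>lborel))"
          using I0 by (intro mult_left_mono) auto
        finally show ?thesis .
      next
        assume "h = h3"
        then have "(h x)\<^sup>2 \<le> (norm x)\<^sup>2 / (16 * pi) * (\<integral>x. ((v x)\<^sup>2)\<^sup>2 \<partial>lborel)" unfolding h3_def using ball_mass_bound[OF _ w22] by simp
        also have "\<dots> \<le> (norm x)\<^sup>2 / (16 * pi) * ((\<integral>x. ((u x)\<^sup>2)\<^sup>2 \<partial>lborel) + (\<integral>x. (u x * v x)\<^sup>2 \<partial>lborel) + (\<integral>x. ((v x)\<^sup>2)\<^sup>2 \<partial>lborel))"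
          using I0 by (intro mult_left_mono) auto
        finally show ?thesis .
      qed
      then show ?thesis by (simp add: K_def field_simps)
    qed
    then have "sqrt ((h x)\<^sup>2) \<le> sqrt (K * (norm x)\<^sup>2)" by (rule real_sqrt_le_mono)
    then show ?thesis by (simp add: real_sqrt_mult)
  qed
  have TI: "integrable lborel (\<lambda>x. X x / (norm x)\<^sup>2 * (h x * h' x))"
    if X[measurable]: "X \<in> borel_measurable borel" and Xb: "\<And>x. \<bar>X x\<bar> \<le> (u x)\<^sup>2 + (v x)\<^sup>2" and h: "h = h1 \<or> h = h2 \<or> h = h3" and h': "h' = h1 \<or> h' = h2 \<or> h' = h3" for X h h'
  proof (rule Bochner_Integration.integrable_bound[OF integrable_mult_right[OF Bochner_Integration.integrable_add[OF Du(2) Dv(2)], of K]])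
    have [measurable]: "h \<in> borel_measurable borel" "h' \<in> borel_measurable borel" using h h' by auto
    show "(\<lambda>x. X x / (norm x)\<^sup>2 * (h x * h' x)) \<in> borel_measurable lborel" by measurable
    have "\<bar>X x / (norm x)\<^sup>2 * (h x * h' x)\<bar> \<le> K * ((u x)\<^sup>2 + (v x)\<^sup>2)" for x
    proof (cases "x = 0")
      case False
      have "\<bar>h x\<bar> * \<bar>h' x\<bar> \<le> (sqrt K * norm x) * (sqrt K * norm x)" using hb[OF h] hb[OF h'] K0 by (intro mult_mono) auto
      also have "\<dots> = K * (norm x)\<^sup>2" using K0 by (simp add: power2_eq_square mult_ac)
      finally have "\<bar>X x\<bar> / (norm x)\<^sup>2 * (\<bar>h x\<bar> * \<bar>h' x\<bar>) \<le> \<bar>X x\<bar> / (norm x)\<^sup>2 * (K * (norm x)\<^sup>2)" by (intro mult_left_mono) auto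
      also have "\<dots> = K * \<bar>X x\<bar>" using False by simp
      also have "\<dots> \<le> K * ((u x)\<^sup>2 + (v x)\<^sup>2)" using Xb K0 by (intro mult_left_mono) auto
      finally show ?thesis by (simp add: abs_mult)
    qed (use K0 in simp)
    then show "AE x in lborel. norm (X x / (norm x)\<^sup>2 * (h x * h' x)) \<le> norm (K * ((u x)\<^sup>2 + (v x)\<^sup>2))" using K0 by simp
  qed
  have uvb: "\<bar>u x * v x\<bar> \<le> (u x)\<^sup>2 + (v x)\<^sup>2" for x
    using sum_squares_bound[of "\<bar>u x\<bar>" "\<bar>v x\<bar>"] abs_ge_zero[of "u x * v x"] unfolding abs_mult power2_abs by linarith
  define T1 where "T1 h h' x = (u x)\<^sup>2 / (norm x)\<^sup>2 * (h x * h' x)" for h h' :: "R2 \<Rightarrow> real" and x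
  define T2 where "T2 h h' x = (u x * v x) / (norm x)\<^sup>2 * (h x * h' x)" for h h' :: "R2 \<Rightarrow> real" and x
  define T3 where "T3 h h' x = (v x)\<^sup>2 / (norm x)\<^sup>2 * (h x * h' x)" for h h' :: "R2 \<Rightarrow> real" and x
  have I1: "integrable lborel (T1 h h')" and I2: "integrable lborel (T2 h h')" and I3: "integrable lborel (T3 h h')"
    if h: "h = h1 \<or> h = h2 \<or> h = h3" and h': "h' = h1 \<or> h' = h2 \<or> h' = h3" for h h'
    unfolding T1_def[abs_def] T2_def[abs_def] T3_def[abs_def] using uvb by (intro TI h h'; simp)+
  let ?J = "integral\<^sup>L lborel"
  have hlin: "ball_mass (\<lambda>y. (a * u y + b * v y)\<^sup>2) x = a\<^sup>2 * h1 x + 2 * a * b * h2 x + b\<^sup>2 * h3 x" for a b x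
  proof -
    note J = integrable_ball_restrict[OF Du(2), of x] integrable_ball_restrict[OF Dv(2), of x] integrable_ball_restrict[OF uv, of x]
    have "(\<integral>y. (if norm y \<le> norm x then (a * u y + b * v y)\<^sup>2 else 0) \<partial>lborel) =
      (\<integral>y. a\<^sup>2 * (if norm y \<le> norm x then (u y)\<^sup>2 else 0) + (2 * a * b) * (if norm y \<le> norm x then u y * v y else 0) + b\<^sup>2 * (if norm y \<le> norm x then (v y)\<^sup>2 else 0) \<partial>lborel)"
      by (intro Bochner_Integration.integral_cong) (auto simp: power2_eq_square algebra_simps)
    also have "\<dots> = a\<^sup>2 * (\<integral>y. (if norm y \<le> norm x then (u y)\<^sup>2 else 0) \<partial>lborel) + (2 * a * b) * (\<integral>y. (if norm y \<le> norm x then u y * v y else 0) \<partial>lborel) + b\<^sup>2 * (\<integral>y. (if norm y \<le> norm x then (v y)\<^sup>2 else 0) \<partial>lborel)"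
      using J by (simp only: Bochner_Integration.integral_add Bochner_Integration.integrable_add integrable_mult_right integral_mult_right_zero)
    finally show ?thesis by (simp add: ball_mass_def h1_def h2_def h3_def add_divide_distrib)
  qed
  have "Bterm (\<lambda>x. a * u x + b * v x) = a^6 * Bterm u + a^5 * b * (4 * ?J (T1 h1 h2) + 2 * ?J (T2 h1 h1))
     + a^4 * b^2 * (4 * ?J (T1 h2 h2) + 2 * ?J (T1 h1 h3) + 8 * ?J (T2 h1 h2) + ?J (T3 h1 h1))
     + a^3 * b^3 * (4 * ?J (T1 h2 h3) + 8 * ?J (T2 h2 h2) + 4 * ?J (T2 h1 h3) + 4 * ?J (T3 h1 h2))
     + a^2 * b^4 * (?J (T1 h3 h3) + 8 * ?J (T2 h2 h3) + 4 * ?J (T3 h2 h2) + 2 * ?J (T3 h1 h3))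
     + a * b^5 * (2 * ?J (T2 h3 h3) + 4 * ?J (T3 h2 h3)) + b^6 * ?J (T3 h3 h3)" for a b
  proof -
    have B: "Bterm u = ?J (T1 h1 h1)" unfolding Bterm_eq[OF u] T1_def h1_def by (simp add: power2_eq_square)
    have pt: "(a * u x + b * v x)\<^sup>2 / (norm x)\<^sup>2 * (a\<^sup>2 * h1 x + 2 * a * b * h2 x + b\<^sup>2 * h3 x)\<^sup>2 =
      a^6 * T1 h1 h1 x + a^5 * b * (4 * T1 h1 h2 x + 2 * T2 h1 h1 x)
     + a^4 * b^2 * (4 * T1 h2 h2 x + 2 * T1 h1 h3 x + 8 * T2 h1 h2 x + T3 h1 h1 x)
     + a^3 * b^3 * (4 * T1 h2 h3 x + 8 * T2 h2 h2 x + 4 * T2 h1 h3 x + 4 * T3 h1 h2 x)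
     + a^2 * b^4 * (T1 h3 h3 x + 8 * T2 h2 h3 x + 4 * T3 h2 h2 x + 2 * T3 h1 h3 x)
     + a * b^5 * (2 * T2 h3 h3 x + 4 * T3 h2 h3 x) + b^6 * T3 h3 h3 x" for x
    proof -
      define N where "N = 1 / (norm x)\<^sup>2"
      have d: "y / (norm x)\<^sup>2 = y * N" for y by (simp add: N_def)
      show ?thesis unfolding T1_def T2_def T3_def d by algebra
    qed
    have "Bterm (\<lambda>x. a * u x + b * v x) = (\<integral>x. (a * u x + b * v x)\<^sup>2 / (norm x)\<^sup>2 * (a\<^sup>2 * h1 x + 2 * a * b * h2 x + b\<^sup>2 * h3 x)\<^sup>2 \<partial>lborel)"
      unfolding Bterm_eq[OF H1r_lincomb(1)[OF u v]] hlin ..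
    also have "\<dots> = a^6 * Bterm u + a^5 * b * (4 * ?J (T1 h1 h2) + 2 * ?J (T2 h1 h1))
     + a^4 * b^2 * (4 * ?J (T1 h2 h2) + 2 * ?J (T1 h1 h3) + 8 * ?J (T2 h1 h2) + ?J (T3 h1 h1))
     + a^3 * b^3 * (4 * ?J (T1 h2 h3) + 8 * ?J (T2 h2 h2) + 4 * ?J (T2 h1 h3) + 4 * ?J (T3 h1 h2))
     + a^2 * b^4 * (?J (T1 h3 h3) + 8 * ?J (T2 h2 h3) + 4 * ?J (T3 h2 h2) + 2 * ?J (T3 h1 h3))
     + a * b^5 * (2 * ?J (T2 h3 h3) + 4 * ?J (T3 h2 h3)) + b^6 * ?J (T3 h3 h3)"
      unfolding pt B
      by (simp only: I1 I2 I3 simp_thms Bochner_Integration.integral_add Bochner_Integration.integrable_add integrable_mult_right integral_mult_right_zero)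
    finally show ?thesis .
  qed
  then show ?thesis by (rule that)
qed

lemma Bterm_le:
  assumes u: "H1r u"
  shows "Bterm u \<le> L2_sq u / (16 * pi) * (\<integral>x. (u x)^4 \<partial>lborel)"
    and "integrable lborel (\<lambda>x. (u x)\<^sup>2 / (norm x)\<^sup>2 * (ball_mass (\<lambda>y. (u y)\<^sup>2) x)\<^sup>2)"
proof -
  note D = H1r_D[OF u]
  note [measurable] = D(1)
  have sq4: "((y::real)\<^sup>2)\<^sup>2 = y^4" for y by (simp flip: power_mult)
  define K where "K = (\<integral>x. (u x)^4 \<partial>lborel) / (16 * pi)"
  have K0: "K \<ge> 0" by (simp add: K_def)
  have pt: "(u x)\<^sup>2 / (norm x)\<^sup>2 * (ball_mass (\<lambda>y. (u y)\<^sup>2) x)\<^sup>2 \<le> K * (u x)\<^sup>2" for x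
  proof (cases "x = 0")
    case False
    have "(ball_mass (\<lambda>y. (u y)\<^sup>2) x)\<^sup>2 \<le> K * (norm x)\<^sup>2"
      using ball_mass_bound[of "\<lambda>y. (u y)\<^sup>2" x] H1r_L4(1)[OF u] by (simp add: sq4 K_def mult.commute)
    then have "(u x)\<^sup>2 / (norm x)\<^sup>2 * (ball_mass (\<lambda>y. (u y)\<^sup>2) x)\<^sup>2 \<le> (u x)\<^sup>2 / (norm x)\<^sup>2 * (K * (norm x)\<^sup>2)" by (intro mult_left_mono) auto
    then show ?thesis using False by (simp add: mult.commute)
  qed (simp add: K0)
  show I: "integrable lborel (\<lambda>x. (u x)\<^sup>2 / (norm x)\<^sup>2 * (ball_mass (\<lambda>y. (u y)\<^sup>2) x)\<^sup>2)"
    by (rule Bochner_Integration.integrable_bound[OF integrable_mult_right[OF D(2), of K]])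
      (use pt in \<open>auto intro: order_trans[OF _ abs_ge_self]\<close>)
  have "Bterm u \<le> (\<integral>x. K * (u x)\<^sup>2 \<partial>lborel)" unfolding Bterm_eq[OF u]
    by (rule integral_mono[OF I integrable_mult_right[OF D(2)] pt])
  then show "Bterm u \<le> L2_sq u / (16 * pi) * (\<integral>x. (u x)^4 \<partial>lborel)" by (simp add: K_def L2_sq_def mult.commute)
qed

section \<open>The exponential term\<close>

definition exp_excess :: "real \<Rightarrow> real" where "exp_excess y = exp (y\<^sup>2) - 1 - y\<^sup>2"

definition exp_excess' :: "real \<Rightarrow> real" where "exp_excess' y = 2 * y * (exp (y\<^sup>2) - 1)"

lemma exp_excess_measurable[measurable]: "exp_excess \<in> borel_measurable borel" "exp_excess' \<in> borel_measurable borel"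
  unfolding exp_excess_def[abs_def] exp_excess'_def[abs_def] by measurable

lemma exp_excess_deriv: "(exp_excess has_real_derivative exp_excess' y) (at y)"
  unfolding exp_excess_def[abs_def] exp_excess'_def by (auto intro!: derivative_eq_intros simp: algebra_simps)

lemma exp_excess_nonneg: "exp_excess y \<ge> 0"
  using exp_ge_add_one_self[of "y\<^sup>2"] unfolding exp_excess_def by linarith

lemma exp_excess_ge: "exp_excess y \<ge> y^4 / 2"
proof -
  have "1 + y\<^sup>2 + (y\<^sup>2)\<^sup>2 / 2 \<le> exp (y\<^sup>2)" by (rule exp_lower_Taylor_quadratic) simp
  then show ?thesis by (simp add: exp_excess_def flip: power_mult)
qed

lemma exp_minus_one_le: "exp t - 1 \<le> t * exp t" if "t \<ge> 0" for t :: real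
proof -
  have "1 - t \<le> exp (-t)" using exp_ge_add_one_self[of "-t"] by linarith
  then have "(1 - t) * exp t \<le> exp (-t) * exp t" by (intro mult_right_mono) auto
  then show ?thesis by (simp add: algebra_simps flip: exp_add)
qed

text \<open>The second bound keeps y^4: where y^2 is small, one factor y^2 can be spent as smallness
  while the other stays integrable. It holds because its defect F in t = y^2 vanishes at 0 and has
  nonnegative derivative.\<close>

lemma exp_excess_le: "exp_excess y \<le> y\<^sup>2 * exp (y\<^sup>2)" "exp_excess y \<le> y^4 / 2 * exp (y\<^sup>2)"
proof -
  show "exp_excess y \<le> y\<^sup>2 * exp (y\<^sup>2)" using exp_minus_one_le[of "y\<^sup>2"] zero_le_power2[of y] unfolding exp_excess_def by linarith
  define F where "F t = t\<^sup>2 / 2 * exp t - exp t + 1 + t" for t :: real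
  have "F 0 \<le> F t" if t: "t \<ge> 0" for t
  proof (rule DERIV_nonneg_imp_nondecreasing[OF t])
    fix x :: real assume x: "0 \<le> x" "x \<le> t"
    have "(F has_real_derivative (x * exp x + x\<^sup>2 / 2 * exp x - exp x + 1)) (at x)"
      unfolding F_def by (auto intro!: derivative_eq_intros simp: power2_eq_square)
    moreover have "0 \<le> x\<^sup>2 / 2 * exp x" by simp
    then have "x * exp x + x\<^sup>2 / 2 * exp x - exp x + 1 \<ge> 0" using exp_minus_one_le[OF x(1)] by linarith
    ultimately show "\<exists>y. (F has_real_derivative y) (at x) \<and> 0 \<le> y" by blast
  qed
  from this[of "y\<^sup>2"] show "exp_excess y \<le> y^4 / 2 * exp (y\<^sup>2)"
    by (simp add: F_def exp_excess_def flip: power_mult)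
qed

text \<open>A quadratic remainder with explicit constant, from the bound 4 exp(2 M^2) on the second
  derivative. The constant has to be explicit because M will depend on the point x.\<close>

lemma exp_excess_taylor:
  assumes "\<bar>y\<bar> \<le> M" "\<bar>y + z\<bar> \<le> M"
  shows "\<bar>exp_excess (y + z) - exp_excess y - exp_excess' y * z\<bar> \<le> 4 * exp (2 * M\<^sup>2) * z\<^sup>2"
proof -
  define B where "B = 4 * exp (2 * M\<^sup>2)"
  have d2: "(exp_excess' has_real_derivative (2 * (exp (s\<^sup>2) - 1) + 4 * s\<^sup>2 * exp (s\<^sup>2))) (at s)" for s
    unfolding exp_excess'_def[abs_def] by (auto intro!: derivative_eq_intros simp: power2_eq_square algebra_simps)
  have b2: "\<bar>2 * (exp (s\<^sup>2) - 1) + 4 * s\<^sup>2 * exp (s\<^sup>2)\<bar> \<le> B" if s: "\<bar>s\<bar> \<le> M" for s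
  proof -
    have "s\<^sup>2 \<le> M\<^sup>2" using s by (simp add: abs_le_square_iff[symmetric])
    have "exp (s\<^sup>2) - 1 \<ge> 0" by simp
    then have "\<bar>2 * (exp (s\<^sup>2) - 1) + 4 * s\<^sup>2 * exp (s\<^sup>2)\<bar> = 2 * (exp (s\<^sup>2) - 1) + 4 * s\<^sup>2 * exp (s\<^sup>2)" by (intro abs_of_nonneg add_nonneg_nonneg mult_nonneg_nonneg) auto
    also have "\<dots> \<le> 4 * ((1 + s\<^sup>2) * exp (s\<^sup>2))" by (simp add: algebra_simps add_increasing)
    also have "\<dots> \<le> 4 * (exp (s\<^sup>2) * exp (s\<^sup>2))" using exp_ge_add_one_self[of "s\<^sup>2"] by (intro mult_left_mono mult_right_mono) auto
    also have "\<dots> = 4 * exp (2 * s\<^sup>2)" by (simp flip: exp_add)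
    also have "\<dots> \<le> B" using \<open>s\<^sup>2 \<le> M\<^sup>2\<close> by (simp add: B_def)
    finally show ?thesis .
  qed
  have L: "\<bar>exp_excess' s - exp_excess' y\<bar> \<le> B * \<bar>s - y\<bar>" if "\<bar>s\<bar> \<le> M" for s
  proof -
    have "norm (exp_excess' s - exp_excess' y) \<le> B * norm (s - y)"
      by (rule field_differentiable_bound[of "{-M..M}" exp_excess' "\<lambda>s. 2 * (exp (s\<^sup>2) - 1) + 4 * s\<^sup>2 * exp (s\<^sup>2)"])
        (use d2 b2 that assms in \<open>auto intro: has_field_derivative_at_within\<close>)
    then show ?thesis by simp
  qed
  have seg: "\<bar>s\<bar> \<le> M \<and> \<bar>s - y\<bar> \<le> \<bar>z\<bar>" if "s \<in> closed_segment y (y + z)" for s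
    using that assms by (auto simp: closed_segment_eq_real_ivl split: if_splits)
  have "norm ((exp_excess (y + z) - exp_excess' y * (y + z)) - (exp_excess y - exp_excess' y * y)) \<le> (B * \<bar>z\<bar>) * norm (y + z - y)"
  proof (rule field_differentiable_bound[of "closed_segment y (y + z)" "\<lambda>s. exp_excess s - exp_excess' y * s" "\<lambda>s. exp_excess' s - exp_excess' y"])
    fix s assume s: "s \<in> closed_segment y (y + z)"
    show "((\<lambda>s. exp_excess s - exp_excess' y * s) has_field_derivative exp_excess' s - exp_excess' y) (at s within closed_segment y (y + z))"
      by (rule has_field_derivative_at_within) (auto intro!: derivative_eq_intros exp_excess_deriv)
    have "B \<ge> 0" by (simp add: B_def)
    then have "B * \<bar>s - y\<bar> \<le> B * \<bar>z\<bar>" using seg[OF s] by (intro mult_left_mono) auto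
    then show "norm (exp_excess' s - exp_excess' y) \<le> B * \<bar>z\<bar>" using L[of s] seg[OF s] by simp
  qed auto
  then show ?thesis by (simp add: B_def algebra_simps power2_eq_square flip: abs_mult)
qed

lemma exp_excess_integrable:
  assumes u: "H1r u"
  shows "integrable lborel (\<lambda>x. exp_excess (u x))"
proof (rule Bochner_Integration.integrable_bound[OF H1r_exp_integrable[OF u u, of 1]])
  note [measurable] = H1r_D(1)[OF u]
  show "(\<lambda>x. exp_excess (u x)) \<in> borel_measurable lborel" by measurable
  have "exp_excess (u x) \<le> (\<bar>u x\<bar> + \<bar>u x\<bar>)\<^sup>2 * exp (1 * (\<bar>u x\<bar> + \<bar>u x\<bar>)\<^sup>2)" for x
  proof -
    have w: "(u x)\<^sup>2 \<le> (\<bar>u x\<bar> + \<bar>u x\<bar>)\<^sup>2" by (simp add: abs_le_square_iff[symmetric])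
    have "exp_excess (u x) \<le> (u x)\<^sup>2 * exp ((u x)\<^sup>2)" by (rule exp_excess_le)
    also have "\<dots> \<le> (\<bar>u x\<bar> + \<bar>u x\<bar>)\<^sup>2 * exp (1 * (\<bar>u x\<bar> + \<bar>u x\<bar>)\<^sup>2)" using w by (intro mult_mono) auto
    finally show ?thesis .
  qed
  then show "AE x in lborel. norm (exp_excess (u x)) \<le> norm ((\<bar>u x\<bar> + \<bar>u x\<bar>)\<^sup>2 * exp (1 * (\<bar>u x\<bar> + \<bar>u x\<bar>)\<^sup>2))"
    using exp_excess_nonneg by simp
qed simp

lemma exp_excess_deriv_integrable:
  assumes u: "H1r u" and v: "H1r v"
  shows "integrable lborel (\<lambda>x. exp_excess' (u x) * v x)"
proof (rule Bochner_Integration.integrable_bound[OF integrable_mult_right[OF H1r_exp_integrable[OF u v, of 1], of 2]])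
  note [measurable] = H1r_D(1)[OF u] H1r_D(1)[OF v]
  show "(\<lambda>x. exp_excess' (u x) * v x) \<in> borel_measurable lborel" by measurable
  have "\<bar>exp_excess' (u x) * v x\<bar> \<le> 2 * ((\<bar>u x\<bar> + \<bar>v x\<bar>)\<^sup>2 * exp (1 * (\<bar>u x\<bar> + \<bar>v x\<bar>)\<^sup>2))" for x
  proof -
    have w: "(u x)\<^sup>2 \<le> (\<bar>u x\<bar> + \<bar>v x\<bar>)\<^sup>2" by (simp add: abs_le_square_iff[symmetric])
    have "\<bar>exp_excess' (u x) * v x\<bar> = 2 * ((\<bar>u x\<bar> * \<bar>v x\<bar>) * (exp ((u x)\<^sup>2) - 1))"
      by (simp add: exp_excess'_def abs_mult)
    also have "\<dots> \<le> 2 * ((\<bar>u x\<bar> + \<bar>v x\<bar>)\<^sup>2 * exp (1 * (\<bar>u x\<bar> + \<bar>v x\<bar>)\<^sup>2))"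
    proof (intro mult_left_mono mult_mono)
      show "\<bar>u x\<bar> * \<bar>v x\<bar> \<le> (\<bar>u x\<bar> + \<bar>v x\<bar>)\<^sup>2" by (simp add: power2_eq_square algebra_simps)
      have "exp ((u x)\<^sup>2) \<le> exp (1 * (\<bar>u x\<bar> + \<bar>v x\<bar>)\<^sup>2)" using w by simp
      then show "exp ((u x)\<^sup>2) - 1 \<le> exp (1 * (\<bar>u x\<bar> + \<bar>v x\<bar>)\<^sup>2)" by linarith
    qed auto
    finally show ?thesis .
  qed
  then show "AE x in lborel. norm (exp_excess' (u x) * v x) \<le> norm (2 * ((\<bar>u x\<bar> + \<bar>v x\<bar>)\<^sup>2 * exp (1 * (\<bar>u x\<bar> + \<bar>v x\<bar>)\<^sup>2)))"
    by (simp add: order_trans[OF _ abs_ge_self])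
qed simp

text \<open>Both coefficients vary, because the curves used later rescale u while adding a multiple
  of v.\<close>

lemma exp_excess_remainder:
  assumes u: "H1r u" and v: "H1r v"
  obtains W where "\<And>a b. \<bar>a - 1\<bar> \<le> 1 \<Longrightarrow> \<bar>b\<bar> \<le> 1 \<Longrightarrow>
    \<bar>(\<integral>x. exp_excess (a * u x + b * v x) \<partial>lborel) - (\<integral>x. exp_excess (u x) \<partial>lborel)
      - (a - 1) * (\<integral>x. exp_excess' (u x) * u x \<partial>lborel) - b * (\<integral>x. exp_excess' (u x) * v x \<partial>lborel)\<bar> \<le> W * (\<bar>a - 1\<bar> + \<bar>b\<bar>)\<^sup>2"
proof -
  \<comment> \<open>For |a - 1|, |b| \<le> 1 all arguments are at most M = 2 (|u| + |v|), and 2 M^2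
    = 8 (|u| + |v|)^2 is the exponent.\<close>
  define w where "w x = (\<bar>u x\<bar> + \<bar>v x\<bar>)\<^sup>2 * exp (8 * (\<bar>u x\<bar> + \<bar>v x\<bar>)\<^sup>2)" for x
  have wI: "integrable lborel w" unfolding w_def by (rule H1r_exp_integrable[OF u v]) simp
  show ?thesis
  proof (rule that[of "4 * integral\<^sup>L lborel w"])
    fix a b :: real assume ab: "\<bar>a - 1\<bar> \<le> 1" "\<bar>b\<bar> \<le> 1"
    define e where "e = \<bar>a - 1\<bar> + \<bar>b\<bar>"
    define R where "R x = exp_excess (a * u x + b * v x) - exp_excess (u x) - (a - 1) * (exp_excess' (u x) * u x) - b * (exp_excess' (u x) * v x)" for x
    note I = exp_excess_integrable[OF H1r_lincomb(1)[OF u v, of a b]] exp_excess_integrable[OF u] exp_excess_deriv_integrable[OF u u] exp_excess_deriv_integrable[OF u v]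
    have RI: "integrable lborel R" unfolding R_def using I by auto
    have Rb: "\<bar>R x\<bar> \<le> 4 * e\<^sup>2 * w x" for x
    proof -
      define z where "z = (a - 1) * u x + b * v x"
      define m where "m = \<bar>u x\<bar> + \<bar>v x\<bar>"
      have m0: "m \<ge> 0" by (simp add: m_def)
      have s: "a * u x + b * v x = u x + z" by (simp add: z_def algebra_simps)
      have zz: "\<bar>z\<bar> \<le> \<bar>a - 1\<bar> * \<bar>u x\<bar> + \<bar>b\<bar> * \<bar>v x\<bar>" unfolding z_def by (rule order_trans[OF abs_triangle_ineq]) (simp add: abs_mult)
      also have "\<dots> \<le> \<bar>a - 1\<bar> * m + \<bar>b\<bar> * m" by (intro add_mono mult_left_mono) (auto simp: m_def)
      finally have z: "\<bar>z\<bar> \<le> e * m" by (simp add: e_def algebra_simps)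
      have z2: "\<bar>z\<bar> \<le> m"
      proof -
        note zz
        also have "\<bar>a - 1\<bar> * \<bar>u x\<bar> + \<bar>b\<bar> * \<bar>v x\<bar> \<le> 1 * \<bar>u x\<bar> + 1 * \<bar>v x\<bar>" using ab by (intro add_mono mult_right_mono) auto
        finally show ?thesis by (simp add: m_def)
      qed
      have "\<bar>exp_excess (u x + z) - exp_excess (u x) - exp_excess' (u x) * z\<bar> \<le> 4 * exp (2 * (2 * m)\<^sup>2) * z\<^sup>2"
        by (rule exp_excess_taylor) (use z2 in \<open>auto simp: m_def\<close>)
      also have "exp_excess (u x + z) - exp_excess (u x) - exp_excess' (u x) * z = R x"
        unfolding R_def s by (simp add: z_def algebra_simps)
      also have "4 * exp (2 * (2 * m)\<^sup>2) * z\<^sup>2 \<le> 4 * exp (2 * (2 * m)\<^sup>2) * (e * m)\<^sup>2"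
        using z m0 by (intro mult_left_mono) (auto simp: abs_le_square_iff[symmetric] e_def)
      also have "\<dots> = 4 * e\<^sup>2 * w x" unfolding w_def m_def[symmetric] by (simp add: power_mult_distrib)
      finally show ?thesis .
    qed
    have "(\<integral>x. exp_excess (a * u x + b * v x) \<partial>lborel) - (\<integral>x. exp_excess (u x) \<partial>lborel)
      - (a - 1) * (\<integral>x. exp_excess' (u x) * u x \<partial>lborel) - b * (\<integral>x. exp_excess' (u x) * v x \<partial>lborel) = integral\<^sup>L lborel R"
      unfolding R_def using I by simp
    also have "\<bar>\<dots>\<bar> \<le> (\<integral>x. \<bar>R x\<bar> \<partial>lborel)" by (rule integral_abs_bound)
    also have "\<dots> \<le> (\<integral>x. 4 * e\<^sup>2 * w x \<partial>lborel)" by (rule integral_mono[OF integrable_abs[OF RI] integrable_mult_right[OF wI] Rb])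
    finally show "\<bar>(\<integral>x. exp_excess (a * u x + b * v x) \<partial>lborel) - (\<integral>x. exp_excess (u x) \<partial>lborel)
      - (a - 1) * (\<integral>x. exp_excess' (u x) * u x \<partial>lborel) - b * (\<integral>x. exp_excess' (u x) * v x \<partial>lborel)\<bar> \<le> 4 * integral\<^sup>L lborel w * (\<bar>a - 1\<bar> + \<bar>b\<bar>)\<^sup>2"
      by (simp add: e_def mult_ac)
  qed
qed

section \<open>Derivatives of the functional along curves in the span of u and v\<close>

lemma has_derivative_of_quadratic_remainder:
  fixes F :: "real \<Rightarrow> real \<Rightarrow> real"
  assumes F: "\<And>a b. \<bar>a - 1\<bar> \<le> 1 \<Longrightarrow> \<bar>b\<bar> \<le> 1 \<Longrightarrow> \<bar>F a b - F 1 0 - (a - 1) * E1 - b * E2\<bar> \<le> W * (\<bar>a - 1\<bar> + \<bar>b\<bar>)\<^sup>2"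
    and al: "(\<alpha> has_real_derivative \<alpha>') (at t0)" "\<alpha> t0 = 1" and be: "(\<beta> has_real_derivative \<beta>') (at t0)" "\<beta> t0 = 0"
  shows "((\<lambda>t. F (\<alpha> t) (\<beta> t)) has_real_derivative (\<alpha>' * E1 + \<beta>' * E2)) (at t0)"
proof -
  define R where "R t = F (\<alpha> t) (\<beta> t) - F 1 0 - (\<alpha> t - 1) * E1 - \<beta> t * E2" for t
  have a: "((\<lambda>h. (\<alpha> (t0 + h) - 1) / h) \<longlongrightarrow> \<alpha>') (at 0)" and b: "((\<lambda>h. \<beta> (t0 + h) / h) \<longlongrightarrow> \<beta>') (at 0)"
    using al be by (simp_all add: DERIV_def)
  have ca: "isCont \<alpha> t0" "isCont \<beta> t0" using al be DERIV_isCont by auto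
  have sh: "((\<lambda>h. t0 + h) \<longlongrightarrow> t0) (at (0::real))" by (auto intro!: tendsto_eq_intros)
  have la: "((\<lambda>h. \<alpha> (t0 + h)) \<longlongrightarrow> 1) (at 0)" and lb: "((\<lambda>h. \<beta> (t0 + h)) \<longlongrightarrow> 0) (at 0)"
    using isCont_tendsto_compose[OF ca(1) sh] isCont_tendsto_compose[OF ca(2) sh] al be by auto
  have eva: "eventually (\<lambda>h. \<bar>\<alpha> (t0 + h) - 1\<bar> \<le> 1) (at 0)" using tendstoD[OF la, of 1] by (auto simp: dist_real_def elim!: eventually_mono)
  have evb: "eventually (\<lambda>h. \<bar>\<beta> (t0 + h)\<bar> \<le> 1) (at 0)" using tendstoD[OF lb, of 1] by (auto simp: dist_real_def elim!: eventually_mono)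
  have R0: "R t0 = 0" using al be by (simp add: R_def)
  have "((\<lambda>h. R (t0 + h) / h) \<longlongrightarrow> 0) (at 0)"
  proof (rule Lim_null_comparison)
    show "eventually (\<lambda>h. norm (R (t0 + h) / h) \<le> \<bar>W\<bar> * ((\<bar>(\<alpha> (t0 + h) - 1) / h\<bar> + \<bar>\<beta> (t0 + h) / h\<bar>)\<^sup>2 * \<bar>h\<bar>)) (at 0)"
      using eva evb
    proof eventually_elim
      case (elim h)
      show ?case
      proof (cases "h = 0")
        case False
        have "\<bar>R (t0 + h)\<bar> \<le> W * (\<bar>\<alpha> (t0 + h) - 1\<bar> + \<bar>\<beta> (t0 + h)\<bar>)\<^sup>2" unfolding R_def using elim by (intro F) auto
        also have "\<dots> \<le> \<bar>W\<bar> * (\<bar>\<alpha> (t0 + h) - 1\<bar> + \<bar>\<beta> (t0 + h)\<bar>)\<^sup>2" by (intro mult_right_mono) auto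
        finally have "\<bar>R (t0 + h)\<bar> / \<bar>h\<bar> \<le> \<bar>W\<bar> * (\<bar>\<alpha> (t0 + h) - 1\<bar> + \<bar>\<beta> (t0 + h)\<bar>)\<^sup>2 / \<bar>h\<bar>" by (intro divide_right_mono) auto
        also have "\<dots> = \<bar>W\<bar> * ((\<bar>(\<alpha> (t0 + h) - 1) / h\<bar> + \<bar>\<beta> (t0 + h) / h\<bar>)\<^sup>2 * \<bar>h\<bar>)"
        proof -
          have "p / k * (p / k) * k = p * p / k" if "k > 0" for p k :: real using that by simp
          from this[of "\<bar>h\<bar>" "\<bar>\<alpha> (t0 + h) - 1\<bar> + \<bar>\<beta> (t0 + h)\<bar>"] show ?thesis
            using False by (simp add: power2_eq_square abs_divide add_divide_distrib[symmetric] del: times_divide_times_eq)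
        qed
        finally show ?thesis by simp
      qed (use R0 in simp)
    qed
    have "((\<lambda>h. \<bar>W\<bar> * ((\<bar>(\<alpha> (t0 + h) - 1) / h\<bar> + \<bar>\<beta> (t0 + h) / h\<bar>)\<^sup>2 * \<bar>h\<bar>)) \<longlongrightarrow> \<bar>W\<bar> * ((\<bar>\<alpha>'\<bar> + \<bar>\<beta>'\<bar>)\<^sup>2 * \<bar>0\<bar>)) (at 0)"
      by (intro tendsto_intros a b)
    then show "((\<lambda>h. \<bar>W\<bar> * ((\<bar>(\<alpha> (t0 + h) - 1) / h\<bar> + \<bar>\<beta> (t0 + h) / h\<bar>)\<^sup>2 * \<bar>h\<bar>)) \<longlongrightarrow> 0) (at 0)" by simp
  qed
  then have "(R has_real_derivative 0) (at t0)" by (simp add: DERIV_def R0)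
  then have "((\<lambda>t. R t + (F 1 0 + (\<alpha> t - 1) * E1 + \<beta> t * E2)) has_real_derivative (0 + (\<alpha>' * E1 + \<beta>' * E2))) (at t0)"
    by (auto intro!: derivative_eq_intros al be)
  then show ?thesis by (simp add: R_def)
qed

text \<open>The pairing of Phi'(u) with u itself, that is the derivative of Phi(a u) at a = 1; the
  factor 3 comes from the degree six of B.\<close>

definition dPhi_self :: "(R2 \<Rightarrow> real) \<Rightarrow> (R2 \<Rightarrow> real) \<Rightarrow> real" where
  "dPhi_self g u = grad_sq u + 3 * Bterm u - 1/2 * (\<integral>x. exp_excess' (u x) * u x \<partial>lborel) - (\<integral>x. g x * u x \<partial>lborel)"

lemma Phi_exp_excess: "Phi g u = 1/2 * grad_sq u + 1/2 * Bterm u - 1/2 * (\<integral>x. exp_excess (u x) \<partial>lborel) - (\<integral>x. g x * u x \<partial>lborel)"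
  by (simp add: Phi_def exp_excess_def)

lemma gu_integrable:
  assumes g: "Lp_fun (4/3) g" and u: "H1r u"
  shows "integrable lborel (\<lambda>x. g x * u x)" "integrable lborel (\<lambda>x. \<bar>g x * u x\<bar>)"
  using Holder_43_4(1)[of g lborel u] g H1r_L4[OF u] H1r_D(1)[OF u] by (auto simp: Lp_fun_def)

lemma exp_excess_curve_deriv:
  assumes u: "H1r u" and v: "H1r v"
    and al: "(\<alpha> has_real_derivative \<alpha>') (at t0)" "\<alpha> t0 = 1" and be: "(\<beta> has_real_derivative \<beta>') (at t0)" "\<beta> t0 = 0"
  shows "((\<lambda>t. \<integral>x. exp_excess (\<alpha> t * u x + \<beta> t * v x) \<partial>lborel) has_real_derivative
     (\<alpha>' * (\<integral>x. exp_excess' (u x) * u x \<partial>lborel) + \<beta>' * (\<integral>x. exp_excess' (u x) * v x \<partial>lborel))) (at t0)"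
proof -
  obtain W where W: "\<And>a b. \<bar>a - 1\<bar> \<le> 1 \<Longrightarrow> \<bar>b\<bar> \<le> 1 \<Longrightarrow>
    \<bar>(\<integral>x. exp_excess (a * u x + b * v x) \<partial>lborel) - (\<integral>x. exp_excess (u x) \<partial>lborel)
      - (a - 1) * (\<integral>x. exp_excess' (u x) * u x \<partial>lborel) - b * (\<integral>x. exp_excess' (u x) * v x \<partial>lborel)\<bar> \<le> W * (\<bar>a - 1\<bar> + \<bar>b\<bar>)\<^sup>2"
    by (rule exp_excess_remainder[OF u v]) blast
  show ?thesis
    by (rule has_derivative_of_quadratic_remainder[OF _ al be, where W = W]) (use W in simp)
qed

text \<open>A chain rule with one number D2, the derivative in direction v, common to all curves
  through u. D2 stays anonymous because minimality will determine its value.\<close>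

lemma Phi_curve_deriv:
  assumes g: "Lp_fun (4/3) g" and u: "H1r u" and v: "H1r v"
  obtains D2 where "\<And>\<alpha> \<beta> \<alpha>' \<beta>' t0. (\<alpha> has_real_derivative \<alpha>') (at t0) \<Longrightarrow> \<alpha> t0 = 1 \<Longrightarrow> (\<beta> has_real_derivative \<beta>') (at t0) \<Longrightarrow> \<beta> t0 = 0 \<Longrightarrow>
    ((\<lambda>t. Phi g (\<lambda>x. \<alpha> t * u x + \<beta> t * v x)) has_real_derivative (\<alpha>' * dPhi_self g u + \<beta>' * D2)) (at t0)"
proof -
  obtain k1 k2 k3 k4 k5 k6 where k:
    "\<And>a b. Bterm (\<lambda>x. a * u x + b * v x) = a^6 * Bterm u + a^5 * b * k1 + a^4 * b^2 * k2 + a^3 * b^3 * k3 + a^2 * b^4 * k4 + a * b^5 * k5 + b^6 * k6"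
    by (rule Bterm_lincomb[OF u v]) blast
  note G = gu_integrable(1)[OF g u] gu_integrable(1)[OF g v]
  have gl: "(\<integral>x. g x * (a * u x + b * v x) \<partial>lborel) = a * (\<integral>x. g x * u x \<partial>lborel) + b * (\<integral>x. g x * v x \<partial>lborel)" for a b
  proof -
    have "(\<integral>x. g x * (a * u x + b * v x) \<partial>lborel) = (\<integral>x. a * (g x * u x) + b * (g x * v x) \<partial>lborel)" by (simp add: algebra_simps)
    then show ?thesis using G by simp
  qed
  define D2 where "D2 = (\<integral>x. wgrad u x \<bullet> wgrad v x \<partial>lborel) + 1/2 * k1 - 1/2 * (\<integral>x. exp_excess' (u x) * v x \<partial>lborel) - (\<integral>x. g x * v x \<partial>lborel)"
  show ?thesis
  proof (rule that[of D2])
    fix \<alpha> \<beta> :: "real \<Rightarrow> real" and \<alpha>' \<beta>' t0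
    assume al: "(\<alpha> has_real_derivative \<alpha>') (at t0)" "\<alpha> t0 = 1" and be: "(\<beta> has_real_derivative \<beta>') (at t0)" "\<beta> t0 = 0"
    show "((\<lambda>t. Phi g (\<lambda>x. \<alpha> t * u x + \<beta> t * v x)) has_real_derivative (\<alpha>' * dPhi_self g u + \<beta>' * D2)) (at t0)"
      unfolding Phi_exp_excess H1r_lincomb(2)[OF u v] k gl
      by (rule derivative_eq_intros al(1) be(1) exp_excess_curve_deriv[OF u v al be] refl)+
        (simp add: al be D2_def dPhi_self_def algebra_simps)
  qed
qed

subsection \<open>The energy on the boundary sphere\<close>

text \<open>On [0, 1] this is the standard bound; beyond it the estimate is shifted by 1. The end
  point 1.32 exceeds 2 (0.303) + ln 2 < 1.301, the largest value of u^2 to which it is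
  applied.\<close>

lemma exp_le_quadratic:
  fixes z :: real
  assumes "0 \<le> z" "z \<le> 33/25"
  shows "exp z \<le> 1 + z + z\<^sup>2"
proof (cases "z \<le> 1")
  case True
  then show ?thesis using assms exp_bound by simp
next
  case False
  define t where "t = z - 1"
  have t: "0 \<le> t" "t \<le> 8/25" using False assms by (auto simp: t_def)
  have "exp z = exp 1 * exp t" by (simp add: t_def flip: exp_add)
  also have "\<dots> \<le> 272/100 * (1 + t + t\<^sup>2)" using t e_less_272 by (intro mult_mono exp_bound) auto
  also have "\<dots> \<le> 3 + 3 * t + t\<^sup>2"
  proof -
    have "t * t \<le> (8/25) * t" using t by (intro mult_right_mono) auto
    then show ?thesis using t by (simp add: power2_eq_square)
  qed
  also have "\<dots> = 1 + z + z\<^sup>2" by (simp add: t_def power2_eq_square algebra_simps)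
  finally show ?thesis .
qed

lemma pi_bounds: "314/100 < pi" "pi < 315/100"
  using pi_approx by (auto simp: abs_if split: if_splits)

text \<open>The integral over \<open>\<bar>x\<bar> \<ge> 1/8\<close> is controlled by the \<open>L\<^sup>4\<close> norm, the rest by the logarithmic
  growth at the origin; the numerical constants have some slack.\<close>
lemma exp_excess_integral_le:
  assumes u: "H1r u" and c: "0 < L2_sq u" "L2_sq u \<le> 432/1000" and s: "0 < grad_sq u" "grad_sq u \<le> pi / 3"
  shows "(\<integral>x. exp_excess (u x) \<partial>lborel) \<le> 5/6 * grad_sq u"
proof -
  obtain f where f: "AE x in lborel. u x = f (norm x)" "f \<in> borel_measurable borel"
    "\<And>a b. 0 < a \<Longrightarrow> a \<le> b \<Longrightarrow> (f b - f a)\<^sup>2 \<le> ln (b / a) / (2 * pi) * grad_sq u"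
    "\<And>r l. 0 < r \<Longrightarrow> 0 < l \<Longrightarrow> (f r)\<^sup>2 \<le> (L2_sq u / l + grad_sq u * l / 2) / (pi * r)"
    by (rule H1r_representation[OF u]) blast
  define c where "c = L2_sq u"
  define s where "s = grad_sq u"
  have c': "0 < c" "c \<le> 432/1000" and s': "0 < s" "s \<le> pi / 3" using c s by (auto simp: c_def s_def)
  \<comment> \<open>The constant of the decay estimate after optimizing over l; the optimum is l =
    sqrt(2 c/s).\<close>
  define K where "K = sqrt (2 * c * s) / pi"
  have K0: "K \<ge> 0" using c' s' by (simp add: K_def)
  have K2: "K\<^sup>2 = 2 * c * s / pi\<^sup>2" using c' s' by (simp add: K_def power_divide)
  have K2s: "8 * K\<^sup>2 \<le> 702/1000 * s"
  proof -
    have "(314/100)\<^sup>2 < pi\<^sup>2" using pi_bounds by (intro power_strict_mono) auto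
    then have "16 * c \<le> 702/1000 * pi\<^sup>2" using c' by (simp add: power2_eq_square)
    then have "16 * c * s \<le> 702/1000 * pi\<^sup>2 * s" using s' by (intro mult_right_mono) auto
    then show ?thesis unfolding K2 by (simp add: field_simps)
  qed
  have Kle: "K \<le> 303/1000"
  proof -
    have "2 * c * s \<le> 2 * (432/1000) * (pi / 3)" using c' s' by (intro mult_mono) auto
    then have "K\<^sup>2 \<le> (288/1000 * pi) / pi\<^sup>2" unfolding K2 by (intro divide_right_mono) auto
    also have "\<dots> = 288/1000 / pi" by (simp add: power2_eq_square)
    also have "\<dots> \<le> 288/1000 / (314/100)" using pi_bounds by (intro divide_left_mono) auto
    also have "\<dots> \<le> (303/1000)\<^sup>2" by (simp add: power2_eq_square)
    finally show ?thesis by (rule power2_le_imp_le) simp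
  qed
  have strauss: "(f r)\<^sup>2 \<le> K / r" if r: "0 < r" for r
  proof -
    define l where "l = sqrt (2 * c / s)"
    have l: "l > 0" using c' s' by (simp add: l_def)
    have "(f r)\<^sup>2 \<le> (c / l + s * l / 2) / (pi * r)" using f(4)[OF r l] by (simp add: c_def s_def)
    also have "c / l + s * l / 2 = sqrt (2 * c * s)"
    proof -
      have l2: "l * l = 2 * c / s" using c' s' by (simp add: l_def)
      have "c / l = s * l / 2" using l l2 s' by (simp add: field_simps)
      then have "c / l + s * l / 2 = s * l" by linarith
      also have "\<dots> = sqrt ((s * l)\<^sup>2)" using s' l by simp
      also have "(s * l)\<^sup>2 = 2 * c * s" using l2 s' by (simp add: power2_eq_square field_simps)
      finally show ?thesis .
    qed
    finally show ?thesis by (simp add: K_def)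
  qed
  have near: "(f r)\<^sup>2 \<le> 2 * K + s / pi * ln (1 / r)" if r: "0 < r" "r \<le> 1" for r
  proof -
    have "(f 1 - f r)\<^sup>2 \<le> ln (1 / r) / (2 * pi) * s" using f(3)[OF r] by (simp add: s_def)
    also have "\<dots> = s / pi * ln (1 / r) / 2" by (simp add: mult_ac)
    finally have 1: "(f 1 - f r)\<^sup>2 \<le> s / pi * ln (1 / r) / 2" .
    have 2: "(f 1)\<^sup>2 \<le> K" using strauss[of 1] by simp
    have "y \<le> 2 * K + X" if "a \<le> X / 2" "b \<le> K" "y \<le> 2 * b + 2 * a" for a b X y :: real
      using that by linarith
    from this[OF 1 2 square_le_double] show ?thesis .
  qed
  have sp: "s / pi \<le> 1/3" using s' by (simp add: field_simps)
  \<comment> \<open>Since s/pi \<le> 1/3 and (1/3) ln 8 = ln 2, the radius 1/8 keeps u^2 in the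
    range where exp is below its quadratic majorant.\<close>
  have outer: "exp_excess (f r) \<le> (f r)^4" if r: "1/8 \<le> r" for r
  proof -
    have z: "(f r)\<^sup>2 \<le> 33/25"
    proof (cases "r \<le> 1")
      case True
      have "s / pi * ln (1 / r) \<le> 1/3 * ln (1 / r)" using True r sp by (intro mult_right_mono) auto
      also have "\<dots> \<le> 1/3 * ln 8" using r True by (intro mult_left_mono) (auto simp: field_simps)
      also have "ln 8 = 3 * ln (2::real)" using ln_realpow[of 2 3] by simp
      finally have "s / pi * ln (1 / r) \<le> ln 2" by simp
      then show ?thesis using near[of r] True r Kle ln2_le_25_over_36 by simp
    next
      case False
      have "K / r \<le> K / 1" using False K0 by (intro divide_left_mono) auto
      then show ?thesis using strauss[of r] False Kle by simp
    qed
    have "exp ((f r)\<^sup>2) \<le> 1 + (f r)\<^sup>2 + ((f r)\<^sup>2)\<^sup>2" by (rule exp_le_quadratic) (use z in auto)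
    then show ?thesis by (simp add: exp_excess_def flip: power_mult)
  qed
  have inner: "exp_excess (f r) \<le> 48/100 * s / r" if r: "0 < r" "r \<le> 1/8" for r
  proof -
    \<comment> \<open>The natural unit of the inner region: (s/pi) ln(1/r) is at most ln p, so
      exp(u^2) grows at most like p, and p^3 = 1/r.\<close>
    define p where "p = r powr (-1/3)"
    have p0: "p > 0" using r by (simp add: p_def)
    have p3: "p^3 = 1 / r"
    proof -
      have "p^3 = p powr (real 3)" using p0 by (simp add: powr_realpow)
      also have "\<dots> = r powr (-1)" using r by (simp add: p_def powr_powr)
      also have "\<dots> = 1 / r" using r(1) by (rule powr_neg_one)
      finally show ?thesis .
    qed
    have p2: "p \<ge> 2"
    proof (rule ccontr)
      assume "\<not> p \<ge> 2"
      then have "p^3 < 2^3" using p0 by (intro power_strict_mono) auto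
      then show False using r unfolding p3 by (simp add: field_simps)
    qed
    have L: "ln (1 / r) = 3 * ln p" using p0 by (simp flip: p3 add: ln_realpow)
    have L0: "ln p \<ge> 0" using p2 by simp
    \<comment> \<open>The line through the origin tangent to the logarithm is p/e; 5/2 is a rational
      lower bound for e.\<close>
    have L1: "ln p \<le> p / (5/2)"
    proof -
      have e: "exp (1::real) \<ge> 5/2" using exp_lower_Taylor_quadratic[of "1::real"] by simp
      have "ln (p / exp 1) \<le> p / exp 1 - 1" using p0 by (intro ln_le_minus_one) auto
      then have "ln p \<le> p / exp 1" using p0 by (simp add: ln_div)
      also have "\<dots> \<le> p / (5/2)" using e p0 by (intro divide_left_mono mult_pos_pos) auto
      finally show ?thesis .
    qed
    define z where "z = (f r)\<^sup>2"
    have z: "z \<le> 2 * K + s / pi * (3 * ln p)" using near[of r] r L by (simp add: z_def)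
    have z1: "z \<le> 606/1000 + ln p"
    proof -
      have "s / pi * (3 * ln p) \<le> 1/3 * (3 * ln p)" using sp L0 by (intro mult_right_mono) auto
      then show ?thesis using z Kle by simp
    qed
    have ez: "exp z \<le> 1974/1000 * p"
    proof -
      have "exp z \<le> exp (606/1000 + ln p)" using z1 by simp
      also have "\<dots> = exp (606/1000) * p" using p0 by (simp add: exp_add)
      also have "\<dots> \<le> (1 + 606/1000 + (606/1000)\<^sup>2) * p" using p0 by (intro mult_right_mono exp_bound) auto
      also have "\<dots> \<le> 1974/1000 * p" using p0 by (intro mult_right_mono) (auto simp: power2_eq_square)
      finally show ?thesis .
    qed
    \<comment> \<open>The result has to be linear in s. Both parts provide a factor s, as K^2 = 2 c
      s/pi^2 and (s/pi)^2 \<le> (1/3) (s/pi); p \<ge> 2 absorbs the constant part into p^2.\<close>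
    have zz: "z\<^sup>2 \<le> 482/1000 * s * p\<^sup>2"
    proof -
      have zn: "z \<ge> 0" by (simp add: z_def)
      have "z\<^sup>2 \<le> (2 * K + s / pi * (3 * ln p))\<^sup>2" using z zn by (intro power_mono) auto
      also have "\<dots> \<le> 2 * (2 * K)\<^sup>2 + 2 * (s / pi * (3 * ln p))\<^sup>2"
      proof -
        have "(a + b)\<^sup>2 \<le> 2 * a\<^sup>2 + 2 * b\<^sup>2" for a b :: real
          using zero_le_power2[of "a - b"] by (simp add: power2_eq_square algebra_simps)
        then show ?thesis .
      qed
      also have "2 * (2 * K)\<^sup>2 = 8 * K\<^sup>2" by (simp add: power_mult_distrib)
      also have "8 * K\<^sup>2 \<le> 702/1000 * s" by (rule K2s)
      also have "702/1000 * s \<le> 702/1000 * s * (p\<^sup>2 / 4)"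
      proof -
        have "2\<^sup>2 \<le> p\<^sup>2" using p2 by (intro power_mono) auto
        then have "702/1000 * s * 1 \<le> 702/1000 * s * (p\<^sup>2 / 4)" using s' by (intro mult_left_mono) auto
        then show ?thesis by simp
      qed
      also have "2 * (s / pi * (3 * ln p))\<^sup>2 \<le> 306/1000 * s * p\<^sup>2"
      proof -
        have "(s / pi)\<^sup>2 = (s / pi) * (s / pi)" by (simp add: power2_eq_square)
        also have "\<dots> \<le> (1/3) * (s / pi)" using sp s' by (intro mult_right_mono) auto
        also have "\<dots> \<le> (1/3) * (s / (314/100))" using pi_bounds s' by (intro mult_left_mono divide_left_mono) auto
        finally have 1: "(s / pi)\<^sup>2 \<le> (1/3) * (s / (314/100))" .
        have 2: "(3 * ln p)\<^sup>2 \<le> (3 * (p / (5/2)))\<^sup>2" using L0 L1 by (intro power_mono mult_left_mono) auto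
        have "(s / pi * (3 * ln p))\<^sup>2 \<le> (1/3) * (s / (314/100)) * (3 * (p / (5/2)))\<^sup>2"
          unfolding power_mult_distrib[of "s / pi"] using 1 2 s' by (intro mult_mono) auto
        also have "\<dots> = (1/3 / (314/100) * 9 / (25/4)) * (s * p\<^sup>2)" by (simp add: power2_eq_square)
        also have "\<dots> \<le> 153/1000 * (s * p\<^sup>2)" using s' by (intro mult_right_mono) auto
        finally show ?thesis by simp
      qed
      finally have "z\<^sup>2 \<le> 702/1000 * s * (p\<^sup>2 / 4) + 306/1000 * s * p\<^sup>2" by simp
      moreover have "0 \<le> s * p\<^sup>2" using s' by simp
      ultimately show ?thesis by linarith
    qed
    have "exp_excess (f r) \<le> (f r)^4 / 2 * exp ((f r)\<^sup>2)" by (rule exp_excess_le)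
    also have "\<dots> = z\<^sup>2 / 2 * exp z" by (simp add: z_def flip: power_mult)
    also have "\<dots> \<le> (482/1000 * s * p\<^sup>2) / 2 * (1974/1000 * p)" using zz ez s' by (intro mult_mono divide_right_mono) auto
    also have "\<dots> = (482/1000 / 2 * (1974/1000)) * (s * p^3)" by (simp add: power2_eq_square power3_eq_cube)
    also have "\<dots> \<le> 48/100 * (s * p^3)" using s' p0 by (intro mult_right_mono) auto
    finally show ?thesis by (simp add: p3)
  qed
  note I4 = H1r_L4[OF u]
  have hb: "integrable lborel (\<lambda>x::R2. indicator (cball 0 (1/8)) x / norm x)" "(\<integral>x. indicator (cball 0 (1/8)) x / norm (x::R2) \<partial>lborel) = 2 * pi * (1/8)"
    using integral_inverse_norm_R2[of "1/8"] by (simp_all add: has_bochner_integral_iff)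
  have "(\<integral>x. exp_excess (u x) \<partial>lborel) \<le> (\<integral>x. (u x)^4 + (48/100 * s) * (indicator (cball 0 (1/8)) x / norm x) \<partial>lborel)"
  proof (rule integral_mono_AE[OF exp_excess_integrable[OF u]])
    show "integrable lborel (\<lambda>x. (u x)^4 + (48/100 * s) * (indicator (cball 0 (1/8)) x / norm x))" using I4(1) hb(1) by (intro Bochner_Integration.integrable_add integrable_mult_right)
    show "AE x in lborel. exp_excess (u x) \<le> (u x)^4 + (48/100 * s) * (indicator (cball 0 (1/8)) x / norm x)"
      using f(1) AE_lborel_singleton[of "0::R2"]
    proof eventually_elim
      case (elim x)
      have e4: "(u x)^4 \<ge> 0" by simp
      show ?case
      proof (cases "norm x \<le> 1/8")
        case True
        then have "exp_excess (u x) \<le> (48/100 * s) * (indicator (cball 0 (1/8)) x / norm x)"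
          using inner[of "norm x"] elim by simp
        then show ?thesis using e4 by linarith
      next
        case False
        then show ?thesis using outer[of "norm x"] elim s' by (simp add: indicator_def)
      qed
    qed
  qed
  also have "\<dots> = (\<integral>x. (u x)^4 \<partial>lborel) + (48/100 * s) * (2 * pi * (1/8))"
    using I4(1) hb by (simp only: Bochner_Integration.integral_add integrable_mult_right integral_mult_right_zero)
  also have "\<dots> \<le> c * s + (48/100 * s) * (2 * pi * (1/8))" using I4(2) by (simp add: c_def s_def)
  \<comment> \<open>The outer part gives 0.432 and the inner part 0.378, in total 0.81 <
    5/6.\<close>
  also have "\<dots> \<le> 432/1000 * s + (48/100 * s) * (2 * (315/100) * (1/8))"
    using c' s' pi_bounds by (intro add_mono mult_left_mono mult_right_mono) auto
  also have "\<dots> \<le> 5/6 * s" using s' by simp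
  finally show ?thesis by (simp add: s_def)
qed

text \<open>The exponential term takes half of 5/6 from the factor 1/2 of the energy, which leaves
  1/12. The nonlocal term is nonnegative and is dropped; the source term is estimated by Holder and
  the sharp L^4 inequality.\<close>

lemma Phi_lower_bound:
  assumes g: "Lp_fun (4/3) g" and u: "H1r u" and c: "0 < L2_sq u" "L2_sq u \<le> 432/1000" and s: "0 < grad_sq u" "grad_sq u \<le> pi / 3"
  shows "Phi g u \<ge> 1/12 * grad_sq u - C4 * Lp_norm (4/3) g * (L2_sq u powr (1/4) * grad_sq u powr (1/4))"
proof -
  have gm: "g \<in> borel_measurable lborel" "integrable lborel (\<lambda>x. \<bar>g x\<bar> powr (4/3))" using g by (auto simp: Lp_fun_def)
  have um: "u \<in> borel_measurable lborel" using H1r_D(1)[OF u] by simp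
  have "(\<integral>x. g x * u x \<partial>lborel) \<le> \<bar>\<integral>x. g x * u x \<partial>lborel\<bar>" by simp
  also have "\<dots> \<le> (\<integral>x. \<bar>g x * u x\<bar> \<partial>lborel)" by (rule integral_abs_bound)
  also have "\<dots> \<le> (\<integral>x. \<bar>g x\<bar> powr (4/3) \<partial>lborel) powr (3/4) * (\<integral>x. (u x)^4 \<partial>lborel) powr (1/4)"
    by (rule Holder_43_4(2)[OF gm(1) um gm(2) H1r_L4(1)[OF u]])
  also have "\<dots> = Lp_norm (4/3) g * Lp_norm 4 u" by (simp add: Lp_norm_4 Lp_norm_def[of "4/3"])
  also have "\<dots> \<le> Lp_norm (4/3) g * (C4 * L2_sq u powr (1/4) * grad_sq u powr (1/4))"
    by (intro mult_left_mono C4_bound(1)) (use H1r_D(5)[OF u] in \<open>auto simp: Lp_norm_def\<close>)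
  finally have "(\<integral>x. g x * u x \<partial>lborel) \<le> C4 * Lp_norm (4/3) g * (L2_sq u powr (1/4) * grad_sq u powr (1/4))" by (simp add: mult_ac)
  then show ?thesis unfolding Phi_exp_excess
    using exp_excess_integral_le[OF u c s] Bterm_nonneg[of u] by linarith
qed

section \<open>The constants \<open>zeta\<close>, \<open>L1\<close>, \<open>L2c\<close>,
  \<open>c0\<close> and \<open>s0\<close>\<close>

definition zeta_coeff :: "nat \<Rightarrow> real" where
  "zeta_coeff k = (4 ^ (k + 2) * (real k + 1) + 1) / ((real k + 1) * fact (k + 3))"

lemma zeta_coeff_nonneg: "zeta_coeff k \<ge> 0"
  by (simp add: zeta_coeff_def)

text \<open>Comparison with the exponential series at 4 t: the numerator is at most 17 (k + 1)
  4^k.\<close>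

lemma zeta_coeff_le: "zeta_coeff k * t^k \<le> 17 * ((4 * t)^k / fact k)" if "t \<ge> 0"
proof -
  have 1: "(4 ^ (k + 2) * (real k + 1) + 1) / (real k + 1) \<le> 17 * 4^k"
  proof -
    have "(1::real) \<le> 4^k * (real k + 1)" using mult_mono[of 1 "4^k" 1 "real k + 1"] by simp
    then have "4 ^ (k + 2) * (real k + 1) + 1 \<le> 17 * 4^k * (real k + 1)" by (simp add: power_add algebra_simps)
    then show ?thesis by (simp add: pos_divide_le_eq)
  qed
  have "zeta_coeff k = (4 ^ (k + 2) * (real k + 1) + 1) / (real k + 1) / fact (k + 3)" by (simp add: zeta_coeff_def)
  also have "\<dots> \<le> (17 * 4^k) / fact (k + 3)" using 1 by (intro divide_right_mono) auto
  also have "\<dots> \<le> (17 * 4^k) / fact k" by (intro divide_left_mono fact_mono mult_pos_pos) auto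
  finally have "zeta_coeff k * t^k \<le> (17 * 4^k) / fact k * t^k" using that by (intro mult_right_mono) auto
  then show ?thesis by (simp add: power_mult_distrib)
qed

lemma zeta_summable: "summable (\<lambda>k. zeta_coeff k * t^k)" if "t \<ge> 0"
proof (rule summable_comparison_test'[where N = 0])
  show "summable (\<lambda>k. 17 * ((4 * t)^k / fact k))"
    using summable_mult[OF summable_exp[of "4 * t"], of 17] by (simp add: divide_inverse mult.commute)
  show "norm (zeta_coeff k * t^k) \<le> 17 * ((4 * t)^k / fact k)" for k
    using zeta_coeff_le[OF that, of k] zeta_coeff_nonneg[of k] that by simp
qed

lemma zeta_eq: "zeta t = (\<Sum>k. zeta_coeff k * t^k)"
  by (simp add: zeta_def zeta_coeff_def)

lemma zeta_mono: "0 \<le> s \<Longrightarrow> s \<le> t \<Longrightarrow> zeta s \<le> zeta t"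
  unfolding zeta_eq by (intro suminf_le zeta_summable mult_left_mono power_mono zeta_coeff_nonneg) auto

text \<open>The constant term of the series is (16 + 1)/3!, and all terms are nonnegative.\<close>

lemma zeta_ge: "17/6 \<le> zeta t" if "t \<ge> 0"
proof -
  have "(\<Sum>k\<in>{0}. zeta_coeff k * t^k) \<le> zeta t" unfolding zeta_eq
    by (intro sum_le_suminf zeta_summable that) (use that zeta_coeff_nonneg in auto)
  moreover have "zeta_coeff 0 = 17/6" by (simp add: zeta_coeff_def fact_numeral)
  ultimately show ?thesis by simp
qed

lemma zeta_arg_mono:
  assumes "0 < c" "c \<le> d" shows "17/6 \<le> zeta (sqrt (c / (3 * pi)))" "zeta (sqrt (c / (3 * pi))) \<le> zeta (sqrt (d / (3 * pi)))"
proof -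
  show "17/6 \<le> zeta (sqrt (c / (3 * pi)))" using assms by (intro zeta_ge) auto
  show "zeta (sqrt (c / (3 * pi))) \<le> zeta (sqrt (d / (3 * pi)))"
    using assms by (intro zeta_mono) (auto intro!: divide_right_mono)
qed

lemma L1_mono:
  assumes G: "Lp_norm (4/3) g > 0" and C: "C4 > 0" and c: "0 < c" "c \<le> d"
  shows "L1 g c \<le> L1 g d"
proof -
  have z: "0 \<le> zeta (sqrt (c / (3 * pi)))" using zeta_arg_mono(1)[OF c] by simp
  show ?thesis
    unfolding L1_def using G C c z
    by (intro mult_mono powr_mono2 divide_right_mono zeta_arg_mono(2)) auto
qed

lemma L2c_mono:
  assumes G: "Lp_norm (4/3) g > 0" and C: "C4 > 0" and c: "0 < c" "c \<le> d"
  shows "L2c g c \<le> L2c g d"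
proof -
  define A where "A = 12 * (pi / 3) powr (-3/4) * C4 * Lp_norm (4/3) g"
  define B where "B = 12 * (pi / 3) powr (1/2) / pi\<^sup>2"
  have e: "L2c g x = x powr (1/4) * A + x powr (3/2) * zeta (sqrt (x / (3 * pi))) * B" for x
    by (simp add: L2c_def A_def B_def mult_ac)
  have AB: "A \<ge> 0" "B \<ge> 0" using G C by (auto simp: A_def B_def)
  have z: "0 \<le> zeta (sqrt (c / (3 * pi)))" using zeta_arg_mono(1)[OF c] by simp
  show ?thesis
    unfolding e using AB c z order_trans[OF z zeta_arg_mono(2)[OF c]]
    by (intro add_mono mult_mono powr_mono2 zeta_arg_mono(2) mult_nonneg_nonneg) auto
qed

lemma small_powr_exists:
  assumes p: "0 < p" and e: "e > 0" "d > 0"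
  shows "\<exists>c::real. 0 < c \<and> c \<le> d \<and> c powr p \<le> e"
proof (intro exI conjI)
  let ?c = "min d (e powr (1/p))"
  show "0 < ?c" "?c \<le> d" using e by auto
  have "?c powr p \<le> (e powr (1/p)) powr p" using e p by (intro powr_mono2) auto
  also have "\<dots> = e" using e p by (simp add: powr_powr)
  finally show "?c powr p \<le> e" .
qed

text \<open>For c \<le> 1 every factor except c^(1/4) is replaced by its value at mass 1; what
  remains is small with c^(1/4).\<close>

lemma L1_small:
  assumes G: "Lp_norm (4/3) g > 0" and C: "C4 > 0"
  shows "\<exists>c. 0 < c \<and> c \<le> 2 * pi \<and> L1 g c \<le> 1"
proof -
  define X where "X = 30 * C4 * Lp_norm (4/3) g * ((2 * 1 powr (5/4) * zeta (sqrt (1 / (3 * pi)))) / (3 * pi\<^sup>2 * C4 * Lp_norm (4/3) g)) powr (3/5)"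
  have X: "X \<ge> 0" unfolding X_def using G C by (intro mult_nonneg_nonneg) auto
  obtain c :: real where c: "0 < c" "c \<le> 1" "c powr (1/4) \<le> 1 / (X + 1)"
    using small_powr_exists[of "1/4" "1 / (X + 1)" 1] X by auto
  have z: "0 \<le> zeta (sqrt (c / (3 * pi)))" using zeta_arg_mono(1)[OF c(1,2)] by simp
  have "L1 g c \<le> 30 * c powr (1/4) * C4 * Lp_norm (4/3) g * ((2 * 1 powr (5/4) * zeta (sqrt (1 / (3 * pi)))) / (3 * pi\<^sup>2 * C4 * Lp_norm (4/3) g)) powr (3/5)"
    unfolding L1_def using G C c z by (intro mult_left_mono powr_mono2 divide_right_mono mult_mono zeta_arg_mono(2)) auto
  also have "\<dots> = c powr (1/4) * X" by (simp add: X_def)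
  also have "\<dots> \<le> 1 / (X + 1) * X" using c X by (intro mult_right_mono) auto
  also have "\<dots> \<le> 1" using X by simp
  finally show ?thesis using c pi_gt3 by (intro exI[of _ c]) auto
qed

lemma L2c_small:
  assumes G: "Lp_norm (4/3) g > 0" and C: "C4 > 0"
  shows "\<exists>c. 0 < c \<and> c \<le> 2 * pi \<and> L2c g c \<le> 1"
proof -
  define X where "X = 12 * (pi / 3) powr (-3/4) * C4 * Lp_norm (4/3) g + 12 * (pi / 3) powr (1/2) / pi\<^sup>2 * zeta (sqrt (1 / (3 * pi)))"
  have z1: "zeta (sqrt (1 / (3 * pi))) \<ge> 0" using zeta_ge[of "sqrt (1 / (3 * pi))"] by simp
  have X: "X \<ge> 0" unfolding X_def using G C z1 by (intro add_nonneg_nonneg mult_nonneg_nonneg) auto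
  obtain c :: real where c: "0 < c" "c \<le> 1" "c powr (1/4) \<le> 1 / (X + 1)"
    using small_powr_exists[of "1/4" "1 / (X + 1)" 1] X by auto
  have z: "0 \<le> zeta (sqrt (c / (3 * pi)))" using zeta_arg_mono(1)[OF c(1,2)] by simp
  have c32: "c powr (3/2) \<le> c powr (1/4)" using c by (intro powr_mono') auto
  have "L2c g c \<le> 12 * c powr (1/4) * (pi / 3) powr (-3/4) * C4 * Lp_norm (4/3) g + 12 * c powr (1/4) * (pi / 3) powr (1/2) / pi\<^sup>2 * zeta (sqrt (1 / (3 * pi)))"
    unfolding L2c_def using G C c z c32 by (intro add_mono mult_mono divide_right_mono zeta_arg_mono(2)) auto
  also have "\<dots> = c powr (1/4) * X" by (simp add: X_def algebra_simps)
  also have "\<dots> \<le> 1 / (X + 1) * X" using c X by (intro mult_right_mono) auto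
  also have "\<dots> \<le> 1" using X by simp
  finally show ?thesis using c pi_gt3 by (intro exI[of _ c]) auto
qed

text \<open>Below the supremum there is a larger admissible mass, and monotonicity brings its
  condition down to c. The smallness lemmas supply a member of each set, without which
  \<open>Sup\<close> would have no meaning.\<close>

lemma L_conditions:
  assumes G: "Lp_norm (4/3) g > 0" and C: "C4 > 0" and c: "0 < c" "c < c0 g"
  shows "L1 g c \<le> 1" "L2c g c \<le> 1"
proof -
  have "c < Sup {c. 0 < c \<and> c \<le> 2 * pi \<and> L1 g c \<le> 1}" using c by (simp add: c0_def c1_def)
  then obtain d where "0 < d" "L1 g d \<le> 1" "c < d"
    using less_cSupD[of "{c. 0 < c \<and> c \<le> 2 * pi \<and> L1 g c \<le> 1}" c] L1_small[OF G C] by auto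
  then show "L1 g c \<le> 1" using L1_mono[OF G C c(1), of d] by simp
  have "c < Sup {c. 0 < c \<and> c \<le> 2 * pi \<and> L2c g c \<le> 1}" using c by (simp add: c0_def c2_def)
  then obtain d where "0 < d" "L2c g d \<le> 1" "c < d"
    using less_cSupD[of "{c. 0 < c \<and> c \<le> 2 * pi \<and> L2c g c \<le> 1}" c] L2c_small[OF G C] by auto
  then show "L2c g c \<le> 1" using L2c_mono[OF G C c(1), of d] by simp
qed

text \<open>The second summand of \<open>L2c\<close>, with zeta replaced by its lower bound 17/6,
  already exceeds 1 beyond mass 0.432. This is where the mass bound in the exponential estimate
  comes from.\<close>

lemma c_small:
  assumes G: "Lp_norm (4/3) g > 0" and C: "C4 > 0" and c: "0 < c" "L2c g c \<le> 1"
  shows "c \<le> 432/1000"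
proof (rule ccontr)
  assume "\<not> c \<le> 432/1000"
  then have c1: "432/1000 < c" by simp
  define P where "P = (pi / 3) powr (1/2)"
  define Z where "Z = zeta (sqrt (c / (3 * pi)))"
  have Z: "17/6 \<le> Z" unfolding Z_def using c by (intro zeta_ge) auto
  have P: "10233/10000 \<le> P"
  proof -
    have "(10233/10000)\<^sup>2 \<le> pi / 3" using pi_approx by (simp add: power2_eq_square)
    then have "10233/10000 \<le> sqrt (pi / 3)" by (rule real_le_rsqrt)
    then show ?thesis by (simp add: P_def powr_half_sqrt)
  qed
  have q: "28382/100000 \<le> c powr (3/2)"
  proof -
    have "(657/1000)\<^sup>2 \<le> c" using c1 by (simp add: power2_eq_square)
    then have s: "657/1000 \<le> sqrt c" by (rule real_le_rsqrt)
    have "c powr (3/2) = c powr (1 + 1/2)" by simp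
    also have "\<dots> = c * sqrt c" using c by (simp only: powr_add) (simp add: powr_half_sqrt)
    also have "\<dots> \<ge> (432/1000) * (657/1000)" using s c1 by (intro mult_mono) auto
    finally show ?thesis by simp
  qed
  have pi2: "pi\<^sup>2 < 98697/10000"
  proof -
    have "pi\<^sup>2 \<le> (31415927/10000000)\<^sup>2" using pi_approx by (intro power_mono) auto
    also have "\<dots> < 98697/10000" by (simp add: power2_eq_square)
    finally show ?thesis .
  qed
  have "12 * c powr (3/2) * P / pi\<^sup>2 * Z \<le> L2c g c"
    unfolding L2c_def P_def Z_def using G C by simp
  from order_trans[OF this c(2)] have le1: "12 * c powr (3/2) * P / pi\<^sup>2 * Z \<le> 1" .
  \<comment> \<open>The left side is about 9.8747, against pi^2 < 9.8697. With 17/6 in place of zeta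
    the value 0.432 is nearly the best possible, so the roundings must be fine.\<close>
  have "12 * (28382/100000) * (10233/10000) * (17/6) \<le> 12 * c powr (3/2) * P * Z"
    using q P Z by (intro mult_mono) auto
  also have "\<dots> = pi\<^sup>2 * (12 * c powr (3/2) * P / pi\<^sup>2 * Z)" by simp
  also have "\<dots> \<le> pi\<^sup>2 * 1" using le1 by (intro mult_left_mono) auto
  finally show False using pi2 by simp
qed

text \<open>The last claim says K c^(1/4) \<le> s^(3/4)/12 with K = C4 |g|. If s =
  \<open>s_c g c\<close>, then s^(3/4) is the reciprocal of the bracket power in \<open>L1\<close>,
  and \<open>L1 g c\<close> \<le> 1 gives even the factor 1/30. If s = pi/3, the first summand of
  \<open>L2c\<close> gives 1/12.\<close>

lemma s0_properties:
  assumes G: "Lp_norm (4/3) g > 0" and C: "C4 > 0" and c: "0 < c" "c < c0 g"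
  shows "0 < s0 g c" "s0 g c \<le> pi / 3" "C4 * Lp_norm (4/3) g * (c powr (1/4) * s0 g c powr (1/4)) \<le> s0 g c / 12"
proof -
  define K where "K = C4 * Lp_norm (4/3) g"
  have K: "K > 0" using G C by (simp add: K_def)
  define Z where "Z = zeta (sqrt (c / (3 * pi)))"
  have Z: "Z > 0" unfolding Z_def using zeta_ge[of "sqrt (c / (3 * pi))"] c by simp
  define X where "X = (2 * c powr (5/4) * Z) / (3 * pi\<^sup>2 * K)"
  have X: "X > 0" unfolding X_def using c Z K by simp
  have sc: "s_c g c = (1 / X) powr (4/5)"
    by (simp add: s_c_def X_def Z_def K_def mult_ac)
  then have sc0: "s_c g c > 0" using X by simp
  then show "0 < s0 g c" "s0 g c \<le> pi / 3" by (auto simp: s0_def)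
  note L = L_conditions[OF G C c]
  have split: "s powr (3/4) * s powr (1/4) = s" if "s > 0" for s :: real
    using that by (simp flip: powr_add)
  show "C4 * Lp_norm (4/3) g * (c powr (1/4) * s0 g c powr (1/4)) \<le> s0 g c / 12"
  proof (cases "s_c g c \<le> pi / 3")
    case True
    then have s: "s0 g c = s_c g c" by (simp add: s0_def)
    have "L1 g c = 30 * c powr (1/4) * K * X powr (3/5)" by (simp add: L1_def X_def Z_def K_def mult_ac)
    then have "30 * (c powr (1/4) * K) * X powr (3/5) \<le> 1" using L by (simp add: mult_ac)
    moreover have "s_c g c powr (3/4) = 1 / X powr (3/5)" unfolding sc using X by (simp add: powr_powr powr_divide)
    ultimately have "30 * (c powr (1/4) * K) \<le> s_c g c powr (3/4)" using X by (simp only: pos_le_divide_eq powr_gt_zero)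
    then have "30 * (c powr (1/4) * K) * s_c g c powr (1/4) \<le> s_c g c powr (3/4) * s_c g c powr (1/4)" by (intro mult_right_mono) auto
    then have "30 * (K * (c powr (1/4) * s_c g c powr (1/4))) \<le> s_c g c" unfolding split[OF sc0] by (simp add: mult_ac)
    then show ?thesis unfolding s K_def[symmetric] using sc0 by linarith
  next
    case False
    then have s: "s0 g c = pi / 3" by (simp add: s0_def)
    have p: "pi / 3 > 0" by simp
    have "12 * c powr (1/4) * (pi / 3) powr (-3/4) * K \<le> L2c g c"
      unfolding L2c_def K_def using c Z[unfolded Z_def] by simp
    then have "12 * (c powr (1/4) * K) * (pi / 3) powr (-3/4) \<le> 1" using L by (simp add: mult_ac)
    moreover have "(pi / 3) powr (-3/4) = 1 / (pi / 3) powr (3/4)" using powr_minus_divide[of "pi / 3" "3/4"] by simp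
    ultimately have "12 * (c powr (1/4) * K) \<le> (pi / 3) powr (3/4)" by (simp add: pos_divide_le_eq)
    then have "12 * (c powr (1/4) * K) * (pi / 3) powr (1/4) \<le> (pi / 3) powr (3/4) * (pi / 3) powr (1/4)" by (intro mult_right_mono) auto
    then have "12 * (K * (c powr (1/4) * (pi / 3) powr (1/4))) \<le> pi / 3" unfolding split[OF p] by (simp add: mult_ac)
    then show ?thesis unfolding s K_def[symmetric] by linarith
  qed
qed

subsection \<open>Dilations and negative energy\<close>

text \<open>The energy is invariant for k = 1 and the mass for k = t. The first case restores lost
  mass; the second, up to a constant factor, produces competitors of prescribed mass.\<close>

lemma H1r_dilate:
  assumes u: "H1r u" and t: "t > 0"
  shows "H1r (\<lambda>x. k * u (t *\<^sub>R x))"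
    and "L2_sq (\<lambda>x. k * u (t *\<^sub>R x)) = k\<^sup>2 / t\<^sup>2 * L2_sq u"
    and "grad_sq (\<lambda>x. k * u (t *\<^sub>R x)) = k\<^sup>2 * grad_sq u"
    and "Bterm (\<lambda>x. k * u (t *\<^sub>R x)) = k^6 / t^4 * Bterm u"
    and "(\<integral>x. exp_excess (k * u (t *\<^sub>R x)) \<partial>lborel) = (1 / t\<^sup>2) * (\<integral>x. exp_excess (k * u x) \<partial>lborel)"
proof -
  note D = H1r_D[OF u]
  note [measurable] = D(1)
  have t0: "t \<noteq> 0" using t by simp
  note L = L2_grad_dilate[OF D(3) t D(1), of k]
  show H: "H1r (\<lambda>x. k * u (t *\<^sub>R x))"
  proof (rule H1r_I[OF _ _ L(1)])
    show "integrable lborel (\<lambda>x. (k * u (t *\<^sub>R x))\<^sup>2)"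
      using integrable_affine_R2[of "\<lambda>x. (u x)\<^sup>2" t 0] t0 D(2) by (simp add: power_mult_distrib)
    have "u (t *\<^sub>R x) = u (t *\<^sub>R y)" if "norm x = norm y" for x y
      using D(4) that by (simp only: radial_def norm_scaleR)
    then show "radial (\<lambda>x. k * u (t *\<^sub>R x))" unfolding radial_def by metis
  qed measurable
  show "L2_sq (\<lambda>x. k * u (t *\<^sub>R x)) = k\<^sup>2 / t\<^sup>2 * L2_sq u"
    using integral_affine_R2[of "\<lambda>x. (u x)\<^sup>2" t 0] t0 by (simp add: L2_sq_def power_mult_distrib)
  show "grad_sq (\<lambda>x. k * u (t *\<^sub>R x)) = k\<^sup>2 * grad_sq u"
    unfolding grad_sq_eq[OF L(1)] L(2) by (simp add: grad_sq_def)
  show "(\<integral>x. exp_excess (k * u (t *\<^sub>R x)) \<partial>lborel) = (1 / t\<^sup>2) * (\<integral>x. exp_excess (k * u x) \<partial>lborel)"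
    using integral_affine_R2[of "\<lambda>x. exp_excess (k * u x)" t 0] t0 by simp
  have bm: "ball_mass (\<lambda>y. (k * u (t *\<^sub>R y))\<^sup>2) x = k\<^sup>2 / t\<^sup>2 * ball_mass (\<lambda>y. (u y)\<^sup>2) (t *\<^sub>R x)" for x
  proof -
    have "(\<integral>y. (if norm y \<le> norm x then (k * u (t *\<^sub>R y))\<^sup>2 else 0) \<partial>lborel)
      = (\<integral>y. k\<^sup>2 * (if norm (t *\<^sub>R y) \<le> norm (t *\<^sub>R x) then (u (t *\<^sub>R y))\<^sup>2 else 0) \<partial>lborel)"
      using t by (intro Bochner_Integration.integral_cong) (auto simp: power_mult_distrib)
    also have "\<dots> = k\<^sup>2 * ((1 / t\<^sup>2) * (\<integral>y. (if norm y \<le> norm (t *\<^sub>R x) then (u y)\<^sup>2 else 0) \<partial>lborel))"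
    proof -
      have "(\<lambda>y. (if norm y \<le> norm (t *\<^sub>R x) then (u y)\<^sup>2 else 0)) \<in> borel_measurable borel" by measurable
      from integral_affine_R2[OF this t0, of 0] show ?thesis
        by (simp only: integral_mult_right_zero add_0_right real_scaleR_def)
    qed
    finally show ?thesis by (simp add: ball_mass_def)
  qed
  have "Bterm (\<lambda>x. k * u (t *\<^sub>R x)) = (\<integral>x. (k^6 / t\<^sup>2) * ((u (t *\<^sub>R x))\<^sup>2 / (norm (t *\<^sub>R x))\<^sup>2 * (ball_mass (\<lambda>y. (u y)\<^sup>2) (t *\<^sub>R x))\<^sup>2) \<partial>lborel)"
    unfolding Bterm_eq[OF H] bm
  proof (intro Bochner_Integration.integral_cong refl)
    fix x
    have "(k * u (t *\<^sub>R x))\<^sup>2 / N * (k\<^sup>2 / t\<^sup>2 * B)\<^sup>2 = (k^6 / t\<^sup>2) * ((u (t *\<^sub>R x))\<^sup>2 / (t\<^sup>2 * N) * B\<^sup>2)" for N B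
      by (simp add: power_mult_distrib power_divide power2_eq_square) (simp add: eval_nat_numeral mult_ac)
    then show "(k * u (t *\<^sub>R x))\<^sup>2 / (norm x)\<^sup>2 * (k\<^sup>2 / t\<^sup>2 * ball_mass (\<lambda>y. (u y)\<^sup>2) (t *\<^sub>R x))\<^sup>2 = (k^6 / t\<^sup>2) * ((u (t *\<^sub>R x))\<^sup>2 / (norm (t *\<^sub>R x))\<^sup>2 * (ball_mass (\<lambda>y. (u y)\<^sup>2) (t *\<^sub>R x))\<^sup>2)"
      using t by (simp add: power_mult_distrib)
  qed
  also have "\<dots> = (k^6 / t\<^sup>2) * ((1 / t\<^sup>2) * (\<integral>x. (u x)\<^sup>2 / (norm x)\<^sup>2 * (ball_mass (\<lambda>y. (u y)\<^sup>2) x)\<^sup>2 \<partial>lborel))"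
    using integral_affine_R2[of "\<lambda>x. (u x)\<^sup>2 / (norm x)\<^sup>2 * (ball_mass (\<lambda>y. (u y)\<^sup>2) x)\<^sup>2" t 0] t0
    by (simp only: integral_mult_right_zero) simp
  finally show "Bterm (\<lambda>x. k * u (t *\<^sub>R x)) = k^6 / t^4 * Bterm u"
    unfolding Bterm_eq[OF u] by (simp flip: power_add)
qed

lemma integral_pos_if_AE_nonzero:
  fixes h :: "R2 \<Rightarrow> real"
  assumes h: "integrable lborel h" and nn: "\<And>x. h x \<ge> 0" and nz: "\<not> (AE x in lborel. h x = 0)"
  shows "(\<integral>x. h x \<partial>lborel) > 0"
proof -
  have "(\<integral>x. h x \<partial>lborel) \<ge> 0" using nn by simp
  moreover have "(\<integral>x. h x \<partial>lborel) \<noteq> 0" using integral_nonneg_eq_0_iff_AE[OF h] nn nz by simp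
  ultimately show ?thesis by simp
qed

text \<open>The zero set is closed, and a closed set of full measure is everything.\<close>

lemma continuous_not_AE_zero:
  fixes g :: "R2 \<Rightarrow> real"
  assumes "continuous_on UNIV g" "g y \<noteq> 0"
  shows "\<not> (AE x in lborel. g x = 0)"
proof
  assume "AE x in lborel. g x = 0"
  then have "AE x in lebesgue. x \<in> {x. g x = 0}" by (auto intro: AE_completion)
  moreover have "closed {x. g x = 0}" using assms(1) by (intro closed_Collect_eq) auto
  ultimately have "y \<in> {x. g x = 0}" by (intro mem_closed_if_AE_lebesgue)
  then show False using assms(2) by simp
qed

text \<open>The function 1/(1 + |x|^2): its square has integral pi times that of (1 + r)^(-2) in the
  area variable, and its gradient is at most twice the function. Radial monotonicity is what
  controls the source term under spreading.\<close>

lemma radial_witness: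
  obtains w :: "R2 \<Rightarrow> real" where "H1r w" "\<And>x. w x > 0" "\<And>x t. 0 < t \<Longrightarrow> t \<le> 1 \<Longrightarrow> w x \<le> w (t *\<^sub>R x)" "continuous_on UNIV w"
proof -
  define w where "w x = 1 / (1 + (norm x)\<^sup>2)" for x :: R2
  define G where "G x = (- 2 / (1 + (norm x)\<^sup>2)\<^sup>2) *\<^sub>R x" for x :: R2
  have p: "1 + (norm x)\<^sup>2 > 0" for x :: R2 by (simp add: add_pos_nonneg)
  have p': "1 + (norm x)\<^sup>2 \<noteq> 0" for x :: R2 using p[of x] by linarith
  have cw: "continuous_on UNIV w" unfolding w_def using p' by (intro continuous_intros) auto
  have cG: "continuous_on UNIV G" unfolding G_def using p' by (intro continuous_intros) auto
  have [measurable]: "w \<in> borel_measurable borel" "G \<in> borel_measurable borel" using cw cG by (auto intro: borel_measurable_continuous_onI)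
  have "(\<integral>\<^sup>+r. ennreal (1 / (1 + r)\<^sup>2) * indicator {0..} r \<partial>lborel) = ennreal (0 - (- 1 / (1 + 0)))"
  proof (rule nn_integral_FTC_atLeast)
    show "((\<lambda>r::real. - 1 / (1 + r)) \<longlongrightarrow> 0) at_top" by real_asymp
    show "((\<lambda>r. - 1 / (1 + r)) has_real_derivative 1 / (1 + r)\<^sup>2) (at r)" if "0 \<le> r" for r :: real
      using that by (auto intro!: derivative_eq_intros simp: power2_eq_square)
  qed auto
  then have "integrable lborel (\<lambda>r::real. 1 / (1 + r)\<^sup>2 * indicator {0..} r)"
    by (intro integrableI_nonneg) (auto simp: ennreal_mult'[symmetric] ennreal_indicator[symmetric] ennreal_mult simp del: ennreal_indicator)
  from integrable_mult_right[OF integrable_mult_indicator[OF _ this, of "{0<..}"], of pi]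
  have "integrable lborel (\<lambda>r::real. pi * (indicator {0<..} r *\<^sub>R (1 / (1 + r)\<^sup>2 * indicator {0..} r)))" by simp
  then have "integrable lborel (\<lambda>r::real. (pi * indicator {0<..} r) * (1 / (1 + r)\<^sup>2))"
    by (rule Bochner_Integration.integrable_cong[THEN iffD1, rotated 2]) (auto split: split_indicator)
  then have wI: "integrable lborel (\<lambda>x. (w x)\<^sup>2)"
    using integral_norm_square_R2(2)[of "\<lambda>r. 1 / (1 + r)\<^sup>2"] by (simp add: w_def power_divide)
  have GI: "integrable lborel (\<lambda>x. (norm (G x))\<^sup>2)"
  proof (rule Bochner_Integration.integrable_bound[OF integrable_mult_right[OF wI, of 4]])
    have "(norm (G x))\<^sup>2 \<le> 4 * (w x)\<^sup>2" for x
    proof -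
      define y where "y = 1 + (norm x)\<^sup>2"
      have y: "y \<ge> 1" "(norm x)\<^sup>2 \<le> y" by (auto simp: y_def)
      have "(norm (G x))\<^sup>2 = 4 * (norm x)\<^sup>2 / (y\<^sup>2)\<^sup>2" by (simp add: G_def y_def power_mult_distrib power_divide)
      also have "\<dots> \<le> 4 * y / (y\<^sup>2)\<^sup>2" using y by (intro divide_right_mono) auto
      also have "\<dots> \<le> 4 * y\<^sup>2 / (y\<^sup>2)\<^sup>2" using y by (intro divide_right_mono mult_left_mono) (auto simp: power2_eq_square)
      also have "\<dots> = 4 * (1 / y)\<^sup>2" using y by (simp add: power_divide power2_eq_square)
      also have "1 / y = w x" by (simp add: w_def y_def)
      finally show ?thesis .
    qed
    then show "AE x in lborel. norm ((norm (G x))\<^sup>2) \<le> norm (4 * (w x)\<^sup>2)" by simp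
  qed measurable
  have d: "(w has_derivative (\<lambda>h. G x \<bullet> h)) (at x)" for x
  proof -
    have n: "((\<lambda>x::R2. 1 + (norm x)\<^sup>2) has_derivative (\<lambda>h. 2 * (x \<bullet> h))) (at x)"
      unfolding power2_norm_eq_inner by (auto intro!: derivative_eq_intros simp: inner_commute)
    show ?thesis unfolding w_def
      by (rule has_derivative_eq_rhs[OF has_derivative_divide[OF has_derivative_const n p']])
        (use p' in \<open>auto simp: G_def power2_eq_square field_simps\<close>)
  qed
  show ?thesis
  proof (rule that[of w])
    show "H1r w"
      by (rule H1r_I[OF _ wI weak_grad_C1[OF d cG wI GI]]) (auto simp: radial_def w_def)
    show "w x > 0" for x using p by (simp add: w_def)
    show "w x \<le> w (t *\<^sub>R x)" if t: "0 < t" "t \<le> 1" for x t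
    proof -
      have "(t * norm x)\<^sup>2 \<le> (norm x)\<^sup>2" using t by (intro power_mono mult_left_le_one_le) auto
      then show ?thesis using p[of x] p[of "t *\<^sub>R x"] t by (auto simp: w_def intro!: divide_left_mono mult_pos_pos)
    qed
  qed (rule cw)
qed

lemma C4_pos: "C4 > 0"
proof -
  obtain w :: "R2 \<Rightarrow> real" where w: "H1r w" "\<And>x. w x > 0" "continuous_on UNIV w" by (rule radial_witness) blast
  have "(\<integral>x. (w x)^4 \<partial>lborel) > 0"
  proof (rule integral_pos_if_AE_nonzero[OF H1r_L4(1)[OF w(1)]])
    show "\<not> (AE x in lborel. (w x)^4 = 0)"
      by (rule continuous_not_AE_zero[of _ 0]) (use w(2)[of 0] w(3) in \<open>auto intro!: continuous_intros\<close>)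
  qed simp
  then show ?thesis using C4_bound(2)[OF _ H1r_D(5)[OF w(1)]] H1r_D(5)[OF w(1)] by blast
qed

text \<open>Spreading the witness as t k w(t x) keeps the mass and makes the energy and the nonlocal
  term of order t^2, while w(t x) \<ge> w(x) keeps the source term at least t k I. For small t the
  linear term wins.\<close>

lemma negative_energy:
  assumes g: "Lp_fun (4/3) g" "continuous_on UNIV g" "\<forall>x. g x \<ge> 0" "\<exists>x. g x \<noteq> 0"
    and c: "c > 0" and s: "s > 0"
  obtains v where "H1r v" "L2_sq v = c" "grad_sq v < s" "Phi g v < 0"
proof -
  obtain w :: "R2 \<Rightarrow> real" where w: "H1r w" "\<And>x. w x > 0" "\<And>x t. 0 < t \<Longrightarrow> t \<le> 1 \<Longrightarrow> w x \<le> w (t *\<^sub>R x)" "continuous_on UNIV w"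
    by (rule radial_witness) blast
  have L: "L2_sq w > 0" unfolding L2_sq_def
  proof (rule integral_pos_if_AE_nonzero[OF H1r_D(2)[OF w(1)]])
    show "\<not> (AE x in lborel. (w x)\<^sup>2 = 0)"
      by (rule continuous_not_AE_zero[of _ 0]) (use w(2)[of 0] w(4) in \<open>auto intro!: continuous_intros\<close>)
  qed simp
  define I where "I = (\<integral>x. g x * w x \<partial>lborel)"
  have I: "I > 0" unfolding I_def
  proof (rule integral_pos_if_AE_nonzero[OF gu_integrable(1)[OF g(1) w(1)]])
    obtain y where "g y \<noteq> 0" using g(4) by auto
    then show "\<not> (AE x in lborel. g x * w x = 0)"
      by (intro continuous_not_AE_zero[of _ y]) (use w(2)[of y] w(4) g(2) in \<open>auto intro!: continuous_intros\<close>)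
    show "g x * w x \<ge> 0" for x using g(3) w(2)[of x] by simp
  qed
  define k where "k = sqrt (c / L2_sq w)"
  have k: "k > 0" "k\<^sup>2 = c / L2_sq w" using c L by (simp_all add: k_def)
  define S where "S = k\<^sup>2 * grad_sq w"
  have S: "S \<ge> 0" using grad_sq_nonneg[of w] by (simp add: S_def)
  define A where "A = S + k^6 * Bterm w"
  have A: "A \<ge> 0" using S Bterm_nonneg[of w] k by (simp add: A_def)
  \<comment> \<open>The second bound makes the linear term win, the third keeps the energy below s;
    adding 1 avoids division by zero.\<close>
  define t where "t = min 1 (min (k * I / (A + 1)) (s / (2 * (S + 1))))"
  have t: "0 < t" "t \<le> 1" "t \<le> k * I / (A + 1)" "t \<le> s / (2 * (S + 1))" using k I A S s by (auto simp: t_def)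
  define v where "v x = (t * k) * w (t *\<^sub>R x)" for x
  note H = H1r_dilate[OF w(1) t(1), of "t * k", folded v_def]
  show ?thesis
  proof (rule that[of v])
    show v: "H1r v" by (rule H(1))
    show "L2_sq v = c" unfolding H(2) using t L k by (simp add: power_mult_distrib)
    have gv: "grad_sq v = t\<^sup>2 * S" unfolding H(3) by (simp add: S_def power_mult_distrib)
    have "t\<^sup>2 * S \<le> t * S" using t S by (intro mult_right_mono) (auto simp: power2_eq_square mult_left_le_one_le)
    also have "\<dots> \<le> s / (2 * (S + 1)) * S" using t S by (intro mult_right_mono) auto
    also have "\<dots> < s"
    proof -
      have "S / (2 * (S + 1)) < 1" using S by simp
      then have "s * (S / (2 * (S + 1))) < s * 1" using s by (intro mult_strict_left_mono)
      then show ?thesis by simp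
    qed
    finally show "grad_sq v < s" by (simp add: gv)
    have Bv: "Bterm v = t\<^sup>2 * (k^6 * Bterm w)"
    proof -
      have "(t * k)^6 / t^4 = t\<^sup>2 * k^6" using t by (simp add: power_mult_distrib field_simps flip: power_add)
      then show ?thesis unfolding H(4) by simp
    qed
    have "t * k * I \<le> (\<integral>x. g x * v x \<partial>lborel)"
    proof -
      have "(\<integral>x. (t * k) * (g x * w x) \<partial>lborel) \<le> (\<integral>x. g x * v x \<partial>lborel)"
      proof (rule integral_mono)
        show "integrable lborel (\<lambda>x. (t * k) * (g x * w x))" using gu_integrable(1)[OF g(1) w(1)] by simp
        show "integrable lborel (\<lambda>x. g x * v x)" by (rule gu_integrable(1)[OF g(1) v])
        show "(t * k) * (g x * w x) \<le> g x * v x" for x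
        proof -
          have "(t * k) * w x \<le> v x" unfolding v_def using w(3)[OF t(1,2), of x] t k by (intro mult_left_mono) auto
          then have "g x * ((t * k) * w x) \<le> g x * v x" using g(3) by (intro mult_left_mono) auto
          then show ?thesis by (simp add: mult_ac)
        qed
      qed
      then show ?thesis by (simp add: I_def)
    qed
    moreover have "(\<integral>x. exp_excess (v x) \<partial>lborel) \<ge> 0" using exp_excess_nonneg by (intro integral_nonneg_AE) auto
    ultimately have "Phi g v \<le> 1/2 * t\<^sup>2 * A - t * k * I"
      unfolding Phi_exp_excess gv Bv by (simp add: A_def algebra_simps)
    also have "\<dots> < 0"
    proof -
      have "t * A \<le> k * I / (A + 1) * A" using t A by (intro mult_right_mono) auto
      also have "\<dots> \<le> k * I"
      proof -
        have "k * I * (A / (A + 1)) \<le> k * I * 1" using k I A by (intro mult_left_mono) auto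
        then show ?thesis by simp
      qed
      finally have "1/2 * (t * A) < k * I" using k I mult_pos_pos[of k I] by linarith
      then have "t * (1/2 * (t * A)) < t * (k * I)" using t by (intro mult_strict_left_mono)
      then show ?thesis by (simp add: power2_eq_square mult_ac)
    qed
    finally show "Phi g v < 0" .
  qed
qed

subsection \<open>Minimizing sequences\<close>

text \<open>Upper semicontinuity without a global dominating function: domination is needed only on
  balls, and the tails are uniformly of order 1/R. The part of h' outside the ball is nonnegative
  and may be added for free.\<close>

lemma integral_limsup_with_tails:
  fixes h :: "nat \<Rightarrow> R2 \<Rightarrow> real"
  assumes hm[measurable]: "\<And>n. h n \<in> borel_measurable borel" "h' \<in> borel_measurable borel"
    and nn: "\<And>n x. h n x \<ge> 0" "\<And>x. h' x \<ge> 0" and hI: "\<And>n. integrable lborel (h n)" "integrable lborel h'"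
    and lim: "AE x in lborel. (\<lambda>n. h n x) \<longlonglongrightarrow> h' x"
    and dom: "\<And>R. R \<ge> 1 \<Longrightarrow> \<exists>D. integrable lborel D \<and> (\<forall>n. AE x in lborel. norm x \<le> R \<longrightarrow> h n x \<le> D x)"
    and tail: "\<And>R n. R \<ge> 1 \<Longrightarrow> (\<integral>x. (if norm x \<le> R then 0 else h n x) \<partial>lborel) \<le> C / R"
    and e: "e > 0"
  shows "eventually (\<lambda>n. (\<integral>x. h n x \<partial>lborel) < (\<integral>x. h' x \<partial>lborel) + e) sequentially"
proof -
  define R where "R = max 1 (2 * (\<bar>C\<bar> + 1) / e)"
  have R: "R \<ge> 1" by (simp add: R_def)
  have "C / R \<le> \<bar>C\<bar> / R" using R by (intro divide_right_mono) auto
  also have "\<dots> < e / 2"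
  proof -
    have "2 * (\<bar>C\<bar> + 1) / e \<le> R" by (simp add: R_def)
    then have "2 * (\<bar>C\<bar> + 1) \<le> R * e" using e by (simp add: pos_divide_le_eq)
    then have "\<bar>C\<bar> < e / 2 * R" by (simp add: mult.commute)
    then show ?thesis using R by (simp add: pos_divide_less_eq)
  qed
  finally have CR: "C / R < e / 2" .
  obtain D where D: "integrable lborel D" "\<And>n. AE x in lborel. norm x \<le> R \<longrightarrow> h n x \<le> D x" using dom[OF R] by blast
  have "(\<lambda>n. \<integral>x. (if norm x \<le> R then h n x else 0) \<partial>lborel) \<longlonglongrightarrow> (\<integral>x. (if norm x \<le> R then h' x else 0) \<partial>lborel)"
  proof (rule integral_dominated_convergence[OF _ _ integrable_abs[OF D(1)]])
    show "AE x in lborel. (\<lambda>n. if norm x \<le> R then h n x else 0) \<longlonglongrightarrow> (if norm x \<le> R then h' x else 0)"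
      using lim by eventually_elim auto
    show "AE x in lborel. norm (if norm x \<le> R then h n x else 0) \<le> \<bar>D x\<bar>" for n
      using D(2)[of n] by eventually_elim (use nn in auto)
  qed measurable
  then have "eventually (\<lambda>n. (\<integral>x. (if norm x \<le> R then h n x else 0) \<partial>lborel) < (\<integral>x. (if norm x \<le> R then h' x else 0) \<partial>lborel) + e / 2) sequentially"
    by (rule order_tendstoD(2)) (use e in simp)
  then show ?thesis
  proof eventually_elim
    case (elim n)
    have i1: "integrable lborel (\<lambda>x. if norm x \<le> R then h n x else 0)" "integrable lborel (\<lambda>x. if norm x \<le> R then 0 else h n x)" "integrable lborel (\<lambda>x. if norm x \<le> R then h' x else 0)"
      by (rule Bochner_Integration.integrable_bound[OF hI(1)[of n]] Bochner_Integration.integrable_bound[OF hI(2)]; force simp: nn)+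
    have "(\<integral>x. h n x \<partial>lborel) = (\<integral>x. (if norm x \<le> R then h n x else 0) + (if norm x \<le> R then 0 else h n x) \<partial>lborel)"
      by (intro Bochner_Integration.integral_cong) auto
    also have "\<dots> = (\<integral>x. (if norm x \<le> R then h n x else 0) \<partial>lborel) + (\<integral>x. (if norm x \<le> R then 0 else h n x) \<partial>lborel)" using i1 by simp
    also have "\<dots> < (\<integral>x. (if norm x \<le> R then h' x else 0) \<partial>lborel) + e / 2 + e / 2" using elim tail[OF R, of n] CR by linarith
    also have "(\<integral>x. (if norm x \<le> R then h' x else 0) \<partial>lborel) \<le> (\<integral>x. h' x \<partial>lborel)" using i1(3) hI(2) nn by (intro integral_mono) auto
    finally show ?case by simp
  qed
qed

text \<open>A diagonal argument over the rational radii. The logarithmic oscillation bound makes the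
  family equicontinuous away from 0, which extends convergence to every r > 0.\<close>

lemma radial_sequence_limit:
  fixes f :: "nat \<Rightarrow> real \<Rightarrow> real"
  assumes S: "S \<ge> 0" and K: "K \<ge> 0"
    and fd: "\<And>n a b. 0 < a \<Longrightarrow> a \<le> b \<Longrightarrow> (f n b - f n a)\<^sup>2 \<le> ln (b / a) / (2 * pi) * S"
    and fb: "\<And>n r. 0 < r \<Longrightarrow> (f n r)\<^sup>2 \<le> K / r"
    and sb: "\<And>n. 0 \<le> s n" "\<And>n. s n \<le> S"
  obtains k where "strict_mono (k :: nat \<Rightarrow> nat)" "\<And>r. 0 < r \<Longrightarrow> convergent (\<lambda>n. f (k n) r)" "convergent (\<lambda>n. s (k n))"
proof -
  \<comment> \<open>The factor sqrt(r) makes the values uniformly bounded in r. The free slot r = 0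
    carries the numbers \<open>s n\<close>, so one extraction serves for both.\<close>
  define F where "F n r = (if r = 0 then s n else sqrt r * f n r)" for n r
  have Fb: "norm (F n r) \<le> max S (sqrt K)" if "r \<in> {r. r \<ge> 0} \<inter> \<rat>" for n r
  proof (cases "r = 0")
    case True
    then show ?thesis using sb[of n] by (simp add: F_def)
  next
    case False
    then have r: "r > 0" using that by simp
    have "(F n r)\<^sup>2 = r * (f n r)\<^sup>2" using r by (simp add: F_def power_mult_distrib)
    also have "\<dots> \<le> r * (K / r)" using r by (intro mult_left_mono fb) auto
    also have "\<dots> = K" using r by simp
    finally have "\<bar>F n r\<bar> \<le> sqrt K" by (metis real_sqrt_abs real_sqrt_le_mono)
    then show ?thesis by simp
  qed
  have "countable ({r::real. r \<ge> 0} \<inter> \<rat>)" by (intro countable_Int2 countable_rat)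
  from function_convergent_subsequence[OF this, of F, OF Fb]
  obtain k where k: "strict_mono (k :: nat \<Rightarrow> nat)" "\<And>r. r \<in> {r. r \<ge> 0} \<inter> \<rat> \<Longrightarrow> \<exists>l. (\<lambda>n. F (k n) r) \<longlonglongrightarrow> l" by auto
  have cs: "convergent (\<lambda>n. s (k n))" using k(2)[of 0] by (auto simp: F_def convergent_def)
  have cq: "convergent (\<lambda>n. f (k n) q)" if q: "q > 0" "q \<in> \<rat>" for q
  proof -
    obtain l where "(\<lambda>n. F (k n) q) \<longlonglongrightarrow> l" using k(2)[of q] q by auto
    then have "(\<lambda>n. F (k n) q / sqrt q) \<longlonglongrightarrow> l / sqrt q" using q by (intro tendsto_intros) auto
    then show ?thesis using q by (auto simp: F_def convergent_def)
  qed
  have "convergent (\<lambda>n. f (k n) r)" if r: "0 < r" for r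
  proof (rule Cauchy_convergent, rule metric_CauchyI)
    fix e :: real assume e: "e > 0"
    \<comment> \<open>Chosen so that ln(q/r) < d keeps the oscillation between r and the rational q
      below e/3 for all n at once.\<close>
    define d where "d = 2 * pi * (e / 3)\<^sup>2 / (S + 1)"
    have d: "d > 0" using e S by (simp add: d_def)
    have "r < r * exp d" using r d by simp
    then obtain q where q: "q \<in> \<rat>" "r < q" "q < r * exp d" using Rats_dense_in_real by blast
    have close: "\<bar>f n q - f n r\<bar> < e / 3" for n
    proof -
      have "q / r < exp d" using q r by (simp add: pos_divide_less_eq mult.commute)
      then have "ln (q / r) < ln (exp d)" using q r by (intro ln_less_cancel_iff[THEN iffD2]) auto
      then have ln: "ln (q / r) < d" by simp
      have "(f n q - f n r)\<^sup>2 \<le> ln (q / r) / (2 * pi) * S" using fd[of r q n] r q by simp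
      also have "\<dots> \<le> d / (2 * pi) * S" using ln S by (intro mult_right_mono divide_right_mono) auto
      also have "\<dots> = (e / 3)\<^sup>2 * (S / (S + 1))" by (simp add: d_def power_divide)
      also have "\<dots> < (e / 3)\<^sup>2 * 1" using S e by (intro mult_strict_left_mono) auto
      finally have "\<bar>f n q - f n r\<bar>\<^sup>2 < (e / 3)\<^sup>2" by simp
      then show ?thesis by (rule power2_less_imp_less) (use e in simp)
    qed
    have "Cauchy (\<lambda>n. f (k n) q)" using cq q r by (intro convergent_Cauchy) auto
    then obtain M where M: "\<And>m n. m \<ge> M \<Longrightarrow> n \<ge> M \<Longrightarrow> dist (f (k m) q) (f (k n) q) < e / 3"
      using metric_CauchyD[of "\<lambda>n. f (k n) q" "e / 3"] e by auto
    show "\<exists>M. \<forall>m\<ge>M. \<forall>n\<ge>M. dist (f (k m) r) (f (k n) r) < e"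
    proof (intro exI allI impI)
      fix m n assume "M \<le> m" "M \<le> n"
      then have "\<bar>f (k m) q - f (k n) q\<bar> < e / 3" using M by (simp add: dist_real_def)
      then show "dist (f (k m) r) (f (k n) r) < e" using close[of "k m"] close[of "k n"] unfolding dist_real_def by linarith
    qed
  qed
  then show ?thesis using that k(1) cs by blast
qed

text \<open>Every term passes in the direction needed for Phi(w) \<le> m: energy and B are lower
  semicontinuous, the exponential integral is upper semicontinuous, and the source pairing is
  controlled by strong L^4 convergence. The L^2 norm is not: there only the inequality
  remains.\<close>

lemma minimizing_sequence_limit:
  fixes u :: "nat \<Rightarrow> R2 \<Rightarrow> real"
  assumes g: "Lp_fun (4/3) g"
    and uH: "\<And>n. H1r (u n)" and upos: "\<And>n x. u n x \<ge> 0" and uc: "\<And>n. L2_sq (u n) = c" and us: "\<And>n. grad_sq (u n) \<le> S" and S: "S \<le> pi / 3"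
    and lim: "(\<lambda>n. Phi g (u n)) \<longlonglongrightarrow> m"
  obtains w where "H1r w" "AE x in lborel. w x \<ge> 0" "L2_sq w \<le> c" "grad_sq w \<le> S" "Phi g w \<le> m"
proof -
  have S0: "S \<ge> 0" using us[of 0] grad_sq_nonneg[of "u 0"] by linarith
  have c0: "c \<ge> 0" using uc[of 0] L2_sq_nonneg[of "u 0"] by simp
  \<comment> \<open>The decay constant for l = 1; an optimal l has no advantage here.\<close>
  define K where "K = (c + S / 2) / pi"
  have K0: "K \<ge> 0" using S0 c0 by (simp add: K_def)
  have "\<exists>f. (AE x in lborel. u n x = f (norm x)) \<and> f \<in> borel_measurable borel \<and>
    (\<forall>a b. 0 < a \<longrightarrow> a \<le> b \<longrightarrow> (f b - f a)\<^sup>2 \<le> ln (b / a) / (2 * pi) * S) \<and> (\<forall>r>0. (f r)\<^sup>2 \<le> K / r)" for n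
  proof -
    obtain f where f: "AE x in lborel. u n x = f (norm x)" "f \<in> borel_measurable borel"
      "\<And>a b. 0 < a \<Longrightarrow> a \<le> b \<Longrightarrow> (f b - f a)\<^sup>2 \<le> ln (b / a) / (2 * pi) * grad_sq (u n)"
      "\<And>r l. 0 < r \<Longrightarrow> 0 < l \<Longrightarrow> (f r)\<^sup>2 \<le> (L2_sq (u n) / l + grad_sq (u n) * l / 2) / (pi * r)"
      by (rule H1r_representation[OF uH[of n]]) blast
    have "(f b - f a)\<^sup>2 \<le> ln (b / a) / (2 * pi) * S" if "0 < a" "a \<le> b" for a b
    proof (rule order_trans[OF f(3)[OF that]])
      show "ln (b / a) / (2 * pi) * grad_sq (u n) \<le> ln (b / a) / (2 * pi) * S" using that us[of n] by (intro mult_left_mono) auto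
    qed
    moreover have "(f r)\<^sup>2 \<le> K / r" if r: "r > 0" for r
    proof -
      have "(f r)\<^sup>2 \<le> (c / 1 + grad_sq (u n) * 1 / 2) / (pi * r)" using f(4)[OF r, of 1] uc[of n] by simp
      also have "\<dots> \<le> (c + S / 2) / (pi * r)" using us[of n] r by (intro divide_right_mono) auto
      finally show ?thesis by (simp add: K_def)
    qed
    ultimately show ?thesis using f(1,2) by blast
  qed
  then have "\<forall>n. \<exists>f. (AE x in lborel. u n x = f (norm x)) \<and> f \<in> borel_measurable borel \<and>
    (\<forall>a b. 0 < a \<longrightarrow> a \<le> b \<longrightarrow> (f b - f a)\<^sup>2 \<le> ln (b / a) / (2 * pi) * S) \<and> (\<forall>r>0. (f r)\<^sup>2 \<le> K / r)" by (rule allI)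
  from choice[OF this] obtain f where "\<forall>n. (AE x in lborel. u n x = f n (norm x)) \<and> f n \<in> borel_measurable borel \<and>
    (\<forall>a b. 0 < a \<longrightarrow> a \<le> b \<longrightarrow> (f n b - f n a)\<^sup>2 \<le> ln (b / a) / (2 * pi) * S) \<and> (\<forall>r>0. (f n r)\<^sup>2 \<le> K / r)" ..
  then have f: "\<And>n. AE x in lborel. u n x = f n (norm x)" and fm[measurable]: "\<And>n. f n \<in> borel_measurable borel"
    and fd: "\<And>n a b. 0 < a \<Longrightarrow> a \<le> b \<Longrightarrow> (f n b - f n a)\<^sup>2 \<le> ln (b / a) / (2 * pi) * S" and fb: "\<And>n r. 0 < r \<Longrightarrow> (f n r)\<^sup>2 \<le> K / r"
    by auto
  obtain k where k: "strict_mono (k :: nat \<Rightarrow> nat)" "\<And>r. 0 < r \<Longrightarrow> convergent (\<lambda>n. f (k n) r)" "convergent (\<lambda>n. grad_sq (u (k n)))"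
    by (rule radial_sequence_limit[OF S0 K0, of f "\<lambda>n. grad_sq (u n)"]) (use fd fb us grad_sq_nonneg in auto)
  define v where "v n = u (k n)" for n
  have vH: "H1r (v n)" for n by (simp add: v_def uH)
  note vD = H1r_D[OF vH]
  have [measurable]: "v n \<in> borel_measurable borel" for n by (rule vD(1))
  define w where "w x = lim (\<lambda>n. f (k n) (norm x))" for x :: R2
  have wm[measurable]: "w \<in> borel_measurable borel" unfolding w_def by (rule borel_measurable_lim_metric) measurable
  have fw: "(\<lambda>n. f (k n) (norm x)) \<longlonglongrightarrow> w x" if "x \<noteq> 0" for x
    using k(2)[of "norm x"] that by (simp add: w_def convergent_LIMSEQ_iff)
  have "AE x in lborel. \<forall>n. v n x = f (k n) (norm x)" using f by (simp add: v_def AE_all_countable)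
  then have AEv: "AE x in lborel. x \<noteq> 0 \<and> (\<forall>n. v n x = f (k n) (norm x)) \<and> (\<lambda>n. v n x) \<longlonglongrightarrow> w x"
    using AE_lborel_singleton[of "0::R2"] by eventually_elim (use fw in auto)
  have wrad: "radial w" by (auto simp: radial_def w_def)
  \<comment> \<open>Here S \<le> pi/3 enters: the logarithm gets the coefficient 1/3, uniformly in
    n, so exp(u^2) stays integrable at the origin.\<close>
  have fsup: "(f n r)\<^sup>2 \<le> 2 * K + 1/3 * ln (1 / r)" if r: "0 < r" "r \<le> 1" for n r
  proof -
    have "(f n 1 - f n r)\<^sup>2 \<le> ln (1 / r) / (2 * pi) * S" using fd[OF r] by simp
    also have "\<dots> \<le> ln (1 / r) / (2 * pi) * (pi / 3)" using r S by (intro mult_left_mono) auto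
    also have "\<dots> = 1/6 * ln (1 / r)" by simp
    finally have "(f n 1 - f n r)\<^sup>2 \<le> 1/6 * ln (1 / r)" .
    then show ?thesis using square_le_double[of "f n r" "f n 1"] fb[of 1 n] by simp
  qed
  have expb: "exp ((f n r)\<^sup>2) \<le> exp (2 * K) * (1 + 1 / r)" if r: "0 < r" for n r
  proof (cases "r \<le> 1")
    case True
    have l0: "ln (1 / r) \<ge> 0" using r True by (intro ln_ge_zero) auto
    have "(f n r)\<^sup>2 \<le> 2 * K + ln (1 / r)" using fsup[OF r True, of n] l0 by linarith
    then have "exp ((f n r)\<^sup>2) \<le> exp (2 * K + ln (1 / r))" by simp
    also have "\<dots> = exp (2 * K) * (1 / r)" using r by (simp add: exp_add)
    also have "\<dots> \<le> exp (2 * K) * (1 + 1 / r)" by (intro mult_left_mono) auto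
    finally show ?thesis .
  next
    case False
    have "(f n r)\<^sup>2 \<le> K / r" by (rule fb[OF r])
    also have "\<dots> \<le> K / 1" using False K0 by (intro divide_left_mono) auto
    finally have "exp ((f n r)\<^sup>2) \<le> exp (2 * K)" using K0 by simp
    also have "\<dots> \<le> exp (2 * K) * (1 + 1 / r)" using r by simp
    finally show ?thesis .
  qed
  have p4: "y^4 \<le> 2 * exp (y\<^sup>2)" for y :: real
    using exp_excess_ge[of y] zero_le_power2[of y] unfolding exp_excess_def by linarith
  have f4: "(f n r)^4 \<le> 2 * (exp (2 * K) * (1 + 1 / r))" if r: "0 < r" for n r
    using p4[of "f n r"] expb[OF r, of n] by linarith
  have wb: "(w x)\<^sup>2 \<le> K / norm x" if "x \<noteq> 0" for x
    by (rule LIMSEQ_le_const2[OF tendsto_power[OF fw[OF that]]]) (use fb that in auto)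
  have w4: "(w x)^4 \<le> 2 * (exp (2 * K) * (1 + 1 / norm x))" if "x \<noteq> 0" for x
    by (rule LIMSEQ_le_const2[OF tendsto_power[OF fw[OF that]]]) (use f4 that in auto)
  have domI: "integrable lborel (\<lambda>x::R2. if norm x \<le> R then a + b / norm x else 0)" if "R \<ge> 0" for R a b :: real
  proof -
    have "emeasure lborel (cball (0::R2) R) < \<infinity>" by (rule emeasure_bounded_finite) simp
    then have "integrable lborel (\<lambda>x::R2. a * indicator (cball 0 R) x + b * (indicator (cball 0 R) x / norm x))"
      using integral_inverse_norm_R2[OF that] by (intro Bochner_Integration.integrable_add integrable_mult_right integrable_real_indicator) (auto simp: has_bochner_integral_iff)
    then show ?thesis by (rule Bochner_Integration.integrable_cong[THEN iffD1, rotated 2]) (auto split: split_indicator)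
  qed
  text \<open>Mass can only be lost in the limit.\<close>
  have wL: "(\<integral>\<^sup>+x. ennreal ((w x)\<^sup>2) \<partial>lborel) \<le> ennreal c"
  proof -
    have "(\<integral>\<^sup>+x. ennreal ((w x)\<^sup>2) \<partial>lborel) = (\<integral>\<^sup>+x. liminf (\<lambda>n. ennreal ((v n x)\<^sup>2)) \<partial>lborel)"
    proof (rule nn_integral_cong_AE, use AEv in eventually_elim)
      case (elim x)
      have L: "(\<lambda>n. ennreal ((v n x)\<^sup>2)) \<longlonglongrightarrow> ennreal ((w x)\<^sup>2)" using elim by (intro tendsto_ennrealI tendsto_intros) auto
      show ?case by (rule lim_imp_Liminf[OF _ L, symmetric]) simp
    qed
    also have "\<dots> \<le> liminf (\<lambda>n. \<integral>\<^sup>+x. ennreal ((v n x)\<^sup>2) \<partial>lborel)" by (rule nn_integral_liminf) simp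
    also have "(\<lambda>n. \<integral>\<^sup>+x. ennreal ((v n x)\<^sup>2) \<partial>lborel) = (\<lambda>n. ennreal c)"
      using uc by (subst nn_integral_eq_integral[OF vD(2)]) (auto simp: L2_sq_def v_def)
    finally show ?thesis by (simp add: Liminf_const)
  qed
  have wI: "integrable lborel (\<lambda>x. (w x)\<^sup>2)" using order_le_less_trans[OF wL] by (intro integrableI_nonneg) auto
  have wc: "L2_sq w \<le> c" unfolding L2_sq_def using wL c0 by (subst (asm) nn_integral_eq_integral[OF wI]) auto
  obtain sl where sl: "(\<lambda>n. grad_sq (v n)) \<longlonglongrightarrow> sl" using k(3) by (auto simp: convergent_def v_def)
  have slS: "sl \<le> S" by (rule LIMSEQ_le_const2[OF sl]) (use us in \<open>auto simp: v_def\<close>)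
  have tl: "(\<lambda>n. \<integral>x. v n x *\<^sub>R Dphi x \<partial>lborel) \<longlonglongrightarrow> (\<integral>x. w x *\<^sub>R Dphi x \<partial>lborel)"
    if T: "test_fun phi Dphi" for phi Dphi
  proof -
    obtain R M where R: "R > 0" "M \<ge> 0" "\<And>x. norm x > R \<Longrightarrow> Dphi x = 0" "\<And>x. norm (Dphi x) \<le> M"
      by (rule test_fun_props[OF T]) blast
    note [measurable] = test_fun_integrable(3,4)[OF T]
    show "(\<lambda>n. \<integral>x. v n x *\<^sub>R Dphi x \<partial>lborel) \<longlonglongrightarrow> (\<integral>x. w x *\<^sub>R Dphi x \<partial>lborel)"
    \<comment> \<open>From |v| \<le> 1 + v^2 and v^2 \<le> K/|x|; the singularity 1/|x| is
      integrable in the plane.\<close>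
    proof (rule integral_dominated_convergence[where w = "\<lambda>x. M * (if norm x \<le> R then 1 + K / norm x else 0)"])
      show "integrable lborel (\<lambda>x. M * (if norm (x::R2) \<le> R then 1 + K / norm x else 0))" using domI[of R 1 K] R by (intro integrable_mult_right) auto
      show "AE x in lborel. (\<lambda>n. v n x *\<^sub>R Dphi x) \<longlonglongrightarrow> w x *\<^sub>R Dphi x" using AEv by eventually_elim (auto intro!: tendsto_intros)
      fix n
      show "AE x in lborel. norm (v n x *\<^sub>R Dphi x) \<le> M * (if norm x \<le> R then 1 + K / norm x else 0)"
        using AEv
      proof eventually_elim
        case (elim x)
        show ?case
        proof (cases "norm x \<le> R")
          case True
          have "\<bar>v n x\<bar> \<le> 1 + (v n x)\<^sup>2" using sum_squares_bound[of "\<bar>v n x\<bar>" 1] abs_ge_zero[of "v n x"] unfolding power2_abs by simp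
          also have "(v n x)\<^sup>2 \<le> K / norm x" using elim fb[of "norm x" "k n"] by simp
          finally have "\<bar>v n x\<bar> * norm (Dphi x) \<le> (1 + K / norm x) * M" using R K0 by (intro mult_mono) auto
          then show ?thesis using True by (simp add: mult.commute)
        qed (use R in simp)
      qed
    qed measurable
  qed
  obtain H where H: "L2_grad w H" "(\<integral>x. (norm (H x))\<^sup>2 \<partial>lborel) \<le> sl"
    by (rule L2_grad_limit[OF vD(3) sl[unfolded grad_sq_def] tl])
  have wH: "H1r w" by (rule H1r_I[OF wm wI H(1) wrad])
  have ws: "grad_sq w \<le> sl" using H(2) by (simp add: grad_sq_eq[OF H(1)])
  have wpos: "AE x in lborel. w x \<ge> 0"
    using AEv by eventually_elim (auto intro!: LIMSEQ_le_const simp: v_def upos)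
  have Eev: "eventually (\<lambda>n. (\<integral>x. exp_excess (v n x) \<partial>lborel) < (\<integral>x. exp_excess (w x) \<partial>lborel) + e) sequentially" if e: "e > 0" for e
  \<comment> \<open>Outside radius R one has v^2 \<le> K/R and v^2 \<le> K, so the integrand, at
    most (v^4/2) exp(v^2), is bounded by (K exp(K)/(2 R)) v^2, and the integral of v^2 is c.\<close>
  proof (rule integral_limsup_with_tails[where C = "K * exp K / 2 * c", OF _ _ _ _ _ _ _ _ _ e])
    show "AE x in lborel. (\<lambda>n. exp_excess (v n x)) \<longlonglongrightarrow> exp_excess (w x)"
      using AEv by eventually_elim (auto simp: exp_excess_def intro!: tendsto_intros)
    fix R :: real assume R: "R \<ge> 1"
    show "\<exists>D. integrable lborel D \<and> (\<forall>n. AE x in lborel. norm x \<le> R \<longrightarrow> exp_excess (v n x) \<le> D x)"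
    proof (intro exI conjI allI)
      show "integrable lborel (\<lambda>x::R2. if norm x \<le> R then exp (2 * K) + exp (2 * K) / norm x else 0)" using R by (intro domI) auto
      show "AE x in lborel. norm x \<le> R \<longrightarrow> exp_excess (v n x) \<le> (if norm x \<le> R then exp (2 * K) + exp (2 * K) / norm x else 0)" for n
        using AEv
      proof eventually_elim
        case (elim x)
        have "exp_excess (v n x) \<le> exp ((v n x)\<^sup>2)" using zero_le_power2[of "v n x"] unfolding exp_excess_def by linarith
        also have "\<dots> \<le> exp (2 * K) + exp (2 * K) / norm x" using expb[of "norm x" "k n"] elim by (simp add: distrib_left)
        finally show ?case by simp
      qed
    qed
    fix n
    have "(\<integral>x. (if norm x \<le> R then 0 else exp_excess (v n x)) \<partial>lborel) \<le> (\<integral>x. (K * exp K / 2 / R) * (v n x)\<^sup>2 \<partial>lborel)"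
    proof (rule integral_mono_AE)
      show "integrable lborel (\<lambda>x. if norm x \<le> R then 0 else exp_excess (v n x))"
        by (rule Bochner_Integration.integrable_bound[OF exp_excess_integrable[OF vH[of n]]]) (auto simp: exp_excess_nonneg)
      show "integrable lborel (\<lambda>x. (K * exp K / 2 / R) * (v n x)\<^sup>2)" using vD(2) by simp
      show "AE x in lborel. (if norm x \<le> R then 0 else exp_excess (v n x)) \<le> (K * exp K / 2 / R) * (v n x)\<^sup>2"
        using AEv
      proof eventually_elim
        case (elim x)
        show ?case
        proof (cases "norm x \<le> R")
          case False
          have a: "(v n x)\<^sup>2 \<le> K / norm x" using fb[of "norm x" "k n"] elim by simp
          also have "\<dots> \<le> K / R" using False R K0 by (intro divide_left_mono mult_pos_pos) auto
          finally have a1: "(v n x)\<^sup>2 \<le> K / R" .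
          also have "K / R \<le> K / 1" using R K0 by (intro divide_left_mono) auto
          finally have a2: "(v n x)\<^sup>2 \<le> K" by simp
          have "exp_excess (v n x) \<le> (v n x)^4 / 2 * exp ((v n x)\<^sup>2)" by (rule exp_excess_le)
          also have "\<dots> = (v n x)\<^sup>2 * exp ((v n x)\<^sup>2) / 2 * (v n x)\<^sup>2" by (simp add: power2_eq_square power4_eq_xxxx)
          also have "\<dots> \<le> (K / R) * exp K / 2 * (v n x)\<^sup>2" using a1 a2 K0 R by (intro mult_right_mono divide_right_mono mult_mono) auto
          finally show ?thesis using False by simp
        qed (use K0 R in simp)
      qed
    qed
    also have "\<dots> = (K * exp K / 2 / R) * c" using uc[of "k n"] by (simp add: L2_sq_def v_def)
    finally show "(\<integral>x. (if norm x \<le> R then 0 else exp_excess (v n x)) \<partial>lborel) \<le> K * exp K / 2 * c / R" by simp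
  qed (use exp_excess_nonneg exp_excess_integrable[OF vH] exp_excess_integrable[OF wH] in \<open>auto\<close>)
  have d4: "(a - b)^4 \<le> 8 * (a^4 + b^4)" for a b :: real
  proof -
    have "(a - b)\<^sup>2 \<le> 2 * a\<^sup>2 + 2 * b\<^sup>2" using zero_le_power2[of "a + b"] by (simp add: power2_eq_square algebra_simps)
    then have "((a - b)\<^sup>2)\<^sup>2 \<le> (2 * a\<^sup>2 + 2 * b\<^sup>2)\<^sup>2" by (intro power_mono) auto
    also have "\<dots> \<le> 2 * (2 * a\<^sup>2)\<^sup>2 + 2 * (2 * b\<^sup>2)\<^sup>2" using zero_le_power2[of "2 * a\<^sup>2 - 2 * b\<^sup>2"] by (simp add: power2_eq_square algebra_simps)
    finally show ?thesis by (simp add: power_mult_distrib flip: power_mult)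
  qed
  have dI: "integrable lborel (\<lambda>x. (v n x - w x)^4)" for n
    by (rule Bochner_Integration.integrable_bound[OF integrable_mult_right[OF Bochner_Integration.integrable_add[OF H1r_L4(1)[OF vH[of n]] H1r_L4(1)[OF wH]], of 8]])
      (auto intro!: AE_I2 order_trans[OF d4])
  \<comment> \<open>Strong convergence in L^4, obtained from the semicontinuity lemma with limit
    function 0. Paired with g in L^(4/3) it gives convergence of the source term although the L^2
    norm may drop.\<close>
  have Dev: "eventually (\<lambda>n. (\<integral>x. (v n x - w x)^4 \<partial>lborel) < (\<integral>x. 0 \<partial>(lborel :: R2 measure)) + e) sequentially" if e: "e > 0" for e
  proof (rule integral_limsup_with_tails[where C = "16 * K * c", OF _ _ _ _ _ _ _ _ _ e])
    show "AE x in lborel. (\<lambda>n. (v n x - w x)^4) \<longlonglongrightarrow> 0"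
      using AEv by eventually_elim (auto intro!: tendsto_eq_intros)
    fix R :: real assume R: "R \<ge> 1"
    show "\<exists>D. integrable lborel D \<and> (\<forall>n. AE x in lborel. norm x \<le> R \<longrightarrow> (v n x - w x)^4 \<le> D x)"
    proof (intro exI conjI allI)
      show "integrable lborel (\<lambda>x::R2. if norm x \<le> R then 32 * exp (2 * K) + 32 * exp (2 * K) / norm x else 0)" using R by (intro domI) auto
      show "AE x in lborel. norm x \<le> R \<longrightarrow> (v n x - w x)^4 \<le> (if norm x \<le> R then 32 * exp (2 * K) + 32 * exp (2 * K) / norm x else 0)" for n
        using AEv
      proof eventually_elim
        case (elim x)
        have "(v n x - w x)^4 \<le> 8 * ((v n x)^4 + (w x)^4)" by (rule d4)
        also have "\<dots> \<le> 8 * (2 * (exp (2 * K) * (1 + 1 / norm x)) + 2 * (exp (2 * K) * (1 + 1 / norm x)))"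
          using f4[of "norm x" "k n"] w4[of x] elim by (intro mult_left_mono add_mono) auto
        also have "\<dots> = 32 * exp (2 * K) + 32 * exp (2 * K) / norm x" by (simp add: algebra_simps)
        finally show ?case by simp
      qed
    qed
    fix n
    have "(\<integral>x. (if norm x \<le> R then 0 else (v n x - w x)^4) \<partial>lborel) \<le> (\<integral>x. (8 * K / R) * ((v n x)\<^sup>2 + (w x)\<^sup>2) \<partial>lborel)"
    proof (rule integral_mono_AE)
      show "integrable lborel (\<lambda>x. if norm x \<le> R then 0 else (v n x - w x)^4)"
        by (rule Bochner_Integration.integrable_bound[OF dI[of n]]) auto
      show "integrable lborel (\<lambda>x. (8 * K / R) * ((v n x)\<^sup>2 + (w x)\<^sup>2))" using vD(2) wI by simp
      show "AE x in lborel. (if norm x \<le> R then 0 else (v n x - w x)^4) \<le> (8 * K / R) * ((v n x)\<^sup>2 + (w x)\<^sup>2)"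
        using AEv
      proof eventually_elim
        case (elim x)
        show ?case
        proof (cases "norm x \<le> R")
          case False
          have KR: "K / norm x \<le> K / R" using False R K0 by (intro divide_left_mono mult_pos_pos) auto
          have a: "(v n x)\<^sup>2 \<le> K / R" using fb[of "norm x" "k n"] elim KR by simp
          have b: "(w x)\<^sup>2 \<le> K / R" using wb[of x] elim KR by simp
          have s: "(v n x - w x)\<^sup>2 \<le> 2 * ((v n x)\<^sup>2 + (w x)\<^sup>2)" using zero_le_power2[of "v n x + w x"] by (simp add: power2_eq_square algebra_simps)
          have "(v n x - w x)^4 = (v n x - w x)\<^sup>2 * (v n x - w x)\<^sup>2" by (simp add: power2_eq_square power4_eq_xxxx)
          also have "\<dots> \<le> (4 * K / R) * (2 * ((v n x)\<^sup>2 + (w x)\<^sup>2))" using s a b K0 R by (intro mult_mono) auto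
          also have "\<dots> = (8 * K / R) * ((v n x)\<^sup>2 + (w x)\<^sup>2)" by (simp add: algebra_simps)
          finally show ?thesis using False by simp
        qed (use K0 R in simp)
      qed
    qed
    also have "\<dots> = (8 * K / R) * (c + L2_sq w)" using uc[of "k n"] vD(2)[of n] wI by (simp add: L2_sq_def v_def)
    also have "\<dots> \<le> (8 * K / R) * (c + c)" using wc K0 R by (intro mult_left_mono) auto
    finally show "(\<integral>x. (if norm x \<le> R then 0 else (v n x - w x)^4) \<partial>lborel) \<le> 16 * K * c / R" by simp
  qed (use dI in auto)
  have gm: "g \<in> borel_measurable lborel" "integrable lborel (\<lambda>x. \<bar>g x\<bar> powr (4/3))" using g by (auto simp: Lp_fun_def)
  have gev: "eventually (\<lambda>n. (\<integral>x. g x * v n x \<partial>lborel) < (\<integral>x. g x * w x \<partial>lborel) + e) sequentially" if e: "e > 0" for e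
  proof -
    define A where "A = (\<integral>x. \<bar>g x\<bar> powr (4/3) \<partial>lborel) powr (3/4)"
    have A: "A \<ge> 0" by (simp add: A_def)
    have "(e / (A + 1))^4 > 0" using e A by simp
    from Dev[OF this] show ?thesis
    proof eventually_elim
      case (elim n)
      have "(\<integral>x. (v n x - w x)^4 \<partial>lborel) powr (1/4) \<le> ((e / (A + 1))^4) powr (1/4)" using elim by (intro powr_mono2) auto
      also have "((e / (A + 1))^4) powr (1/4) = e / (A + 1)"
      proof -
        have "e / (A + 1) > 0" using e A by simp
        then have "((e / (A + 1))^4) powr (1/4) = ((e / (A + 1)) powr 4) powr (1/4)" by simp
        also have "\<dots> = (e / (A + 1)) powr (4 * (1/4))" by (rule powr_powr)
        finally show ?thesis using e A by simp
      qed
      finally have e2: "(\<integral>x. (v n x - w x)^4 \<partial>lborel) powr (1/4) \<le> e / (A + 1)" .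
      have "(\<integral>x. g x * v n x \<partial>lborel) - (\<integral>x. g x * w x \<partial>lborel) = (\<integral>x. g x * (v n x - w x) \<partial>lborel)"
        using gu_integrable(1)[OF g vH[of n]] gu_integrable(1)[OF g wH] by (simp add: right_diff_distrib)
      also have "\<dots> \<le> \<bar>\<integral>x. g x * (v n x - w x) \<partial>lborel\<bar>" by simp
      also have "\<dots> \<le> (\<integral>x. \<bar>g x * (v n x - w x)\<bar> \<partial>lborel)" by (rule integral_abs_bound)
      also have "\<dots> \<le> A * (\<integral>x. (v n x - w x)^4 \<partial>lborel) powr (1/4)"
        unfolding A_def by (rule Holder_43_4(2)[OF gm(1) _ gm(2) dI]) measurable
      also have "\<dots> \<le> A * (e / (A + 1))" using e2 A by (intro mult_left_mono) auto
      also have "\<dots> < e"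
      proof -
        have "e * (A / (A + 1)) < e * 1" using e A by (intro mult_strict_left_mono) auto
        then show ?thesis by (simp add: mult.commute)
      qed
      finally show ?case by simp
    qed
  qed
  \<comment> \<open>Fatou's lemma; the inner masses converge for each x by domination with K/|y| on
    a disc. The case of a negative bound is separated because \<open>ennreal\<close> would truncate
    it to 0.\<close>
  have Bev: "eventually (\<lambda>n. Bterm w - e < Bterm (v n)) sequentially" if e: "e > 0" for e
  proof (cases "Bterm w - e < 0")
    case True
    then show ?thesis using Bterm_nonneg by (intro always_eventually allI) (rule less_le_trans)
  next
    case False
    let ?I = "\<lambda>u x. (u x)\<^sup>2 / (norm x)\<^sup>2 * (ball_mass (\<lambda>y. (u y)\<^sup>2) x)\<^sup>2"
    have bm: "(\<lambda>n. ball_mass (\<lambda>y. (v n y)\<^sup>2) x) \<longlonglongrightarrow> ball_mass (\<lambda>y. (w y)\<^sup>2) x" for x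
    proof -
      have "(\<lambda>n. \<integral>y. (if norm y \<le> norm x then (v n y)\<^sup>2 else 0) \<partial>lborel) \<longlonglongrightarrow> (\<integral>y. (if norm y \<le> norm x then (w y)\<^sup>2 else 0) \<partial>lborel)"
      proof (rule integral_dominated_convergence[where w = "\<lambda>y. if norm y \<le> norm x then 0 + K / norm y else 0"])
        show "integrable lborel (\<lambda>y::R2. if norm y \<le> norm x then 0 + K / norm y else 0)" by (rule domI) simp
        show "AE y in lborel. (\<lambda>n. if norm y \<le> norm x then (v n y)\<^sup>2 else 0) \<longlonglongrightarrow> (if norm y \<le> norm x then (w y)\<^sup>2 else 0)"
          using AEv by eventually_elim (auto intro!: tendsto_intros)
        show "AE y in lborel. norm (if norm y \<le> norm x then (v n y)\<^sup>2 else 0) \<le> (if norm y \<le> norm x then 0 + K / norm y else 0)" for n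
          using AEv by eventually_elim (use fb in auto)
      qed measurable
      then show ?thesis unfolding ball_mass_def by (intro tendsto_intros) auto
    qed
    have "ennreal (Bterm w) = (\<integral>\<^sup>+x. ennreal (?I w x) \<partial>lborel)"
      unfolding Bterm_eq[OF wH] by (rule nn_integral_eq_integral[symmetric, OF Bterm_le(2)[OF wH]]) simp
    also have "\<dots> = (\<integral>\<^sup>+x. liminf (\<lambda>n. ennreal (?I (v n) x)) \<partial>lborel)"
    proof (rule nn_integral_cong_AE, use AEv in eventually_elim)
      case (elim x)
      have L: "(\<lambda>n. ennreal (?I (v n) x)) \<longlonglongrightarrow> ennreal (?I w x)" using elim by (intro tendsto_ennrealI tendsto_intros bm) auto
      show ?case by (rule lim_imp_Liminf[OF _ L, symmetric]) simp
    qed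
    also have "\<dots> \<le> liminf (\<lambda>n. \<integral>\<^sup>+x. ennreal (?I (v n) x) \<partial>lborel)" by (rule nn_integral_liminf) measurable
    also have "(\<lambda>n. \<integral>\<^sup>+x. ennreal (?I (v n) x) \<partial>lborel) = (\<lambda>n. ennreal (Bterm (v n)))"
      unfolding Bterm_eq[OF vH] by (subst nn_integral_eq_integral[OF Bterm_le(2)[OF vH]]) auto
    finally have "ennreal (Bterm w) \<le> liminf (\<lambda>n. ennreal (Bterm (v n)))" .
    moreover have "ennreal (Bterm w - e) < ennreal (Bterm w)" using e False by (intro ennreal_lessI) auto
    ultimately have "ennreal (Bterm w - e) < liminf (\<lambda>n. ennreal (Bterm (v n)))" by (rule less_le_trans[rotated])
    then have "eventually (\<lambda>n. ennreal (Bterm w - e) < ennreal (Bterm (v n))) sequentially" by (rule less_LiminfD)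
    then show ?thesis by eventually_elim (use False Bterm_nonneg in \<open>auto simp: ennreal_less_iff\<close>)
  qed
  have limv: "(\<lambda>n. Phi g (v n)) \<longlonglongrightarrow> m" using LIMSEQ_subseq_LIMSEQ[OF lim k(1)] by (simp add: v_def o_def)
  have "Phi g w \<le> m"
  proof (rule field_le_epsilon)
    fix e :: real assume e: "e > 0"
    have sev: "eventually (\<lambda>n. grad_sq w - e / 3 < grad_sq (v n)) sequentially"
      by (rule order_tendstoD(1)[OF sl]) (use ws e in simp)
    have e3: "e / 3 > 0" using e by simp
    have "eventually (\<lambda>n. Phi g w - e \<le> Phi g (v n)) sequentially"
      using sev Bev[OF e3] Eev[OF e3] gev[OF e3]
      by eventually_elim (use e in \<open>simp add: Phi_exp_excess\<close>)
    then have "Phi g w - e \<le> m" by (rule tendsto_lowerbound[OF limv]) simp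
    then show "Phi g w \<le> m + e" by simp
  qed
  then show ?thesis using that[OF wH wpos wc] ws slS by linarith
qed

subsection \<open>The constrained minimizer\<close>

lemma Lp_norm_pos:
  assumes g: "Lp_fun p g" "continuous_on UNIV g" "\<exists>x. g x \<noteq> 0"
  shows "Lp_norm p g > 0"
proof -
  obtain y where y: "g y \<noteq> 0" using g(3) by blast
  have "(\<integral>x. \<bar>g x\<bar> powr p \<partial>lborel) > 0"
  proof (rule integral_pos_if_AE_nonzero)
    show "integrable lborel (\<lambda>x. \<bar>g x\<bar> powr p)" using g(1) by (simp add: Lp_fun_def)
    show "\<not> (AE x in lborel. \<bar>g x\<bar> powr p = 0)" using continuous_not_AE_zero[OF g(2) y] by simp
  qed simp
  then show ?thesis by (simp add: Lp_norm_def)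
qed

lemma source_scaling:
  fixes g :: "R2 \<Rightarrow> real"
  assumes d: "\<forall>x. g differentiable (at x)" and ineq: "\<forall>x. 2 * g x + frechet_derivative g (at x) x \<ge> 0" and t: "1 \<le> t"
  shows "g x \<le> t\<^sup>2 * g (t *\<^sub>R x)"
proof -
  have "(\<lambda>t. t\<^sup>2 * g (t *\<^sub>R x)) 1 \<le> (\<lambda>t. t\<^sup>2 * g (t *\<^sub>R x)) t"
  proof (rule DERIV_nonneg_imp_nondecreasing[OF t], intro exI conjI)
    fix s :: real assume s: "1 \<le> s"
    define L where "L = frechet_derivative g (at (s *\<^sub>R x))"
    have L: "(g has_derivative L) (at (s *\<^sub>R x))" unfolding L_def using d frechet_derivative_works by blast
    then interpret L: bounded_linear L by (rule has_derivative_bounded_linear)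
    have "((\<lambda>r. r *\<^sub>R x) has_derivative (\<lambda>h. h *\<^sub>R x)) (at s)" by (auto intro!: derivative_eq_intros)
    from has_derivative_compose[OF this L] have "((\<lambda>r. g (r *\<^sub>R x)) has_real_derivative L x) (at s)"
      by (simp add: has_field_derivative_def L.scaleR mult_commute_abs)
    then show "((\<lambda>t. t\<^sup>2 * g (t *\<^sub>R x)) has_real_derivative s * (2 * g (s *\<^sub>R x) + L (s *\<^sub>R x))) (at s)"
      by (auto intro!: derivative_eq_intros simp: L.scaleR power2_eq_square algebra_simps)
    show "0 \<le> s * (2 * g (s *\<^sub>R x) + L (s *\<^sub>R x))" using ineq s by (simp add: L_def)
  qed
  then show ?thesis by simp
qed

text \<open>The factor t^2 in the hypothesis is the Jacobian that appears when the dilation is moved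
  from g to u.\<close>

lemma source_dilate:
  assumes g: "Lp_fun (4/3) g" and gs: "\<And>x. g x \<le> t\<^sup>2 * g (t *\<^sub>R x)" and u: "H1r u" and pos: "AE x in lborel. u x \<ge> 0" and t: "t > 0"
  shows "(\<integral>x. g x * u x \<partial>lborel) \<le> (\<integral>x. g x * u ((1 / t) *\<^sub>R x) \<partial>lborel)"
proof -
  have [measurable]: "g \<in> borel_measurable borel" "u \<in> borel_measurable borel" using g H1r_D(1)[OF u] by (auto simp: Lp_fun_def)
  have v: "H1r (\<lambda>x. u ((1 / t) *\<^sub>R x))" using H1r_dilate(1)[OF u, of "1 / t" 1] t by simp
  have I: "integrable lborel (\<lambda>x. g (t *\<^sub>R x) * u x)"
    using integrable_affine_R2[of "\<lambda>x. g (t *\<^sub>R x) * u x" "1 / t" 0] gu_integrable(1)[OF g v] t by simp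
  have "(\<integral>x. g x * u x \<partial>lborel) \<le> (\<integral>x. t\<^sup>2 * (g (t *\<^sub>R x) * u x) \<partial>lborel)"
  proof (rule integral_mono_AE)
    show "integrable lborel (\<lambda>x. g x * u x)" by (rule gu_integrable(1)[OF g u])
    show "integrable lborel (\<lambda>x. t\<^sup>2 * (g (t *\<^sub>R x) * u x))" using I by simp
    show "AE x in lborel. g x * u x \<le> t\<^sup>2 * (g (t *\<^sub>R x) * u x)"
      using pos
    proof eventually_elim
      case (elim x)
      then show ?case using mult_right_mono[OF gs[of x], of "u x"] by (simp add: mult.assoc)
    qed
  qed
  also have "\<dots> = (\<integral>x. g x * u ((1 / t) *\<^sub>R x) \<partial>lborel)"
    using integral_affine_R2[of "\<lambda>x. g (t *\<^sub>R x) * u x" "1 / t" 0] t by (simp add: power_divide)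
  finally show ?thesis .
qed

text \<open>The nonlocal and exponential terms are even in u, the energy does not increase, and the
  source term can only gain because g \<ge> 0. So minimizing sequences may be taken
  nonnegative.\<close>

lemma Phi_abs_le:
  assumes g: "Lp_fun (4/3) g" "\<forall>x. g x \<ge> 0" and u: "H1r u"
  shows "H1r (\<lambda>x. \<bar>u x\<bar>)" "L2_sq (\<lambda>x. \<bar>u x\<bar>) = L2_sq u" "grad_sq (\<lambda>x. \<bar>u x\<bar>) \<le> grad_sq u" "Phi g (\<lambda>x. \<bar>u x\<bar>) \<le> Phi g u"
proof -
  note D = H1r_D[OF u]
  note [measurable] = D(1)
  obtain H where H: "L2_grad (\<lambda>x. \<bar>u x\<bar>) H" "(\<integral>x. (norm (H x))\<^sup>2 \<partial>lborel) \<le> (\<integral>x. (norm (wgrad u x))\<^sup>2 \<partial>lborel)"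
    by (rule L2_grad_abs[OF D(1-3)])
  have "radial (\<lambda>x. \<bar>u x\<bar>)" using D(4) unfolding radial_def by metis
  then show v: "H1r (\<lambda>x. \<bar>u x\<bar>)" by (intro H1r_I[OF _ _ H(1)]) (use D(2) in auto)
  show "L2_sq (\<lambda>x. \<bar>u x\<bar>) = L2_sq u" by (simp add: L2_sq_def)
  show gr: "grad_sq (\<lambda>x. \<bar>u x\<bar>) \<le> grad_sq u" using H(2) by (simp add: grad_sq_eq[OF H(1)] grad_sq_def)
  have "(\<integral>x. g x * u x \<partial>lborel) \<le> (\<integral>x. g x * \<bar>u x\<bar> \<partial>lborel)"
    by (rule integral_mono[OF gu_integrable(1)[OF g(1) u] gu_integrable(1)[OF g(1) v]]) (use g(2) in \<open>auto intro: mult_left_mono\<close>)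
  moreover have "Bterm (\<lambda>x. \<bar>u x\<bar>) = Bterm u" by (simp add: Bterm_def profile_def)
  ultimately show "Phi g (\<lambda>x. \<bar>u x\<bar>) \<le> Phi g u" using gr by (simp add: Phi_def)
qed

text \<open>The bound of B by the fourth power, combined with \<open>exp_excess\<close> \<ge> y^4/2.
  It yields 2 B \<le> c/(4 pi) F, the comparison behind both uses of dilations.\<close>

lemma Bterm_exp_excess:
  assumes u: "H1r u"
  shows "Bterm u \<le> L2_sq u / (8 * pi) * (\<integral>x. exp_excess (u x) \<partial>lborel)" "(\<integral>x. (u x)^4 \<partial>lborel) \<le> 2 * (\<integral>x. exp_excess (u x) \<partial>lborel)"
proof -
  have "(\<integral>x. (u x)^4 / 2 \<partial>lborel) \<le> (\<integral>x. exp_excess (u x) \<partial>lborel)"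
    by (rule integral_mono[OF _ exp_excess_integrable[OF u]]) (use H1r_L4(1)[OF u] exp_excess_ge in auto)
  then show *: "(\<integral>x. (u x)^4 \<partial>lborel) \<le> 2 * (\<integral>x. exp_excess (u x) \<partial>lborel)" by simp
  have "Bterm u \<le> L2_sq u / (16 * pi) * (\<integral>x. (u x)^4 \<partial>lborel)" by (rule Bterm_le(1)[OF u])
  also have "\<dots> \<le> L2_sq u / (16 * pi) * (2 * (\<integral>x. exp_excess (u x) \<partial>lborel))" using * L2_sq_nonneg[of u] by (intro mult_left_mono) auto
  finally show "Bterm u \<le> L2_sq u / (8 * pi) * (\<integral>x. exp_excess (u x) \<partial>lborel)" by simp
qed

lemma H1r_L4_pos:
  assumes u: "H1r u" and c: "L2_sq u > 0"
  shows "(\<integral>x. (u x)^4 \<partial>lborel) > 0" "grad_sq u > 0"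
proof -
  have "\<not> (AE x in lborel. (u x)^4 = 0)"
  proof
    assume "AE x in lborel. (u x)^4 = 0"
    then have "AE x in lborel. (u x)\<^sup>2 = 0" by eventually_elim simp
    then have "L2_sq u = 0" unfolding L2_sq_def by (rule integral_eq_zero_AE)
    then show False using c by simp
  qed
  then show *: "(\<integral>x. (u x)^4 \<partial>lborel) > 0" by (intro integral_pos_if_AE_nonzero[OF H1r_L4(1)[OF u]]) auto
  then have "grad_sq u \<noteq> 0" using H1r_L4(2)[OF u] by auto
  then show "grad_sq u > 0" using grad_sq_nonneg[of u] by simp
qed

text \<open>Dilating up to the prescribed mass costs nothing: the gradient norm is invariant in the plane,
  and for mass below \<open>4 * pi\<close> the nonlocal term is controlled by the exponential one.\<close>
lemma dilate_to_mass:
  assumes g: "Lp_fun (4/3) g" and gs: "\<And>t x. t \<ge> 1 \<Longrightarrow> g x \<le> t\<^sup>2 * g (t *\<^sub>R x)"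
    and w: "H1r w" and pos: "AE x in lborel. w x \<ge> 0" and c: "0 < L2_sq w" "L2_sq w \<le> c" "c \<le> 4 * pi"
  obtains v where "H1r v" "AE x in lborel. v x \<ge> 0" "L2_sq v = c" "grad_sq v = grad_sq w" "Phi g v \<le> Phi g w"
proof -
  define t where "t = sqrt (c / L2_sq w)"
  have t: "t \<ge> 1" "t\<^sup>2 = c / L2_sq w" using c by (auto simp: t_def)
  then have t0: "t > 0" by simp
  define v where "v x = 1 * w ((1 / t) *\<^sub>R x)" for x
  note H = H1r_dilate[OF w, of "1 / t" 1, folded v_def]
  have [measurable]: "w \<in> borel_measurable borel" using H1r_D(1)[OF w] .
  define B F where "B = Bterm w" and "F = (\<integral>x. exp_excess (w x) \<partial>lborel)"
  have F0: "F \<ge> 0" unfolding F_def using exp_excess_nonneg by (intro integral_nonneg_AE) auto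
  show ?thesis
  proof (rule that[of v])
    show "H1r v" using H(1) t0 by simp
    show "AE x in lborel. v x \<ge> 0" using AE_affine_R2[of "1 / t" "\<lambda>x. w x \<ge> 0" 0] t0 pos by (simp add: v_def)
    show "L2_sq v = c" using H(2) t0 t(2) c by (simp add: power_divide)
    show gv: "grad_sq v = grad_sq w" using H(3) t0 by simp
    have Bv: "Bterm v = t^4 * B" using H(4) t0 by (simp add: B_def power_divide)
    have Fv: "(\<integral>x. exp_excess (v x) \<partial>lborel) = t\<^sup>2 * F" using H(5) t0 by (simp add: F_def power_divide v_def)
    have gw: "(\<integral>x. g x * w x \<partial>lborel) \<le> (\<integral>x. g x * v x \<partial>lborel)"
      using source_dilate[OF g gs[OF t(1)] w pos t0] by (simp add: v_def)
    have "2 * t\<^sup>2 * B \<le> 2 * t\<^sup>2 * (L2_sq w / (8 * pi) * F)"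
      using Bterm_exp_excess(1)[OF w] by (intro mult_left_mono) (auto simp: B_def F_def)
    also have "\<dots> = c / (4 * pi) * F" using c by (simp add: t(2))
    also have "\<dots> \<le> 1 * F" using c F0 by (intro mult_right_mono) auto
    finally have 1: "2 * t\<^sup>2 * B \<le> F" by simp
    have t2: "t\<^sup>2 \<ge> 1" using t(1) by simp
    have B0: "B \<ge> 0" by (simp add: B_def Bterm_nonneg)
    have "(t\<^sup>2 + 1) * B \<le> 2 * t\<^sup>2 * B" using t2 B0 by (intro mult_right_mono) auto
    then have "(t\<^sup>2 - 1) * ((t\<^sup>2 + 1) * B) \<le> (t\<^sup>2 - 1) * F" using 1 t2 by (intro mult_left_mono) auto
    then have "t^4 * B - t\<^sup>2 * F \<le> B - F" by (simp add: algebra_simps power4_eq_xxxx power2_eq_square)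
    then show "Phi g v \<le> Phi g w" unfolding Phi_exp_excess gv Bv Fv using gw by (simp add: B_def F_def)
  qed
qed

text \<open>The ball is open, so the limit might fall on its boundary. There the energy is
  nonnegative, whereas the infimum is negative.\<close>

lemma minimizer_exists:
  assumes g: "Lp_fun (4/3) g" "continuous_on UNIV g" "\<forall>x. g x \<ge> 0" "\<exists>x. g x \<noteq> 0"
    and gs: "\<And>t x. t \<ge> 1 \<Longrightarrow> g x \<le> t\<^sup>2 * g (t *\<^sub>R x)"
    and c: "0 < c" "c \<le> 432/1000" and s: "0 < s" "s \<le> pi / 3"
    and bd: "C4 * Lp_norm (4/3) g * (c powr (1/4) * s powr (1/4)) \<le> s / 12"
  obtains u where "H1r u" "AE x in lborel. u x \<ge> 0" "L2_sq u = c" "grad_sq u < s"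
    "\<And>v. H1r v \<Longrightarrow> L2_sq v = c \<Longrightarrow> grad_sq v < s \<Longrightarrow> Phi g u \<le> Phi g v"
proof -
  define P where "P = {Phi g v |v. H1r v \<and> L2_sq v = c \<and> grad_sq v < s}"
  have CL: "C4 * Lp_norm (4/3) g \<ge> 0" using C4_pos by (simp add: Lp_norm_def)
  \<comment> \<open>On the closed ball the source term is largest at the radius s, so one estimate
    covers all v; at \<open>grad_sq v = s\<close> the bound reads Phi \<ge> 0.\<close>
  have lower: "Phi g v \<ge> 1/12 * grad_sq v - s / 12" if v: "H1r v" "L2_sq v = c" "grad_sq v \<le> s" for v
  proof -
    have g0: "grad_sq v > 0" using H1r_L4_pos(2)[OF v(1)] v(2) c by simp
    have "C4 * Lp_norm (4/3) g * (c powr (1/4) * grad_sq v powr (1/4)) \<le> C4 * Lp_norm (4/3) g * (c powr (1/4) * s powr (1/4))"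
      using CL g0 v(3) by (intro mult_left_mono powr_mono2) auto
    then show ?thesis using Phi_lower_bound[OF g(1) v(1)] v g0 c s bd by simp
  qed
  obtain z where z: "H1r z" "L2_sq z = c" "grad_sq z < s" "Phi g z < 0" by (rule negative_energy[OF g c(1) s(1)])
  have Pne: "P \<noteq> {}" using z by (auto simp: P_def)
  have "y \<ge> - s / 12" if "y \<in> P" for y
  proof -
    from that obtain v where v: "y = Phi g v" "H1r v" "L2_sq v = c" "grad_sq v < s" by (auto simp: P_def)
    then show ?thesis using lower[of v] grad_sq_nonneg[of v] by simp
  qed
  then have bb: "bdd_below P" by (auto simp: bdd_below_def)
  define m where "m = Inf P"
  have mle: "m \<le> Phi g v" if "H1r v" "L2_sq v = c" "grad_sq v < s" for v
    unfolding m_def by (rule cInf_lower[OF _ bb]) (use that in \<open>auto simp: P_def\<close>)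
  have "m < 0" using mle[OF z(1-3)] z(4) by simp
  have "\<exists>v. H1r v \<and> (\<forall>x. v x \<ge> 0) \<and> L2_sq v = c \<and> grad_sq v \<le> s \<and> m \<le> Phi g v \<and> Phi g v \<le> m + inverse (real (Suc n))" for n
  proof -
    have "Inf P < m + inverse (real (Suc n))" by (simp add: m_def)
    from cInf_lessD[OF Pne this]
    obtain v where v: "H1r v" "L2_sq v = c" "grad_sq v < s" "Phi g v < m + inverse (real (Suc n))" by (auto simp: P_def)
    note A = Phi_abs_le[OF g(1,3) v(1)]
    have "m \<le> Phi g (\<lambda>x. \<bar>v x\<bar>)" using A v by (intro mle) auto
    then show ?thesis using A v by (intro exI[of _ "\<lambda>x. \<bar>v x\<bar>"]) auto
  qed
  then have "\<forall>n. \<exists>v. H1r v \<and> (\<forall>x. v x \<ge> 0) \<and> L2_sq v = c \<and> grad_sq v \<le> s \<and> m \<le> Phi g v \<and> Phi g v \<le> m + inverse (real (Suc n))" by (rule allI)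
  from choice[OF this] obtain u where "\<forall>n. H1r (u n) \<and> (\<forall>x. u n x \<ge> 0) \<and> L2_sq (u n) = c \<and> grad_sq (u n) \<le> s \<and> m \<le> Phi g (u n) \<and> Phi g (u n) \<le> m + inverse (real (Suc n))" ..
  then have u: "\<And>n. H1r (u n)" "\<And>n x. u n x \<ge> 0" "\<And>n. L2_sq (u n) = c" "\<And>n. grad_sq (u n) \<le> s"
    "\<And>n. m \<le> Phi g (u n)" "\<And>n. Phi g (u n) \<le> m + inverse (real (Suc n))" by auto
  have "(\<lambda>n. m + inverse (real (Suc n))) \<longlonglongrightarrow> m + 0" by (intro tendsto_add tendsto_const LIMSEQ_inverse_real_of_nat)
  then have lim: "(\<lambda>n. Phi g (u n)) \<longlonglongrightarrow> m"
    by (intro tendsto_sandwich[OF _ _ tendsto_const, of m "\<lambda>n. Phi g (u n)" sequentially "\<lambda>n. m + inverse (real (Suc n))"]) (use u(5,6) in auto)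
  obtain w where w: "H1r w" "AE x in lborel. w x \<ge> 0" "L2_sq w \<le> c" "grad_sq w \<le> s" "Phi g w \<le> m"
    by (rule minimizing_sequence_limit[OF g(1) u(1-4) s(2) lim])
  \<comment> \<open>A dilation cannot restore mass to the zero function. Vanishing is excluded
    because it would make Phi(w) \<ge> 0 > m.\<close>
  have "L2_sq w \<noteq> 0"
  proof
    assume 0: "L2_sq w = 0"
    then have "AE x in lborel. (w x)\<^sup>2 = 0"
      using integral_nonneg_eq_0_iff_AE[OF H1r_D(2)[OF w(1)]] by (simp add: L2_sq_def)
    then have AE: "AE x in lborel. w x = 0" by eventually_elim simp
    have "(\<integral>x. g x * w x \<partial>lborel) = 0" by (rule integral_eq_zero_AE) (use AE in eventually_elim, simp)
    moreover have "(\<integral>x. exp_excess (w x) \<partial>lborel) = 0"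
      by (rule integral_eq_zero_AE) (use AE in eventually_elim, simp add: exp_excess_def)
    ultimately have "Phi g w \<ge> 0" unfolding Phi_exp_excess using grad_sq_nonneg[of w] Bterm_nonneg[of w] by simp
    then show False using w(5) \<open>m < 0\<close> by simp
  qed
  then have w0: "L2_sq w > 0" using L2_sq_nonneg[of w] by simp
  have c4: "c \<le> 4 * pi" using c pi_bounds by simp
  obtain v where v: "H1r v" "AE x in lborel. v x \<ge> 0" "L2_sq v = c" "grad_sq v = grad_sq w" "Phi g v \<le> Phi g w"
    by (rule dilate_to_mass[OF g(1) gs w(1,2) w0 w(3) c4])
  \<comment> \<open>The restored function still has Phi(v) \<le> m < 0, while \<open>lower\<close>
    would give Phi(v) \<ge> 0 on the sphere.\<close>
  have "grad_sq v \<noteq> s" using lower[OF v(1,3)] v(5) w(5) \<open>m < 0\<close> by auto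
  then have "grad_sq v < s" using v(4) w(4) by simp
  then show ?thesis
  proof (rule that[OF v(1,2,3)])
    fix z assume "H1r z" "L2_sq z = c" "grad_sq z < s"
    then show "Phi g v \<le> Phi g z" using mle[of z] v(5) w(5) by simp
  qed
qed

text \<open>The constraint is handled by the curves \<open>\<rho>(t) (u + t v)\<close>, with \<open>\<rho>(t)\<close> restoring the mass.\<close>
lemma constrained_minimizer_Euler_Lagrange:
  assumes g: "Lp_fun (4/3) g" and u: "H1r u" "L2_sq u = c" "grad_sq u < s" and c: "c > 0"
    and min: "\<And>w. H1r w \<Longrightarrow> L2_sq w = c \<Longrightarrow> grad_sq w < s \<Longrightarrow> Phi g u \<le> Phi g w"
    and v: "H1r v"
  shows "((\<lambda>t. Phi g (\<lambda>x. u x + t * v x)) has_real_derivative (dPhi_self g u / c * (\<integral>x. u x * v x \<partial>lborel))) (at 0)"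
proof -
  obtain D2 where D2: "\<And>\<alpha> \<beta> \<alpha>' \<beta>' t0. (\<alpha> has_real_derivative \<alpha>') (at t0) \<Longrightarrow> \<alpha> t0 = 1 \<Longrightarrow> (\<beta> has_real_derivative \<beta>') (at t0) \<Longrightarrow> \<beta> t0 = 0 \<Longrightarrow>
    ((\<lambda>t. Phi g (\<lambda>x. \<alpha> t * u x + \<beta> t * v x)) has_real_derivative (\<alpha>' * dPhi_self g u + \<beta>' * D2)) (at t0)"
    using Phi_curve_deriv[OF g u(1) v] by blast
  define I where "I = (\<integral>x. u x * v x \<partial>lborel)"
  \<comment> \<open>The mass of u + t v; it equals c at t = 0 and hence is positive nearby.\<close>
  define q where "q t = c + 2 * t * I + t\<^sup>2 * L2_sq v" for t
  define \<rho> where "\<rho> t = sqrt c / sqrt (q t)" for t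
  have q0: "q 0 = c" by (simp add: q_def)
  have dq: "(q has_real_derivative 2 * I) (at 0)" unfolding q_def by (auto intro!: derivative_eq_intros)
  have r0: "\<rho> 0 = 1" using c by (simp add: \<rho>_def q0)
  have dr: "(\<rho> has_real_derivative - I / c) (at 0)"
  proof -
    have "((\<lambda>t. sqrt (q t)) has_real_derivative inverse (sqrt (q 0)) / 2 * (2 * I)) (at 0)"
      by (rule DERIV_chain2[OF DERIV_real_sqrt dq]) (use c q0 in simp)
    then have "(\<rho> has_real_derivative (0 * sqrt (q 0) - sqrt c * (inverse (sqrt (q 0)) / 2 * (2 * I))) / (sqrt (q 0) * sqrt (q 0))) (at 0)"
      unfolding \<rho>_def by (intro DERIV_divide DERIV_const) (use c q0 in auto)
    moreover have "(0 * sqrt (q 0) - sqrt c * (inverse (sqrt (q 0)) / 2 * (2 * I))) / (sqrt (q 0) * sqrt (q 0)) = - I / c"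
      using c by (simp add: q0)
    ultimately show ?thesis by (simp only:)
  qed
  have db: "((\<lambda>t. \<rho> t * t) has_real_derivative 1) (at 0)"
    using DERIV_mult[OF dr DERIV_ident] by (simp add: r0)
  define w where "w t = (\<lambda>x. \<rho> t * u x + (\<rho> t * t) * v x)" for t
  have wH: "H1r (w t)" for t unfolding w_def by (rule H1r_lincomb(1)[OF u(1) v])
  have wL: "L2_sq (w t) = c" if "q t > 0" for t
  proof -
    have "L2_sq (w t) = (\<rho> t)\<^sup>2 * q t"
      unfolding w_def H1r_lincomb(3)[OF u(1) v] u(2) by (simp add: q_def I_def algebra_simps power2_eq_square)
    also have "\<dots> = c" using that c by (simp add: \<rho>_def power_divide)
    finally show ?thesis .
  qed
  have cont: "isCont q 0" "isCont \<rho> 0" using dq dr DERIV_isCont by blast+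
  have gc: "isCont (\<lambda>t. grad_sq (w t)) 0"
    unfolding w_def H1r_lincomb(2)[OF u(1) v] by (intro continuous_intros cont)
  have w0: "w 0 = u" by (simp add: w_def r0)
  have "eventually (\<lambda>t. q t > 0) (at 0)" using order_tendstoD(1)[OF cont(1)[unfolded isCont_def]] c q0 by simp
  moreover have "eventually (\<lambda>t. grad_sq (w t) < s) (at 0)"
    using order_tendstoD(2)[OF gc[unfolded isCont_def]] u(3) w0 by simp
  ultimately have "eventually (\<lambda>t. Phi g u \<le> Phi g (w t)) (at 0)"
    by eventually_elim (use min wH wL in auto)
  then obtain d where d: "d > 0" "\<And>t. t \<noteq> 0 \<Longrightarrow> \<bar>t\<bar> < d \<Longrightarrow> Phi g u \<le> Phi g (w t)"
    by (auto simp: eventually_at dist_real_def)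
  have "((\<lambda>t. Phi g (w t)) has_real_derivative (- I / c * dPhi_self g u + 1 * D2)) (at 0)"
    using D2[OF dr r0 db] by (simp add: w_def)
  moreover have "Phi g (w 0) \<le> Phi g (w t)" if "\<bar>0 - t\<bar> < d" for t
    using d(2)[of t] w0 that by (cases "t = 0") auto
  \<comment> \<open>Both the energy constraint, which is open, and the mass constraint hold for
    small t, so t = 0 is an unconstrained local minimum of one real variable. This determines
    D2.\<close>
  ultimately have "- I / c * dPhi_self g u + 1 * D2 = 0" using DERIV_local_min[OF _ d(1)] by blast
  then have D2e: "D2 = dPhi_self g u / c * I" by (simp add: mult_ac)
  have "((\<lambda>t. Phi g (\<lambda>x. 1 * u x + t * v x)) has_real_derivative (0 * dPhi_self g u + 1 * D2)) (at 0)"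
    by (rule D2[where \<alpha> = "\<lambda>_. 1" and \<beta> = "\<lambda>t. t"]) auto
  then show ?thesis by (simp add: D2e I_def)
qed

text \<open>Compare with \<open>a u(a x)\<close>, \<open>a \<le> 1\<close>, which has the same mass and a smaller gradient.\<close>
lemma constrained_minimizer_multiplier:
  assumes g: "Lp_fun (4/3) g" and gs: "\<And>t x. t \<ge> 1 \<Longrightarrow> g x \<le> t\<^sup>2 * g (t *\<^sub>R x)"
    and u: "H1r u" "L2_sq u = c" "grad_sq u < s" and pos: "AE x in lborel. u x \<ge> 0" and c: "0 < c" "c \<le> 2 * pi"
    and min: "\<And>w. H1r w \<Longrightarrow> L2_sq w = c \<Longrightarrow> grad_sq w < s \<Longrightarrow> Phi g u \<le> Phi g w"
  shows "dPhi_self g u < 0"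
proof -
  define E where "E = (\<integral>x. exp_excess' (u x) * u x \<partial>lborel)"
  define F where "F = (\<integral>x. exp_excess (u x) \<partial>lborel)"
  define G where "G = (\<integral>x. g x * u x \<partial>lborel)"
  define A where "A = grad_sq u + Bterm u"
  \<comment> \<open>An upper bound for Phi along the dilated family, equal to it at a = 1. The
    source term is replaced by its bound a G, so g never has to be differentiated under the
    integral.\<close>
  define q where "q a = a\<^sup>2 / 2 * A - 1 / (2 * a\<^sup>2) * (\<integral>x. exp_excess (a * u x + 0 * u x) \<partial>lborel) - a * G" for a
  have q1: "q 1 = Phi g u" unfolding Phi_exp_excess by (simp add: q_def A_def G_def)
  have qa: "q 1 \<le> q a" if a: "0 < a" "a \<le> 1" for a
  proof -
    define v where "v x = a * u (a *\<^sub>R x)" for x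
    note H = H1r_dilate[OF u(1) a(1), of a, folded v_def]
    have "a\<^sup>2 * grad_sq u \<le> 1 * grad_sq u" using a grad_sq_nonneg[of u] by (intro mult_right_mono power_le_one) auto
    then have "Phi g u \<le> Phi g v" using H(1-3) a u(2,3) by (intro min) auto
    also have "\<dots> \<le> q a"
    proof -
      have Bv: "Bterm v = a\<^sup>2 * Bterm u"
      proof -
        have "a^6 / a^4 = a\<^sup>2" using a by (simp add: field_simps flip: power_add)
        then show ?thesis unfolding H(4) by simp
      qed
      have Fv: "(\<integral>x. exp_excess (v x) \<partial>lborel) = (1 / a\<^sup>2) * (\<integral>x. exp_excess (a * u x) \<partial>lborel)"
        using H(5) by (simp add: v_def)
      have "G \<le> (\<integral>x. g x * u (a *\<^sub>R x) \<partial>lborel)"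
        using source_dilate[OF g gs u(1) pos, of "1 / a"] a by (simp add: G_def)
      then have "a * G \<le> (\<integral>x. g x * v x \<partial>lborel)"
        using a mult_left_mono[of G _ a] by (simp add: v_def mult.left_commute)
      then show ?thesis unfolding Phi_exp_excess H(3) Bv Fv by (simp add: q_def A_def algebra_simps)
    qed
    finally show ?thesis by (simp add: q1)
  qed
  have dq: "(q has_real_derivative A + F - E / 2 - G) (at 1)"
  proof -
    have "((\<lambda>a. \<integral>x. exp_excess (a * u x + 0 * u x) \<partial>lborel) has_real_derivative 1 * E + 0 * E) (at 1)"
      unfolding E_def by (rule exp_excess_curve_deriv[OF u(1) u(1)]) auto
    then show ?thesis unfolding q_def
      by (auto intro!: derivative_eq_intros simp: F_def diff_divide_distrib)
  qed
  \<comment> \<open>Only a \<le> 1 keeps the competitor inside the energy ball, so minimality gives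
    a one-sided condition: the derivative at 1 cannot be positive.\<close>
  have "A + F - E / 2 - G \<le> 0"
  proof (rule ccontr)
    assume "\<not> ?thesis"
    then obtain d where d: "d > 0" "\<And>h. h > 0 \<Longrightarrow> h < d \<Longrightarrow> q (1 - h) < q 1"
      using DERIV_pos_inc_left[OF dq] by force
    define h where "h = min (d / 2) (1 / 2)"
    have "0 < h" "h < d" "h \<le> 1 / 2" using d(1) by (auto simp: h_def)
    then show False using d(2)[of h] qa[of "1 - h"] by simp
  qed
  \<comment> \<open>Since \<open>dPhi_self g u\<close> equals (A + F - E/2 - G) + (2 B - F), this
    strict inequality makes it negative.\<close>
  moreover have "2 * Bterm u < F"
  proof -
    have F: "F > 0" using Bterm_exp_excess(2)[OF u(1)] H1r_L4_pos(1)[OF u(1)] u(2) c by (simp add: F_def)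
    have "2 * Bterm u \<le> c / (4 * pi) * F" using Bterm_exp_excess(1)[OF u(1)] by (simp add: F_def u(2))
    also have "\<dots> < 1 * F" using c F pi_gt_zero by (intro mult_strict_right_mono) (auto simp: pos_divide_less_eq)
    finally show ?thesis by simp
  qed
  ultimately show ?thesis by (simp add: dPhi_self_def A_def E_def G_def)
qed

theorem theorem1p1:
  fixes g :: "real ^ 2 \<Rightarrow> real"
  assumes G1_cont: "continuous_on UNIV g"
      and G1_nonneg: "\<forall>x. g x \<ge> 0"
      and G1_L43: "Lp_fun (4/3) g"
      and G1_radial: "radial g"
      and G1_nonzero: "\<exists>x. g x \<noteq> 0"
      and G2_diff: "\<forall>x. g differentiable (at x)"
      and G2_L43: "Lp_fun (4/3) (\<lambda>x. frechet_derivative g (at x) x)"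
      and G2_ineq: "\<forall>x. 2 * g x + frechet_derivative g (at x) x \<ge> 0"
  shows "\<forall>c. 0 < c \<and> c < c0 g \<longrightarrow>
           (\<exists>u lam. solves_P g c u lam \<and> lam > 0 \<and> ereal (Phi g u) = m_level g c)"
proof (intro allI impI)
  fix c assume "0 < c \<and> c < c0 g"
  then have c: "0 < c" "c < c0 g" by auto
  have L: "Lp_norm (4/3) g > 0" by (rule Lp_norm_pos[OF G1_L43 G1_cont G1_nonzero])
  have c432: "c \<le> 432/1000" by (rule c_small[OF L C4_pos c(1) L_conditions(2)[OF L C4_pos c]])
  have gs: "g x \<le> t\<^sup>2 * g (t *\<^sub>R x)" if "t \<ge> 1" for t x by (rule source_scaling[OF G2_diff G2_ineq that])
  obtain u where u: "H1r u" "AE x in lborel. u x \<ge> 0" "L2_sq u = c" "grad_sq u < s0 g c"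
    and min: "\<And>v. H1r v \<Longrightarrow> L2_sq v = c \<Longrightarrow> grad_sq v < s0 g c \<Longrightarrow> Phi g u \<le> Phi g v"
    using minimizer_exists[OF G1_L43 G1_cont G1_nonneg G1_nonzero gs c(1) c432 s0_properties[OF L C4_pos c]] by blast
  have "dPhi_self g u < 0"
    by (rule constrained_minimizer_multiplier[OF G1_L43 gs u(1,3,4,2) c(1) _ min]) (use c432 pi_bounds in auto)
  \<comment> \<open>Testing the equation with v = u shows that no other multiplier is
    possible.\<close>
  moreover have "solves_P g c u (- dPhi_self g u / c)"
    unfolding solves_P_def
    using constrained_minimizer_Euler_Lagrange[OF G1_L43 u(1,3,4) c(1) min] u(1,3) by simp
  moreover have "ereal (Phi g u) = m_level g c"
    unfolding m_level_def
    by (intro antisym INF_greatest INF_lower) (use u min in auto)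
  ultimately show "\<exists>u lam. solves_P g c u lam \<and> lam > 0 \<and> ereal (Phi g u) = m_level g c"
    using c(1) by (intro exI[of _ u] exI[of _ "- dPhi_self g u / c"]) (auto simp: divide_neg_pos)
qed

end
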